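(* Let $n\ge 2$, $1\le k\le n$. Equip the $\mathfrak g_0$-geometric crystal $\mathcal V_1=(\mathcal V_1,\{e_i\},\{\gamma_i\},\{\varepsilon_i\})_{1\le i\le n}$ with the $0$-structure $$\gamma_0:=\overline\gamma_0\circ\overline\sigma,\qquad \varepsilon_0:=\overline\varepsilon_0\circ\overline\sigma,\qquad e_0^c:=\overline\sigma^{-1}\circ\overline e_0^{\,c}\circ\overline\sigma .$$ Then $(\mathcal V_1,\{e_i\}_{i\in I},\{\gamma_i\}_{i\in I},\{\varepsilon_i\}_{i\in I})$, $I=\{0,1,\dots,n\}$, is an $A_n^{(1)}$-geometric crystal (denoted $\mathcal V(A_n^{(1)})$). Furthermore, $v_1:(\mathbb C^\times)^{kk'}\to\mathcal V(A_n^{(1)})=\mathcal V_1$ gives a positive structure on it.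
   Context: **Cartan data.** $n\ge2$, $1\le k\le n$, $k'=n+1-k$, $I=\{0,1,\dots,n\}$; $A=(a_{ij})_{i,j\in I}$ is the Cartan matrix of $A_n^{(1)}$: $a_{ii}=2$, $a_{ij}=-1$ if $i\equiv j\pm1 \pmod{n+1}$, $a_{ij}=0$ otherwise. $\mathfrak g_0$ and $\mathfrak g_n$ are the subalgebras (of type $A_n$) with index sets $I\setminus\{0\}$ and $I\setminus\{n\}$. **Geometric crystals** (for such a simply-laced matrix with index set $J$). A quadruple $(X,\{e_i\}_{i\in J},\{\gamma_i\}_{i\in J},\{\varepsilon_i\}_{i\in J})$, with $X$ an ind-variety, $e_i:\mathbb C^\times\times X\to X$, $(c,x)\mapsto e_i^c(x)$, rational $\mathbb C^\times$-actions, and $\gamma_i,\varepsilon_i:X\to\mathbb C$ rational functions, is a geometric crystal if: (i) $\{1\}\times X\subset \mathrm{dom}(e_i)$ for any $i$, where $\mathrm{dom}(e_i)$ is the domain of definition of $e_i$; (ii) $\gamma_j(e_i^c(x))=c^{a_{ij}}\gamma_j(x)$; (iii) $e_i^{c_1}e_j^{c_2}=e_j^{c_2}e_i^{c_1}$ if $a_{ij}=a_{ji}=0$, and $e_i^{c_1}e_j^{c_1c_2}e_i^{c_2}=e_j^{c_2}e_i^{c_1c_2}e_j^{c_1}$ if $a_{ij}=a_{ji}=-1$; (iv) $\varepsilon_i(e_i^c(x))=c^{-1}\varepsilon_i(x)$, and $\varepsilon_i(e_j^c(x))=\varepsilon_i(x)$ if $a_{ij}=a_{ji}=0$. A non-zero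 rational function on a torus is positive if it is a quotient $g/h$ with $g,h$ positive linear combinations of characters; a rational map of tori is positive if its composition with every character is positive. A birational isomorphism $\theta:T'\to X$ from an algebraic torus is a positive structure if all $\gamma_i\circ\theta$, $\varepsilon_i\circ\theta$ and all maps $(c,t)\mapsto\theta^{-1}(e_i^c(\theta(t)))$, $\mathbb C^\times\times T'\to T'$, are positive. **The module.** $W(\varpi_k)$ has basis the tuples $(i_1,\dots,i_k)$, $1\le i_1<\dots<i_k\le n+1$ (regarded as $k$-subsets). For $1\le i\le n$, $f_i$ replaces the entry $i$ by $i+1$ if $i$ occurs and $i+1$ does not, and gives $0$ otherwise; $f_0$ replaces $n+1$ by $1$ if $n+1$ occurs and $1$ does not, and gives $0$ otherwise. For $c\in\mathbb C^\times$ and $1\le i\le n$, $\alpha_i^\vee(c)$ multiplies a basis vector by $c$ if it contains $i$ but not $i+1$, by $c^{-1}$ if it contains $i+1$ but not $i$, by $1$ otherwise; $\alpha_0^\vee(c)$ is the same with $(i,i+1)$ replaced by $(n+1,1)$. Put $y_i(c)=1+cf_i$, $Y_i(c)=y_i(1/c)\alpha_i^\vee(c)$, $u_1=(1,2,\dots,k)$, $u_2=(1,\dots,k-1,n+1)$. **$\mathcal V_1$ and $\mathcal V_2$.** Let $S_1=\{(l,m)\in\mathbb Z^2:1\le l\le k<l+m\le n+1\}$, $S_2=\{(l,m)\in\mathbb Z^2:1\le l\le k\le l+m\le n\}$; write $x=(x^{(l)}_m)_{(l,m)\in S_1}$, $y=(y^{(l)}_m)_{(l,m)\in S_2}\in(\mathbb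 C^\times)^{kk'}$, with $x^{(l)}_m=1$ for $(l,m)\notin S_1$, $y^{(l)}_m=1$ for $(l,m)\notin S_2$. Put $v_1(x)=P_kP_{k-1}\cdots P_1u_1$ with $P_l=Y_{n+1-l}(x^{(l)}_{n+1-l})Y_{n-l}(x^{(l)}_{n-l})\cdots Y_{k-l+1}(x^{(l)}_{k-l+1})$ (indices decreasing), and $v_2(y)=Q_kQ_{k-1}\cdots Q_1u_2$ with $Q_l=Y_{n-l}(y^{(l)}_{n-l})\cdots Y_{k-l}(y^{(l)}_{k-l})$. $\mathcal V_1=\{v_1(x)\}$, $\mathcal V_2=\{v_2(y)\}\subset W(\varpi_k)$; $v_1,v_2$ are birational and serve as coordinates. For $1\le i\le n$ put $a=\max(k-i+1,1)$, $b=\min(k,n-i+1)$. The $\mathfrak g_0$-geometric crystal structure on $\mathcal V_1$ is $$D^{(l)}_i(x)=\frac{x^{(l)}_i\prod_{j=l+1}^{b}(x^{(j)}_i)^2}{\prod_{j=l+1}^{b+1}x^{(j)}_{i-1}\prod_{j=l}^{b}x^{(j)}_{i+1}},\quad \gamma_i(v_1(x))=D^{(a)}_i\frac{x^{(a)}_i}{x^{(a)}_{i-1}x^{(a-1)}_{i+1}},\quad \varepsilon_i(v_1(x))=\sum_{l=a}^b\frac1{D^{(l)}_i},$$ $e_i^c(v_1(x))=v_1(x')$ with $x'^{(l)}_m=x^{(l)}_m$ for $m\ne i$ and $$x'^{(l)}_i=x^{(l)}_i\,\frac{\sum_{p=a}^{l-1}1/D^{(p)}_i+\sum_{p=l}^{b}c/D^{(p)}_i}{\sum_{p=a}^{l}1/D^{(p)}_i+\sum_{p=l+1}^{b}c/D^{(p)}_i}.$$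 For $0\le i\le n-1$, the $\mathfrak g_n$-geometric crystal structure $(\overline e_i,\overline\gamma_i,\overline\varepsilon_i)$ on $\mathcal V_2$ is given by the same formulas with $x,v_1,D^{(l)}_i$ replaced by $y,v_2,E^{(l)}_i$ and $a,b$ replaced by $\max(k-i,1)$ and $\min(k,n-i)$. **The map $\overline\sigma$.** A path in $S_1$ is a sequence of points of $S_1$ with steps $(i,j)\to(i,j+1)$ (horizontal, weight $x^{(i)}_j/x^{(i)}_{j+1}$) or $(i,j)\to(i-1,j+1)$ (vertical, weight $1$); its weight is the product of the weights of its steps. For $(l,m)\in S_1$, $X^{(l)}_m(x)$ is the sum of the weights of all paths from $(l,m)$ to $(1,n)$; $X^{(l)}_m:=1/x^{(1)}_n$ if $l+m=k$, and $X^{(k+1)}_m:=1$. Put $\Sigma(x)^{(l)}_m=x^{(l+1)}_mX^{(l)}_m(x)/X^{(l+1)}_m(x)$ for $(l,m)\in S_2$. Then $\overline\sigma:\mathcal V_1\to\mathcal V_2$ is the birational map $\overline\sigma(v_1(x))=v_2(\Sigma(x))$.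
   Formalization: Axiom (i), {1}×X ⊂ dom(e_i), is proved only for (1,x) with x in a dense open subset of X; the pointwise inclusion fails, e.g. for n=3, k=2, i=2 at points with x^(1)_2 x^(2)_2 + x^(1)_3 x^(2)_1 = 0. *)

theory Defs
  imports "HOL-Analysis.Abstract_Topology" "HOL-Number_Theory.Cong"
begin

section \<open>Quasi-affine varieties and rational maps\<close>

text \<open>
  Points of affine space are functions \<open>'b \<Rightarrow> complex\<close>; the coordinate functions are the
  evaluations.
\<close>

inductive_set poly_fun :: "(('b \<Rightarrow> complex) \<Rightarrow> complex) set" where
  const: "(\<lambda>p. c) \<in> poly_fun"
| coord: "(\<lambda>p. p i) \<in> poly_fun"
| add: "f \<in> poly_fun \<Longrightarrow> g \<in> poly_fun \<Longrightarrow> (\<lambda>p. f p + g p) \<in> poly_fun"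
| mult: "f \<in> poly_fun \<Longrightarrow> g \<in> poly_fun \<Longrightarrow> (\<lambda>p. f p * g p) \<in> poly_fun"

definition zariski :: "('b \<Rightarrow> complex) topology" where
  "zariski = topology (\<lambda>U. \<exists>F\<subseteq>poly_fun. U = {p. \<exists>f\<in>F. f p \<noteq> 0})"

lemma openin_zariski: "openin zariski U \<longleftrightarrow> (\<exists>F\<subseteq>poly_fun. U = {p. \<exists>f\<in>F. f p \<noteq> 0})"
proof -
  let ?P = "\<lambda>U :: ('b \<Rightarrow> complex) set. \<exists>F\<subseteq>poly_fun. U = {p. \<exists>f\<in>F. f p \<noteq> 0}"
  have "?P (U \<inter> V)" if UV: "?P U" "?P V" for U V :: "('b \<Rightarrow> complex) set"
  proof -
    obtain F where F: "F \<subseteq> poly_fun" "U = {p. \<exists>f\<in>F. f p \<noteq> 0}" using UV(1) by (elim exE conjE)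
    obtain G where G: "G \<subseteq> poly_fun" "V = {p. \<exists>f\<in>G. f p \<noteq> 0}" using UV(2) by (elim exE conjE)
    define H where "H = (\<lambda>(f, g). \<lambda>p. f p * g p) ` (F \<times> G)"
    have "H \<subseteq> poly_fun"
    proof
      fix h assume "h \<in> H"
      then obtain f g where "f \<in> F" "g \<in> G" "h = (\<lambda>p. f p * g p)" by (auto simp: H_def)
      then show "h \<in> poly_fun" using F(1) G(1) poly_fun.mult by blast
    qed
    moreover have "U \<inter> V = {p. \<exists>h\<in>H. h p \<noteq> 0}"
      unfolding F(2) G(2) H_def by (simp add: set_eq_iff split_beta)
    ultimately show "?P (U \<inter> V)" by (intro exI[of _ H] conjI)
  qed
  moreover have "?P (\<Union>K)" if K: "\<forall>U\<in>K. ?P U" for K :: "('b \<Rightarrow> complex) set set"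
  proof -
    define F where "F = {f \<in> poly_fun. {p. f p \<noteq> 0} \<subseteq> \<Union>K}"
    have "p \<in> {p. \<exists>f\<in>F. f p \<noteq> 0}" if "p \<in> \<Union>K" for p
    proof -
      from that obtain U where U: "U \<in> K" "p \<in> U" by (rule UnionE)
      from K U(1) have "?P U" by (rule bspec)
      then obtain G where G: "G \<subseteq> poly_fun" "U = {p. \<exists>f\<in>G. f p \<noteq> 0}" by (elim exE conjE)
      from U(2) obtain f where f: "f \<in> G" "f p \<noteq> 0" unfolding G(2) by blast
      have "{p. f p \<noteq> 0} \<subseteq> U" using f(1) by (subst G(2)) blast
      then have "f \<in> F" using f(1) G(1) U(1) unfolding F_def by blast
      with f(2) show ?thesis by blast
    qed
    then have "\<Union>K = {p. \<exists>f\<in>F. f p \<noteq> 0}" unfolding F_def by blast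
    moreover have "F \<subseteq> poly_fun" unfolding F_def by simp
    ultimately show ?thesis by (intro exI[of _ F] conjI)
  qed
  ultimately have "istopology ?P" unfolding istopology_def by (intro conjI allI impI)
  then show ?thesis unfolding zariski_def by (rule fun_cong[OF topology_inverse'])
qed

text \<open>
  Irreducible quasi-affine varieties. The index type may be infinite; the second conjunct makes
  the variety live in a finite-dimensional affine subspace.
\<close>

definition variety :: "('b \<Rightarrow> complex) set \<Rightarrow> bool" where
  "variety X \<longleftrightarrow>
     X \<noteq> {} \<and>
     (\<exists>B. finite B \<and> (\<forall>p\<in>X. \<forall>q\<in>X. \<forall>i. i \<notin> B \<longrightarrow> p i = q i)) \<and>
     (\<exists>U C. openin zariski U \<and> closedin zariski C \<and> X = U \<inter> C) \<and>
     (\<forall>U V. openin (subtopology zariski X) U \<and> openin (subtopology zariski X) V \<and>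
        U \<noteq> {} \<and> V \<noteq> {} \<longrightarrow> U \<inter> V \<noteq> {})"

text \<open>On an irreducible \<open>X\<close> a non-empty open subset is dense.\<close>

definition generically :: "('b \<Rightarrow> complex) set \<Rightarrow> (('b \<Rightarrow> complex) \<Rightarrow> bool) \<Rightarrow> bool" where
  "generically X Q \<longleftrightarrow> (\<exists>U. openin (subtopology zariski X) U \<and> U \<noteq> {} \<and> (\<forall>p\<in>U. Q p))"

definition regular_fun_on ::
    "('b \<Rightarrow> complex) set \<Rightarrow> ('b \<Rightarrow> complex) set \<Rightarrow> (('b \<Rightarrow> complex) \<Rightarrow> complex) \<Rightarrow> bool" where
  "regular_fun_on X U f \<longleftrightarrow>
     (\<forall>p\<in>U. \<exists>V. openin (subtopology zariski X) V \<and> p \<in> V \<and> V \<subseteq> U \<and>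
        (\<exists>g\<in>poly_fun. \<exists>h\<in>poly_fun. \<forall>q\<in>V. h q \<noteq> 0 \<and> f q = g q / h q))"

definition regular_map_on ::
    "('b \<Rightarrow> complex) set \<Rightarrow> ('b \<Rightarrow> complex) set \<Rightarrow> ('c \<Rightarrow> complex) set
      \<Rightarrow> (('b \<Rightarrow> complex) \<Rightarrow> ('c \<Rightarrow> complex)) \<Rightarrow> bool" where
  "regular_map_on X U Y \<phi> \<longleftrightarrow> \<phi> ` U \<subseteq> Y \<and> (\<forall>i. regular_fun_on X U (\<lambda>p. \<phi> p i))"

text \<open>
  A rational function or rational map is given by a total HOL function that is regular on some
  non-empty open set. Its values elsewhere carry no meaning: two such functions represent the
  same rational map iff they agree generically, and identities between rational maps are
  accordingly stated with \<open>generically\<close>.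
\<close>

definition rational_fun :: "('b \<Rightarrow> complex) set \<Rightarrow> (('b \<Rightarrow> complex) \<Rightarrow> complex) \<Rightarrow> bool" where
  "rational_fun X f \<longleftrightarrow>
     (\<exists>U. openin (subtopology zariski X) U \<and> U \<noteq> {} \<and> regular_fun_on X U f)"

definition rational_map ::
    "('b \<Rightarrow> complex) set \<Rightarrow> ('c \<Rightarrow> complex) set \<Rightarrow> (('b \<Rightarrow> complex) \<Rightarrow> ('c \<Rightarrow> complex)) \<Rightarrow> bool" where
  "rational_map X Y \<phi> \<longleftrightarrow>
     (\<exists>U. openin (subtopology zariski X) U \<and> U \<noteq> {} \<and> regular_map_on X U Y \<phi>)"

text \<open>
  \<open>rat_value X Y \<phi> p q\<close>: the rational map represented by \<open>\<phi>\<close> is defined at \<open>p\<close>, with value \<open>q\<close>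
  (which may differ from \<open>\<phi> p\<close>).
\<close>

definition rat_value ::
    "('b \<Rightarrow> complex) set \<Rightarrow> ('c \<Rightarrow> complex) set \<Rightarrow> (('b \<Rightarrow> complex) \<Rightarrow> ('c \<Rightarrow> complex))
      \<Rightarrow> ('b \<Rightarrow> complex) \<Rightarrow> ('c \<Rightarrow> complex) \<Rightarrow> bool" where
  "rat_value X Y \<phi> p q \<longleftrightarrow>
     (\<exists>U \<psi>. openin (subtopology zariski X) U \<and> p \<in> U \<and> regular_map_on X U Y \<psi> \<and>
        generically X (\<lambda>r. r \<in> U \<and> \<psi> r = \<phi> r) \<and> \<psi> p = q)"

definition rat_dom ::
    "('b \<Rightarrow> complex) set \<Rightarrow> ('c \<Rightarrow> complex) set \<Rightarrow> (('b \<Rightarrow> complex) \<Rightarrow> ('c \<Rightarrow> complex))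
      \<Rightarrow> ('b \<Rightarrow> complex) set" where
  "rat_dom X Y \<phi> = {p. \<exists>q. rat_value X Y \<phi> p q}"

definition is_rat_inverse ::
    "('b \<Rightarrow> complex) set \<Rightarrow> ('c \<Rightarrow> complex) set \<Rightarrow> (('b \<Rightarrow> complex) \<Rightarrow> ('c \<Rightarrow> complex))
      \<Rightarrow> (('c \<Rightarrow> complex) \<Rightarrow> ('b \<Rightarrow> complex)) \<Rightarrow> bool" where
  "is_rat_inverse X Y \<phi> \<psi> \<longleftrightarrow>
     rational_map X Y \<phi> \<and> rational_map Y X \<psi> \<and>
     generically X (\<lambda>p. \<psi> (\<phi> p) = p) \<and> generically Y (\<lambda>q. \<phi> (\<psi> q) = q)"

definition birational ::
    "('b \<Rightarrow> complex) set \<Rightarrow> ('c \<Rightarrow> complex) set \<Rightarrow> (('b \<Rightarrow> complex) \<Rightarrow> ('c \<Rightarrow> complex)) \<Rightarrow> bool" where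
  "birational X Y \<phi> \<longleftrightarrow> (\<exists>\<psi>. is_rat_inverse X Y \<phi> \<psi>)"

text \<open>The inverse of a birational map is unique as a rational map, so any representative will do.\<close>

definition rat_inv ::
    "('b \<Rightarrow> complex) set \<Rightarrow> ('c \<Rightarrow> complex) set \<Rightarrow> (('b \<Rightarrow> complex) \<Rightarrow> ('c \<Rightarrow> complex))
      \<Rightarrow> (('c \<Rightarrow> complex) \<Rightarrow> ('b \<Rightarrow> complex))" where
  "rat_inv X Y \<phi> = (SOME \<psi>. is_rat_inverse X Y \<phi> \<psi>)"

text \<open>
  \<open>ctimes X\<close> is \<open>\<complex>\<^sup>\<times> \<times> X\<close>; the pair \<open>(c, x)\<close> is encoded as \<open>case_option c x\<close>, i.e. the coordinate
  \<open>None\<close> carries \<open>c\<close>.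
\<close>

definition ctimes :: "('b \<Rightarrow> complex) set \<Rightarrow> ('b option \<Rightarrow> complex) set" where
  "ctimes X = {case_option c x | c x. c \<noteq> 0 \<and> x \<in> X}"

definition uncurry1 :: "(complex \<Rightarrow> ('b \<Rightarrow> complex) \<Rightarrow> 'r) \<Rightarrow> ('b option \<Rightarrow> complex) \<Rightarrow> 'r" where
  "uncurry1 Q z = Q (z None) (z \<circ> Some)"

definition uncurry2 ::
    "(complex \<Rightarrow> complex \<Rightarrow> ('b \<Rightarrow> complex) \<Rightarrow> 'r) \<Rightarrow> ('b option option \<Rightarrow> complex) \<Rightarrow> 'r" where
  "uncurry2 Q z = Q (z None) (z (Some None)) (z \<circ> Some \<circ> Some)"


section \<open>Geometric crystals\<close>

definition rational_action ::
    "('b \<Rightarrow> complex) set \<Rightarrow> (complex \<Rightarrow> ('b \<Rightarrow> complex) \<Rightarrow> ('b \<Rightarrow> complex)) \<Rightarrow> bool" where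
  "rational_action X e \<longleftrightarrow>
     rational_map (ctimes X) X (uncurry1 e) \<and>
     (\<forall>x q. rat_value (ctimes X) X (uncurry1 e) (case_option 1 x) q \<longrightarrow> q = x) \<and>
     generically (ctimes (ctimes X)) (uncurry2 (\<lambda>c1 c2 x. e c1 (e c2 x) = e (c1 * c2) x))"

text \<open>
  In the third conjunct, \<open>{1} \<times> X \<subseteq> dom e\<^sub>i\<close> is read in the sense of rational maps: the points
  \<open>(1, x)\<close> are in the domain for \<open>x\<close> in a dense open subset of \<open>X\<close>, so that \<open>e\<^sub>i\<^sup>1\<close> is a
  rational map on \<open>X\<close> (and then the identity). The pointwise inclusion fails in general for the crystals
  below: a quotient such as
  \<open>(\<Sum>p<l. 1/D\<^sub>p + \<Sum>p\<ge>l. c/D\<^sub>p) / (\<Sum>p\<le>l. 1/D\<^sub>p + \<Sum>p>l. c/D\<^sub>p)\<close>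
  is indeterminate at \<open>c = 1\<close> where \<open>\<Sum>p. 1/D\<^sub>p = 0\<close>.
\<close>

definition geometric_crystal ::
    "'i set \<Rightarrow> ('i \<Rightarrow> 'i \<Rightarrow> int) \<Rightarrow> ('b \<Rightarrow> complex) set
      \<Rightarrow> ('i \<Rightarrow> complex \<Rightarrow> ('b \<Rightarrow> complex) \<Rightarrow> ('b \<Rightarrow> complex))
      \<Rightarrow> ('i \<Rightarrow> ('b \<Rightarrow> complex) \<Rightarrow> complex) \<Rightarrow> ('i \<Rightarrow> ('b \<Rightarrow> complex) \<Rightarrow> complex) \<Rightarrow> bool" where
  "geometric_crystal J A X e \<gamma> \<epsilon> \<longleftrightarrow>
     variety X \<and>
     (\<forall>i\<in>J. rational_action X (e i) \<and> rational_fun X (\<gamma> i) \<and> rational_fun X (\<epsilon> i)) \<and>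
     (\<forall>i\<in>J. generically X (\<lambda>x. case_option 1 x \<in> rat_dom (ctimes X) X (uncurry1 (e i)))) \<and>
     (\<forall>i\<in>J. \<forall>j\<in>J. generically (ctimes X)
        (uncurry1 (\<lambda>c x. \<gamma> j (e i c x) = c powi A i j * \<gamma> j x))) \<and>
     (\<forall>i\<in>J. \<forall>j\<in>J. A i j = 0 \<and> A j i = 0 \<longrightarrow> generically (ctimes (ctimes X))
        (uncurry2 (\<lambda>c1 c2 x. e i c1 (e j c2 x) = e j c2 (e i c1 x)))) \<and>
     (\<forall>i\<in>J. \<forall>j\<in>J. A i j = -1 \<and> A j i = -1 \<longrightarrow> generically (ctimes (ctimes X))
        (uncurry2 (\<lambda>c1 c2 x.
           e i c1 (e j (c1 * c2) (e i c2 x)) = e j c2 (e i (c1 * c2) (e j c1 x))))) \<and>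
     (\<forall>i\<in>J. generically (ctimes X) (uncurry1 (\<lambda>c x. \<epsilon> i (e i c x) = inverse c * \<epsilon> i x))) \<and>
     (\<forall>i\<in>J. \<forall>j\<in>J. A i j = 0 \<and> A j i = 0 \<longrightarrow>
        generically (ctimes X) (uncurry1 (\<lambda>c x. \<epsilon> i (e j c x) = \<epsilon> i x)))"


section \<open>Positivity\<close>

text \<open>
  The torus with coordinates indexed by \<open>S\<close>; the coordinates outside \<open>S\<close> are \<open>1\<close>. With this
  convention \<open>ctimes (torus S) = torus (insert None (Some ` S))\<close>.
\<close>

definition torus :: "'s set \<Rightarrow> ('s \<Rightarrow> complex) set" where
  "torus S = {x. (\<forall>s\<in>S. x s \<noteq> 0) \<and> (\<forall>s. s \<notin> S \<longrightarrow> x s = 1)}"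

definition torus_char :: "'s set \<Rightarrow> ('s \<Rightarrow> int) \<Rightarrow> ('s \<Rightarrow> complex) \<Rightarrow> complex" where
  "torus_char S \<nu> x = (\<Prod>s\<in>S. x s powi \<nu> s)"

definition positive_comb :: "'s set \<Rightarrow> (('s \<Rightarrow> complex) \<Rightarrow> complex) \<Rightarrow> bool" where
  "positive_comb S g \<longleftrightarrow>
     (\<exists>M (a :: ('s \<Rightarrow> int) \<Rightarrow> real). finite M \<and> M \<noteq> {} \<and> (\<forall>\<nu>\<in>M. a \<nu> > 0) \<and>
        (\<forall>x\<in>torus S. g x = (\<Sum>\<nu>\<in>M. complex_of_real (a \<nu>) * torus_char S \<nu> x)))"

definition positive_fun :: "'s set \<Rightarrow> (('s \<Rightarrow> complex) \<Rightarrow> complex) \<Rightarrow> bool" where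
  "positive_fun S f \<longleftrightarrow>
     (\<exists>g h. positive_comb S g \<and> positive_comb S h \<and> generically (torus S) (\<lambda>x. f x = g x / h x))"

definition positive_map ::
    "'s set \<Rightarrow> 't set \<Rightarrow> (('s \<Rightarrow> complex) \<Rightarrow> ('t \<Rightarrow> complex)) \<Rightarrow> bool" where
  "positive_map S S' \<phi> \<longleftrightarrow>
     rational_map (torus S) (torus S') \<phi> \<and>
     (\<forall>\<nu>. positive_fun S (\<lambda>x. torus_char S' \<nu> (\<phi> x)))"

definition positive_structure ::
    "'i set \<Rightarrow> ('b \<Rightarrow> complex) set \<Rightarrow> ('i \<Rightarrow> complex \<Rightarrow> ('b \<Rightarrow> complex) \<Rightarrow> ('b \<Rightarrow> complex))
      \<Rightarrow> ('i \<Rightarrow> ('b \<Rightarrow> complex) \<Rightarrow> complex) \<Rightarrow> ('i \<Rightarrow> ('b \<Rightarrow> complex) \<Rightarrow> complex)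
      \<Rightarrow> 's set \<Rightarrow> (('s \<Rightarrow> complex) \<Rightarrow> ('b \<Rightarrow> complex)) \<Rightarrow> bool" where
  "positive_structure J X e \<gamma> \<epsilon> S \<theta> \<longleftrightarrow>
     finite S \<and> birational (torus S) X \<theta> \<and>
     (\<forall>i\<in>J. positive_fun S (\<gamma> i \<circ> \<theta>) \<and> positive_fun S (\<epsilon> i \<circ> \<theta>) \<and>
        positive_map (insert None (Some ` S)) S
          (uncurry1 (\<lambda>c t. rat_inv (torus S) X \<theta> (e i c (\<theta> t)))))"


section \<open>The module and the varieties \<open>\<V>\<^sub>1\<close>, \<open>\<V>\<^sub>2\<close>\<close>

definition cartan :: "int \<Rightarrow> int \<Rightarrow> int \<Rightarrow> int" where
  "cartan n i j =
     (if i = j then 2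
      else if [i = j + 1] (mod (n + 1)) \<or> [i = j - 1] (mod (n + 1)) then -1 else 0)"

definition basisW :: "int \<Rightarrow> int \<Rightarrow> int set set" where
  "basisW n k = {J. J \<subseteq> {1..n + 1} \<and> card J = nat k}"

text \<open>
  A vector of the module is its coefficient function, zero outside \<open>basisW n k\<close>.
  The operators with index \<open>i\<close> act on the entries \<open>src n i\<close> and \<open>i + 1\<close>, which are
  \<open>i, i + 1\<close> for \<open>i \<ge> 1\<close> and \<open>n + 1, 1\<close> for \<open>i = 0\<close>.
\<close>

definition src :: "int \<Rightarrow> int \<Rightarrow> int" where
  "src n i = (if i = 0 then n + 1 else i)"

definition f_basis :: "int \<Rightarrow> int \<Rightarrow> int set \<Rightarrow> int set option" where
  "f_basis n i J =
     (if src n i \<in> J \<and> i + 1 \<notin> J then Some (insert (i + 1) (J - {src n i})) else None)"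

definition f_op :: "int \<Rightarrow> int \<Rightarrow> int \<Rightarrow> (int set \<Rightarrow> complex) \<Rightarrow> (int set \<Rightarrow> complex)" where
  "f_op n k i v = (\<lambda>J. \<Sum>J' | J' \<in> basisW n k \<and> f_basis n i J' = Some J. v J')"

definition alpha_op :: "int \<Rightarrow> int \<Rightarrow> complex \<Rightarrow> (int set \<Rightarrow> complex) \<Rightarrow> (int set \<Rightarrow> complex)" where
  "alpha_op n i c v = (\<lambda>J.
     (if src n i \<in> J \<and> i + 1 \<notin> J then c
      else if i + 1 \<in> J \<and> src n i \<notin> J then inverse c else 1) * v J)"

definition y_op :: "int \<Rightarrow> int \<Rightarrow> int \<Rightarrow> complex \<Rightarrow> (int set \<Rightarrow> complex) \<Rightarrow> (int set \<Rightarrow> complex)" where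
  "y_op n k i c v = (\<lambda>J. v J + c * f_op n k i v J)"

definition Y_op :: "int \<Rightarrow> int \<Rightarrow> int \<Rightarrow> complex \<Rightarrow> (int set \<Rightarrow> complex) \<Rightarrow> (int set \<Rightarrow> complex)" where
  "Y_op n k i c v = y_op n k i (1 / c) (alpha_op n i c v)"

definition basis_vec :: "int set \<Rightarrow> int set \<Rightarrow> complex" where
  "basis_vec K = (\<lambda>J. if J = K then 1 else 0)"

definition S1 :: "int \<Rightarrow> int \<Rightarrow> (int \<times> int) set" where
  "S1 n k = {(l, m). 1 \<le> l \<and> l \<le> k \<and> k < l + m \<and> l + m \<le> n + 1}"

definition S2 :: "int \<Rightarrow> int \<Rightarrow> (int \<times> int) set" where
  "S2 n k = {(l, m). 1 \<le> l \<and> l \<le> k \<and> k \<le> l + m \<and> l + m \<le> n}"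

text \<open>
  The coordinate \<open>x\<^sup>(\<^sup>l\<^sup>)\<^sub>m\<close> is \<open>x (l, m)\<close>. Note that \<open>fold\<close> applies the operator belonging to the
  first list element first, i.e. that operator stands rightmost in the product.
\<close>

definition v1 :: "int \<Rightarrow> int \<Rightarrow> (int \<times> int \<Rightarrow> complex) \<Rightarrow> (int set \<Rightarrow> complex)" where
  "v1 n k x =
     fold (\<lambda>l. fold (\<lambda>m. Y_op n k m (x (l, m))) [k - l + 1..n + 1 - l]) [1..k]
       (basis_vec {1..k})"

definition v2 :: "int \<Rightarrow> int \<Rightarrow> (int \<times> int \<Rightarrow> complex) \<Rightarrow> (int set \<Rightarrow> complex)" where
  "v2 n k y =
     fold (\<lambda>l. fold (\<lambda>m. Y_op n k m (y (l, m))) [k - l..n - l]) [1..k]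
       (basis_vec (insert (n + 1) {1..k - 1}))"

definition V1 :: "int \<Rightarrow> int \<Rightarrow> (int set \<Rightarrow> complex) set" where
  "V1 n k = v1 n k ` torus (S1 n k)"

definition V2 :: "int \<Rightarrow> int \<Rightarrow> (int set \<Rightarrow> complex) set" where
  "V2 n k = v2 n k ` torus (S2 n k)"

definition coords1 :: "int \<Rightarrow> int \<Rightarrow> (int set \<Rightarrow> complex) \<Rightarrow> (int \<times> int \<Rightarrow> complex)" where
  "coords1 n k = inv_into (torus (S1 n k)) (v1 n k)"

definition coords2 :: "int \<Rightarrow> int \<Rightarrow> (int set \<Rightarrow> complex) \<Rightarrow> (int \<times> int \<Rightarrow> complex)" where
  "coords2 n k = inv_into (torus (S2 n k)) (v2 n k)"


section \<open>The two crystal structures of finite type\<close>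

text \<open>
  The common formulas in coordinates. \<open>S\<close> is the index set of the coordinates and \<open>a, b\<close> are the
  summation bounds, which depend on \<open>i\<close>.
\<close>

definition D_coord :: "int \<Rightarrow> int \<Rightarrow> int \<Rightarrow> (int \<times> int \<Rightarrow> complex) \<Rightarrow> complex" where
  "D_coord b l i x =
     x (l, i) * (\<Prod>j=l+1..b. (x (j, i))\<^sup>2)
       / ((\<Prod>j=l+1..b+1. x (j, i - 1)) * (\<Prod>j=l..b. x (j, i + 1)))"

definition gamma_coord :: "int \<Rightarrow> int \<Rightarrow> int \<Rightarrow> (int \<times> int \<Rightarrow> complex) \<Rightarrow> complex" where
  "gamma_coord a b i x = D_coord b a i x * (x (a, i) / (x (a, i - 1) * x (a - 1, i + 1)))"

definition eps_coord :: "int \<Rightarrow> int \<Rightarrow> int \<Rightarrow> (int \<times> int \<Rightarrow> complex) \<Rightarrow> complex" where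
  "eps_coord a b i x = (\<Sum>l=a..b. 1 / D_coord b l i x)"

definition e_coord ::
    "(int \<times> int) set \<Rightarrow> int \<Rightarrow> int \<Rightarrow> int \<Rightarrow> complex \<Rightarrow> (int \<times> int \<Rightarrow> complex)
      \<Rightarrow> (int \<times> int \<Rightarrow> complex)" where
  "e_coord S a b i c x = (\<lambda>(l, m).
     if (l, m) \<in> S \<and> m = i then
       x (l, i) * (((\<Sum>p=a..l-1. 1 / D_coord b p i x) + (\<Sum>p=l..b. c / D_coord b p i x))
                 / ((\<Sum>p=a..l. 1 / D_coord b p i x) + (\<Sum>p=l+1..b. c / D_coord b p i x)))
     else x (l, m))"

definition a1 :: "int \<Rightarrow> int \<Rightarrow> int" where "a1 k i = max (k - i + 1) 1"
definition b1 :: "int \<Rightarrow> int \<Rightarrow> int \<Rightarrow> int" where "b1 n k i = min k (n - i + 1)"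
definition a2 :: "int \<Rightarrow> int \<Rightarrow> int" where "a2 k i = max (k - i) 1"
definition b2 :: "int \<Rightarrow> int \<Rightarrow> int \<Rightarrow> int" where "b2 n k i = min k (n - i)"

definition gamma1 :: "int \<Rightarrow> int \<Rightarrow> int \<Rightarrow> (int set \<Rightarrow> complex) \<Rightarrow> complex" where
  "gamma1 n k i p = gamma_coord (a1 k i) (b1 n k i) i (coords1 n k p)"

definition eps1 :: "int \<Rightarrow> int \<Rightarrow> int \<Rightarrow> (int set \<Rightarrow> complex) \<Rightarrow> complex" where
  "eps1 n k i p = eps_coord (a1 k i) (b1 n k i) i (coords1 n k p)"

definition e1 :: "int \<Rightarrow> int \<Rightarrow> int \<Rightarrow> complex \<Rightarrow> (int set \<Rightarrow> complex) \<Rightarrow> (int set \<Rightarrow> complex)" where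
  "e1 n k i c p = v1 n k (e_coord (S1 n k) (a1 k i) (b1 n k i) i c (coords1 n k p))"

definition gamma2 :: "int \<Rightarrow> int \<Rightarrow> int \<Rightarrow> (int set \<Rightarrow> complex) \<Rightarrow> complex" where
  "gamma2 n k i p = gamma_coord (a2 k i) (b2 n k i) i (coords2 n k p)"

definition eps2 :: "int \<Rightarrow> int \<Rightarrow> int \<Rightarrow> (int set \<Rightarrow> complex) \<Rightarrow> complex" where
  "eps2 n k i p = eps_coord (a2 k i) (b2 n k i) i (coords2 n k p)"

definition e2 :: "int \<Rightarrow> int \<Rightarrow> int \<Rightarrow> complex \<Rightarrow> (int set \<Rightarrow> complex) \<Rightarrow> (int set \<Rightarrow> complex)" where
  "e2 n k i c p = v2 n k (e_coord (S2 n k) (a2 k i) (b2 n k i) i c (coords2 n k p))"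


section \<open>The map \<open>\<sigma>\<close> and the \<open>0\<close>-structure\<close>

definition path_step :: "int \<times> int \<Rightarrow> int \<times> int \<Rightarrow> bool" where
  "path_step s t \<longleftrightarrow> t = (fst s, snd s + 1) \<or> t = (fst s - 1, snd s + 1)"

definition step_weight :: "(int \<times> int \<Rightarrow> complex) \<Rightarrow> int \<times> int \<Rightarrow> int \<times> int \<Rightarrow> complex" where
  "step_weight x s t = (if fst t = fst s then x s / x t else 1)"

text \<open>A path is the list of its points; the one-point path has weight \<open>1\<close>.\<close>

definition paths :: "int \<Rightarrow> int \<Rightarrow> int \<times> int \<Rightarrow> (int \<times> int) list set" where
  "paths n k s =
     {ps. ps \<noteq> [] \<and> set ps \<subseteq> S1 n k \<and> successively path_step ps \<and> hd ps = s \<and> last ps = (1, n)}"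

definition path_weight :: "(int \<times> int \<Rightarrow> complex) \<Rightarrow> (int \<times> int) list \<Rightarrow> complex" where
  "path_weight x ps = prod_list (map2 (step_weight x) ps (tl ps))"

definition Xfun :: "int \<Rightarrow> int \<Rightarrow> (int \<times> int \<Rightarrow> complex) \<Rightarrow> int \<Rightarrow> int \<Rightarrow> complex" where
  "Xfun n k x l m =
     (if l = k + 1 then 1
      else if l + m = k then 1 / x (1, n)
      else (\<Sum>ps\<in>paths n k (l, m). path_weight x ps))"

definition Sigma_map :: "int \<Rightarrow> int \<Rightarrow> (int \<times> int \<Rightarrow> complex) \<Rightarrow> (int \<times> int \<Rightarrow> complex)" where
  "Sigma_map n k x = (\<lambda>(l, m).
     if (l, m) \<in> S2 n k then x (l + 1, m) * Xfun n k x l m / Xfun n k x (l + 1) m else 1)"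

definition sigma :: "int \<Rightarrow> int \<Rightarrow> (int set \<Rightarrow> complex) \<Rightarrow> (int set \<Rightarrow> complex)" where
  "sigma n k p = v2 n k (Sigma_map n k (coords1 n k p))"

definition gammaV :: "int \<Rightarrow> int \<Rightarrow> int \<Rightarrow> (int set \<Rightarrow> complex) \<Rightarrow> complex" where
  "gammaV n k i = (if i = 0 then gamma2 n k 0 \<circ> sigma n k else gamma1 n k i)"

definition epsV :: "int \<Rightarrow> int \<Rightarrow> int \<Rightarrow> (int set \<Rightarrow> complex) \<Rightarrow> complex" where
  "epsV n k i = (if i = 0 then eps2 n k 0 \<circ> sigma n k else eps1 n k i)"

definition eV :: "int \<Rightarrow> int \<Rightarrow> int \<Rightarrow> complex \<Rightarrow> (int set \<Rightarrow> complex) \<Rightarrow> (int set \<Rightarrow> complex)" where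
  "eV n k i c =
     (if i = 0 then rat_inv (V1 n k) (V2 n k) (sigma n k) \<circ> e2 n k 0 c \<circ> sigma n k
      else e1 n k i c)"

end

theory Submission
  imports Defs "HOL-Computational_Algebra.Polynomial"
begin

text \<open>
  The positive real points are Zariski dense, and subtraction-free denominators do not vanish
  there. So all identities only have to be checked at positive points.

  Let \<open>\<rho>\<close> be the cyclic rotation of \<open>1, \<dots>, n + 1\<close>. It turns \<open>v\<^sub>1\<close> into \<open>v\<^sub>2\<close> up to a shift of the
  coordinates, and exchanging the factors of \<open>v\<^sub>1(x)\<close> by braid moves gives
  \<open>v\<^sub>1(x) = x\<^sup>(\<^sup>1\<^sup>)\<^sub>n v\<^sub>2(\<Sigma>(x))\<close>. Hence the cone over the positive points of \<open>\<V>\<^sub>1\<close> is stable under \<open>\<rho>\<close>, and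
  \<open>\<sigma>\<close> and its inverse are rescalings. Let \<open>A\<^sub>i\<close> be the set of the \<open>k\<close> cyclically consecutive indices ending
  in \<open>i\<close>, let \<open>B\<^sub>i\<close> be \<open>A\<^sub>i\<close> with \<open>i\<close> replaced by \<open>i + 1\<close>, and let \<open>E\<^sub>i\<close> be the raising operator. On the
  cone, for all \<open>i\<close> modulo \<open>n + 1\<close> and up to scalars, \<open>e\<^sub>i\<^sup>c(p) = exp(a E\<^sub>i) p\<close> with
  \<open>a = (c - 1) p(A\<^sub>i) / p(B\<^sub>i)\<close>, while \<open>\<gamma>\<^sub>i(p) = p(A\<^sub>i)\<^sup>2 / (p(A\<^sub>i\<^sub>-\<^sub>1) p(A\<^sub>i\<^sub>+\<^sub>1))\<close> and
  \<open>\<epsilon>\<^sub>i(p) = p(B\<^sub>i) / p(A\<^sub>i)\<close>. This description does not distinguish the index \<open>0\<close>. The Verma relation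
  reduces to the three-term relation
  \<open>p(A\<^sub>i) (E\<^sub>i p)(B\<^sub>i\<^sub>+\<^sub>1) + p(A\<^sub>i\<^sub>+\<^sub>1) (E\<^sub>i\<^sub>+\<^sub>1 p)(B\<^sub>i) = p(B\<^sub>i) p(B\<^sub>i\<^sub>+\<^sub>1)\<close>, which by rotation has to be
  checked for \<open>i = 1\<close> only.
\<close>

section \<open>Positive points\<close>

text \<open>Rational maps compose only if the image of one meets the domain of the next, and
  \<open>rat_inv\<close> returns an unknown representative. Both difficulties vanish for maps that
  are regular near every positive point and send positive points to positive points; every generic
  statement is transported through such maps. The parameter \<open>a\<close> comes from
  \<open>(E_i p)(A_i) = p(B_i)\<close>: it is the value for which \<open>p(A_i)\<close> is
  multiplied by \<open>c\<close>. No other \<open>p(A_m)\<close> changes, so a monomial in these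
  coefficients transforms by a power of \<open>c\<close>. That \<open>p(B_i) / p(A_i)\<close> is the
  given sum is not computed directly. The action in coordinates is realized by a raising step first,
  and the coefficients at \<open>A_i\<close> before and after the step with \<open>c = 2\<close> are
  compared. The same comparison at \<open>B_i\<close> yields the values \<open>(E_j p)(B_i)\<close>
  that enter the three-term relation. The exchange of factors shows only that each point of the cone
  is the rotation of another one. So statements descend from an index to its predecessor, and
  periodicity supplies the larger indices.\<close>

definition cpos :: "complex set" where
  "cpos = of_real ` {0::real<..}"

lemma cpos_of_real [simp]: "of_real r \<in> cpos \<longleftrightarrow> r > 0"
  by (auto simp: cpos_def)

lemma cpos_one [simp]: "1 \<in> cpos"
  using cpos_of_real[of 1] by simp

lemma cpos_nonzero: "z \<in> cpos \<Longrightarrow> z \<noteq> 0"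
  by (auto simp: cpos_def)

lemma cposE:
  assumes "z \<in> cpos" obtains r where "r > 0" "z = of_real r"
  using assms unfolding cpos_def by auto

lemma cpos_add: "z \<in> cpos \<Longrightarrow> w \<in> cpos \<Longrightarrow> z + w \<in> cpos"
  by (elim cposE) (simp flip: of_real_add)

lemma cpos_mult: "z \<in> cpos \<Longrightarrow> w \<in> cpos \<Longrightarrow> z * w \<in> cpos"
  by (elim cposE) (simp flip: of_real_mult)

lemma cpos_inverse: "z \<in> cpos \<Longrightarrow> inverse z \<in> cpos"
  by (elim cposE) (simp flip: of_real_inverse)

lemma cpos_divide: "z \<in> cpos \<Longrightarrow> w \<in> cpos \<Longrightarrow> z / w \<in> cpos"
  by (simp add: divide_inverse cpos_mult cpos_inverse)

lemma cpos_power: "z \<in> cpos \<Longrightarrow> z ^ m \<in> cpos"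
  by (induction m) (simp_all add: cpos_mult)

lemma cpos_prod: "(\<And>i. i \<in> A \<Longrightarrow> f i \<in> cpos) \<Longrightarrow> prod f A \<in> cpos"
  by (induction A rule: infinite_finite_induct) (simp_all add: cpos_mult)

lemma cpos_sum: "finite A \<Longrightarrow> A \<noteq> {} \<Longrightarrow> (\<And>i. i \<in> A \<Longrightarrow> f i \<in> cpos) \<Longrightarrow> sum f A \<in> cpos"
  by (induction A rule: finite_ne_induct) (simp_all add: cpos_add)

lemma infinite_cpos: "infinite cpos"
  unfolding cpos_def by (subst finite_image_iff) (auto simp: infinite_Ioi inj_on_def)

definition tpos :: "'s set \<Rightarrow> ('s \<Rightarrow> complex) set" where
  "tpos S = {x \<in> torus S. \<forall>s. x s \<in> cpos}"

definition ctimes_pos :: "('b \<Rightarrow> complex) set \<Rightarrow> ('b option \<Rightarrow> complex) set" where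
  "ctimes_pos P = {case_option c x | c x. c \<in> cpos \<and> x \<in> P}"

lemma tpos_torus: "x \<in> tpos S \<Longrightarrow> x \<in> torus S"
  and tpos_cpos: "x \<in> tpos S \<Longrightarrow> x s \<in> cpos"
  by (simp_all add: tpos_def)

lemma tposI: "(\<And>s. s \<in> S \<Longrightarrow> x s \<in> cpos) \<Longrightarrow> (\<And>s. s \<notin> S \<Longrightarrow> x s = 1) \<Longrightarrow> x \<in> tpos S"
  unfolding tpos_def torus_def mem_Collect_eq using cpos_nonzero cpos_one by (smt (verit))

lemma case_option_o_Some [simp]: "case_option c x \<circ> Some = x"
  by (simp add: fun_eq_iff)

lemma case_option_surj: "case_option (z None) (z \<circ> Some) = z"
  by (auto simp: fun_eq_iff split: option.split)

lemma mem_ctimes: "z \<in> ctimes X \<longleftrightarrow> z None \<noteq> 0 \<and> z \<circ> Some \<in> X"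
proof
  assume "z None \<noteq> 0 \<and> z \<circ> Some \<in> X"
  then show "z \<in> ctimes X"
    unfolding ctimes_def mem_Collect_eq
    by (intro exI[of _ "z None"] exI[of _ "z \<circ> Some"]) (simp add: case_option_surj)
qed (auto simp: ctimes_def)

lemma mem_ctimes_pos: "z \<in> ctimes_pos X \<longleftrightarrow> z None \<in> cpos \<and> z \<circ> Some \<in> X"
proof
  assume "z None \<in> cpos \<and> z \<circ> Some \<in> X"
  then show "z \<in> ctimes_pos X"
    unfolding ctimes_pos_def mem_Collect_eq
    by (intro exI[of _ "z None"] exI[of _ "z \<circ> Some"]) (simp add: case_option_surj)
qed (auto simp: ctimes_pos_def)

lemma ctimes_torus: "ctimes (torus S) = torus (insert None (Some ` S))"
proof (rule set_eqI)
  fix z :: "'a option \<Rightarrow> complex"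
  have "(\<forall>s. s \<notin> insert None (Some ` S) \<longrightarrow> z s = 1) \<longleftrightarrow> (\<forall>s. s \<notin> S \<longrightarrow> z (Some s) = 1)"
    by (subst split_option_all) auto
  then show "z \<in> ctimes (torus S) \<longleftrightarrow> z \<in> torus (insert None (Some ` S))"
    unfolding mem_ctimes torus_def mem_Collect_eq by auto
qed

lemma ctimes_tpos: "ctimes_pos (tpos S) = tpos (insert None (Some ` S))"
proof (rule set_eqI)
  fix z :: "'a option \<Rightarrow> complex"
  have "z \<in> ctimes (torus S) \<longleftrightarrow> z \<in> torus (insert None (Some ` S))"
    by (simp add: ctimes_torus)
  moreover have "(\<forall>s. z s \<in> cpos) \<longleftrightarrow> z None \<in> cpos \<and> (\<forall>s. z (Some s) \<in> cpos)"
    by (metis not_Some_eq)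
  ultimately show "z \<in> ctimes_pos (tpos S) \<longleftrightarrow> z \<in> tpos (insert None (Some ` S))"
    unfolding mem_ctimes mem_ctimes_pos tpos_def using cpos_nonzero by auto
qed

section \<open>Polynomial functions\<close>

lemmas poly_fun_intros = poly_fun.const poly_fun.coord poly_fun.add poly_fun.mult

lemma poly_fun_minus: "f \<in> poly_fun \<Longrightarrow> g \<in> poly_fun \<Longrightarrow> (\<lambda>p. f p - g p) \<in> poly_fun"
  using poly_fun.add[OF _ poly_fun.mult[OF poly_fun.const[of "-1"]], of f g] by simp

lemma poly_fun_prod: "(\<And>i. i \<in> A \<Longrightarrow> f i \<in> poly_fun) \<Longrightarrow> (\<lambda>p. \<Prod>i\<in>A. f i p) \<in> poly_fun"
  by (induction A rule: infinite_finite_induct) (simp_all add: poly_fun_intros)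

lemma poly_fun_case_option: "f \<in> poly_fun \<Longrightarrow> (\<lambda>x. f (case_option c x)) \<in> poly_fun"
proof (induction rule: poly_fun.induct)
  case (coord i)
  then show ?case by (cases i) (simp_all add: poly_fun_intros)
qed (simp_all add: poly_fun_intros)

text \<open>Restriction to a line replaces multivariate algebra: density and irreducibility below
  reduce to the finiteness of the roots of a univariate polynomial.\<close>

lemma poly_fun_line:
  assumes "f \<in> poly_fun"
  shows "\<exists>r. \<forall>t. f (\<lambda>i. a i + t * b i) = poly r t"
  using assms
proof (induction rule: poly_fun.induct)
  case (const c)
  show ?case by (intro exI[of _ "[:c:]"]) simp
next
  case (coord i)
  show ?case by (intro exI[of _ "[:a i, b i:]"]) simp
next
  case (add f g)
  then obtain r s where "\<forall>t. f (\<lambda>i. a i + t * b i) = poly r t" "\<forall>t. g (\<lambda>i. a i + t * b i) = poly s t"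
    by blast
  then show ?case by (intro exI[of _ "r + s"]) simp
next
  case (mult f g)
  then obtain r s where "\<forall>t. f (\<lambda>i. a i + t * b i) = poly r t" "\<forall>t. g (\<lambda>i. a i + t * b i) = poly s t"
    by blast
  then show ?case by (intro exI[of _ "r * s"]) simp
qed

lemma poly_fun_vanish_line:
  assumes "f \<in> poly_fun" "infinite A" "\<And>t. t \<in> A \<Longrightarrow> f (\<lambda>i. a i + t * b i) = 0"
  shows "f (\<lambda>i. a i + t * b i) = 0"
proof -
  obtain r where r: "\<And>t. f (\<lambda>i. a i + t * b i) = poly r t"
    using poly_fun_line[OF assms(1)] by blast
  have "r = 0"
  proof (rule ccontr)
    assume "r \<noteq> 0"
    then have "finite {t. poly r t = 0}" by (rule poly_roots_finite)
    moreover have "A \<subseteq> {t. poly r t = 0}" using assms(3) r by auto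
    ultimately show False using assms(2) finite_subset by blast
  qed
  then show ?thesis by (simp add: r)
qed

text \<open>The principal open set of \<open>f\<close>.\<close>

definition nz :: "('a \<Rightarrow> complex) \<Rightarrow> 'a set" where
  "nz f = {p. f p \<noteq> 0}"

lemma nz_iff: "p \<in> nz f \<longleftrightarrow> f p \<noteq> 0"
  by (simp add: nz_def)

lemma nz_mult [simp]: "nz (\<lambda>p. f p * g p) = nz f \<inter> nz g"
  by (auto simp: nz_def)

lemma nz_const [simp]: "c \<noteq> 0 \<Longrightarrow> nz (\<lambda>_. c) = UNIV"
  by (auto simp: nz_def)

lemma openin_principal:
  assumes "f \<in> poly_fun"
  shows "openin (subtopology zariski X) (X \<inter> nz f)"
proof -
  have "openin zariski (nz f)"
    unfolding openin_zariski nz_def by (rule exI[of _ "{f}"]) (simp add: assms)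
  then show ?thesis by (rule openin_subtopology_Int2)
qed

lemma openin_contains_principal:
  assumes "openin (subtopology zariski X) U" "p \<in> U"
  shows "\<exists>f\<in>poly_fun. p \<in> nz f \<and> X \<inter> nz f \<subseteq> U \<and> p \<in> X"
proof -
  from assms(1) obtain W where W: "openin zariski W" "U = W \<inter> X"
    unfolding openin_subtopology by auto
  from W(1) obtain F where F: "F \<subseteq> poly_fun" "W = (\<Union>f\<in>F. nz f)"
    unfolding openin_zariski nz_def by auto
  show ?thesis using assms(2) F unfolding W(2) by blast
qed

text \<open>Principal open sets form a base, so one polynomial is enough as a witness of a generic
  statement.\<close>

lemma generically_iff:
  "generically X Q \<longleftrightarrow> (\<exists>f\<in>poly_fun. X \<inter> nz f \<noteq> {} \<and> X \<inter> nz f \<subseteq> Collect Q)"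
proof
  assume "generically X Q"
  then obtain U where U: "openin (subtopology zariski X) U" "U \<noteq> {}" "U \<subseteq> Collect Q"
    unfolding generically_def by auto
  from U(2) obtain p where p: "p \<in> U" by auto
  from openin_contains_principal[OF U(1) p] U(3)
  show "\<exists>f\<in>poly_fun. X \<inter> nz f \<noteq> {} \<and> X \<inter> nz f \<subseteq> Collect Q" by blast
next
  assume "\<exists>f\<in>poly_fun. X \<inter> nz f \<noteq> {} \<and> X \<inter> nz f \<subseteq> Collect Q"
  then obtain f where f: "f \<in> poly_fun" "X \<inter> nz f \<noteq> {}" "X \<inter> nz f \<subseteq> Collect Q" by auto
  show "generically X Q"
    unfolding generically_def
    by (rule exI[of _ "X \<inter> nz f"]) (use openin_principal[OF f(1)] f in auto)
qed

section \<open>Spaces with a Zariski dense set of positive points\<close>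

text \<open>The third conjunct is Zariski density of \<open>P\<close> in \<open>X\<close>, the
  fourth irreducibility of \<open>X\<close>, both phrased with principal open sets. They are bundled
  because both pass to products with the multiplicative group and to images.\<close>

definition pos_dense :: "('b \<Rightarrow> complex) set \<Rightarrow> ('b \<Rightarrow> complex) set \<Rightarrow> bool" where
  "pos_dense X P \<longleftrightarrow>
     P \<subseteq> X \<and> P \<noteq> {} \<and>
     (\<forall>f\<in>poly_fun. P \<inter> nz f = {} \<longrightarrow> X \<inter> nz f = {}) \<and>
     (\<forall>f\<in>poly_fun. \<forall>g\<in>poly_fun. X \<inter> nz f \<noteq> {} \<longrightarrow> X \<inter> nz g \<noteq> {} \<longrightarrow> X \<inter> nz f \<inter> nz g \<noteq> {})"

lemma pos_denseD:
  assumes "pos_dense X P"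
  shows pos_dense_subset: "P \<subseteq> X"
    and pos_dense_nonempty: "P \<noteq> {}"
    and pos_dense_vanish: "f \<in> poly_fun \<Longrightarrow> P \<inter> nz f = {} \<Longrightarrow> X \<inter> nz f = {}"
    and pos_dense_inter: "f \<in> poly_fun \<Longrightarrow> g \<in> poly_fun \<Longrightarrow> X \<inter> nz f \<noteq> {} \<Longrightarrow> X \<inter> nz g \<noteq> {} \<Longrightarrow>
           X \<inter> nz f \<inter> nz g \<noteq> {}"
  using assms by (auto simp: pos_dense_def)

lemma generically_conj:
  assumes "pos_dense X P" "generically X Q" "generically X R"
  shows "generically X (\<lambda>p. Q p \<and> R p)"
proof -
  obtain f where f: "f \<in> poly_fun" "X \<inter> nz f \<noteq> {}" "X \<inter> nz f \<subseteq> Collect Q"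
    using assms(2) unfolding generically_iff by blast
  obtain g where g: "g \<in> poly_fun" "X \<inter> nz g \<noteq> {}" "X \<inter> nz g \<subseteq> Collect R"
    using assms(3) unfolding generically_iff by blast
  have "X \<inter> nz f \<inter> nz g \<noteq> {}" by (rule pos_dense_inter[OF assms(1) f(1) g(1) f(2) g(2)])
  then show ?thesis
    unfolding generically_iff
    by (intro bexI[of _ "\<lambda>p. f p * g p"]) (use f g in \<open>auto simp: poly_fun_intros\<close>)
qed

lemma generically_mono:
  assumes "generically X Q" "\<And>p. p \<in> X \<Longrightarrow> Q p \<Longrightarrow> R p"
  shows "generically X R"
proof -
  obtain f where f: "f \<in> poly_fun" "X \<inter> nz f \<noteq> {}" "X \<inter> nz f \<subseteq> Collect Q"
    using assms(1) unfolding generically_iff by blast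
  then show ?thesis unfolding generically_iff using assms(2) by (intro bexI[of _ f]) auto
qed

lemma generically_posI:
  assumes "pos_dense X P" "f \<in> poly_fun" "P \<subseteq> nz f" "\<And>p. p \<in> X \<Longrightarrow> p \<in> nz f \<Longrightarrow> Q p"
  shows "generically X Q"
  unfolding generically_iff
  using pos_dense_subset[OF assms(1)] pos_dense_nonempty[OF assms(1)] assms(2-4)
  by (intro bexI[of _ f]) auto

lemma generically_pos:
  assumes "pos_dense X P" "generically X Q"
  shows "\<exists>f\<in>poly_fun. P \<inter> nz f \<noteq> {} \<and> X \<inter> nz f \<subseteq> Collect Q"
  using assms(2) pos_dense_vanish[OF assms(1)] unfolding generically_iff by blast

lemma pos_dense_torus:
  assumes "finite S"
  shows "pos_dense (torus S) (tpos S)"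
proof -
  have dense: "torus S \<inter> nz f = {}" if f: "f \<in> poly_fun" "tpos S \<inter> nz f = {}" for f
  proof -
    \<comment> \<open>The coordinates in \<open>F\<close> are freed from positivity one at a time;
      along each of them \<open>f\<close> is a univariate polynomial with infinitely many
      zeros.\<close>
    have "\<forall>x\<in>torus S. (\<forall>s. s \<notin> F \<longrightarrow> x s \<in> cpos) \<longrightarrow> f x = 0" if "finite F" for F
      using that
    proof (induction F rule: finite_induct)
      case empty
      then show ?case using f(2) by (auto simp: tpos_def nz_def)
    next
      case (insert s F)
      show ?case
      proof (intro ballI impI)
        fix x assume x: "x \<in> torus S" "\<forall>t. t \<notin> insert s F \<longrightarrow> x t \<in> cpos"
        show "f x = 0"
        proof (cases "s \<in> S")
          case True
          have eq: "(\<lambda>i. (x(s := 0)) i + t * (if i = s then 1 else 0)) = x(s := t)" for t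
            by (auto simp: fun_eq_iff)
          have "f (\<lambda>i. (x(s := 0)) i + x s * (if i = s then 1 else 0)) = 0"
          proof (rule poly_fun_vanish_line[OF f(1) infinite_cpos])
            fix t :: complex assume t: "t \<in> cpos"
            have "x(s := t) \<in> torus S" using x(1) True t cpos_nonzero by (auto simp: torus_def)
            moreover have "\<forall>u. u \<notin> F \<longrightarrow> (x(s := t)) u \<in> cpos" using x(2) t by auto
            ultimately show "f (\<lambda>i. (x(s := 0)) i + t * (if i = s then 1 else 0)) = 0"
              unfolding eq using insert.IH by blast
          qed
          then show ?thesis unfolding eq by simp
        next
          case False
          then have "x s = 1" using x(1) by (simp add: torus_def)
          then have "\<forall>t. t \<notin> F \<longrightarrow> x t \<in> cpos" using x(2) by (metis cpos_one insertE)
          then show ?thesis using x(1) insert.IH by blast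
        qed
      qed
    qed
    from this[OF assms] show ?thesis by (auto simp: torus_def nz_def)
  qed
  have inter: "torus S \<inter> nz f \<inter> nz g \<noteq> {}"
    if fg: "f \<in> poly_fun" "g \<in> poly_fun" "torus S \<inter> nz f \<noteq> {}" "torus S \<inter> nz g \<noteq> {}" for f g
  proof -
    obtain p where p: "p \<in> tpos S" "p \<in> nz f" using dense[OF fg(1)] fg(3) by blast
    obtain q where q: "q \<in> tpos S" "q \<in> nz g" using dense[OF fg(2)] fg(4) by blast
    \<comment> \<open>The positive points are convex. On the segment from \<open>p\<close> to
      \<open>q\<close> neither polynomial vanishes identically, so some point of it avoids the roots
      of both.\<close>
    define line where "line t = (\<lambda>i. p i + t * (q i - p i))" for t
    obtain r where r: "\<forall>t. f (line t) = poly r t"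
      unfolding line_def using poly_fun_line[OF fg(1), of p "\<lambda>i. q i - p i"] by auto
    obtain s where s: "\<forall>t. g (line t) = poly s t"
      unfolding line_def using poly_fun_line[OF fg(2), of p "\<lambda>i. q i - p i"] by auto
    have "line 0 = p" "line 1 = q" by (auto simp: line_def)
    then have "poly r 0 \<noteq> 0" "poly s 1 \<noteq> 0" using p(2) q(2) r s by (auto simp: nz_def simp flip: r s)
    then have "r \<noteq> 0" "s \<noteq> 0" by auto
    then have "finite {t. poly (r * s) t = 0}" by (intro poly_roots_finite) simp
    moreover have "infinite (complex_of_real ` {0<..<1})"
      by (subst finite_image_iff) (auto simp: infinite_Ioo inj_on_def)
    ultimately have "\<not> complex_of_real ` {0<..<1} \<subseteq> {t. poly (r * s) t = 0}"
      using finite_subset by blast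
    then obtain t :: real where t: "0 < t" "t < 1" "poly (r * s) (of_real t) \<noteq> 0"
      by (metis (mono_tags, lifting) greaterThanLessThan_iff image_subsetI mem_Collect_eq)
    have "line (of_real t) \<in> tpos S"
    proof (rule tposI)
      fix i
      have "of_real (1 - t) * p i + of_real t * q i \<in> cpos"
        using t tpos_cpos[OF p(1)] tpos_cpos[OF q(1)]
        by (intro cpos_add cpos_mult) (auto simp del: of_real_diff)
      then show "line (of_real t) i \<in> cpos" by (simp add: line_def algebra_simps)
    next
      fix i assume "i \<notin> S"
      then show "line (of_real t) i = 1"
        using tpos_torus[OF p(1)] tpos_torus[OF q(1)] by (simp add: line_def torus_def)
    qed
    moreover have "line (of_real t) \<in> nz f" "line (of_real t) \<in> nz g"
      using t(3) r s by (auto simp: nz_def)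
    ultimately show ?thesis using tpos_torus by blast
  qed
  have "(\<lambda>_. 1) \<in> tpos S" by (rule tposI) auto
  then have "tpos S \<subseteq> torus S" "tpos S \<noteq> {}" using tpos_torus by auto
  then show ?thesis unfolding pos_dense_def using dense inter by blast
qed

lemma pos_dense_ctimes:
  assumes X: "pos_dense X P"
  shows "pos_dense (ctimes X) (ctimes_pos P)"
proof -
  have line: "(\<lambda>i. (case_option 0 x) i + t * (case_option 1 (\<lambda>_. 0)) i) = case_option t x"
    for t :: complex and x :: "'a \<Rightarrow> complex"
    by (auto simp: fun_eq_iff split: option.split)
  have dense: "ctimes X \<inter> nz f = {}" if f: "f \<in> poly_fun" "ctimes_pos P \<inter> nz f = {}" for f
  proof -
    \<comment> \<open>Density is applied with \<open>c\<close> fixed and positive; afterwards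
      \<open>c\<close> itself is freed along a line.\<close>
    have 1: "f (case_option c x) = 0" if "c \<in> cpos" "x \<in> X" for c x
    proof -
      have "P \<inter> nz (\<lambda>x. f (case_option c x)) = {}"
        using f(2) that(1) by (auto simp: mem_ctimes_pos nz_def disjoint_iff)
      then have "X \<inter> nz (\<lambda>x. f (case_option c x)) = {}"
        by (rule pos_dense_vanish[OF X poly_fun_case_option[OF f(1)]])
      with that(2) show ?thesis by (auto simp: nz_def)
    qed
    have "f (case_option c x) = 0" if "x \<in> X" for c x
      using poly_fun_vanish_line[OF f(1) infinite_cpos, of "case_option 0 x" "case_option 1 (\<lambda>_. 0)" c]
        1 that unfolding line by simp
    then have "f z = 0" if "z \<in> ctimes X" for z
      using that by (metis mem_ctimes case_option_surj)
    then show ?thesis by (auto simp: nz_def)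
  qed
  have inter: "ctimes X \<inter> nz f \<inter> nz g \<noteq> {}"
    if fg: "f \<in> poly_fun" "g \<in> poly_fun" "ctimes X \<inter> nz f \<noteq> {}" "ctimes X \<inter> nz g \<noteq> {}" for f g
  proof -
    obtain p q where pq: "p \<in> ctimes X" "p \<in> nz f" "q \<in> ctimes X" "q \<in> nz g" using fg by blast
    \<comment> \<open>The two given points have different first coordinates. Irreducibility of
      \<open>X\<close> first provides a common \<open>x\<close>, then a common first coordinate is
      chosen away from the roots over \<open>x\<close>.\<close>
    have "X \<inter> nz (\<lambda>x. f (case_option (p None) x)) \<inter> nz (\<lambda>x. g (case_option (q None) x)) \<noteq> {}"
    proof (rule pos_dense_inter[OF X poly_fun_case_option[OF fg(1)] poly_fun_case_option[OF fg(2)]])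
      show "X \<inter> nz (\<lambda>x. f (case_option (p None) x)) \<noteq> {}"
      proof -
        have "p \<circ> Some \<in> X \<inter> nz (\<lambda>x. f (case_option (p None) x))"
          using pq(1,2) by (simp add: mem_ctimes nz_def case_option_surj)
        then show ?thesis by blast
      qed
      show "X \<inter> nz (\<lambda>x. g (case_option (q None) x)) \<noteq> {}"
      proof -
        have "q \<circ> Some \<in> X \<inter> nz (\<lambda>x. g (case_option (q None) x))"
          using pq(3,4) by (simp add: mem_ctimes nz_def case_option_surj)
        then show ?thesis by blast
      qed
    qed
    then obtain x where x: "x \<in> X" "f (case_option (p None) x) \<noteq> 0" "g (case_option (q None) x) \<noteq> 0"
      by (auto simp: nz_def)
    obtain r where r: "\<forall>t. f (case_option t x) = poly r t"
      using poly_fun_line[OF fg(1), of "case_option 0 x" "case_option 1 (\<lambda>_. 0)"] unfolding line by auto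
    obtain s where s: "\<forall>t. g (case_option t x) = poly s t"
      using poly_fun_line[OF fg(2), of "case_option 0 x" "case_option 1 (\<lambda>_. 0)"] unfolding line by auto
    have "r \<noteq> 0" "s \<noteq> 0" using x r s by auto
    then have "finite {t. poly (r * s) t = 0}" by (intro poly_roots_finite) simp
    then have "\<not> cpos \<subseteq> {t. poly (r * s) t = 0}" using infinite_cpos finite_subset by blast
    then obtain t where t: "t \<in> cpos" "poly (r * s) t \<noteq> 0" by blast
    then have "case_option t x \<in> ctimes X" "case_option t x \<in> nz f" "case_option t x \<in> nz g"
      using x(1) r s cpos_nonzero by (auto simp: mem_ctimes nz_def)
    then show ?thesis by blast
  qed
  obtain p where "p \<in> P" using pos_dense_nonempty[OF X] by blast
  then have "case_option 1 p \<in> ctimes_pos P" by (simp add: mem_ctimes_pos)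
  then have "ctimes_pos P \<noteq> {}" by blast
  moreover have "ctimes_pos P \<subseteq> ctimes X"
    using cpos_nonzero pos_dense_subset[OF X] by (auto simp: mem_ctimes mem_ctimes_pos)
  ultimately have "ctimes_pos P \<subseteq> ctimes X" "ctimes_pos P \<noteq> {}" by simp_all
  then show ?thesis unfolding pos_dense_def using dense inter by blast
qed

section \<open>Rational maps that are regular near the positive points\<close>

definition frac_on :: "'a set \<Rightarrow> ('a \<Rightarrow> complex) \<Rightarrow> ('a \<Rightarrow> complex) \<Rightarrow> ('a \<Rightarrow> complex) \<Rightarrow> bool" where
  "frac_on A N M f \<longleftrightarrow> (\<forall>p\<in>A. M p \<noteq> 0 \<and> f p = N p / M p)"

lemma frac_onD:
  assumes "frac_on (X \<inter> B) N M f" "p \<in> X" "p \<in> B"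
  shows "M p \<noteq> 0" "f p = N p / M p"
  using assms by (simp_all add: frac_on_def)

text \<open>One global fraction on a principal open set, in place of the local fractions of
  \<open>regular_fun_on\<close>. Cross-multiplication then gives a single polynomial
  identity.\<close>

definition reg :: "('b \<Rightarrow> complex) set \<Rightarrow> (('b \<Rightarrow> complex) \<Rightarrow> complex) \<Rightarrow> (('b \<Rightarrow> complex) \<Rightarrow> complex) \<Rightarrow> bool" where
  "reg X D f \<longleftrightarrow> (\<exists>N\<in>poly_fun. \<exists>M\<in>poly_fun. frac_on (X \<inter> nz D) N M f)"

definition reg_map :: "('b \<Rightarrow> complex) set \<Rightarrow> (('b \<Rightarrow> complex) \<Rightarrow> complex) \<Rightarrow> (('b \<Rightarrow> complex) \<Rightarrow> ('c \<Rightarrow> complex)) \<Rightarrow> bool" where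
  "reg_map X D \<phi> \<longleftrightarrow> (\<forall>j. reg X D (\<lambda>p. \<phi> p j))"

lemma reg_mapI: "(\<And>j. reg X D (\<lambda>p. \<phi> p j)) \<Longrightarrow> reg_map X D \<phi>"
  by (simp add: reg_map_def)

lemma reg_mapD: "reg_map X D \<phi> \<Longrightarrow> reg X D (\<lambda>p. \<phi> p j)"
  by (simp add: reg_map_def)

definition scal :: "('b \<Rightarrow> complex) set \<Rightarrow> ('b \<Rightarrow> complex) set \<Rightarrow> (('b \<Rightarrow> complex) \<Rightarrow> complex) \<Rightarrow> bool" where
  "scal X P f \<longleftrightarrow> (\<exists>D\<in>poly_fun. P \<subseteq> nz D \<and> reg X D f)"

text \<open>The domain of definition contains all of \<open>P\<close> and the image of
  \<open>P\<close> lies in \<open>Q\<close>. Hence the composite of two such maps is again of this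
  kind, and no separate check that it is defined is needed.\<close>

definition mor :: "('b \<Rightarrow> complex) set \<Rightarrow> ('b \<Rightarrow> complex) set \<Rightarrow> ('c \<Rightarrow> complex) set \<Rightarrow> ('c \<Rightarrow> complex) set
    \<Rightarrow> (('b \<Rightarrow> complex) \<Rightarrow> ('c \<Rightarrow> complex)) \<Rightarrow> bool" where
  "mor X P Y Q \<phi> \<longleftrightarrow> \<phi> ` P \<subseteq> Q \<and>
     (\<exists>D\<in>poly_fun. P \<subseteq> nz D \<and> \<phi> ` (X \<inter> nz D) \<subseteq> Y \<and> reg_map X D \<phi>)"

lemma regI:
  assumes "N \<in> poly_fun" "M \<in> poly_fun" "\<And>p. p \<in> X \<Longrightarrow> p \<in> nz D \<Longrightarrow> M p \<noteq> 0 \<and> f p = N p / M p"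
  shows "reg X D f"
  unfolding reg_def frac_on_def by (intro bexI[OF _ assms(1)] bexI[OF _ assms(2)]) (simp add: assms(3))

lemma regE:
  assumes "reg X D f"
  obtains N M where "N \<in> poly_fun" "M \<in> poly_fun" "frac_on (X \<inter> nz D) N M f"
  using assms unfolding reg_def by (elim bexE)

lemma reg_mono: "reg X D f \<Longrightarrow> X \<inter> nz E \<subseteq> nz D \<Longrightarrow> reg X E f"
  by (erule regE, rule regI, assumption+) (auto dest: frac_onD)

lemma reg_map_mono: "reg_map X D f \<Longrightarrow> X \<inter> nz E \<subseteq> nz D \<Longrightarrow> reg_map X E f"
  by (rule reg_mapI, rule reg_mono, erule reg_mapD)

lemma reg_const: "reg X D (\<lambda>_. c)"
  by (rule regI[of "\<lambda>_. c" "\<lambda>_. 1"]) (auto simp: poly_fun_intros)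

lemma reg_poly: "f \<in> poly_fun \<Longrightarrow> reg X D f"
  by (rule regI[of f "\<lambda>_. 1"]) (auto simp: poly_fun_intros)

lemma reg_add:
  assumes "reg X D f" "reg X D g"
  shows "reg X D (\<lambda>p. f p + g p)"
proof -
  obtain N M where 1: "N \<in> poly_fun" "M \<in> poly_fun" "frac_on (X \<inter> nz D) N M f"
    by (rule regE[OF assms(1)])
  obtain N' M' where 2: "N' \<in> poly_fun" "M' \<in> poly_fun" "frac_on (X \<inter> nz D) N' M' g"
    by (rule regE[OF assms(2)])
  show ?thesis
    by (rule regI[of "\<lambda>p. N p * M' p + N' p * M p" "\<lambda>p. M p * M' p"])
       (use 1(1,2) 2(1,2) frac_onD[OF 1(3)] frac_onD[OF 2(3)] in \<open>simp_all add: poly_fun_intros field_simps\<close>)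
qed

lemma reg_mult:
  assumes "reg X D f" "reg X D g"
  shows "reg X D (\<lambda>p. f p * g p)"
proof -
  obtain N M where 1: "N \<in> poly_fun" "M \<in> poly_fun" "frac_on (X \<inter> nz D) N M f"
    by (rule regE[OF assms(1)])
  obtain N' M' where 2: "N' \<in> poly_fun" "M' \<in> poly_fun" "frac_on (X \<inter> nz D) N' M' g"
    by (rule regE[OF assms(2)])
  show ?thesis
    by (rule regI[of "\<lambda>p. N p * N' p" "\<lambda>p. M p * M' p"])
       (use 1(1,2) 2(1,2) frac_onD[OF 1(3)] frac_onD[OF 2(3)] in \<open>simp_all add: poly_fun_intros\<close>)
qed

lemma reg_inverse:
  assumes "reg X D f" "\<And>p. p \<in> X \<Longrightarrow> p \<in> nz D \<Longrightarrow> f p \<noteq> 0"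
  shows "reg X D (\<lambda>p. inverse (f p))"
proof -
  obtain N M where 1: "N \<in> poly_fun" "M \<in> poly_fun" "frac_on (X \<inter> nz D) N M f"
    by (rule regE[OF assms(1)])
  show ?thesis
    by (rule regI[OF 1(2,1)]) (use frac_onD[OF 1(3)] assms(2) in force)
qed

lemma reg_poly_comp:
  assumes "q \<in> poly_fun" "reg_map X D \<phi>"
  shows "reg X D (\<lambda>p. q (\<phi> p))"
  using assms(1)
proof (induction rule: poly_fun.induct)
  case (coord i)
  show ?case by (rule reg_mapD[OF assms(2)])
qed (auto intro: reg_const reg_add reg_mult)

lemma scalI: "D \<in> poly_fun \<Longrightarrow> P \<subseteq> nz D \<Longrightarrow> reg X D f \<Longrightarrow> scal X P f"
  unfolding scal_def by blast

lemma scalE: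
  assumes "scal X P f"
  obtains D where "D \<in> poly_fun" "P \<subseteq> nz D" "reg X D f"
  using assms unfolding scal_def by (elim bexE conjE)

lemma scal_common:
  assumes "scal X P f" "scal X P g"
  obtains D where "D \<in> poly_fun" "P \<subseteq> nz D" "reg X D f" "reg X D g"
proof -
  obtain D where D: "D \<in> poly_fun" "P \<subseteq> nz D" "reg X D f" by (rule scalE[OF assms(1)])
  obtain E where E: "E \<in> poly_fun" "P \<subseteq> nz E" "reg X E g" by (rule scalE[OF assms(2)])
  show ?thesis
  proof (rule that[of "\<lambda>p. D p * E p"])
    show "reg X (\<lambda>p. D p * E p) f" by (rule reg_mono[OF D(3)]) auto
    show "reg X (\<lambda>p. D p * E p) g" by (rule reg_mono[OF E(3)]) auto
  qed (use D(1,2) E(1,2) in \<open>simp_all add: poly_fun_intros\<close>)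
qed

lemma scal_const: "scal X P (\<lambda>_. c)"
  by (rule scalI[of "\<lambda>_. 1"]) (auto intro: reg_const poly_fun_intros)

lemma scal_poly: "f \<in> poly_fun \<Longrightarrow> scal X P f"
  by (rule scalI[of "\<lambda>_. 1"]) (auto intro: reg_poly poly_fun_intros)

lemma scal_coord: "scal X P (\<lambda>p. p i)"
  by (intro scal_poly poly_fun_intros)

lemma scal_add: "scal X P f \<Longrightarrow> scal X P g \<Longrightarrow> scal X P (\<lambda>p. f p + g p)"
  by (erule (1) scal_common) (rule scalI, assumption+, rule reg_add)

lemma scal_mult: "scal X P f \<Longrightarrow> scal X P g \<Longrightarrow> scal X P (\<lambda>p. f p * g p)"
  by (erule (1) scal_common) (rule scalI, assumption+, rule reg_mult)

text \<open>On the smaller open set the numerator of \<open>f\<close> is invertible.\<close>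

lemma scal_nonzero:
  assumes "pos_dense X P" "scal X P f" "\<And>p. p \<in> P \<Longrightarrow> f p \<noteq> 0"
  obtains D where "D \<in> poly_fun" "P \<subseteq> nz D" "reg X D f" "X \<inter> nz D \<subseteq> nz f"
proof -
  obtain D where D: "D \<in> poly_fun" "P \<subseteq> nz D" "reg X D f" by (rule scalE[OF assms(2)])
  obtain N M where 1: "N \<in> poly_fun" "M \<in> poly_fun" "frac_on (X \<inter> nz D) N M f"
    by (rule regE[OF D(3)])
  show ?thesis
  proof (rule that[of "\<lambda>p. D p * N p"])
    show "P \<subseteq> nz (\<lambda>p. D p * N p)"
    proof
      fix p assume p: "p \<in> P"
      then have "p \<in> X" "p \<in> nz D" using pos_dense_subset[OF assms(1)] D(2) by auto
      with assms(3)[OF p] frac_onD[OF 1(3)] show "p \<in> nz (\<lambda>p. D p * N p)" by (auto simp: nz_iff)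
    qed
    show "reg X (\<lambda>p. D p * N p) f" using D(3) by (rule reg_mono) auto
    show "X \<inter> nz (\<lambda>p. D p * N p) \<subseteq> nz f"
      using frac_onD[OF 1(3)] by (auto simp: nz_iff)
  qed (use D(1) 1(1) in \<open>simp add: poly_fun_intros\<close>)
qed

lemma scal_inverse:
  assumes "pos_dense X P" "scal X P f" "\<And>p. p \<in> P \<Longrightarrow> f p \<noteq> 0"
  shows "scal X P (\<lambda>p. inverse (f p))"
proof -
  obtain D where D: "D \<in> poly_fun" "P \<subseteq> nz D" "reg X D f" "X \<inter> nz D \<subseteq> nz f"
    by (rule scal_nonzero[OF assms])
  show ?thesis by (rule scalI[OF D(1,2) reg_inverse[OF D(3)]]) (use D(4) in \<open>auto simp: nz_iff\<close>)
qed

lemma scal_divide: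
  assumes "pos_dense X P" "scal X P f" "scal X P g" "\<And>p. p \<in> P \<Longrightarrow> g p \<noteq> 0"
  shows "scal X P (\<lambda>p. f p / g p)"
  unfolding divide_inverse by (intro scal_mult scal_inverse assms)

lemma scal_sum: "(\<And>i. i \<in> A \<Longrightarrow> scal X P (f i)) \<Longrightarrow> scal X P (\<lambda>p. \<Sum>i\<in>A. f i p)"
  by (induction A rule: infinite_finite_induct) (simp_all add: scal_const scal_add)

lemma scal_prod: "(\<And>i. i \<in> A \<Longrightarrow> scal X P (f i)) \<Longrightarrow> scal X P (\<lambda>p. \<Prod>i\<in>A. f i p)"
  by (induction A rule: infinite_finite_induct) (simp_all add: scal_const scal_mult)

lemma scal_power: "scal X P f \<Longrightarrow> scal X P (\<lambda>p. f p ^ m)"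
  by (induction m) (simp_all add: scal_const scal_mult)

lemma scal_powi:
  assumes "pos_dense X P" "scal X P f" "\<And>p. p \<in> P \<Longrightarrow> f p \<noteq> 0"
  shows "scal X P (\<lambda>p. f p powi m)"
  unfolding power_int_def by (cases "0 \<le> m") (auto intro!: scal_power scal_inverse assms)

lemma morE:
  assumes "mor X P Y Q \<phi>"
  obtains D where "D \<in> poly_fun" "P \<subseteq> nz D" "\<phi> ` (X \<inter> nz D) \<subseteq> Y" "reg_map X D \<phi>" "\<phi> ` P \<subseteq> Q"
  using assms unfolding mor_def by (elim bexE conjE)

lemma morI: "D \<in> poly_fun \<Longrightarrow> P \<subseteq> nz D \<Longrightarrow> \<phi> ` (X \<inter> nz D) \<subseteq> Y \<Longrightarrow> reg_map X D \<phi> \<Longrightarrow> \<phi> ` P \<subseteq> Q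
   \<Longrightarrow> mor X P Y Q \<phi>"
  unfolding mor_def by blast

lemma mor_scal: "mor X P Y Q \<phi> \<Longrightarrow> scal X P (\<lambda>p. \<phi> p j)"
  by (erule morE) (rule scalI, assumption+, rule reg_mapD)

lemma mor_pos: "mor X P Y Q \<phi> \<Longrightarrow> p \<in> P \<Longrightarrow> \<phi> p \<in> Q"
  unfolding mor_def by blast

text \<open>The function \<open>E\<close> composed with the map does not vanish on \<open>P\<close>,
  so the domain can be shrunk, still around \<open>P\<close>, until the image avoids the zeros of
  \<open>E\<close>.\<close>

lemma mor_pullback:
  assumes "pos_dense X P" "mor X P Y Q \<phi>" "E \<in> poly_fun" "Q \<subseteq> nz E"
  obtains D where "D \<in> poly_fun" "P \<subseteq> nz D" "\<phi> ` (X \<inter> nz D) \<subseteq> Y \<inter> nz E" "reg_map X D \<phi>"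
proof -
  obtain D where D: "D \<in> poly_fun" "P \<subseteq> nz D" "\<phi> ` (X \<inter> nz D) \<subseteq> Y" "reg_map X D \<phi>" "\<phi> ` P \<subseteq> Q"
    by (rule morE[OF assms(2)])
  have "scal X P (\<lambda>p. E (\<phi> p))" by (rule scalI[OF D(1,2) reg_poly_comp[OF assms(3) D(4)]])
  then obtain F where F: "F \<in> poly_fun" "P \<subseteq> nz F" "X \<inter> nz F \<subseteq> nz (\<lambda>p. E (\<phi> p))"
    by (rule scal_nonzero[OF assms(1)]) (use D(5) assms(4) in \<open>auto simp: nz_def\<close>)
  show ?thesis
  proof (rule that[of "\<lambda>p. D p * F p"])
    show "reg_map X (\<lambda>p. D p * F p) \<phi>" by (rule reg_map_mono[OF D(4)]) auto
    show "\<phi> ` (X \<inter> nz (\<lambda>p. D p * F p)) \<subseteq> Y \<inter> nz E" using D(3) F(3) by (auto simp: nz_iff)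
  qed (use D F in \<open>auto simp: poly_fun_intros\<close>)
qed

lemma reg_comp:
  assumes "reg Y E f" "\<phi> ` (X \<inter> nz D) \<subseteq> Y \<inter> nz E" "reg_map X D \<phi>"
  shows "reg X D (\<lambda>p. f (\<phi> p))"
proof -
  obtain N M where 1: "N \<in> poly_fun" "M \<in> poly_fun" "frac_on (Y \<inter> nz E) N M f"
    by (rule regE[OF assms(1)])
  have 2: "\<phi> p \<in> Y" "\<phi> p \<in> nz E" if "p \<in> X" "p \<in> nz D" for p using assms(2) that by auto
  have "reg X D (\<lambda>p. N (\<phi> p) * inverse (M (\<phi> p)))"
    by (intro reg_mult reg_inverse reg_poly_comp 1 assms(3) frac_onD(1)[OF 1(3)] 2)
  then obtain A B where 3: "A \<in> poly_fun" "B \<in> poly_fun"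
    "frac_on (X \<inter> nz D) A B (\<lambda>p. N (\<phi> p) * inverse (M (\<phi> p)))"
    by (rule regE)
  show ?thesis
    by (rule regI[OF 3(1,2)]) (use frac_onD[OF 3(3)] frac_onD[OF 1(3)] 2 in \<open>simp add: divide_inverse\<close>)
qed

lemma mor_comp:
  assumes X: "pos_dense X P" and \<phi>: "mor X P Y Q \<phi>" and \<psi>: "mor Y Q Z R \<psi>"
  shows "mor X P Z R (\<lambda>p. \<psi> (\<phi> p))"
proof -
  obtain E where E: "E \<in> poly_fun" "Q \<subseteq> nz E" "\<psi> ` (Y \<inter> nz E) \<subseteq> Z" "reg_map Y E \<psi>" "\<psi> ` Q \<subseteq> R"
    by (rule morE[OF \<psi>])
  obtain D where D: "D \<in> poly_fun" "P \<subseteq> nz D" "\<phi> ` (X \<inter> nz D) \<subseteq> Y \<inter> nz E" "reg_map X D \<phi>"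
    by (rule mor_pullback[OF X \<phi> E(1,2)])
  show ?thesis
  proof (rule morI[OF D(1,2)])
    show "reg_map X D (\<lambda>p. \<psi> (\<phi> p))" by (rule reg_mapI, rule reg_comp[OF reg_mapD[OF E(4)] D(3,4)])
    show "(\<lambda>p. \<psi> (\<phi> p)) ` (X \<inter> nz D) \<subseteq> Z" using D(3) E(3) by blast
    show "(\<lambda>p. \<psi> (\<phi> p)) ` P \<subseteq> R" using mor_pos[OF \<phi>] E(5) by blast
  qed
qed

lemma scal_comp:
  assumes X: "pos_dense X P" and \<phi>: "mor X P Y Q \<phi>" and f: "scal Y Q f"
  shows "scal X P (\<lambda>p. f (\<phi> p))"
proof -
  obtain E where E: "E \<in> poly_fun" "Q \<subseteq> nz E" "reg Y E f" by (rule scalE[OF f])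
  obtain D where D: "D \<in> poly_fun" "P \<subseteq> nz D" "\<phi> ` (X \<inter> nz D) \<subseteq> Y \<inter> nz E" "reg_map X D \<phi>"
    by (rule mor_pullback[OF X \<phi> E(1,2)])
  show ?thesis by (rule scalI[OF D(1,2) reg_comp[OF E(3) D(3,4)]])
qed

lemma scal_all:
  assumes "finite A" "\<And>j. j \<in> A \<Longrightarrow> scal X P (f j)"
  shows "\<exists>D\<in>poly_fun. P \<subseteq> nz D \<and> (\<forall>j\<in>A. reg X D (f j))"
  using assms
proof (induction A rule: finite_induct)
  case empty
  then show ?case by (intro bexI[of _ "\<lambda>_. 1"]) (auto simp: poly_fun_intros)
next
  case (insert a A)
  have "\<exists>D\<in>poly_fun. P \<subseteq> nz D \<and> (\<forall>j\<in>A. reg X D (f j))"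
    by (rule insert.IH) (rule insert.prems[OF insertI2])
  then obtain D where D: "D \<in> poly_fun" "P \<subseteq> nz D" "\<forall>j\<in>A. reg X D (f j)" by blast
  obtain E where E: "E \<in> poly_fun" "P \<subseteq> nz E" "reg X E (f a)"
    by (rule scalE[OF insert.prems[OF insertI1]])
  show ?case
  proof (intro bexI[of _ "\<lambda>p. D p * E p"] conjI ballI)
    fix j assume "j \<in> insert a A"
    then consider "j = a" | "j \<in> A" by blast
    then show "reg X (\<lambda>p. D p * E p) (f j)"
    proof cases
      case 1
      show ?thesis unfolding 1 by (rule reg_mono[OF E(3)]) auto
    next
      case 2
      with D(3) have "reg X D (f j)" by blast
      then show ?thesis by (rule reg_mono) auto
    qed
  qed (use D E in \<open>auto simp: poly_fun_intros\<close>)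
qed

lemma mor_torusI:
  assumes X: "pos_dense X P" and "finite S"
    and "\<And>s. s \<in> S \<Longrightarrow> scal X P (\<lambda>p. \<phi> p s)"
    and "\<And>s p. s \<in> S \<Longrightarrow> p \<in> P \<Longrightarrow> \<phi> p s \<in> cpos"
    and out: "\<And>s p. s \<notin> S \<Longrightarrow> p \<in> X \<Longrightarrow> \<phi> p s = 1"
  shows "mor X P (torus S) (tpos S) \<phi>"
proof -
  \<comment> \<open>Where this product is nonzero the image lies in the torus, and at positive
    points it is nonzero.\<close>
  have "scal X P (\<lambda>p. \<Prod>s\<in>S. \<phi> p s)" by (intro scal_prod assms)
  then obtain E where E: "E \<in> poly_fun" "P \<subseteq> nz E" "X \<inter> nz E \<subseteq> nz (\<lambda>p. \<Prod>s\<in>S. \<phi> p s)"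
    by (rule scal_nonzero[OF X]) (use assms(2,4) cpos_nonzero in auto)
  obtain D where D: "D \<in> poly_fun" "P \<subseteq> nz D" "\<forall>s\<in>S. reg X D (\<lambda>p. \<phi> p s)"
    using scal_all[OF assms(2), of X P "\<lambda>s p. \<phi> p s"] assms(3) by blast
  show ?thesis
  proof (rule morI[of "\<lambda>p. D p * E p"])
    show "\<phi> ` (X \<inter> nz (\<lambda>p. D p * E p)) \<subseteq> torus S"
    proof -
      have "\<phi> p s \<noteq> 0" if "p \<in> X" "p \<in> nz E" "s \<in> S" for p s
        using that E(3) assms(2) by (auto simp: nz_iff)
      then show ?thesis using out by (auto simp: torus_def)
    qed
    have "reg X (\<lambda>p. D p * E p) (\<lambda>p. \<phi> p j)" for j
    proof (cases "j \<in> S")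
      case True
      with D(3) have "reg X D (\<lambda>p. \<phi> p j)" by blast
      then show ?thesis by (rule reg_mono) auto
    next
      case False
      show ?thesis by (rule regI[of "\<lambda>_. 1" "\<lambda>_. 1"]) (auto simp: poly_fun_intros out[OF False])
    qed
    then show "reg_map X (\<lambda>p. D p * E p) \<phi>" by (rule reg_mapI)
    show "\<phi> ` P \<subseteq> tpos S"
      using assms(4) out pos_dense_subset[OF X] by (auto intro!: tposI)
  qed (use D E in \<open>auto simp: poly_fun_intros\<close>)
qed

lemma mor_id: "mor X P X P (\<lambda>p. p)"
  by (rule morI[of "\<lambda>_. 1"]) (auto simp: poly_fun_intros intro!: reg_mapI reg_poly)

lemma mor_Some: "mor (ctimes X) (ctimes_pos P) X P (\<lambda>z. z \<circ> Some)"
  by (rule morI[of "\<lambda>_. 1"]) (auto simp: poly_fun_intros mem_ctimes mem_ctimes_pos intro!: reg_mapI reg_poly)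

lemma mor_pair:
  assumes X: "pos_dense X P" and f: "scal X P f" "\<And>p. p \<in> P \<Longrightarrow> f p \<in> cpos" and \<phi>: "mor X P Y Q \<phi>"
  shows "mor X P (ctimes Y) (ctimes_pos Q) (\<lambda>p. case_option (f p) (\<phi> p))"
proof -
  obtain E where E: "E \<in> poly_fun" "P \<subseteq> nz E" "reg X E f" "X \<inter> nz E \<subseteq> nz f"
    by (rule scal_nonzero[OF X f(1)]) (use f(2) cpos_nonzero in auto)
  obtain D where D: "D \<in> poly_fun" "P \<subseteq> nz D" "\<phi> ` (X \<inter> nz D) \<subseteq> Y" "reg_map X D \<phi>" "\<phi> ` P \<subseteq> Q"
    by (rule morE[OF \<phi>])
  show ?thesis
  proof (rule morI[of "\<lambda>p. D p * E p"])
    have "reg X (\<lambda>p. D p * E p) (\<lambda>p. case_option (f p) (\<phi> p) j)" for j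
      by (cases j) (auto intro: reg_mono[OF E(3)] reg_mono[OF reg_mapD[OF D(4)]])
    then show "reg_map X (\<lambda>p. D p * E p) (\<lambda>p. case_option (f p) (\<phi> p))" by (rule reg_mapI)
    have "f p \<noteq> 0" "\<phi> p \<in> Y" if "p \<in> X" "p \<in> nz D" "p \<in> nz E" for p
      using that D(3) E(4) by (auto simp: nz_iff)
    then show "(\<lambda>p. case_option (f p) (\<phi> p)) ` (X \<inter> nz (\<lambda>p. D p * E p)) \<subseteq> ctimes Y"
      by (auto simp: mem_ctimes)
    show "(\<lambda>p. case_option (f p) (\<phi> p)) ` P \<subseteq> ctimes_pos Q"
      using f(2) D(5) by (auto simp: mem_ctimes_pos)
  qed (use D E in \<open>auto simp: poly_fun_intros\<close>)
qed

text \<open>The cross-multiplied difference of the two fractions is a polynomial vanishing on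
  \<open>P\<close>, hence on \<open>X\<close>.\<close>

lemma reg_eq:
  assumes X: "pos_dense X P" and "P \<subseteq> nz D" "reg X D f" "reg X D g"
    and eq: "\<And>p. p \<in> P \<Longrightarrow> f p = g p" and p: "p \<in> X" "p \<in> nz D"
  shows "f p = g p"
proof -
  obtain N M where 1: "N \<in> poly_fun" "M \<in> poly_fun" "frac_on (X \<inter> nz D) N M f"
    by (rule regE[OF assms(3)])
  obtain N' M' where 2: "N' \<in> poly_fun" "M' \<in> poly_fun" "frac_on (X \<inter> nz D) N' M' g"
    by (rule regE[OF assms(4)])
  have "N r * M' r - N' r * M r = 0" if r: "r \<in> P" for r
  proof -
    have "r \<in> X" "r \<in> nz D" using r pos_dense_subset[OF X] assms(2) by auto
    then show ?thesis using eq[OF r] frac_onD[OF 1(3), of r] frac_onD[OF 2(3), of r] by (simp add: frac_eq_eq)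
  qed
  then have "P \<inter> nz (\<lambda>r. N r * M' r - N' r * M r) = {}" by (auto simp: nz_def)
  then have "X \<inter> nz (\<lambda>r. N r * M' r - N' r * M r) = {}"
    by (rule pos_dense_vanish[OF X, rotated]) (intro poly_fun_minus poly_fun_intros 1 2)
  then have "N p * M' p - N' p * M p = 0" using p by (auto simp: nz_def)
  then show ?thesis using frac_onD[OF 1(3) p] frac_onD[OF 2(3) p] by (simp add: frac_eq_eq)
qed

lemma scal_eq:
  assumes X: "pos_dense X P" and "scal X P f" "scal X P g" "\<And>p. p \<in> P \<Longrightarrow> f p = g p"
  shows "generically X (\<lambda>p. f p = g p)"
proof -
  obtain D where D: "D \<in> poly_fun" "P \<subseteq> nz D" "reg X D f" "reg X D g"
    by (rule scal_common[OF assms(2,3)])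
  have "f p = g p" if "p \<in> X" "p \<in> nz D" for p
    by (rule reg_eq[OF X D(2-4) assms(4) that])
  then show ?thesis by (rule generically_posI[OF X D(1,2)])
qed

lemma uncurry1_case_option [simp]: "uncurry1 e (case_option c x) = e c x"
  by (simp add: uncurry1_def)

lemma vanish_generic:
  assumes X: "pos_dense X P" and "f \<in> poly_fun" "g \<in> poly_fun" "X \<inter> nz g \<noteq> {}"
    and "\<And>p. p \<in> X \<Longrightarrow> p \<in> nz g \<Longrightarrow> f p = 0" and "p \<in> X"
  shows "f p = 0"
proof (rule ccontr)
  assume "f p \<noteq> 0"
  then have "X \<inter> nz f \<noteq> {}" using assms(6) by (auto simp: nz_iff)
  then have "X \<inter> nz f \<inter> nz g \<noteq> {}" by (rule pos_dense_inter[OF X assms(2,3) _ assms(4)])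
  then show False using assms(5) by (auto simp: nz_iff)
qed

lemma mor_eq:
  assumes X: "pos_dense X P" and "mor X P Y Q \<phi>" "mor X P Y' Q' \<psi>" "\<And>p. p \<in> P \<Longrightarrow> \<phi> p = \<psi> p"
  shows "generically X (\<lambda>p. \<phi> p = \<psi> p)"
proof -
  obtain D where D: "D \<in> poly_fun" "P \<subseteq> nz D" "reg_map X D \<phi>"
    by (rule morE[OF assms(2)])
  obtain E where E: "E \<in> poly_fun" "P \<subseteq> nz E" "reg_map X E \<psi>"
    by (rule morE[OF assms(3)])
  let ?F = "\<lambda>p. D p * E p"
  have r: "reg_map X ?F \<phi>" "reg_map X ?F \<psi>"
    by (rule reg_map_mono[OF D(3)], force) (rule reg_map_mono[OF E(3)], force)
  show ?thesis
  proof (rule generically_posI[OF X, of ?F])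
    fix p assume p: "p \<in> X" "p \<in> nz ?F"
    have "\<phi> p j = \<psi> p j" for j
      by (rule reg_eq[OF X _ reg_mapD[OF r(1)] reg_mapD[OF r(2)] _ p]) (use D E assms(4) in auto)
    then show "\<phi> p = \<psi> p" by (rule ext)
  qed (use D E in \<open>auto simp: poly_fun_intros\<close>)
qed

text \<open>An open set of \<open>Y\<close> could miss the image. Since it meets \<open>Q\<close>,
  and \<open>Q\<close> is covered by positive points of \<open>X\<close>, its preimage is not
  empty.\<close>

lemma generically_comp:
  assumes X: "pos_dense X P" and Y: "pos_dense Y Q" and \<phi>: "mor X P Y Q \<phi>" and surj: "Q \<subseteq> \<phi> ` P"
    and R: "generically Y R"
  shows "generically X (\<lambda>p. \<phi> p \<in> Y \<and> R (\<phi> p))"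
proof -
  obtain E where E: "E \<in> poly_fun" "Q \<inter> nz E \<noteq> {}" "Y \<inter> nz E \<subseteq> Collect R"
    using generically_pos[OF Y R] by (elim bexE conjE)
  obtain D where D: "D \<in> poly_fun" "P \<subseteq> nz D" "\<phi> ` (X \<inter> nz D) \<subseteq> Y" "reg_map X D \<phi>"
    by (rule morE[OF \<phi>])
  have "reg X D (\<lambda>p. E (\<phi> p))" by (rule reg_poly_comp[OF E(1) D(4)])
  then obtain N M where NM: "N \<in> poly_fun" "M \<in> poly_fun" "frac_on (X \<inter> nz D) N M (\<lambda>p. E (\<phi> p))"
    by (rule regE)
  let ?F = "\<lambda>p. D p * N p"
  from E(2) obtain q where "q \<in> Q" "q \<in> nz E" by blast
  with surj obtain p where p: "p \<in> P" "\<phi> p \<in> nz E" by blast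
  then have "p \<in> X" "p \<in> nz D" using D(2) pos_dense_subset[OF X] by auto
  then have "p \<in> X \<inter> nz ?F" using frac_onD[OF NM(3), of p] p(2) by (auto simp: nz_iff)
  moreover have "\<phi> r \<in> Y \<and> R (\<phi> r)" if "r \<in> X" "r \<in> nz ?F" for r
  proof -
    have r: "r \<in> nz D" "N r \<noteq> 0" using that(2) by (auto simp: nz_iff)
    then have "\<phi> r \<in> nz E" using frac_onD[OF NM(3) that(1) r(1)] by (simp add: nz_iff)
    moreover have "\<phi> r \<in> Y" using D(3) that(1) r(1) by blast
    ultimately show ?thesis using E(3) by blast
  qed
  ultimately show ?thesis
    unfolding generically_iff by (intro bexI[of _ ?F]) (use D(1) NM(1) in \<open>auto simp: poly_fun_intros\<close>)
qed

lemma regular_fun_onD: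
  assumes "regular_fun_on X U f" "p \<in> U"
  obtains V g h where "openin (subtopology zariski X) V" "p \<in> V" "g \<in> poly_fun" "h \<in> poly_fun"
    "frac_on (X \<inter> V) g h f"
proof -
  from assms(1) have "\<forall>p\<in>U. \<exists>V. openin (subtopology zariski X) V \<and> p \<in> V \<and> V \<subseteq> U \<and>
        (\<exists>g\<in>poly_fun. \<exists>h\<in>poly_fun. frac_on V g h f)"
    unfolding regular_fun_on_def frac_on_def .
  from bspec[OF this assms(2)] obtain V g h where "openin (subtopology zariski X) V" "p \<in> V"
    "g \<in> poly_fun" "h \<in> poly_fun" "frac_on V g h f" by (elim exE conjE bexE)
  then show ?thesis by (intro that[of V g h]) (auto simp: frac_on_def)
qed

lemma regular_fun_onI:
  assumes "reg X D f" "E \<in> poly_fun" "X \<inter> nz E \<subseteq> nz D" "\<And>p. p \<in> X \<Longrightarrow> p \<in> nz E \<Longrightarrow> g p = f p"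
  shows "regular_fun_on X (X \<inter> nz E) g"
proof -
  obtain N M where NM: "N \<in> poly_fun" "M \<in> poly_fun" "frac_on (X \<inter> nz D) N M f"
    by (rule regE[OF assms(1)])
  have "\<forall>q\<in>X \<inter> nz E. M q \<noteq> 0 \<and> g q = N q / M q"
    using frac_onD[OF NM(3)] assms(3,4) by auto
  then show ?thesis
    unfolding regular_fun_on_def
    by (intro ballI exI[of _ "X \<inter> nz E"] conjI bexI[OF _ NM(1)] bexI[OF _ NM(2)] openin_principal[OF assms(2)])
       auto
qed

lemma regular_map_onI:
  assumes "reg_map X D \<phi>" "E \<in> poly_fun" "X \<inter> nz E \<subseteq> nz D" "\<phi> ` (X \<inter> nz D) \<subseteq> Y"
    "\<And>p. p \<in> X \<Longrightarrow> p \<in> nz E \<Longrightarrow> \<psi> p = \<phi> p"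
  shows "regular_map_on X (X \<inter> nz E) Y \<psi>"
proof -
  have "regular_fun_on X (X \<inter> nz E) (\<lambda>p. \<psi> p i)" for i
    by (rule regular_fun_onI[OF reg_mapD[OF assms(1)] assms(2,3)]) (use assms(5) in simp)
  moreover have "\<psi> p \<in> Y" if "p \<in> X" "p \<in> nz E" for p
    using assms(3,4) assms(5)[OF that] that by auto
  ultimately show ?thesis unfolding regular_map_on_def by auto
qed

lemma mor_rational_map:
  assumes X: "pos_dense X P" and \<phi>: "mor X P Y Q \<phi>" and eq: "generically X (\<lambda>p. \<psi> p = \<phi> p)"
  shows "rational_map X Y \<psi>"
proof -
  obtain D where D: "D \<in> poly_fun" "P \<subseteq> nz D" "\<phi> ` (X \<inter> nz D) \<subseteq> Y" "reg_map X D \<phi>"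
    by (rule morE[OF \<phi>])
  have "X \<inter> nz D \<noteq> {}" using D(2) pos_dense_subset[OF X] pos_dense_nonempty[OF X] by blast
  then have "generically X (\<lambda>p. p \<in> nz D)" unfolding generically_iff using D(1) by blast
  from generically_conj[OF X eq this] obtain F where
    F: "F \<in> poly_fun" "X \<inter> nz F \<noteq> {}" "X \<inter> nz F \<subseteq> {p. \<psi> p = \<phi> p \<and> p \<in> nz D}"
    unfolding generically_iff by blast
  have "regular_map_on X (X \<inter> nz F) Y \<psi>"
    by (rule regular_map_onI[OF D(4) F(1) _ D(3)]) (use F(3) in auto)
  with openin_principal[OF F(1)] F(2) show ?thesis unfolding rational_map_def by blast
qed

lemma generically_refl: "pos_dense X P \<Longrightarrow> (\<And>p. p \<in> X \<Longrightarrow> Q p) \<Longrightarrow> generically X Q"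
  by (rule generically_posI[of X P "\<lambda>_. 1"]) (auto simp: poly_fun_intros)

lemma scal_rational_fun:
  assumes X: "pos_dense X P" and f: "scal X P f"
  shows "rational_fun X f"
proof -
  obtain D where D: "D \<in> poly_fun" "P \<subseteq> nz D" "reg X D f" by (rule scalE[OF f])
  have "regular_fun_on X (X \<inter> nz D) f" by (rule regular_fun_onI[OF D(3,1)]) auto
  moreover have "X \<inter> nz D \<noteq> {}" using D(2) pos_dense_subset[OF X] pos_dense_nonempty[OF X] by blast
  ultimately show ?thesis unfolding rational_fun_def using openin_principal[OF D(1)] by blast
qed

text \<open>The chosen inverse is known only through its compositions. Substituting the explicit
  inverse into the identity for the composite on \<open>X\<close> determines the choice generically
  on \<open>Y\<close>.\<close>

lemma rat_inv_generic:
  assumes X: "pos_dense X P" and Y: "pos_dense Y Q"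
    and \<phi>: "mor X P Y Q \<phi>" and \<psi>: "mor Y Q X P \<psi>"
    and 1: "\<And>p. p \<in> P \<Longrightarrow> \<psi> (\<phi> p) = p" and 2: "\<And>q. q \<in> Q \<Longrightarrow> \<phi> (\<psi> q) = q"
  shows "is_rat_inverse X Y \<phi> \<psi>" and "generically Y (\<lambda>q. rat_inv X Y \<phi> q = \<psi> q)"
proof -
  have 3: "generically Y (\<lambda>q. \<phi> (\<psi> q) = q)"
    by (rule mor_eq[OF Y mor_comp[OF Y \<psi> \<phi>] mor_id 2])
  show inv: "is_rat_inverse X Y \<phi> \<psi>"
    unfolding is_rat_inverse_def
    by (intro conjI mor_rational_map[OF X \<phi>] mor_rational_map[OF Y \<psi>] generically_refl[OF X]
        generically_refl[OF Y] mor_eq[OF X mor_comp[OF X \<phi> \<psi>] mor_id 1] 3) auto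
  then have "is_rat_inverse X Y \<phi> (rat_inv X Y \<phi>)" unfolding rat_inv_def by (rule someI[where P = "is_rat_inverse X Y \<phi>"])
  then have "generically X (\<lambda>p. rat_inv X Y \<phi> (\<phi> p) = p)" unfolding is_rat_inverse_def by blast
  moreover have "P \<subseteq> \<psi> ` Q"
  proof
    fix p assume "p \<in> P"
    then show "p \<in> \<psi> ` Q" using 1[of p] mor_pos[OF \<phi>, of p] by (intro image_eqI[of _ _ "\<phi> p"]) simp_all
  qed
  ultimately have "generically Y (\<lambda>q. \<psi> q \<in> X \<and> rat_inv X Y \<phi> (\<phi> (\<psi> q)) = \<psi> q)"
    by (intro generically_comp[OF Y X \<psi>])
  from generically_conj[OF Y this 3] show "generically Y (\<lambda>q. rat_inv X Y \<phi> q = \<psi> q)"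
    by (rule generically_mono) auto
qed

section \<open>A criterion for geometric crystals\<close>

text \<open>The given representative may be defined at \<open>(1, x)\<close> while the fraction of
  \<open>e\<close> is \<open>0/0\<close> there. So the two fractions are cross-multiplied on the
  whole product, then restricted to \<open>c = 1\<close>, where a general \<open>y\<close> allows
  cancellation of the denominator of \<open>e\<close>. The resulting identity
  \<open>g = y_j h\<close> has no denominator of \<open>e\<close> any more and extends to
  \<open>x\<close> by irreducibility.\<close>

lemma rat_value_at_one:
  assumes X: "pos_dense X P" and e: "mor (ctimes X) (ctimes_pos P) X P (uncurry1 e)"
    and eq: "generically (ctimes X) (\<lambda>z. uncurry1 e' z = uncurry1 e z)"
    and one: "\<And>p. p \<in> P \<Longrightarrow> e 1 p = p"
    and val: "rat_value (ctimes X) X (uncurry1 e') (case_option 1 x) q"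
  shows "q = x"
proof -
  let ?Z = "ctimes X" and ?p = "case_option 1 x"
  note Z = pos_dense_ctimes[OF X]
  obtain U \<psi> where U: "openin (subtopology zariski ?Z) U" "?p \<in> U" "regular_map_on ?Z U X \<psi>"
    "generically ?Z (\<lambda>r. r \<in> U \<and> \<psi> r = uncurry1 e' r)" "\<psi> ?p = q"
    using val unfolding rat_value_def by (elim exE conjE)
  have xX: "x \<in> X"
    using openin_subset[OF U(1)] U(2) by (auto simp: topspace_subtopology mem_ctimes)
  obtain F where F: "F \<in> poly_fun" "?Z \<inter> nz F \<noteq> {}"
     "?Z \<inter> nz F \<subseteq> {r. (r \<in> U \<and> \<psi> r = uncurry1 e' r) \<and> uncurry1 e' r = uncurry1 e r}"
    using generically_conj[OF Z U(4) eq] unfolding generically_iff by blast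
  obtain D where D: "D \<in> poly_fun" "ctimes_pos P \<subseteq> nz D" "reg_map ?Z D (uncurry1 e)"
    by (rule morE[OF e])
  \<comment> \<open>The slice \<open>c = 1\<close> of the domain polynomial; it does not vanish on
    \<open>P\<close> because \<open>1\<close> is positive.\<close>
  define D1 where "D1 = (\<lambda>y. D (case_option 1 y))"
  have D1: "D1 \<in> poly_fun" unfolding D1_def by (rule poly_fun_case_option[OF D(1)])
  have D1P: "P \<subseteq> nz D1" using D(2) by (auto simp: D1_def nz_iff mem_ctimes_pos subset_iff)
  have XD1: "X \<inter> nz D1 \<noteq> {}" using D1P pos_dense_subset[OF X] pos_dense_nonempty[OF X] by blast
  have "\<psi> ?p j = x j" for j
  proof -
    have "regular_fun_on ?Z U (\<lambda>r. \<psi> r j)" using U(3) by (simp add: regular_map_on_def)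
    then obtain V g h where V: "openin (subtopology zariski ?Z) V" "?p \<in> V"
      and gh: "g \<in> poly_fun" "h \<in> poly_fun" "frac_on (?Z \<inter> V) g h (\<lambda>r. \<psi> r j)"
      by (rule regular_fun_onD[OF _ U(2)])
    obtain f where f: "f \<in> poly_fun" "?p \<in> nz f" "?Z \<inter> nz f \<subseteq> V" "?p \<in> ?Z"
      using openin_contains_principal[OF V] by (elim bexE conjE)
    obtain N M where NM: "N \<in> poly_fun" "M \<in> poly_fun" "frac_on (?Z \<inter> nz D) N M (\<lambda>z. uncurry1 e z j)"
      by (rule regE[OF reg_mapD[OF D(3)]])
    have ZD: "?Z \<inter> nz D \<noteq> {}" using D(2) pos_dense_subset[OF Z] pos_dense_nonempty[OF Z] by blast
    have "?Z \<inter> nz (\<lambda>p. F p * D p) \<noteq> {}"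
      using pos_dense_inter[OF Z F(1) D(1) F(2) ZD] by (simp add: Int_assoc)
    moreover have "?Z \<inter> nz f \<noteq> {}" using f(2,4) by blast
    ultimately have "?Z \<inter> nz (\<lambda>p. F p * D p) \<inter> nz f \<noteq> {}"
      by (rule pos_dense_inter[OF Z poly_fun.mult[OF F(1) D(1)] f(1)])
    then have ne: "?Z \<inter> nz (\<lambda>p. (F p * D p) * f p) \<noteq> {}" by (simp add: Int_assoc)
    have gM: "g z * M z - N z * h z = 0" if "z \<in> ?Z" for z
    proof (rule vanish_generic[OF Z _ _ ne _ that])
      fix r assume r: "r \<in> ?Z" "r \<in> nz (\<lambda>p. (F p * D p) * f p)"
      then have "r \<in> V" "r \<in> nz D" "\<psi> r = uncurry1 e r" using f(3) F(3) by auto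
      then show "g r * M r - N r * h r = 0"
        using frac_onD[OF gh(3) r(1)] frac_onD[OF NM(3) r(1)] by (simp add: frac_eq_eq)
    qed (intro poly_fun_minus poly_fun.mult gh NM F D f)+
    have "g (case_option 1 y) - y j * h (case_option 1 y) = 0" if "y \<in> X" for y
    proof (rule vanish_generic[OF X _ D1 XD1 _ that])
      fix y assume y: "y \<in> X" "y \<in> nz D1"
      let ?z = "case_option 1 y"
      have z: "?z \<in> ?Z" "?z \<in> nz D" using y by (auto simp: mem_ctimes D1_def nz_iff)
      have "reg X D1 (\<lambda>y. uncurry1 e (case_option 1 y) j)"
        by (rule regI[OF poly_fun_case_option[OF NM(1), of 1] poly_fun_case_option[OF NM(2), of 1]])
           (use frac_onD[OF NM(3), of "case_option 1 _"] in \<open>simp add: mem_ctimes D1_def nz_iff\<close>)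
      then have "uncurry1 e ?z j = y j"
        by (rule reg_eq[OF X D1P _ reg_poly _ y]) (use one in \<open>auto simp: poly_fun_intros uncurry1_def\<close>)
      then have "N ?z = y j * M ?z" "M ?z \<noteq> 0"
        using frac_onD[OF NM(3) z] by (auto simp: field_simps)
      then show "g ?z - y j * h ?z = 0" using gM[OF z(1)] by (simp add: algebra_simps)
    qed (intro poly_fun_minus poly_fun.mult poly_fun_case_option gh poly_fun_intros)
    from this[OF xX] have "g ?p = x j * h ?p" by simp
    moreover have "h ?p \<noteq> 0" "\<psi> ?p j = g ?p / h ?p" using frac_onD[OF gh(3) f(4) V(2)] by auto
    ultimately show ?thesis by simp
  qed
  then show "q = x" using U(5) by (auto simp: fun_eq_iff)
qed

lemma rat_dom_at_one:
  assumes X: "pos_dense X P" and e: "mor (ctimes X) (ctimes_pos P) X P (uncurry1 e)"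
    and eq: "generically (ctimes X) (\<lambda>z. uncurry1 e' z = uncurry1 e z)"
  shows "generically X (\<lambda>x. case_option 1 x \<in> rat_dom (ctimes X) X (uncurry1 e'))"
proof -
  let ?Z = "ctimes X"
  note Z = pos_dense_ctimes[OF X]
  obtain D where D: "D \<in> poly_fun" "ctimes_pos P \<subseteq> nz D" "uncurry1 e ` (?Z \<inter> nz D) \<subseteq> X"
    "reg_map ?Z D (uncurry1 e)" by (rule morE[OF e])
  have reg: "regular_map_on ?Z (?Z \<inter> nz D) X (uncurry1 e)"
    by (rule regular_map_onI[OF D(4,1) _ D(3)]) auto
  have "?Z \<inter> nz D \<noteq> {}" using D(2) pos_dense_subset[OF Z] pos_dense_nonempty[OF Z] by blast
  then have "generically ?Z (\<lambda>r. r \<in> ?Z \<inter> nz D)" unfolding generically_iff using D(1) by blast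
  from generically_conj[OF Z this eq]
  have gen: "generically ?Z (\<lambda>r. r \<in> ?Z \<inter> nz D \<and> uncurry1 e r = uncurry1 e' r)"
    by (rule generically_mono) auto
  show ?thesis
  proof (rule generically_posI[OF X poly_fun_case_option[OF D(1)]])
    show "P \<subseteq> nz (\<lambda>x. D (case_option 1 x))"
      using D(2) by (auto simp: nz_iff mem_ctimes_pos subset_iff)
    fix p assume "p \<in> X" "p \<in> nz (\<lambda>x. D (case_option 1 x))"
    then have "case_option 1 p \<in> ?Z \<inter> nz D" by (simp add: mem_ctimes nz_iff)
    with reg gen openin_principal[OF D(1)]
    show "case_option 1 p \<in> rat_dom ?Z X (uncurry1 e')"
      unfolding rat_dom_def rat_value_def by blast
  qed
qed

text \<open>
  All conditions only have to be checked at positive points, for maps \<open>e\<close> that represent the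
  same rational maps as \<open>e'\<close>.
\<close>

lemma geometric_crystalI:
  fixes e e' :: "'i \<Rightarrow> complex \<Rightarrow> ('b \<Rightarrow> complex) \<Rightarrow> ('b \<Rightarrow> complex)"
  assumes X: "pos_dense X P" and var: "variety X"
    and e: "\<And>i. i \<in> J \<Longrightarrow> mor (ctimes X) (ctimes_pos P) X P (uncurry1 (e i))"
    and eq: "\<And>i. i \<in> J \<Longrightarrow> generically (ctimes X) (\<lambda>z. uncurry1 (e' i) z = uncurry1 (e i) z)"
    and one: "\<And>i p. i \<in> J \<Longrightarrow> p \<in> P \<Longrightarrow> e i 1 p = p"
    and act: "\<And>i c d p. i \<in> J \<Longrightarrow> c \<in> cpos \<Longrightarrow> d \<in> cpos \<Longrightarrow> p \<in> P \<Longrightarrow> e i c (e i d p) = e i (c * d) p"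
    and \<gamma>: "\<And>i. i \<in> J \<Longrightarrow> scal X P (\<gamma> i)" and \<epsilon>: "\<And>i. i \<in> J \<Longrightarrow> scal X P (\<epsilon> i)"
    and \<gamma>e: "\<And>i j c p. i \<in> J \<Longrightarrow> j \<in> J \<Longrightarrow> c \<in> cpos \<Longrightarrow> p \<in> P \<Longrightarrow> \<gamma> j (e i c p) = c powi A i j * \<gamma> j p"
    and comm: "\<And>i j c d p. i \<in> J \<Longrightarrow> j \<in> J \<Longrightarrow> A i j = 0 \<Longrightarrow> A j i = 0 \<Longrightarrow> c \<in> cpos \<Longrightarrow> d \<in> cpos \<Longrightarrow> p \<in> P
         \<Longrightarrow> e i c (e j d p) = e j d (e i c p)"
    and braid: "\<And>i j c d p. i \<in> J \<Longrightarrow> j \<in> J \<Longrightarrow> A i j = -1 \<Longrightarrow> A j i = -1 \<Longrightarrow> c \<in> cpos \<Longrightarrow> d \<in> cpos \<Longrightarrow> p \<in> P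
         \<Longrightarrow> e i c (e j (c * d) (e i d p)) = e j d (e i (c * d) (e j c p))"
    and \<epsilon>e: "\<And>i c p. i \<in> J \<Longrightarrow> c \<in> cpos \<Longrightarrow> p \<in> P \<Longrightarrow> \<epsilon> i (e i c p) = inverse c * \<epsilon> i p"
    and \<epsilon>e0: "\<And>i j c p. i \<in> J \<Longrightarrow> j \<in> J \<Longrightarrow> A i j = 0 \<Longrightarrow> A j i = 0 \<Longrightarrow> c \<in> cpos \<Longrightarrow> p \<in> P
         \<Longrightarrow> \<epsilon> i (e j c p) = \<epsilon> i p"
  shows "geometric_crystal J A X e' \<gamma> \<epsilon>"
proof -
  let ?Z = "ctimes X" and ?Q = "ctimes_pos P"
  let ?W = "ctimes ?Z" and ?R = "ctimes_pos ?Q"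
  note Z = pos_dense_ctimes[OF X]
  note W = pos_dense_ctimes[OF Z]
  have pos: "e i c p \<in> P" if "i \<in> J" "c \<in> cpos" "p \<in> P" for i c p
    using mor_pos[OF e[OF that(1)], of "case_option c p"] that by (simp add: mem_ctimes_pos uncurry1_def)
  have inv: "e i c (e i (inverse c) p) = p" if "i \<in> J" "c \<in> cpos" "p \<in> P" for i c p
    using act[OF that(1,2) cpos_inverse[OF that(2)] that(3)] one[OF that(1,3)] cpos_nonzero[OF that(2)] by simp
  \<comment> \<open>Applying \<open>e i\<close> to points depending on a positive parameter space, and replacing \<open>e'\<close> by \<open>e\<close> there.\<close>
  have app: "mor T V X P (\<lambda>t. e i (f t) (\<phi> t))"
    if "pos_dense T V" "i \<in> J" "scal T V f" "f ` V \<subseteq> cpos" "mor T V X P \<phi>"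
    for T V :: "('s \<Rightarrow> complex) set" and i f \<phi>
  proof -
    have "mor T V ?Z ?Q (\<lambda>t. case_option (f t) (\<phi> t))"
      by (rule mor_pair[OF that(1,3) _ that(5)]) (use that(4) in blast)
    from mor_comp[OF that(1) this e[OF that(2)]] show ?thesis by simp
  qed
  have rep: "generically T (\<lambda>t. e' i (f t) (\<phi> t) = e i (f t) (\<phi> t))"
    if "pos_dense T V" "i \<in> J" "scal T V f" "f ` V \<subseteq> cpos" "mor T V X P \<phi>"
      "\<forall>c\<in>cpos. \<forall>p\<in>P. \<exists>t\<in>V. f t = c \<and> \<phi> t = p"
    for T V :: "('s \<Rightarrow> complex) set" and i f \<phi>
  proof -
    have "?Q \<subseteq> (\<lambda>t. case_option (f t) (\<phi> t)) ` V"
    proof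
      fix z assume "z \<in> ?Q"
      then have "z None \<in> cpos" "z \<circ> Some \<in> P" by (auto simp: mem_ctimes_pos)
      with that(6) obtain t where "t \<in> V" "f t = z None" "\<phi> t = z \<circ> Some" by blast
      then show "z \<in> (\<lambda>t. case_option (f t) (\<phi> t)) ` V"
        by (intro image_eqI[of _ _ t]) (simp_all add: case_option_surj)
    qed
    moreover have "mor T V ?Z ?Q (\<lambda>t. case_option (f t) (\<phi> t))"
      by (rule mor_pair[OF that(1,3) _ that(5)]) (use that(4) in blast)
    ultimately have "generically T (\<lambda>t. case_option (f t) (\<phi> t) \<in> ?Z \<and>
        uncurry1 (e' i) (case_option (f t) (\<phi> t)) = uncurry1 (e i) (case_option (f t) (\<phi> t)))"
      by (intro generically_comp[OF that(1) Z _ _ eq[OF that(2)]])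
    then show ?thesis by (rule generically_mono) simp
  qed
  have scN: "scal ?Z ?Q (\<lambda>z. z None)" "\<And>t. t \<in> ?Q \<Longrightarrow> t None \<in> cpos"
    by (auto simp: mem_ctimes_pos intro: scal_coord)
  note mS = mor_Some[of X P]
  have w1: "scal ?W ?R (\<lambda>z. z None)" "(\<lambda>z. z None) ` ?R \<subseteq> cpos"
    and w2: "scal ?W ?R (\<lambda>z. z (Some None))" "(\<lambda>z. z (Some None)) ` ?R \<subseteq> cpos"
    and w12: "scal ?W ?R (\<lambda>z. z None * z (Some None))" "(\<lambda>z. z None * z (Some None)) ` ?R \<subseteq> cpos"
    by (auto simp: mem_ctimes_pos intro: scal_coord scal_mult cpos_mult)
  have mSS: "mor ?W ?R X P (\<lambda>z. z \<circ> Some \<circ> Some)"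
    by (rule mor_comp[OF W mor_Some mor_Some])
  have memR: "case_option c (case_option d p) \<in> ?R" if "c \<in> cpos" "d \<in> cpos" "p \<in> P" for c d p
    using that by (simp add: mem_ctimes_pos)
  have parR: "t \<circ> Some \<circ> Some \<in> P" "t None \<in> cpos" "t (Some None) \<in> cpos" if "t \<in> ?R" for t
    using that by (auto simp: mem_ctimes_pos comp_def)
  have rep1: "generically ?Z (\<lambda>z. e' i (z None) (z \<circ> Some) = e i (z None) (z \<circ> Some))" if "i \<in> J" for i
    using eq[OF that] by (simp add: uncurry1_def)
  have repd: "generically ?W (\<lambda>z. e' i (z (Some None)) (z \<circ> Some \<circ> Some) = e i (z (Some None)) (z \<circ> Some \<circ> Some))"
    if "i \<in> J" for i
    by (rule rep[OF W that w2 mSS]) (intro ballI bexI[OF _ memR[OF cpos_one]]; simp)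
  have repc: "generically ?W (\<lambda>z. e' i (z None) (z \<circ> Some \<circ> Some) = e i (z None) (z \<circ> Some \<circ> Some))"
    if "i \<in> J" for i
    by (rule rep[OF W that w1 mSS]) (intro ballI bexI[OF _ memR[OF _ cpos_one]]; simp)
  have md: "mor ?W ?R X P (\<lambda>z. e i (z (Some None)) (z \<circ> Some \<circ> Some))" if "i \<in> J" for i
    by (rule app[OF W that w2 mSS])
  have mc: "mor ?W ?R X P (\<lambda>z. e i (z None) (z \<circ> Some \<circ> Some))" if "i \<in> J" for i
    by (rule app[OF W that w1 mSS])
  \<comment> \<open>The surjectivity required by \<open>rep\<close> is obtained by giving the other
    action the parameter \<open>1\<close>.\<close>
  have surj_cd: "\<forall>c\<in>cpos. \<forall>p\<in>P. \<exists>t\<in>?R. t None = c \<and> e j (t (Some None)) (t \<circ> Some \<circ> Some) = p"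
    if "j \<in> J" for j
    using memR[OF _ cpos_one] one[OF that]
    by (intro ballI bexI[of _ "case_option _ (case_option 1 _)"]) auto
  have surj_dc: "\<forall>c\<in>cpos. \<forall>p\<in>P. \<exists>t\<in>?R. t (Some None) = c \<and> e j (t None) (t \<circ> Some \<circ> Some) = p"
    if "j \<in> J" for j
    using memR[OF cpos_one] one[OF that]
    by (intro ballI bexI[of _ "case_option 1 (case_option _ _)"]) auto
  have surj_pd: "\<forall>c\<in>cpos. \<forall>p\<in>P. \<exists>t\<in>?R. t None * t (Some None) = c \<and> e j (t (Some None)) (t \<circ> Some \<circ> Some) = p"
    if "j \<in> J" for j
    using memR[OF _ cpos_one] one[OF that]
    by (intro ballI bexI[of _ "case_option _ (case_option 1 _)"]) auto
  have surj_pc: "\<forall>c\<in>cpos. \<forall>p\<in>P. \<exists>t\<in>?R. t None * t (Some None) = c \<and> e j (t None) (t \<circ> Some \<circ> Some) = p"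
    if "j \<in> J" for j
    using memR[OF cpos_one] one[OF that]
    by (intro ballI bexI[of _ "case_option 1 (case_option _ _)"]) auto
  have rep_cd: "generically ?W (\<lambda>z. e' i (z None) (e' j (z (Some None)) (z \<circ> Some \<circ> Some))
                 = e i (z None) (e j (z (Some None)) (z \<circ> Some \<circ> Some)))" if "i \<in> J" "j \<in> J" for i j
    using generically_conj[OF W repd[OF that(2)] rep[OF W that(1) w1 md[OF that(2)] surj_cd[OF that(2)]]]
    by (rule generically_mono) auto
  have rep_dc: "generically ?W (\<lambda>z. e' j (z (Some None)) (e' i (z None) (z \<circ> Some \<circ> Some))
                 = e j (z (Some None)) (e i (z None) (z \<circ> Some \<circ> Some)))" if "i \<in> J" "j \<in> J" for i j
    using generically_conj[OF W repc[OF that(1)] rep[OF W that(2) w2 mc[OF that(1)] surj_dc[OF that(1)]]]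
    by (rule generically_mono) auto
  have mpd: "mor ?W ?R X P (\<lambda>z. e j (z None * z (Some None)) (e i (z (Some None)) (z \<circ> Some \<circ> Some)))"
    if "i \<in> J" "j \<in> J" for i j by (rule app[OF W that(2) w12 md[OF that(1)]])
  have mpc: "mor ?W ?R X P (\<lambda>z. e j (z None * z (Some None)) (e i (z None) (z \<circ> Some \<circ> Some)))"
    if "i \<in> J" "j \<in> J" for i j by (rule app[OF W that(2) w12 mc[OF that(1)]])
  \<comment> \<open>With second parameter \<open>inverse c\<close> the middle action has parameter
    \<open>1\<close>, so only \<open>e i (inverse c)\<close> has to be undone.\<close>
  have surj3: "\<forall>c\<in>cpos. \<forall>p\<in>P. \<exists>t\<in>?R. t None = c \<and> e j (t None * t (Some None)) (e i (t (Some None)) (t \<circ> Some \<circ> Some)) = p"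
    if ij: "i \<in> J" "j \<in> J" for i j
  proof (intro ballI)
    fix c p assume cp: "c \<in> cpos" "p \<in> P"
    note that = ij cp
    have "e i (inverse c) (e i c p) = p"
      using inv[OF that(1) cpos_inverse[OF that(3)] that(4)] by simp
    then show "\<exists>t\<in>?R. t None = c \<and> e j (t None * t (Some None)) (e i (t (Some None)) (t \<circ> Some \<circ> Some)) = p"
      using memR[OF that(3) cpos_inverse[OF that(3)] pos[OF that(1,3,4)]] cpos_nonzero[OF that(3)] one[OF that(2,4)]
      by (intro bexI[of _ "case_option c (case_option (inverse c) (e i c p))"]) auto
  qed
  have surj3': "\<forall>c\<in>cpos. \<forall>p\<in>P. \<exists>t\<in>?R. t (Some None) = c \<and> e j (t None * t (Some None)) (e i (t None) (t \<circ> Some \<circ> Some)) = p"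
    if ij: "i \<in> J" "j \<in> J" for i j
  proof (intro ballI)
    fix c p assume cp: "c \<in> cpos" "p \<in> P"
    note that = ij cp
    have "e i (inverse c) (e i c p) = p"
      using inv[OF that(1) cpos_inverse[OF that(3)] that(4)] by simp
    then show "\<exists>t\<in>?R. t (Some None) = c \<and> e j (t None * t (Some None)) (e i (t None) (t \<circ> Some \<circ> Some)) = p"
      using memR[OF cpos_inverse[OF that(3)] that(3) pos[OF that(1,3,4)]] cpos_nonzero[OF that(3)] one[OF that(2,4)]
      by (intro bexI[of _ "case_option (inverse c) (case_option c (e i c p))"]) auto
  qed
  have rep3: "generically ?W (\<lambda>z. e' i (z None) (e' j (z None * z (Some None)) (e' i (z (Some None)) (z \<circ> Some \<circ> Some)))
               = e i (z None) (e j (z None * z (Some None)) (e i (z (Some None)) (z \<circ> Some \<circ> Some))))"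
    if "i \<in> J" "j \<in> J" for i j
    using generically_conj[OF W repd[OF that(1)]
        generically_conj[OF W rep[OF W that(2) w12 md[OF that(1)] surj_pd[OF that(1)]]
          rep[OF W that(1) w1 mpd[OF that] surj3[OF that]]]]
    by (rule generically_mono) auto
  have rep3': "generically ?W (\<lambda>z. e' i (z (Some None)) (e' j (z None * z (Some None)) (e' i (z None) (z \<circ> Some \<circ> Some)))
               = e i (z (Some None)) (e j (z None * z (Some None)) (e i (z None) (z \<circ> Some \<circ> Some))))"
    if "i \<in> J" "j \<in> J" for i j
    using generically_conj[OF W repc[OF that(1)]
        generically_conj[OF W rep[OF W that(2) w12 mc[OF that(1)] surj_pc[OF that(1)]]
          rep[OF W that(1) w2 mpc[OF that] surj3'[OF that]]]]
    by (rule generically_mono) auto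

  have "rational_action X (e' i)" if i: "i \<in> J" for i
    unfolding rational_action_def
  proof (intro conjI allI impI)
    show "rational_map ?Z X (uncurry1 (e' i))" by (rule mor_rational_map[OF Z e[OF i] eq[OF i]])
    show "q = x" if "rat_value ?Z X (uncurry1 (e' i)) (case_option 1 x) q" for x q
      by (rule rat_value_at_one[OF X e[OF i] eq[OF i] one[OF i] that])
    have repp: "generically ?W (\<lambda>z. e' i (z None * z (Some None)) (z \<circ> Some \<circ> Some)
                  = e i (z None * z (Some None)) (z \<circ> Some \<circ> Some))"
      by (rule rep[OF W i w12 mSS]) (intro ballI bexI[OF _ memR[OF _ cpos_one]]; simp)
    have "generically ?W (\<lambda>z. e i (z None) (e i (z (Some None)) (z \<circ> Some \<circ> Some))
                 = e i (z None * z (Some None)) (z \<circ> Some \<circ> Some))"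
      by (rule mor_eq[OF W app[OF W i w1 md[OF i]] app[OF W i w12 mSS]]) (intro act i parR)
    from generically_conj[OF W this generically_conj[OF W rep_cd[OF i i] repp]]
    show "generically ?W (uncurry2 (\<lambda>c1 c2 x. e' i c1 (e' i c2 x) = e' i (c1 * c2) x))"
      by (rule generically_mono) (simp add: uncurry2_def)
  qed
  moreover have "generically ?Z (uncurry1 (\<lambda>c x. \<gamma> j (e' i c x) = c powi A i j * \<gamma> j x))"
    if "i \<in> J" "j \<in> J" for i j
  proof -
    have "generically ?Z (\<lambda>z. \<gamma> j (uncurry1 (e i) z) = z None powi A i j * \<gamma> j (z \<circ> Some))"
      by (rule scal_eq[OF Z scal_comp[OF Z e[OF that(1)] \<gamma>[OF that(2)]]
           scal_mult[OF scal_powi[OF Z scN(1)] scal_comp[OF Z mS \<gamma>[OF that(2)]]]])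
         (use \<gamma>e that cpos_nonzero in \<open>auto simp: uncurry1_def mem_ctimes_pos\<close>)
    from generically_conj[OF Z this eq[OF that(1)]] show ?thesis
      by (rule generically_mono) (simp add: uncurry1_def)
  qed
  moreover have "generically ?W (uncurry2 (\<lambda>c1 c2 x. e' i c1 (e' j c2 x) = e' j c2 (e' i c1 x)))"
    if ij: "i \<in> J" "j \<in> J" and A: "A i j = 0 \<and> A j i = 0" for i j
  proof -
    have "generically ?W (\<lambda>z. e i (z None) (e j (z (Some None)) (z \<circ> Some \<circ> Some))
                  = e j (z (Some None)) (e i (z None) (z \<circ> Some \<circ> Some)))"
      by (rule mor_eq[OF W app[OF W ij(1) w1 md[OF ij(2)]] app[OF W ij(2) w2 mc[OF ij(1)]]])
         (use A in \<open>intro comm ij parR; simp\<close>)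
    from generically_conj[OF W this generically_conj[OF W rep_cd[OF ij] rep_dc[OF ij]]]
    show ?thesis by (rule generically_mono) (simp add: uncurry2_def)
  qed
  moreover have "generically ?W (uncurry2 (\<lambda>c1 c2 x.
           e' i c1 (e' j (c1 * c2) (e' i c2 x)) = e' j c2 (e' i (c1 * c2) (e' j c1 x))))"
    if ij: "i \<in> J" "j \<in> J" and A: "A i j = -1 \<and> A j i = -1" for i j
  proof -
    have "generically ?W (\<lambda>z. e i (z None) (e j (z None * z (Some None)) (e i (z (Some None)) (z \<circ> Some \<circ> Some)))
              = e j (z (Some None)) (e i (z None * z (Some None)) (e j (z None) (z \<circ> Some \<circ> Some))))"
      by (rule mor_eq[OF W app[OF W ij(1) w1 mpd[OF ij]] app[OF W ij(2) w2 mpc[OF ij(2,1)]]])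
         (use A in \<open>intro braid ij parR; simp\<close>)
    from generically_conj[OF W this generically_conj[OF W rep3[OF ij] rep3'[OF ij(2,1)]]]
    show ?thesis by (rule generically_mono) (simp add: uncurry2_def)
  qed
  moreover have "generically ?Z (uncurry1 (\<lambda>c x. \<epsilon> i (e' i c x) = inverse c * \<epsilon> i x))" if "i \<in> J" for i
  proof -
    have "generically ?Z (\<lambda>z. \<epsilon> i (uncurry1 (e i) z) = inverse (z None) * \<epsilon> i (z \<circ> Some))"
      by (rule scal_eq[OF Z scal_comp[OF Z e[OF that(1)] \<epsilon>[OF that(1)]]
           scal_mult[OF scal_inverse[OF Z scN(1)] scal_comp[OF Z mS \<epsilon>[OF that(1)]]]])
         (use \<epsilon>e that cpos_nonzero in \<open>auto simp: uncurry1_def mem_ctimes_pos\<close>)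
    from generically_conj[OF Z this eq[OF that(1)]] show ?thesis
      by (rule generically_mono) (simp add: uncurry1_def)
  qed
  moreover have "generically ?Z (uncurry1 (\<lambda>c x. \<epsilon> i (e' j c x) = \<epsilon> i x))"
    if "i \<in> J" "j \<in> J" "A i j = 0 \<and> A j i = 0" for i j
  proof -
    have "generically ?Z (\<lambda>z. \<epsilon> i (uncurry1 (e j) z) = \<epsilon> i (z \<circ> Some))"
      by (rule scal_eq[OF Z scal_comp[OF Z e[OF that(2)] \<epsilon>[OF that(1)]] scal_comp[OF Z mS \<epsilon>[OF that(1)]]])
         (use \<epsilon>e0 that in \<open>auto simp: uncurry1_def mem_ctimes_pos\<close>)
    from generically_conj[OF Z this eq[OF that(2)]] show ?thesis
      by (rule generically_mono) (simp add: uncurry1_def)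
  qed
  ultimately show ?thesis
    unfolding geometric_crystal_def
    using var scal_rational_fun[OF X] \<gamma> \<epsilon> rat_dom_at_one[OF X e eq] by blast
qed

section \<open>Subtraction-free functions\<close>

text \<open>Equality is demanded at positive points only, so formulas may be exchanged for others
  that are known just there. Together with regularity, density turns it into the generic equality of
  \<open>positive_fun\<close>.\<close>

definition subtraction_free :: "'s set \<Rightarrow> (('s \<Rightarrow> complex) \<Rightarrow> complex) \<Rightarrow> bool" where
  "subtraction_free S f \<longleftrightarrow>
     (\<exists>g h. positive_comb S g \<and> positive_comb S h \<and> (\<forall>x\<in>tpos S. f x = g x / h x))"

text \<open>Different indices may carry the same character, as happens for sums and products; the
  coefficients of equal characters are collected, and positivity prevents cancellation.\<close>

lemma positive_combI:
  assumes "finite I" "I \<noteq> {}" "\<And>i. i \<in> I \<Longrightarrow> c i > 0"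
    and g: "\<And>x. x \<in> torus S \<Longrightarrow> g x = (\<Sum>i\<in>I. complex_of_real (c i) * torus_char S (\<nu> i) x)"
  shows "positive_comb S g"
  unfolding positive_comb_def
proof (intro exI conjI ballI)
  let ?a = "\<lambda>\<mu>. \<Sum>i\<in>{i \<in> I. \<nu> i = \<mu>}. c i"
  show "finite (\<nu> ` I)" "\<nu> ` I \<noteq> {}" using assms by auto
  show "?a \<mu> > 0" if "\<mu> \<in> \<nu> ` I" for \<mu> using that assms by (intro sum_pos) auto
  fix x assume x: "x \<in> torus S"
  have "g x = (\<Sum>\<mu>\<in>\<nu> ` I. \<Sum>i\<in>{i \<in> I. \<nu> i = \<mu>}. complex_of_real (c i) * torus_char S (\<nu> i) x)"
    unfolding g[OF x] by (rule sum.image_gen[OF assms(1)])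
  also have "\<dots> = (\<Sum>\<mu>\<in>\<nu> ` I. complex_of_real (?a \<mu>) * torus_char S \<mu> x)"
    by (intro sum.cong refl) (simp add: sum_distrib_right)
  finally show "g x = (\<Sum>\<mu>\<in>\<nu> ` I. complex_of_real (?a \<mu>) * torus_char S \<mu> x)" .
qed

lemma positive_combE:
  assumes "positive_comb S g"
  obtains M a where "finite M" "M \<noteq> {}" "\<forall>\<nu>\<in>M. a \<nu> > 0"
    "\<forall>x\<in>torus S. g x = (\<Sum>\<nu>\<in>M. complex_of_real (a \<nu>) * torus_char S \<nu> x)"
  using assms unfolding positive_comb_def by (elim exE conjE)

lemma torus_char_add:
  assumes "x \<in> torus S"
  shows "torus_char S (\<lambda>s. \<mu> s + \<nu> s) x = torus_char S \<mu> x * torus_char S \<nu> x"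
  unfolding torus_char_def prod.distrib[symmetric]
  using assms by (intro prod.cong refl power_int_add) (auto simp: torus_def)

lemma positive_comb_const:
  assumes "r > 0" shows "positive_comb S (\<lambda>_. complex_of_real r)"
  by (rule positive_combI[of "{()}" "\<lambda>_. r" _ _ "\<lambda>_ _. 0"]) (use assms in \<open>auto simp: torus_char_def\<close>)

lemma positive_comb_coord:
  assumes "finite S" shows "positive_comb S (\<lambda>x. x s)"
proof (cases "s \<in> S")
  case True
  show ?thesis
  proof (rule positive_combI[of "{()}" "\<lambda>_. 1" _ _ "\<lambda>_ t. if t = s then 1 else 0"])
    fix x assume "x \<in> torus S"
    have "(\<Prod>t\<in>S. x t powi (if t = s then 1 else 0)) = (\<Prod>t\<in>S. if t = s then x s else 1)"
      by (intro prod.cong) auto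
    then show "x s = (\<Sum>i\<in>{()}. complex_of_real 1 * torus_char S (\<lambda>t. if t = s then 1 else 0) x)"
      using True assms by (simp add: torus_char_def prod.delta)
  qed auto
next
  case False
  show ?thesis
    by (rule positive_combI[of "{()}" "\<lambda>_. 1" _ _ "\<lambda>_ _. 0"])
       (use False in \<open>auto simp: torus_char_def torus_def\<close>)
qed

lemma positive_comb_add:
  assumes "positive_comb S f" "positive_comb S g"
  shows "positive_comb S (\<lambda>x. f x + g x)"
proof -
  obtain M a where 1: "finite M" "M \<noteq> {}" "\<forall>\<nu>\<in>M. a \<nu> > 0"
    "\<forall>x\<in>torus S. f x = (\<Sum>\<nu>\<in>M. complex_of_real (a \<nu>) * torus_char S \<nu> x)"
    by (rule positive_combE[OF assms(1)])
  obtain L b where 2: "finite L" "L \<noteq> {}" "\<forall>\<nu>\<in>L. b \<nu> > 0"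
    "\<forall>x\<in>torus S. g x = (\<Sum>\<nu>\<in>L. complex_of_real (b \<nu>) * torus_char S \<nu> x)"
    by (rule positive_combE[OF assms(2)])
  show ?thesis
    by (rule positive_combI[of "M <+> L" "case_sum a b" S _ "case_sum id id"])
       (use 1 2 in \<open>auto simp: sum.Plus\<close>)
qed

lemma positive_comb_mult:
  assumes "positive_comb S f" "positive_comb S g"
  shows "positive_comb S (\<lambda>x. f x * g x)"
proof -
  obtain M a where 1: "finite M" "M \<noteq> {}" "\<forall>\<nu>\<in>M. a \<nu> > 0"
    "\<forall>x\<in>torus S. f x = (\<Sum>\<nu>\<in>M. complex_of_real (a \<nu>) * torus_char S \<nu> x)"
    by (rule positive_combE[OF assms(1)])
  obtain L b where 2: "finite L" "L \<noteq> {}" "\<forall>\<nu>\<in>L. b \<nu> > 0"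
    "\<forall>x\<in>torus S. g x = (\<Sum>\<nu>\<in>L. complex_of_real (b \<nu>) * torus_char S \<nu> x)"
    by (rule positive_combE[OF assms(2)])
  show ?thesis
  proof (rule positive_combI[of "M \<times> L" "\<lambda>(\<mu>, \<nu>). a \<mu> * b \<nu>" S _ "\<lambda>(\<mu>, \<nu>) s. \<mu> s + \<nu> s"])
    fix x assume x: "x \<in> torus S"
    show "f x * g x = (\<Sum>i\<in>M \<times> L. complex_of_real (case i of (\<mu>, \<nu>) \<Rightarrow> a \<mu> * b \<nu>) *
       torus_char S (case i of (\<mu>, \<nu>) \<Rightarrow> \<lambda>s. \<mu> s + \<nu> s) x)"
      unfolding bspec[OF 1(4) x] bspec[OF 2(4) x] sum_product sum.cartesian_product
      by (intro sum.cong refl) (auto simp: torus_char_add[OF x])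
  qed (use 1 2 in \<open>auto\<close>)
qed

lemma positive_comb_cpos:
  assumes "positive_comb S g" "x \<in> tpos S"
  shows "g x \<in> cpos"
proof -
  obtain M a where 1: "finite M" "M \<noteq> {}" "\<forall>\<nu>\<in>M. a \<nu> > 0"
    "\<forall>x\<in>torus S. g x = (\<Sum>\<nu>\<in>M. complex_of_real (a \<nu>) * torus_char S \<nu> x)"
    by (rule positive_combE[OF assms(1)])
  have "x s powi m \<in> cpos" for s m
    using tpos_cpos[OF assms(2), of s] unfolding power_int_def by (auto intro: cpos_power cpos_inverse)
  then have "torus_char S \<nu> x \<in> cpos" for \<nu> unfolding torus_char_def by (intro cpos_prod)
  then show ?thesis
    unfolding bspec[OF 1(4) tpos_torus[OF assms(2)]] using 1 by (intro cpos_sum cpos_mult) auto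
qed

lemma subtraction_freeI:
  "positive_comb S g \<Longrightarrow> positive_comb S h \<Longrightarrow> (\<And>x. x \<in> tpos S \<Longrightarrow> f x = g x / h x) \<Longrightarrow> subtraction_free S f"
  unfolding subtraction_free_def by blast

lemma subtraction_freeE:
  assumes "subtraction_free S f"
  obtains g h where "positive_comb S g" "positive_comb S h" "\<forall>x\<in>tpos S. f x = g x / h x"
  using assms unfolding subtraction_free_def by (elim exE conjE)

lemma subtraction_free_cong:
  "subtraction_free S f \<Longrightarrow> (\<And>x. x \<in> tpos S \<Longrightarrow> f x = g x) \<Longrightarrow> subtraction_free S g"
  by (elim subtraction_freeE, rule subtraction_freeI, assumption+) auto

lemma subtraction_free_cpos:
  assumes "subtraction_free S f" "x \<in> tpos S" shows "f x \<in> cpos"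
  using assms(1) by (rule subtraction_freeE) (use assms(2) positive_comb_cpos in \<open>auto intro!: cpos_divide\<close>)

lemma sf_comb: "positive_comb S g \<Longrightarrow> subtraction_free S g"
  using positive_comb_const[of 1 S] by (intro subtraction_freeI[of S g "\<lambda>_. 1"]) simp_all

lemma sf_const: "r > 0 \<Longrightarrow> subtraction_free S (\<lambda>_. complex_of_real r)"
  by (intro sf_comb positive_comb_const)

lemma sf_one: "subtraction_free S (\<lambda>_. 1)"
  using sf_const[of 1] by simp

lemma sf_coord: "finite S \<Longrightarrow> subtraction_free S (\<lambda>x. x s)"
  by (intro sf_comb positive_comb_coord)

lemma sf_add:
  assumes "subtraction_free S f" "subtraction_free S g"
  shows "subtraction_free S (\<lambda>x. f x + g x)"
proof -
  obtain a b where 1: "positive_comb S a" "positive_comb S b" "\<forall>x\<in>tpos S. f x = a x / b x"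
    by (rule subtraction_freeE[OF assms(1)])
  obtain c d where 2: "positive_comb S c" "positive_comb S d" "\<forall>x\<in>tpos S. g x = c x / d x"
    by (rule subtraction_freeE[OF assms(2)])
  show ?thesis
  proof (rule subtraction_freeI)
    show "positive_comb S (\<lambda>x. a x * d x + c x * b x)" "positive_comb S (\<lambda>x. b x * d x)"
      by (intro positive_comb_add positive_comb_mult 1 2)+
    fix x assume x: "x \<in> tpos S"
    then have "b x \<noteq> 0" "d x \<noteq> 0" using 1 2 positive_comb_cpos cpos_nonzero by blast+
    then show "f x + g x = (a x * d x + c x * b x) / (b x * d x)"
      using 1(3) 2(3) x by (simp add: field_simps)
  qed
qed

lemma sf_mult:
  assumes "subtraction_free S f" "subtraction_free S g"
  shows "subtraction_free S (\<lambda>x. f x * g x)"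
proof -
  obtain a b where 1: "positive_comb S a" "positive_comb S b" "\<forall>x\<in>tpos S. f x = a x / b x"
    by (rule subtraction_freeE[OF assms(1)])
  obtain c d where 2: "positive_comb S c" "positive_comb S d" "\<forall>x\<in>tpos S. g x = c x / d x"
    by (rule subtraction_freeE[OF assms(2)])
  show ?thesis
    by (rule subtraction_freeI[OF positive_comb_mult[OF 1(1) 2(1)] positive_comb_mult[OF 1(2) 2(2)]])
       (use 1(3) 2(3) in simp)
qed

lemma sf_inverse:
  assumes "subtraction_free S f"
  shows "subtraction_free S (\<lambda>x. inverse (f x))"
proof -
  obtain a b where 1: "positive_comb S a" "positive_comb S b" "\<forall>x\<in>tpos S. f x = a x / b x"
    by (rule subtraction_freeE[OF assms(1)])
  show ?thesis by (rule subtraction_freeI[OF 1(2,1)]) (use 1(3) in simp)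
qed

lemma sf_divide:
  "subtraction_free S f \<Longrightarrow> subtraction_free S g \<Longrightarrow> subtraction_free S (\<lambda>x. f x / g x)"
  unfolding divide_inverse by (intro sf_mult sf_inverse)

lemma sf_prod: "(\<And>i. i \<in> A \<Longrightarrow> subtraction_free S (f i)) \<Longrightarrow> subtraction_free S (\<lambda>x. \<Prod>i\<in>A. f i x)"
  by (induction A rule: infinite_finite_induct) (simp_all add: sf_one sf_mult)

lemma sf_sum:
  assumes "finite A" "A \<noteq> {}" "\<And>i. i \<in> A \<Longrightarrow> subtraction_free S (f i)"
  shows "subtraction_free S (\<lambda>x. \<Sum>i\<in>A. f i x)"
  using assms by (induction A rule: finite_ne_induct) (simp_all add: sf_add)

lemma sf_power: "subtraction_free S f \<Longrightarrow> subtraction_free S (\<lambda>x. f x ^ m)"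
  by (induction m) (simp_all add: sf_one sf_mult)

lemma sf_powi: "subtraction_free S f \<Longrightarrow> subtraction_free S (\<lambda>x. f x powi m)"
  unfolding power_int_def by (cases "0 \<le> m") (simp_all add: sf_power sf_inverse)

lemma sf_torus_char:
  "(\<And>s. s \<in> S' \<Longrightarrow> subtraction_free S (\<lambda>x. \<phi> x s)) \<Longrightarrow> subtraction_free S (\<lambda>x. torus_char S' \<nu> (\<phi> x))"
  unfolding torus_char_def by (intro sf_prod sf_powi)

lemma sf_comp:
  assumes f: "subtraction_free S' f" and \<phi>: "\<And>s. s \<in> S' \<Longrightarrow> subtraction_free S (\<lambda>x. \<phi> x s)"
    and pos: "\<And>x. x \<in> tpos S \<Longrightarrow> \<phi> x \<in> tpos S'"
  shows "subtraction_free S (\<lambda>x. f (\<phi> x))"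
proof -
  have comb: "subtraction_free S (\<lambda>x. g (\<phi> x))" if g: "positive_comb S' g" for g
  proof -
    obtain M a where 1: "finite M" "M \<noteq> {}" "\<forall>\<nu>\<in>M. a \<nu> > 0"
      "\<forall>x\<in>torus S'. g x = (\<Sum>\<nu>\<in>M. complex_of_real (a \<nu>) * torus_char S' \<nu> x)"
      by (rule positive_combE[OF g])
    have "subtraction_free S (\<lambda>x. \<Sum>\<nu>\<in>M. complex_of_real (a \<nu>) * torus_char S' \<nu> (\<phi> x))"
      using 1(1-3) \<phi> by (intro sf_sum sf_mult sf_const sf_torus_char) auto
    then show ?thesis by (rule subtraction_free_cong) (simp add: bspec[OF 1(4) tpos_torus[OF pos]])
  qed
  obtain a b where 1: "positive_comb S' a" "positive_comb S' b" "\<forall>x\<in>tpos S'. f x = a x / b x"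
    by (rule subtraction_freeE[OF f])
  show ?thesis
    by (rule subtraction_free_cong[OF sf_divide[OF comb[OF 1(1)] comb[OF 1(2)]]]) (use 1(3) pos in simp)
qed

lemma scal_cong:
  assumes "scal X P f" "\<And>p. p \<in> X \<Longrightarrow> f p = g p"
  shows "scal X P g"
proof -
  obtain D where D: "D \<in> poly_fun" "P \<subseteq> nz D" "reg X D f" by (rule scalE[OF assms(1)])
  obtain N M where NM: "N \<in> poly_fun" "M \<in> poly_fun" "frac_on (X \<inter> nz D) N M f" by (rule regE[OF D(3)])
  have "reg X D g" by (rule regI[OF NM(1,2)]) (use frac_onD[OF NM(3)] assms(2) in auto)
  with D show ?thesis by (intro scalI[of D])
qed

lemma scal_positive_comb:
  assumes "finite S" "positive_comb S g"
  shows "scal (torus S) (tpos S) g"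
proof -
  note T = pos_dense_torus[OF assms(1)]
  obtain M a where 1: "finite M" "M \<noteq> {}" "\<forall>\<nu>\<in>M. a \<nu> > 0"
    "\<forall>x\<in>torus S. g x = (\<Sum>\<nu>\<in>M. complex_of_real (a \<nu>) * torus_char S \<nu> x)"
    by (rule positive_combE[OF assms(2)])
  have nz: "x s \<noteq> 0" if "x \<in> tpos S" for x s using tpos_cpos[OF that] cpos_nonzero by blast
  have "scal (torus S) (tpos S) (\<lambda>x. \<Sum>\<nu>\<in>M. complex_of_real (a \<nu>) * torus_char S \<nu> x)"
    unfolding torus_char_def by (intro scal_sum scal_mult scal_const scal_prod scal_powi T scal_coord nz)
  then show ?thesis by (rule scal_cong) (simp add: 1(4))
qed

lemma positive_funI:
  assumes "finite S" "scal (torus S) (tpos S) f" "subtraction_free S f"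
  shows "positive_fun S f"
proof -
  note T = pos_dense_torus[OF assms(1)]
  obtain a b where 1: "positive_comb S a" "positive_comb S b" "\<forall>x\<in>tpos S. f x = a x / b x"
    by (rule subtraction_freeE[OF assms(3)])
  have "generically (torus S) (\<lambda>x. f x = a x / b x)"
    by (rule scal_eq[OF T assms(2) scal_divide[OF T scal_positive_comb[OF assms(1) 1(1)]
            scal_positive_comb[OF assms(1) 1(2)]]])
       (use 1 positive_comb_cpos cpos_nonzero in blast)+
  with 1 show ?thesis unfolding positive_fun_def by blast
qed

lemma positive_fun_generic:
  assumes "finite S" "positive_fun S f" "generically (torus S) (\<lambda>x. g x = f x)"
  shows "positive_fun S g"
proof -
  obtain a b where 1: "positive_comb S a" "positive_comb S b" "generically (torus S) (\<lambda>x. f x = a x / b x)"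
    using assms(2) unfolding positive_fun_def by (elim exE conjE)
  have "generically (torus S) (\<lambda>x. g x = a x / b x)"
    using generically_conj[OF pos_dense_torus[OF assms(1)] 1(3) assms(3)] by (rule generically_mono) simp
  with 1(1,2) show ?thesis unfolding positive_fun_def by blast
qed

text \<open>The explicit inverse \<open>\<kappa>\<close> stands in for \<open>rat_inv\<close>, and
  \<open>e\<close> for \<open>e'\<close>: each agrees with the original generically, which suffices
  because positivity is a generic condition.\<close>

lemma positive_structureI:
  fixes e e' :: "'i \<Rightarrow> complex \<Rightarrow> ('b \<Rightarrow> complex) \<Rightarrow> ('b \<Rightarrow> complex)"
  assumes X: "pos_dense X P" and S: "finite S"
    and \<theta>: "mor (torus S) (tpos S) X P \<theta>" and \<kappa>: "mor X P (torus S) (tpos S) \<kappa>"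
    and \<kappa>\<theta>: "\<And>t. t \<in> tpos S \<Longrightarrow> \<kappa> (\<theta> t) = t" and \<theta>\<kappa>: "\<And>p. p \<in> P \<Longrightarrow> \<theta> (\<kappa> p) = p"
    and e: "\<And>i. i \<in> J \<Longrightarrow> mor (ctimes X) (ctimes_pos P) X P (uncurry1 (e i))"
    and eq: "\<And>i. i \<in> J \<Longrightarrow> generically (ctimes X) (\<lambda>z. uncurry1 (e' i) z = uncurry1 (e i) z)"
    and one: "\<And>i p. i \<in> J \<Longrightarrow> p \<in> P \<Longrightarrow> e i 1 p = p"
    and \<gamma>: "\<And>i. i \<in> J \<Longrightarrow> scal X P (\<gamma> i)" and \<epsilon>: "\<And>i. i \<in> J \<Longrightarrow> scal X P (\<epsilon> i)"
    and \<gamma>s: "\<And>i. i \<in> J \<Longrightarrow> subtraction_free S (\<gamma> i \<circ> \<theta>)"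
    and \<epsilon>s: "\<And>i. i \<in> J \<Longrightarrow> subtraction_free S (\<epsilon> i \<circ> \<theta>)"
    and es: "\<And>i s. i \<in> J \<Longrightarrow> s \<in> S \<Longrightarrow>
        subtraction_free (insert None (Some ` S)) (\<lambda>z. \<kappa> (e i (z None) (\<theta> (z \<circ> Some))) s)"
  shows "positive_structure J X e' \<gamma> \<epsilon> S \<theta>"
proof -
  let ?T = "torus S" and ?S = "insert None (Some ` S)"
  note T = pos_dense_torus[OF S]
  note Z = pos_dense_ctimes[OF X]
  note TT = pos_dense_ctimes[OF T]
  have fin: "finite ?S" using S by simp
  have inv: "is_rat_inverse ?T X \<theta> \<kappa>" "generically X (\<lambda>q. rat_inv ?T X \<theta> q = \<kappa> q)"
    by (rule rat_inv_generic[OF T X \<theta> \<kappa>]; use \<kappa>\<theta> \<theta>\<kappa> in simp)+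
  have "positive_map ?S S (uncurry1 (\<lambda>c t. rat_inv ?T X \<theta> (e' i c (\<theta> t))))" (is "positive_map _ _ ?F")
    if i: "i \<in> J" for i
  proof -
    define E where "E = (\<lambda>z. \<kappa> (e i (z None) (\<theta> (z \<circ> Some))))"
    have mp: "mor (ctimes ?T) (ctimes_pos (tpos S)) (ctimes X) (ctimes_pos P)
        (\<lambda>z. case_option (z None) (\<theta> (z \<circ> Some)))"
      by (intro mor_pair[OF TT] scal_coord mor_comp[OF TT mor_Some \<theta>]) (simp add: mem_ctimes_pos)
    have me: "mor (ctimes ?T) (ctimes_pos (tpos S)) X P (\<lambda>z. e i (z None) (\<theta> (z \<circ> Some)))"
      using mor_comp[OF TT mp e[OF i]] by simp
    have mE: "mor (ctimes ?T) (ctimes_pos (tpos S)) ?T (tpos S) E"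
      unfolding E_def by (rule mor_comp[OF TT me \<kappa>])
    have pre: "\<exists>t\<in>tpos S. \<theta> t = p" if "p \<in> P" for p
      using \<theta>\<kappa>[OF that] mor_pos[OF \<kappa> that] by blast
    \<comment> \<open>This covering and the next one are the surjectivity conditions for pulling
      back the generic identities for \<open>e'\<close> and for \<open>rat_inv\<close>.\<close>
    have s1: "ctimes_pos P \<subseteq> (\<lambda>z. case_option (z None) (\<theta> (z \<circ> Some))) ` ctimes_pos (tpos S)"
    proof
      fix z assume z: "z \<in> ctimes_pos P"
      then obtain t where t: "t \<in> tpos S" "\<theta> t = z \<circ> Some" using pre by (auto simp: mem_ctimes_pos)
      show "z \<in> (\<lambda>z. case_option (z None) (\<theta> (z \<circ> Some))) ` ctimes_pos (tpos S)"
        by (rule image_eqI[of _ _ "case_option (z None) t"])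
           (use t z in \<open>simp_all add: mem_ctimes_pos case_option_surj\<close>)
    qed
    have s2: "P \<subseteq> (\<lambda>z. e i (z None) (\<theta> (z \<circ> Some))) ` ctimes_pos (tpos S)"
    proof
      fix p assume p: "p \<in> P"
      then obtain t where t: "t \<in> tpos S" "\<theta> t = p" using pre by blast
      show "p \<in> (\<lambda>z. e i (z None) (\<theta> (z \<circ> Some))) ` ctimes_pos (tpos S)"
        by (rule image_eqI[of _ _ "case_option 1 t"]) (use t one[OF i p] in \<open>simp_all add: mem_ctimes_pos\<close>)
    qed
    have gen: "generically (ctimes ?T) (\<lambda>z. ?F z = E z)"
      using generically_conj[OF TT generically_comp[OF TT Z mp s1 eq[OF i]] generically_comp[OF TT X me s2 inv(2)]]
      by (rule generically_mono) (elim conjE, simp only: uncurry1_case_option, simp add: uncurry1_def E_def)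
    then have "rational_map (ctimes ?T) ?T ?F" by (rule mor_rational_map[OF TT mE])
    moreover have "positive_fun ?S (\<lambda>x. torus_char S \<nu> (?F x))" for \<nu>
    proof (rule positive_fun_generic[OF fin positive_funI[OF fin]])
      have "torus_char S \<nu> x \<noteq> 0" if "x \<in> tpos S" for x
        using tpos_cpos[OF that] cpos_nonzero S by (simp add: torus_char_def power_int_eq_0_iff)
      have nz: "E z s \<noteq> 0" if "z \<in> ctimes_pos (tpos S)" for z s
        using tpos_cpos[OF mor_pos[OF mE that]] cpos_nonzero by blast
      have "scal (ctimes ?T) (ctimes_pos (tpos S)) (\<lambda>z. torus_char S \<nu> (E z))"
        unfolding torus_char_def by (intro scal_prod scal_powi TT mor_scal[OF mE] nz)
      then show "scal (torus ?S) (tpos ?S) (\<lambda>z. torus_char S \<nu> (E z))"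
        by (simp add: ctimes_torus ctimes_tpos)
      show "subtraction_free ?S (\<lambda>z. torus_char S \<nu> (E z))"
        unfolding E_def by (intro sf_torus_char es i)
      show "generically (torus ?S) (\<lambda>x. torus_char S \<nu> (?F x) = torus_char S \<nu> (E x))"
        using gen unfolding ctimes_torus by (rule generically_mono) simp
    qed
    ultimately show ?thesis unfolding positive_map_def ctimes_torus by blast
  qed
  moreover have "positive_fun S (\<gamma> i \<circ> \<theta>)" "positive_fun S (\<epsilon> i \<circ> \<theta>)" if "i \<in> J" for i
    using positive_funI[OF S _ \<gamma>s[OF that]] positive_funI[OF S _ \<epsilon>s[OF that]]
      scal_comp[OF T \<theta> \<gamma>[OF that]] scal_comp[OF T \<theta> \<epsilon>[OF that]] by (simp_all add: comp_def)
  moreover have "birational ?T X \<theta>" using inv(1) unfolding birational_def by blast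
  ultimately show ?thesis unfolding positive_structure_def using S by blast
qed

section \<open>Elementary operators on functions of sets\<close>

text \<open>The operator \<open>y(1/c) \<alpha>^vee(c)\<close> for the root that moves the entry
  \<open>s\<close> to \<open>t\<close>, written coefficientwise. Arbitrary pairs are allowed because
  index 0 is the pair \<open>(n + 1, 1)\<close>, and the exchange of the charts produces pairs
  \<open>(n + 1, a)\<close>.\<close>

definition Ypair :: "int \<Rightarrow> int \<Rightarrow> complex \<Rightarrow> (int set \<Rightarrow> complex) \<Rightarrow> (int set \<Rightarrow> complex)" where
  "Ypair s t c v = (\<lambda>J. if s \<in> J \<and> t \<notin> J then c * v J
     else if t \<in> J \<and> s \<notin> J then v J / c + v (insert s (J - {t})) else v J)"

text \<open>The opposite one-parameter subgroup \<open>exp(a E)\<close>, where \<open>E\<close>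
  moves \<open>t\<close> to \<open>s\<close>; since \<open>E\<close> has square zero, it is
  \<open>1 + a E\<close>.\<close>

definition Xpair :: "int \<Rightarrow> int \<Rightarrow> complex \<Rightarrow> (int set \<Rightarrow> complex) \<Rightarrow> (int set \<Rightarrow> complex)" where
  "Xpair s t a v = (\<lambda>J. v J + (if s \<in> J \<and> t \<notin> J then a * v (insert t (J - {s})) else 0))"

lemma cases_insert:
  obtains R where "s \<notin> R" "J = R \<or> J = insert s R"
  by (cases "s \<in> J") (metis mk_disjoint_insert, blast)

text \<open>The operator identities below depend only on which of two, three or four named entries
  lie in \<open>J\<close>, so each of them is a finite check over the remaining part
  \<open>R\<close>.\<close>

lemma cases_insert2:
  obtains R where "s \<notin> R" "t \<notin> R" "J = R \<or> J = insert s R \<or> J = insert t R \<or> J = insert s (insert t R)"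
proof -
  obtain R where R: "s \<notin> R" "J = R \<or> J = insert s R" by (rule cases_insert)
  obtain T where T: "t \<notin> T" "R = T \<or> R = insert t T" by (rule cases_insert)
  from R T show ?thesis
    by (intro that[of T]; simp?; elim disjE; simp)
qed

lemma cases_insert3:
  obtains R where "s \<notin> R" "t \<notin> R" "u \<notin> R"
    "J = R \<or> J = insert s R \<or> J = insert t R \<or> J = insert u R \<or> J = insert s (insert t R) \<or>
     J = insert s (insert u R) \<or> J = insert t (insert u R) \<or> J = insert s (insert t (insert u R))"
proof -
  obtain R where R: "s \<notin> R" "t \<notin> R" "J = R \<or> J = insert s R \<or> J = insert t R \<or> J = insert s (insert t R)"
    by (rule cases_insert2)
  obtain T where T: "u \<notin> T" "R = T \<or> R = insert u T" by (rule cases_insert)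
  from R T show ?thesis
    by (intro that[of T]; simp?; elim disjE; simp)
qed

lemmas pair_simps = Ypair_def Xpair_def insert_Diff_if insert_commute

lemma Xpair_Ypair_same:
  assumes "s \<noteq> t" "c \<noteq> 0" "c + a \<noteq> 0"
  shows "Xpair s t a (Ypair s t c v) = Ypair s t (c + a) (Xpair s t (a / (c * (c + a))) v)"
proof
  fix J
  obtain R where "s \<notin> R" "t \<notin> R" "J = R \<or> J = insert s R \<or> J = insert t R \<or> J = insert s (insert t R)"
    by (rule cases_insert2)
  then show "Xpair s t a (Ypair s t c v) J = Ypair s t (c + a) (Xpair s t (a / (c * (c + a))) v) J"
    using assms by (elim disjE; simp add: pair_simps; (simp add: divide_simps)?; (simp add: algebra_simps)?)
qed

text \<open>Raising for one simple root commutes with lowering for another, so only the torus part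
  of \<open>Ypair\<close> acts, and it rescales the parameter.\<close>

lemma Xpair_Ypair_right:
  assumes "s \<noteq> t" "t \<noteq> u" "s \<noteq> u" "c \<noteq> 0"
  shows "Xpair s t a (Ypair t u c v) = Ypair t u c (Xpair s t (c * a) v)"
proof
  fix J
  obtain R where "s \<notin> R" "t \<notin> R" "u \<notin> R"
    "J = R \<or> J = insert s R \<or> J = insert t R \<or> J = insert u R \<or> J = insert s (insert t R) \<or>
     J = insert s (insert u R) \<or> J = insert t (insert u R) \<or> J = insert s (insert t (insert u R))"
    by (rule cases_insert3)
  then show "Xpair s t a (Ypair t u c v) J = Ypair t u c (Xpair s t (c * a) v) J"
    using assms by (elim disjE; simp add: pair_simps; (simp add: divide_simps)?; (simp add: algebra_simps)?)
qed

lemma Xpair_Ypair_left: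
  assumes "s \<noteq> t" "t \<noteq> u" "s \<noteq> u" "c \<noteq> 0"
  shows "Xpair t u a (Ypair s t c v) = Ypair s t c (Xpair t u (c * a) v)"
proof
  fix J
  obtain R where "s \<notin> R" "t \<notin> R" "u \<notin> R"
    "J = R \<or> J = insert s R \<or> J = insert t R \<or> J = insert u R \<or> J = insert s (insert t R) \<or>
     J = insert s (insert u R) \<or> J = insert t (insert u R) \<or> J = insert s (insert t (insert u R))"
    by (rule cases_insert3)
  then show "Xpair t u a (Ypair s t c v) J = Ypair s t c (Xpair t u (c * a) v) J"
    using assms by (elim disjE; simp add: pair_simps; (simp add: divide_simps)?; (simp add: algebra_simps)?)
qed

lemma cases_insert4:
  obtains R A B where "s \<notin> R" "t \<notin> R" "u \<notin> R" "w \<notin> R" "J = A \<union> B \<union> R"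
    "A = {} \<or> A = {s} \<or> A = {t} \<or> A = {s, t}" "B = {} \<or> B = {u} \<or> B = {w} \<or> B = {u, w}"
proof -
  obtain R where R: "s \<notin> R" "t \<notin> R" "J = R \<or> J = insert s R \<or> J = insert t R \<or> J = insert s (insert t R)"
    by (rule cases_insert2)
  obtain T where T: "u \<notin> T" "w \<notin> T" "R = T \<or> R = insert u T \<or> R = insert w T \<or> R = insert u (insert w T)"
    by (rule cases_insert2)
  obtain A where A: "A = {} \<or> A = {s} \<or> A = {t} \<or> A = {s, t}" "J = A \<union> R"
    using R(3) by (metis Un_empty_left Un_insert_left)
  obtain B where B: "B = {} \<or> B = {u} \<or> B = {w} \<or> B = {u, w}" "R = B \<union> T"
    using T(3) by (metis Un_empty_left Un_insert_left)
  have "s \<notin> T" "t \<notin> T" using R(1,2) B(2) by auto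
  then show ?thesis using A B T(1,2) by (intro that[of T A B]) (simp_all add: Un_assoc)
qed

lemma Xpair_Ypair_disjoint:
  assumes "s \<noteq> t" "u \<noteq> w" "s \<noteq> u" "s \<noteq> w" "t \<noteq> u" "t \<noteq> w"
  shows "Xpair s t a (Ypair u w c v) = Ypair u w c (Xpair s t a v)"
proof
  fix J
  obtain R A B where "s \<notin> R" "t \<notin> R" "u \<notin> R" "w \<notin> R" "J = A \<union> B \<union> R"
    "A = {} \<or> A = {s} \<or> A = {t} \<or> A = {s, t}" "B = {} \<or> B = {u} \<or> B = {w} \<or> B = {u, w}"
    by (rule cases_insert4)
  then show "Xpair s t a (Ypair u w c v) J = Ypair u w c (Xpair s t a v) J"
    using assms by (elim disjE; simp add: pair_simps; (simp add: algebra_simps add_divide_distrib)?)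
qed

lemma Ypair_disjoint:
  assumes "s \<noteq> t" "u \<noteq> w" "s \<noteq> u" "s \<noteq> w" "t \<noteq> u" "t \<noteq> w"
  shows "Ypair s t c (Ypair u w d v) = Ypair u w d (Ypair s t c v)"
proof
  fix J
  obtain R A B where "s \<notin> R" "t \<notin> R" "u \<notin> R" "w \<notin> R" "J = A \<union> B \<union> R"
    "A = {} \<or> A = {s} \<or> A = {t} \<or> A = {s, t}" "B = {} \<or> B = {u} \<or> B = {w} \<or> B = {u, w}"
    by (rule cases_insert4)
  then show "Ypair s t c (Ypair u w d v) J = Ypair u w d (Ypair s t c v) J"
    using assms by (elim disjE; simp add: pair_simps; (simp add: algebra_simps add_divide_distrib)?)
qed

lemma Xpair_disjoint:
  assumes "s \<noteq> t" "u \<noteq> w" "s \<noteq> u" "s \<noteq> w" "t \<noteq> u" "t \<noteq> w"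
  shows "Xpair s t a (Xpair u w b v) = Xpair u w b (Xpair s t a v)"
proof
  fix J
  obtain R A B where "s \<notin> R" "t \<notin> R" "u \<notin> R" "w \<notin> R" "J = A \<union> B \<union> R"
    "A = {} \<or> A = {s} \<or> A = {t} \<or> A = {s, t}" "B = {} \<or> B = {u} \<or> B = {w} \<or> B = {u, w}"
    by (rule cases_insert4)
  then show "Xpair s t a (Xpair u w b v) J = Xpair u w b (Xpair s t a v) J"
    using assms by (elim disjE; simp add: pair_simps; (simp add: algebra_simps)?)
qed

lemma Xpair_add:
  assumes "s \<noteq> t"
  shows "Xpair s t a (Xpair s t b v) = Xpair s t (a + b) v"
proof
  fix J
  obtain R where "s \<notin> R" "t \<notin> R" "J = R \<or> J = insert s R \<or> J = insert t R \<or> J = insert s (insert t R)"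
    by (rule cases_insert2)
  then show "Xpair s t a (Xpair s t b v) J = Xpair s t (a + b) v J"
    using assms by (elim disjE; simp add: pair_simps; (simp add: algebra_simps)?)
qed

lemma Ypair_braid:
  assumes "s \<noteq> t" "t \<noteq> u" "s \<noteq> u" "c1 \<noteq> 0" "c2 \<noteq> 0" "c3 \<noteq> 0" "c2 + c1 * c3 \<noteq> 0"
  shows "Ypair t u c1 (Ypair s t c2 (Ypair t u c3 v)) =
         Ypair s t (c2 / c1 + c3) (Ypair t u (c1 * c3) (Ypair s t (c1 * c2 / (c2 + c1 * c3)) v))"
proof
  fix J
  have nz: "c2 / c1 + c3 \<noteq> 0" using assms by (simp add: field_simps)
  obtain R where "s \<notin> R" "t \<notin> R" "u \<notin> R"
    "J = R \<or> J = insert s R \<or> J = insert t R \<or> J = insert u R \<or> J = insert s (insert t R) \<or>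
     J = insert s (insert u R) \<or> J = insert t (insert u R) \<or> J = insert s (insert t (insert u R))"
    by (rule cases_insert3)
  then show "Ypair t u c1 (Ypair s t c2 (Ypair t u c3 v)) J =
         Ypair s t (c2 / c1 + c3) (Ypair t u (c1 * c3) (Ypair s t (c1 * c2 / (c2 + c1 * c3)) v)) J"
    using assms nz by (elim disjE; simp add: pair_simps; (simp add: divide_simps)?; (simp add: algebra_simps)?)
qed

text \<open>In unitriangular three by three matrices, with order \<open>s, t, u\<close>, the
  hypotheses compare the entries \<open>(1,2)\<close>, \<open>(2,3)\<close> and
  \<open>(1,3)\<close>.\<close>

lemma Xpair_braid:
  assumes "s \<noteq> t" "t \<noteq> u" "s \<noteq> u" "d1 + d3 = g2" "g1 + g3 = d2" "d1 * d2 = g2 * g3"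
  shows "Xpair s t d1 (Xpair t u d2 (Xpair s t d3 v)) = Xpair t u g1 (Xpair s t g2 (Xpair t u g3 v))"
proof
  fix J
  \<comment> \<open>The fourth equation follows from the others; it is the one that appears on the
    exterior square, that is, for sets with two of the three entries.\<close>
  have a: "d1 = g2 - d3" "g1 = d2 - g3" "d1 * d2 = g2 * g3" "d2 * d3 = g1 * g2"
    using assms(4-6) by (auto simp: algebra_simps)
  obtain R where "s \<notin> R" "t \<notin> R" "u \<notin> R"
    "J = R \<or> J = insert s R \<or> J = insert t R \<or> J = insert u R \<or> J = insert s (insert t R) \<or>
     J = insert s (insert u R) \<or> J = insert t (insert u R) \<or> J = insert s (insert t (insert u R))"
    by (rule cases_insert3)
  then show "Xpair s t d1 (Xpair t u d2 (Xpair s t d3 v)) J = Xpair t u g1 (Xpair s t g2 (Xpair t u g3 v)) J"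
    using assms(1-3)
    by (elim disjE; simp add: pair_simps; (use a(3,4) in \<open>simp add: algebra_simps flip: assms(4,5)\<close>)?)
qed

text \<open>A lift of the relation \<open>(t u)(s u) = (s t)(t u)\<close> between transpositions.
  The support condition matters: on a vector concentrated at the entry \<open>s\<close> alone, the
  left side reaches \<open>u\<close> and the right side reaches \<open>t\<close>.\<close>

lemma Ypair_boundary:
  assumes "s \<noteq> t" "t \<noteq> u" "s \<noteq> u" "c1 \<noteq> 0" "c2 \<noteq> 0" and supp: "\<And>J. t \<notin> J \<Longrightarrow> v J = 0"
  shows "Ypair t u c1 (Ypair s u c2 v) = Ypair s t c2 (Ypair t u (c1 * c2) v)"
proof
  fix J
  obtain R where "s \<notin> R" "t \<notin> R" "u \<notin> R"
    "J = R \<or> J = insert s R \<or> J = insert t R \<or> J = insert u R \<or> J = insert s (insert t R) \<or>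
     J = insert s (insert u R) \<or> J = insert t (insert u R) \<or> J = insert s (insert t (insert u R))"
    by (rule cases_insert3)
  then show "Ypair t u c1 (Ypair s u c2 v) J = Ypair s t c2 (Ypair t u (c1 * c2) v) J"
    using assms by (elim disjE; simp add: pair_simps; (simp add: divide_simps)?)
qed

lemma Ypair_scale: "Ypair s t c (\<lambda>J. r * v J) = (\<lambda>J. r * Ypair s t c v J)"
  by (auto simp: Ypair_def fun_eq_iff algebra_simps)

lemma Xpair_scale: "Xpair s t c (\<lambda>J. r * v J) = (\<lambda>J. r * Xpair s t c v J)"
  by (auto simp: Xpair_def fun_eq_iff algebra_simps)

lemma Ypair_rotate:
  assumes "inj \<rho>"
  shows "Ypair s t c (\<lambda>J. p (\<rho> ` J)) = (\<lambda>J. Ypair (\<rho> s) (\<rho> t) c p (\<rho> ` J))"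
  using assms by (auto simp: Ypair_def fun_eq_iff image_set_diff inj_image_mem_iff)

lemma Xpair_rotate:
  assumes "inj \<rho>"
  shows "Xpair s t c (\<lambda>J. p (\<rho> ` J)) = (\<lambda>J. Xpair (\<rho> s) (\<rho> t) c p (\<rho> ` J))"
  using assms by (auto simp: Xpair_def fun_eq_iff image_set_diff inj_image_mem_iff)

definition in_module :: "int \<Rightarrow> int \<Rightarrow> (int set \<Rightarrow> complex) \<Rightarrow> bool" where
  "in_module n k v \<longleftrightarrow> (\<forall>J. J \<notin> basisW n k \<longrightarrow> v J = 0)"

lemma exchange_basisW:
  assumes "J \<in> basisW n k" "t \<in> J" "s \<notin> J" "s \<in> {1..n + 1}"
  shows "insert s (J - {t}) \<in> basisW n k"
proof -
  have J: "J \<subseteq> {1..n + 1}" "card J = nat k" using assms(1) by (auto simp: basisW_def)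
  have fin: "finite J" by (rule finite_subset[OF J(1)]) simp
  have "card J > 0" using fin assms(2) by (auto simp: card_gt_0_iff)
  then have "card (insert s (J - {t})) = card J" using fin assms(2,3) by simp
  then show ?thesis using J assms(4) by (auto simp: basisW_def)
qed

lemma in_module_Ypair:
  assumes v: "in_module n k v" and "s \<in> {1..n + 1}" "t \<in> {1..n + 1}" "s \<noteq> t"
  shows "in_module n k (Ypair s t c v)"
  unfolding in_module_def
proof (intro allI impI)
  fix J assume J: "J \<notin> basisW n k"
  then have "v J = 0" using v by (simp add: in_module_def)
  moreover have "v (insert s (J - {t})) = 0" if "t \<in> J" "s \<notin> J"
  proof (rule ccontr)
    assume "v (insert s (J - {t})) \<noteq> 0"
    then have "insert s (J - {t}) \<in> basisW n k" using v by (auto simp: in_module_def)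
    then have "insert t (insert s (J - {t}) - {s}) \<in> basisW n k"
      using that assms(3,4) by (intro exchange_basisW[where t = s and s = t]) auto
    moreover have "insert t (insert s (J - {t}) - {s}) = J" using that by auto
    ultimately show False using J by simp
  qed
  ultimately show "Ypair s t c v J = 0" by (simp add: Ypair_def)
qed

lemma src_ne: "1 \<le> n \<Longrightarrow> src n i \<noteq> i + 1"
  by (auto simp: src_def)

lemma Y_op_eq:
  assumes v: "in_module n k v" and n: "1 \<le> n" and i: "0 \<le> i" "i \<le> n"
  shows "Y_op n k i c v = (if c = 0 then Y_op n k i c v else Ypair (src n i) (i + 1) c v)"
proof (cases "c = 0")
  case False
  let ?s = "src n i" and ?t = "i + 1"
  have ne: "?s \<noteq> ?t" by (rule src_ne[OF n])
  have "Y_op n k i c v J = Ypair ?s ?t c v J" for J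
  proof -
    let ?J' = "insert ?s (J - {?t})"
    \<comment> \<open>A lowering step is injective where it is defined, so the sum in
      \<open>f_op\<close> has at most one term.\<close>
    have "{J'. J' \<in> basisW n k \<and> f_basis n i J' = Some J} =
        (if ?t \<in> J \<and> ?s \<notin> J \<and> ?J' \<in> basisW n k then {?J'} else {})"
      using ne by (auto simp: f_basis_def insert_absorb)
    then have f: "f_op n k i w J = (if ?t \<in> J \<and> ?s \<notin> J \<and> ?J' \<in> basisW n k then w ?J' else 0)" for w
      by (simp add: f_op_def)
    have "v ?J' = 0" if "?J' \<notin> basisW n k" using v that by (simp add: in_module_def)
    then show ?thesis
      using ne False by (auto simp: Y_op_def y_op_def f alpha_op_def Ypair_def field_simps)
  qed
  with False show ?thesis by auto
qed simp

section \<open>Chains\<close>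

text \<open>One factor \<open>P_l\<close> of the product: the largest index stands leftmost and is
  applied last.\<close>

definition chain :: "(int \<Rightarrow> complex) \<Rightarrow> int \<Rightarrow> int \<Rightarrow> (int set \<Rightarrow> complex) \<Rightarrow> (int set \<Rightarrow> complex)" where
  "chain z a b = fold (\<lambda>m. Ypair m (m + 1) (z m)) [a..b]"

lemma chain_empty [simp]: "b < a \<Longrightarrow> chain z a b v = v"
  by (simp add: chain_def)

lemma chain_last: "a \<le> b \<Longrightarrow> chain z a b v = Ypair b (b + 1) (z b) (chain z a (b - 1) v)"
  by (simp add: chain_def upto_rec2)

lemma chain_first: "a \<le> b \<Longrightarrow> chain z a b v = chain z (a + 1) b (Ypair a (a + 1) (z a) v)"
  by (simp add: chain_def upto_rec1)

text \<open>Induction on the upper end that starts from the empty interval, where a chain is the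
  identity.\<close>

lemma int_upto_induct [consumes 1, case_names base step]:
  fixes a b :: int
  assumes "a - 1 \<le> b" "P (a - 1)" "\<And>b. a \<le> b \<Longrightarrow> P (b - 1) \<Longrightarrow> P b"
  shows "P b"
  using assms(1)
proof (induction b rule: int_ge_induct)
  case (step i)
  then show ?case using assms(3)[of "i + 1"] by simp
qed (rule assms(2))

lemma chain_cong:
  assumes "\<And>m. a \<le> m \<Longrightarrow> m \<le> b \<Longrightarrow> z m = z' m"
  shows "chain z a b v = chain z' a b v"
proof (cases "a - 1 \<le> b")
  case True
  then show ?thesis using assms by (induction b rule: int_upto_induct) (simp_all add: chain_last)
qed simp

lemma chain_scale: "chain z a b (\<lambda>J. r * v J) = (\<lambda>J. r * chain z a b v J)"
proof (cases "a - 1 \<le> b")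
  case True
  then show ?thesis
    by (induction b rule: int_upto_induct) (simp_all add: chain_last Ypair_scale)
qed simp

lemma in_module_chain:
  assumes "in_module n k v" "1 \<le> a" "b \<le> n"
  shows "in_module n k (chain z a b v)"
proof (cases "a - 1 \<le> b")
  case True
  then show ?thesis using assms(3)
    by (induction b rule: int_upto_induct) (use assms(1,2) in \<open>auto simp: chain_last intro!: in_module_Ypair\<close>)
qed (use assms in simp)

lemma chain_support:
  assumes v: "\<And>J. \<not> S \<subseteq> J \<Longrightarrow> v J = 0" and S: "\<And>m. m \<in> S \<Longrightarrow> m < a" and J: "\<not> S \<subseteq> J"
  shows "chain z a b v J = 0"
proof (cases "a - 1 \<le> b")
  case True
  have "\<forall>J. \<not> S \<subseteq> J \<longrightarrow> chain z a b v J = 0" using True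
  proof (induction b rule: int_upto_induct)
    case (step b)
    have "\<not> S \<subseteq> insert b (J - {b + 1})" if "\<not> S \<subseteq> J" for J
      using that S step.hyps by fastforce
    with step show ?case by (simp add: chain_last Ypair_def)
  qed (use v in simp)
  with J show ?thesis by blast
qed (use v J in simp)

lemma Ypair_chain_commute:
  assumes "\<And>m. a \<le> m \<Longrightarrow> m \<le> b \<Longrightarrow> s \<noteq> m \<and> s \<noteq> m + 1 \<and> t \<noteq> m \<and> t \<noteq> m + 1" and "s \<noteq> t"
  shows "Ypair s t c (chain z a b v) = chain z a b (Ypair s t c v)"
proof (cases "a - 1 \<le> b")
  case True
  then show ?thesis using assms(1)
  proof (induction b rule: int_upto_induct)
    case (step b)
    have "Ypair s t c (chain z a (b - 1) v) = chain z a (b - 1) (Ypair s t c v)"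
      by (rule step.IH) (use step.prems in auto)
    then show ?case using step.hyps step.prems[of b] assms(2) by (simp add: chain_last Ypair_disjoint)
  qed simp
qed simp

lemma chain_coeff_zero:
  assumes v: "\<And>J. a \<notin> J \<Longrightarrow> v J = 0" and "a - 1 \<le> t" "\<And>j. a \<le> j \<Longrightarrow> j \<le> t + 1 \<Longrightarrow> j \<notin> J"
  shows "chain z a t v J = 0"
  using assms(2,3)
proof (induction t rule: int_upto_induct)
  case (step t)
  have "t \<notin> J" "t + 1 \<notin> J" using step.prems step.hyps by auto
  then show ?case using step by (simp add: chain_last Ypair_def)
qed (use v in auto)

text \<open>The only contribution comes from carrying the entry \<open>a\<close> through the whole
  chain, and each single move has coefficient 1.\<close>

lemma chain_coeff_one:
  assumes v: "\<And>J. a \<notin> J \<Longrightarrow> v J = 0" and "a - 1 \<le> t" "\<And>j. a \<le> j \<Longrightarrow> j \<le> t + 1 \<Longrightarrow> j \<notin> R"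
  shows "chain z a t v (insert (t + 1) R) = v (insert a R)"
  using assms(2,3)
proof (induction t rule: int_upto_induct)
  case (step t)
  have R: "t \<notin> R" "t + 1 \<notin> R" using step.prems step.hyps by auto
  have "chain z a (t - 1) v (insert (t + 1) R) = 0"
    by (rule chain_coeff_zero[OF v]) (use step in auto)
  moreover have "chain z a (t - 1) v (insert t R) = v (insert a R)"
    using step.IH step.prems by simp
  moreover have "insert t (insert (t + 1) R - {t + 1}) = insert t R" using R by auto
  ultimately show ?case using R step.hyps by (simp add: chain_last Ypair_def)
qed simp

text \<open>The entry \<open>a\<close> is carried up to \<open>s\<close>, completing the block. The
  torus parts act trivially on the block except at its upper end, where \<open>i\<close> is present
  and \<open>i + 1\<close> is not; this happens only if the chain gets as far as
  \<open>i\<close>.\<close>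

lemma chain_coeff_interval:
  assumes v: "\<And>J. a \<notin> J \<Longrightarrow> v J = 0" and s: "a \<le> s" "s \<le> i" and "s - 1 \<le> t"
    and "\<And>j. a \<le> j \<Longrightarrow> j \<le> max (t + 1) i \<Longrightarrow> j \<notin> R"
  shows "chain z a t v ({s..i} \<union> R) = (if i \<le> t then z i else 1) * v (insert a ({s + 1..i} \<union> R))"
  using assms(4,5)
proof (induction t rule: int_upto_induct)
  case base
  have "{s..i} \<union> R = insert (s - 1 + 1) ({s + 1..i} \<union> R)" using s by auto
  then show ?case
    using chain_coeff_one[where t = "s - 1" and R = "{s + 1..i} \<union> R" and z = z and a = a, OF v] s base by auto
next
  case (step t)
  let ?J = "{s..i} \<union> R"
  have IH: "chain z a (t - 1) v ?J = (if i \<le> t - 1 then z i else 1) * v (insert a ({s + 1..i} \<union> R))"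
    by (rule step.IH) (use step.prems in auto)
  have R: "t \<notin> R" "t + 1 \<notin> R" using step s by auto
  consider "t < i" | "t = i" | "i < t" by linarith
  then show ?case
  proof cases
    case 1
    then have "t \<in> ?J" "t + 1 \<in> ?J" using step.hyps by auto
    then show ?thesis using 1 IH step.hyps s by (simp add: chain_last Ypair_def)
  next
    case 2
    then have "t \<in> ?J" "t + 1 \<notin> ?J" using step.hyps R by auto
    then show ?thesis using 2 IH step.hyps s by (simp add: chain_last Ypair_def)
  next
    case 3
    then have "t \<notin> ?J" "t + 1 \<notin> ?J" using R by auto
    then show ?thesis using 3 IH step.hyps s by (simp add: chain_last Ypair_def)
  qed
qed

lemma Xpair_chain_out:
  assumes "b < i - 1"
  shows "Xpair i (i + 1) \<alpha> (chain z a b v) = chain z a b (Xpair i (i + 1) \<alpha> v)"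
proof (cases "a - 1 \<le> b")
  case True
  then show ?thesis using assms
    by (induction b rule: int_upto_induct) (simp_all add: chain_last Xpair_Ypair_disjoint)
qed simp

text \<open>Moving the raising operator through the chain, the factors with index
  \<open>i + 1\<close> and \<open>i - 1\<close> rescale its parameter, the factor with index
  \<open>i\<close> changes by the rank one identity, and all others commute. \<open>Z\<close>
  continues \<open>z\<close> by \<open>1\<close>, so that a missing neighbour does not need a
  separate formula.\<close>

lemma Xpair_chain:
  assumes "a - 1 \<le> b" and nz: "\<And>m. a \<le> m \<Longrightarrow> m \<le> b \<Longrightarrow> z m \<noteq> 0"
    and Z: "Z = (\<lambda>m. if a \<le> m \<and> m \<le> b then z m else 1)"
    and "a \<le> i \<Longrightarrow> i \<le> b \<Longrightarrow> z i + \<alpha> * Z (i + 1) \<noteq> 0"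
  shows "Xpair i (i + 1) \<alpha> (chain z a b v) =
    chain (z(i := z i + \<alpha> * Z (i + 1))) a b
      (Xpair i (i + 1) (if a \<le> i \<and> i \<le> b then \<alpha> * Z (i + 1) * Z (i - 1) / (z i * (z i + \<alpha> * Z (i + 1)))
         else \<alpha> * Z (i + 1) * Z (i - 1)) v)"
  using assms
proof (induction b arbitrary: \<alpha> Z rule: int_upto_induct)
  case base
  show ?case unfolding base by auto
next
  case (step b)
  let ?Z' = "\<lambda>m. if a \<le> m \<and> m \<le> b - 1 then z m else 1"
  let ?X = "Xpair i (i + 1)"
  have nz': "z m \<noteq> 0" if "a \<le> m" "m \<le> b - 1" for m using step.prems(1) that by simp
  have zb: "z b \<noteq> 0" using step.prems(1) step.hyps by simp
  note IH = step.IH[OF nz' refl]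
  consider "b > i + 1" | "b = i + 1" | "b = i" | "b = i - 1" | "b < i - 1" by linarith
  then show ?case
  proof cases
    case 1
    have "?X \<alpha> (chain z a b v) = Ypair b (b + 1) (z b) (?X \<alpha> (chain z a (b - 1) v))"
      using 1 step.hyps by (simp add: chain_last Xpair_Ypair_disjoint)
    then show ?thesis
      using 1 step.hyps step.prems(3) IH[of \<alpha>] unfolding step.prems(2) by (simp add: chain_last)
  next
    case 2
    have "?X \<alpha> (chain z a b v) = Ypair b (b + 1) (z b) (?X (z b * \<alpha>) (chain z a (b - 1) v))"
      using 2 step.hyps zb by (simp add: chain_last Xpair_Ypair_right)
    then show ?thesis
      using 2 step.hyps step.prems(3) IH[of "z b * \<alpha>"] unfolding step.prems(2)
      by (simp add: chain_last mult.commute)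
  next
    case 3
    have ne: "z i + \<alpha> \<noteq> 0" using 3 step.hyps step.prems(3) unfolding step.prems(2) by simp
    let ?\<alpha> = "\<alpha> / (z i * (z i + \<alpha>))"
    have "?X \<alpha> (chain z a b v) = Ypair i (i + 1) (z i + \<alpha>) (?X ?\<alpha> (chain z a (i - 1) v))"
      using 3 step.hyps zb ne by (simp add: chain_last Xpair_Ypair_same)
    also have "?X ?\<alpha> (chain z a (i - 1) v) = chain (z(i := z i + ?\<alpha>)) a (i - 1) (?X (?\<alpha> * ?Z' (i - 1)) v)"
      using 3 IH[of ?\<alpha>] by (simp add: fun_upd_def)
    also have "\<dots> = chain (z(i := z i + \<alpha>)) a (i - 1) (?X (?\<alpha> * ?Z' (i - 1)) v)"
      by (rule chain_cong) auto
    finally show ?thesis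
      using 3 step.hyps unfolding step.prems(2) by (simp add: chain_last[of a i] fun_upd_def)
  next
    case 4
    have "?X \<alpha> (chain z a b v) = Ypair b (b + 1) (z b) (?X (\<alpha> * z b) (chain z a (b - 1) v))"
      using 4 step.hyps zb Xpair_Ypair_left[of b i "i + 1" "z b" \<alpha>] by (simp add: chain_last mult.commute)
    also have "?X (\<alpha> * z b) (chain z a (b - 1) v) = chain z a (b - 1) (?X (\<alpha> * z b) v)"
      by (rule Xpair_chain_out) (use 4 in simp)
    also have "Ypair b (b + 1) (z b) (chain z a (b - 1) (?X (\<alpha> * z b) v)) = chain z a b (?X (\<alpha> * z b) v)"
      using step.hyps by (simp only: chain_last)
    also have "\<dots> = chain (z(i := z i + \<alpha> * Z (i + 1))) a b (?X (\<alpha> * z b) v)"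
      by (rule chain_cong) (use 4 in auto)
    finally show ?thesis using 4 step.hyps unfolding step.prems(2) by (simp add: fun_upd_def)
  next
    case 5
    have "?X \<alpha> (chain z a b v) = chain z a b (?X \<alpha> v)"
      by (rule Xpair_chain_out) (use 5 in simp)
    also have "\<dots> = chain (z(i := z i + \<alpha> * Z (i + 1))) a b (?X \<alpha> v)"
      by (rule chain_cong) (use 5 in auto)
    finally show ?thesis using 5 step.hyps unfolding step.prems(2) by (simp add: fun_upd_def)
  qed
qed

lemma sum_last_int: "(a::int) \<le> b \<Longrightarrow> sum f {a..b} = sum f {a..b - 1} + f b"
proof -
  assume "a \<le> b"
  then have "{a..b} = insert b {a..b - 1}" by auto
  then show ?thesis by (simp add: ac_simps)
qed

lemma prod_first_int: "(a::int) \<le> b \<Longrightarrow> prod f {a..b} = f a * prod f {a + 1..b}"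
proof -
  assume "a \<le> b"
  then have "{a..b} = insert a {a + 1..b}" by auto
  then show ?thesis by simp
qed

lemma prod_last_int: "(a::int) \<le> b \<Longrightarrow> prod f {a..b} = prod f {a..b - 1} * f b"
proof -
  assume "a \<le> b"
  then have "{a..b} = insert b {a..b - 1}" by auto
  then show ?thesis by (simp add: ac_simps)
qed

lemma fold_Y_op:
  assumes v: "in_module n k v" and n: "1 \<le> n" and a: "1 \<le> a" "b \<le> n"
    and z: "\<And>m. a \<le> m \<Longrightarrow> m \<le> b \<Longrightarrow> z m \<noteq> 0"
  shows "fold (\<lambda>m. Y_op n k m (z m)) [a..b] v = chain z a b v"
proof (cases "a - 1 \<le> b")
  case True
  then show ?thesis using a z
  proof (induction b rule: int_upto_induct)
    case (step b)
    have "in_module n k (chain z a (b - 1) v)" by (rule in_module_chain[OF v]) (use step in auto)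
    then have "Y_op n k b (z b) (chain z a (b - 1) v) = Ypair b (b + 1) (z b) (chain z a (b - 1) v)"
      using Y_op_eq[OF _ n, of k "chain z a (b - 1) v" b "z b"] step by (simp add: src_def)
    with step show ?case by (simp add: upto_rec2 chain_last)
  qed simp
qed simp

section \<open>Coefficients of v1 at intervals and cyclic intervals\<close>

definition level :: "int \<Rightarrow> int \<Rightarrow> (int \<times> int \<Rightarrow> complex) \<Rightarrow> int \<Rightarrow> (int set \<Rightarrow> complex)" where
  "level n k x j = fold (\<lambda>l. chain (\<lambda>m. x (l, m)) (k - l + 1) (n + 1 - l)) [1..j] (basis_vec {1..k})"

lemma level_zero [simp]: "j \<le> 0 \<Longrightarrow> level n k x j = basis_vec {1..k}"
  by (simp add: level_def)

lemma level_step: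
  "1 \<le> j \<Longrightarrow> level n k x j = chain (\<lambda>m. x (j, m)) (k - j + 1) (n + 1 - j) (level n k x (j - 1))"
  by (simp add: level_def upto_rec2)

locale grassmann =
  fixes n k :: int
  assumes n2: "2 \<le> n" and k1: "1 \<le> k" and kn: "k \<le> n"
begin

lemma torusD:
  assumes "x \<in> torus (S1 n k)"
  shows "x s \<noteq> 0" "s \<notin> S1 n k \<Longrightarrow> x s = 1"
proof -
  have x: "\<forall>s\<in>S1 n k. x s \<noteq> 0" "\<forall>s. s \<notin> S1 n k \<longrightarrow> x s = 1"
    using assms by (simp_all add: torus_def)
  show "x s = 1" if "s \<notin> S1 n k" for s using x(2) that by blast
  then show "x s \<noteq> 0" using x(1) by (metis zero_neq_one)
qed

lemma in_module_basis: "in_module n k (basis_vec {1..k})"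
  using k1 kn by (auto simp: in_module_def basis_vec_def basisW_def)

lemma in_module_level: "j \<le> k \<Longrightarrow> in_module n k (level n k x j)"
proof (cases "0 \<le> j")
  case True
  assume "j \<le> k"
  have "0 - 1 + 1 - 1 \<le> j" using True by simp
  then have "1 - 1 \<le> j" using True by simp
  then show ?thesis using \<open>j \<le> k\<close>
    by (induction j rule: int_upto_induct)
       (auto simp: level_step intro!: in_module_basis in_module_chain)
qed (simp add: in_module_basis)

lemma v1_level:
  assumes x: "x \<in> torus (S1 n k)"
  shows "v1 n k x = level n k x k"
proof -
  have "fold (\<lambda>l. fold (\<lambda>m. Y_op n k m (x (l, m))) [k - l + 1..n + 1 - l]) [1..j] (basis_vec {1..k})
      = level n k x j" if "1 - 1 \<le> j" "j \<le> k" for j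
    using that
  proof (induction j rule: int_upto_induct)
    case (step j)
    then show ?case
      by (simp add: upto_rec2 level_step)
         (rule fold_Y_op[OF in_module_level]; use n2 k1 torusD[OF x] in simp)
  qed simp
  from this[of k] show ?thesis using k1 by (simp add: v1_def)
qed

text \<open>The first \<open>j\<close> factors use only indices from \<open>k - j + 1\<close> on, so
  the entries up to \<open>k - j\<close> have not been moved yet.\<close>

lemma level_support: "0 \<le> j \<Longrightarrow> j \<le> k \<Longrightarrow> \<not> {1..k - j} \<subseteq> J \<Longrightarrow> level n k x j J = 0"
proof -
  assume *: "0 \<le> j" "j \<le> k" "\<not> {1..k - j} \<subseteq> J"
  then have "1 - 1 \<le> j" by simp
  then show ?thesis using *(2,3)
  proof (induction j arbitrary: J rule: int_upto_induct)
    case base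
    then show ?case by (auto simp: basis_vec_def)
  next
    case (step j)
    show ?case unfolding level_step[OF step.hyps]
    proof (rule chain_support[of "{1..k - j}"])
      show "level n k x (j - 1) J = 0" if "\<not> {1..k - j} \<subseteq> J" for J
        by (rule step.IH) (use that step.prems in force)+
    qed (use step.prems in auto)
  qed
qed

text \<open>The \<open>j\<close>-th factor carries the entry \<open>k - j + 1\<close> all the way to
  \<open>n + 2 - j\<close>, with coefficient 1.\<close>

lemma level_top:
  assumes "0 \<le> j" "j \<le> k"
  shows "level n k x j ({1..k - j} \<union> {n + 2 - j..n + 1}) = 1"
proof -
  have "1 - 1 \<le> j" using assms by simp
  then show ?thesis using assms(2)
  proof (induction j rule: int_upto_induct)
    case base
    then show ?case by (simp add: basis_vec_def)
  next
    case (step j)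
    let ?R = "{1..k - j} \<union> {n + 3 - j..n + 1}"
    have "{1..k - j} \<union> {n + 2 - j..n + 1} = insert (n + 1 - j + 1) ?R" using step.hyps by auto
    moreover have "level n k x j (insert (n + 1 - j + 1) ?R) = level n k x (j - 1) (insert (k - j + 1) ?R)"
      unfolding level_step[OF step.hyps]
    proof (rule chain_coeff_one)
      fix J assume "k - j + 1 \<notin> J"
      then have "\<not> {1..k - (j - 1)} \<subseteq> J" using step.prems step.hyps by (auto simp: subset_iff intro!: exI[of _ "k - j + 1"])
      then show "level n k x (j - 1) J = 0" by (intro level_support) (use step in auto)
    qed (use step kn in auto)
    moreover have "insert (k - j + 1) ?R = {1..k - (j - 1)} \<union> {n + 2 - (j - 1)..n + 1}"
      using step by auto
    ultimately show ?case using step by simp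
  qed
qed

text \<open>Starting from \<open>level_top\<close>, the factor with number \<open>l\<close> prolongs
  the block ending in \<open>i\<close> downwards by one entry and contributes its torus parameter at
  \<open>i\<close>.\<close>

lemma level_T:
  assumes x: "x \<in> torus (S1 n k)" and j: "0 \<le> j" "j \<le> l" "l \<le> k" and i: "k - j \<le> i" "i \<le> n + 1 - j"
  shows "level n k x l ({1..k - l} \<union> {i - l + j + 1..i} \<union> {n + 2 - j..n + 1}) = (\<Prod>p=j+1..l. x (p, i))"
proof -
  have "(j + 1) - 1 \<le> l" using j by simp
  then show ?thesis using j(3)
  proof (induction l rule: int_upto_induct)
    case base
    then show ?case using level_top[of j x] j(1) by simp
  next
    case (step l)
    let ?R = "{1..k - l} \<union> {n + 2 - j..n + 1}" and ?s = "i - l + j + 1"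
    have "{1..k - l} \<union> {?s..i} \<union> {n + 2 - j..n + 1} = {?s..i} \<union> ?R" by auto
    moreover have "level n k x l ({?s..i} \<union> ?R) =
        (if i \<le> n + 1 - l then x (l, i) else 1) * level n k x (l - 1) (insert (k - l + 1) ({?s + 1..i} \<union> ?R))"
    proof -
      have l: "1 \<le> l" using step j by simp
      show ?thesis unfolding level_step[OF l]
      proof (rule chain_coeff_interval)
        fix J assume "k - l + 1 \<notin> J"
        then have "\<not> {1..k - (l - 1)} \<subseteq> J" using step.prems l by (auto simp: subset_iff intro!: exI[of _ "k - l + 1"])
        then show "level n k x (l - 1) J = 0" by (intro level_support) (use step l in auto)
      next
        fix p assume "k - l + 1 \<le> p" "p \<le> max (n + 1 - l + 1) i"
        then show "p \<notin> ?R" using i step by auto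
      qed (use step i j in auto)
    qed
    moreover have "(if i \<le> n + 1 - l then x (l, i) else 1) = x (l, i)"
      using torusD(2)[OF x, of "(l, i)"] by (auto simp: S1_def)
    moreover have "insert (k - l + 1) ({?s + 1..i} \<union> ?R) =
        {1..k - (l - 1)} \<union> {i - (l - 1) + j + 1..i} \<union> {n + 2 - j..n + 1}"
      using step by auto
    ultimately show ?case using step by (simp add: prod_last_int mult.commute)
  qed
qed

text \<open>At these sets the coefficients of v1 are monomials in the coordinates, and quotients of
  them recover each single coordinate; see \<open>kappa\<close>.\<close>

definition Tset :: "int \<Rightarrow> int \<Rightarrow> int set" where
  "Tset j i = {i - (k - j) + 1..i} \<union> {n + 2 - j..n + 1}"

lemma v1_T:
  assumes "x \<in> torus (S1 n k)" "0 \<le> j" "j \<le> k" "k - j \<le> i" "i \<le> n + 1 - j"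
  shows "v1 n k x (Tset j i) = (\<Prod>p=j+1..k. x (p, i))"
proof -
  have "{1..k - k} \<union> {i - k + j + 1..i} \<union> {n + 2 - j..n + 1} = Tset j i" by (auto simp: Tset_def)
  then show ?thesis using level_T[OF assms(1,2,3) _ assms(4,5)] v1_level[OF assms(1)] by simp
qed

definition Qprod :: "int \<Rightarrow> (int \<times> int \<Rightarrow> complex) \<Rightarrow> complex" where
  "Qprod i x = (\<Prod>p=1..k. x (p, i))"

lemma Qprod_eq:
  assumes x: "x \<in> torus (S1 n k)" and "c \<le> max 1 (k - i + 1)" "min k (n - i + 1) \<le> d"
  shows "(\<Prod>p=c..d. x (p, i)) = Qprod i x"
proof -
  have "(\<Prod>p=c..d. x (p, i)) = (\<Prod>p\<in>{c..d} \<union> {1..k}. x (p, i))"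
    by (rule prod.mono_neutral_left) (use assms in \<open>auto intro!: torusD(2) simp: S1_def\<close>)
  also have "\<dots> = Qprod i x" unfolding Qprod_def
    by (rule prod.mono_neutral_right) (use assms in \<open>auto intro!: torusD(2) simp: S1_def\<close>)
  finally show ?thesis .
qed

definition Aset :: "int \<Rightarrow> int set" where
  "Aset i = {j \<in> {1..n + 1}. (i - j) mod (n + 1) < k}"

text \<open>For \<open>i < k\<close> the cyclic interval wraps around, and the part before the wrap
  consists of the \<open>k - i\<close> largest entries.\<close>

lemma Aset_Tset:
  assumes "0 \<le> i" "i \<le> n + 1"
  shows "Aset i = Tset (max 0 (k - i)) i"
proof (rule set_eqI)
  fix j
  show "j \<in> Aset i \<longleftrightarrow> j \<in> Tset (max 0 (k - i)) i"
  proof (cases "1 \<le> j \<and> j \<le> n + 1")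
    case True
    have "(i - j) mod (n + 1) = (if j \<le> i then i - j else i - j + (n + 1))"
    proof (cases "j \<le> i")
      case False
      have "(i - j) mod (n + 1) = (i - j + (n + 1)) mod (n + 1)" by simp
      also have "\<dots> = i - j + (n + 1)" using False True assms by (intro mod_pos_pos_trivial) auto
      finally show ?thesis using False by simp
    qed (use True assms in \<open>auto intro!: mod_pos_pos_trivial\<close>)
    then show ?thesis using True assms kn k1 by (auto simp: Aset_def Tset_def)
  next
    case False
    then show ?thesis using assms kn k1 by (auto simp: Aset_def Tset_def)
  qed
qed

lemma v1_Aset:
  assumes "x \<in> torus (S1 n k)" "0 \<le> i" "i \<le> n + 1"
  shows "v1 n k x (Aset i) = Qprod i x"
proof -
  have "v1 n k x (Aset i) = (\<Prod>p=max 0 (k - i)+1..k. x (p, i))"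
    unfolding Aset_Tset[OF assms(2,3)] by (rule v1_T[OF assms(1)]) (use assms k1 kn in auto)
  then show ?thesis using Qprod_eq[OF assms(1), of "max 0 (k - i) + 1" i k] by simp
qed

lemma Qprod_zero: "x \<in> torus (S1 n k) \<Longrightarrow> Qprod 0 x = 1"
  and Qprod_last: "x \<in> torus (S1 n k) \<Longrightarrow> Qprod (n + 1) x = 1"
  unfolding Qprod_def using k1 by (auto intro!: prod.neutral torusD(2) simp: S1_def)

end

section \<open>The action in coordinates as a raising operator\<close>

text \<open>Denominator of the coordinate formula in row \<open>l\<close>. The numerator is the same
  expression for \<open>l - 1\<close>, so that products over the rows telescope.\<close>

definition den :: "int \<Rightarrow> int \<Rightarrow> int \<Rightarrow> complex \<Rightarrow> (int \<times> int \<Rightarrow> complex) \<Rightarrow> int \<Rightarrow> complex" where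
  "den a b i c x l = (\<Sum>p=a..b. (if p \<le> l then 1 else c) / D_coord b p i x)"

lemma den_split:
  assumes "a - 1 \<le> l" "l \<le> b"
  shows "(\<Sum>p=a..l. 1 / D_coord b p i x) + (\<Sum>p=l+1..b. c / D_coord b p i x) = den a b i c x l"
proof -
  have "{a..b} = {a..l} \<union> {l + 1..b}" using assms by auto
  then have "den a b i c x l = (\<Sum>p=a..l. (if p \<le> l then 1 else c) / D_coord b p i x)
      + (\<Sum>p=l+1..b. (if p \<le> l then 1 else c) / D_coord b p i x)"
    unfolding den_def by (simp add: sum.union_disjoint)
  then show ?thesis by simp
qed

lemma e_coord_eq:
  assumes "a \<le> l" "l \<le> b" "(l, i) \<in> S"
  shows "e_coord S a b i c x (l, i) = x (l, i) * (den a b i c x (l - 1) / den a b i c x l)"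
  using assms den_split[of a "l - 1" b i x c] den_split[of a l b i x c] by (simp add: e_coord_def)

lemma e_coord_other: "m \<noteq> i \<or> (l, m) \<notin> S \<Longrightarrow> e_coord S a b i c x (l, m) = x (l, m)"
  by (auto simp: e_coord_def)

lemma den_step:
  assumes "a \<le> l" "l \<le> b"
  shows "den a b i c x (l - 1) = den a b i c x l + (c - 1) / D_coord b l i x"
proof -
  have "den a b i c x (l - 1) = (\<Sum>p=a..b. (if p \<le> l then 1 else c) / D_coord b p i x
      + (if p = l then (c - 1) / D_coord b l i x else 0))"
    unfolding den_def by (rule sum.cong) (auto simp: diff_divide_distrib)
  also have "\<dots> = den a b i c x l + (c - 1) / D_coord b l i x"
    using assms by (simp add: den_def sum.distrib)
  finally show ?thesis .
qed

lemma den_last: "b \<le> l \<Longrightarrow> den a b i c x l = eps_coord a b i x"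
  unfolding den_def eps_coord_def by (rule sum.cong) auto

lemma den_first: "l < a \<Longrightarrow> den a b i c x l = c * eps_coord a b i x"
  unfolding den_def eps_coord_def sum_distrib_left by (rule sum.cong) auto

text \<open>In the quotient of consecutive \<open>D\<close>'s the long products cancel; this local
  form is what matches the change of the parameter from row to row.\<close>

lemma D_coord_step:
  assumes "l \<le> b" "\<And>s. x s \<noteq> 0"
  shows "D_coord b (l - 1) i x * x (l, i - 1) * x (l - 1, i + 1) = x (l - 1, i) * x (l, i) * D_coord b l i x"
proof -
  have 1: "(\<Prod>j=l..b. (x (j, i))\<^sup>2) = (x (l, i))\<^sup>2 * (\<Prod>j=l+1..b. (x (j, i))\<^sup>2)"
    by (rule prod_first_int[OF assms(1)])
  have 2: "(\<Prod>j=l..b+1. x (j, i - 1)) = x (l, i - 1) * (\<Prod>j=l+1..b+1. x (j, i - 1))"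
    by (rule prod_first_int) (use assms(1) in simp)
  have 3: "(\<Prod>j=l-1..b. x (j, i + 1)) = x (l - 1, i + 1) * (\<Prod>j=l..b. x (j, i + 1))"
    using prod_first_int[of "l - 1" b] assms(1) by simp
  define A B C where "A = (\<Prod>j=l+1..b. (x (j, i))\<^sup>2)" and "B = (\<Prod>j=l+1..b+1. x (j, i - 1))"
    and "C = (\<Prod>j=l..b. x (j, i + 1))"
  have nz: "B \<noteq> 0" "C \<noteq> 0" using assms(2) by (simp_all add: B_def C_def)
  have l: "l - 1 + 1 = l" by simp
  have e1: "D_coord b (l - 1) i x = x (l - 1, i) * ((x (l, i))\<^sup>2 * A) / (x (l, i - 1) * B * (x (l - 1, i + 1) * C))"
    unfolding D_coord_def l 1 2 3 A_def B_def C_def ..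
  have e2: "D_coord b l i x = x (l, i) * A / (B * C)"
    unfolding D_coord_def A_def B_def C_def ..
  show ?thesis unfolding e1 e2 using assms(2) nz by (simp add: power2_eq_square field_simps)
qed

lemma D_coord_nonzero: "(\<And>s. x s \<noteq> 0) \<Longrightarrow> D_coord b l i x \<noteq> 0"
  by (simp add: D_coord_def)

context grassmann
begin

lemma mem_S1_iff:
  assumes "1 \<le> i" "i \<le> n"
  shows "(l, i) \<in> S1 n k \<longleftrightarrow> a1 k i \<le> l \<and> l \<le> b1 n k i"
  by (auto simp: S1_def a1_def b1_def)

lemma a1_b1: "1 \<le> i \<Longrightarrow> i \<le> n \<Longrightarrow> a1 k i \<le> b1 n k i \<and> 1 \<le> a1 k i \<and> b1 n k i \<le> k"
  using k1 kn by (auto simp: a1_def b1_def)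

lemma level_cong:
  assumes "j \<le> k" "\<And>l m. 1 \<le> l \<Longrightarrow> l \<le> j \<Longrightarrow> x (l, m) = x' (l, m)"
  shows "level n k x j = level n k x' j"
proof (cases "1 - 1 \<le> j")
  case True
  then show ?thesis using assms(2)
    by (induction j rule: int_upto_induct) (auto simp: level_step intro!: chain_cong)
qed simp

text \<open>Before the first row of column \<open>i\<close> the raising operator annihilates the
  vector: it is either the highest weight vector, or every set in its support contains
  \<open>i\<close>.\<close>

lemma Xpair_level_low:
  assumes "1 \<le> i" "0 \<le> l" "l \<le> k" "l = 0 \<or> i \<le> k - l"
  shows "Xpair i (i + 1) \<tau> (level n k x l) = level n k x l"
proof -
  have "level n k x l (insert (i + 1) (J - {i})) = 0" for J
  proof (cases "i \<le> k - l")
    case True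
    then have "\<not> {1..k - l} \<subseteq> insert (i + 1) (J - {i})" using assms(1) by (auto simp: subset_iff)
    then show ?thesis using assms(2,3) by (intro level_support)
  next
    case False
    have "insert (i + 1) (J - {i}) \<noteq> {1..k}"
    proof
      assume "insert (i + 1) (J - {i}) = {1..k}"
      then have "i + 1 \<in> {1..k}" by blast
      with False assms show False by auto
    qed
    then show ?thesis using False assms by (auto simp: basis_vec_def)
  qed
  then show ?thesis by (auto simp: Xpair_def)
qed

lemma Xpair_level_step:
  assumes x: "x \<in> torus (S1 n k)" and l: "1 \<le> l" "l \<le> k"
    and nz: "(l, i) \<in> S1 n k \<Longrightarrow> x (l, i) + \<tau> * x (l, i + 1) \<noteq> 0"
  shows "Xpair i (i + 1) \<tau> (level n k x l) =
    chain (\<lambda>m. if m = i then x (l, i) + \<tau> * x (l, i + 1) else x (l, m)) (k - l + 1) (n + 1 - l)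
      (Xpair i (i + 1) (if (l, i) \<in> S1 n k
         then \<tau> * x (l, i + 1) * x (l, i - 1) / (x (l, i) * (x (l, i) + \<tau> * x (l, i + 1)))
         else \<tau> * x (l, i + 1) * x (l, i - 1)) (level n k x (l - 1)))"
proof -
  have Z: "(\<lambda>m. x (l, m)) = (\<lambda>m. if k - l + 1 \<le> m \<and> m \<le> n + 1 - l then x (l, m) else 1)"
  proof
    fix m show "x (l, m) = (if k - l + 1 \<le> m \<and> m \<le> n + 1 - l then x (l, m) else 1)"
      using torusD(2)[OF x, of "(l, m)"] l by (auto simp: S1_def)
  qed
  have mem: "(l, i) \<in> S1 n k \<longleftrightarrow> k - l + 1 \<le> i \<and> i \<le> n + 1 - l" using l by (auto simp: S1_def)
  have "(\<lambda>m. x (l, m))(i := w) = (\<lambda>m. if m = i then w else x (l, m))" for w by (auto simp: fun_eq_iff)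
  then show ?thesis
    unfolding level_step[OF l(1)] mem
    using Xpair_chain[where \<alpha> = \<tau> and i = i and v = "level n k x (l - 1)", OF _ _ Z] torusD(1)[OF x] nz l kn
    unfolding mem by simp
qed

lemma e_coord_torus:
  assumes x: "x \<in> torus (S1 n k)" and i: "1 \<le> i" "i \<le> n"
    and nz: "\<And>l. a1 k i - 1 \<le> l \<Longrightarrow> l \<le> b1 n k i \<Longrightarrow> den (a1 k i) (b1 n k i) i c x l \<noteq> 0"
  shows "e_coord (S1 n k) (a1 k i) (b1 n k i) i c x \<in> torus (S1 n k)"
proof -
  have "e_coord (S1 n k) (a1 k i) (b1 n k i) i c x (l, m) \<noteq> 0" for l m
  proof (cases "m = i \<and> (l, i) \<in> S1 n k")
    case True
    then have "a1 k i \<le> l" "l \<le> b1 n k i" using mem_S1_iff[OF i] by auto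
    then show ?thesis using True e_coord_eq[of "a1 k i" l "b1 n k i" i "S1 n k" c x] nz torusD(1)[OF x] by simp
  next
    case False
    then have "e_coord (S1 n k) (a1 k i) (b1 n k i) i c x (l, m) = x (l, m)" by (intro e_coord_other) auto
    then show ?thesis using torusD(1)[OF x] by simp
  qed
  moreover have "e_coord (S1 n k) (a1 k i) (b1 n k i) i c x (l, m) = 1" if "(l, m) \<notin> S1 n k" for l m
    using e_coord_other[of m i l "S1 n k"] that torusD(2)[OF x that] by simp
  ultimately show ?thesis unfolding torus_def by auto
qed

text \<open>
  Moving the one-parameter subgroup through the product of the \<open>Y\<close>'s from the left; \<open>\<tau> l\<close> is its
  parameter in front of the \<open>l\<close>-th factor.
\<close>

lemma v1_e_coord:
  assumes x: "x \<in> torus (S1 n k)" and i: "1 \<le> i" "i \<le> n"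
    and nz: "\<And>l. a1 k i - 1 \<le> l \<Longrightarrow> l \<le> b1 n k i \<Longrightarrow> den (a1 k i) (b1 n k i) i c x l \<noteq> 0"
  shows "Xpair i (i + 1) ((c - 1) / eps_coord (a1 k i) (b1 n k i) i x) (v1 n k x) =
    v1 n k (e_coord (S1 n k) (a1 k i) (b1 n k i) i c x)"
proof -
  define a b where "a = a1 k i" and "b = b1 n k i"
  define D where "D l = D_coord b l i x" for l
  define d where "d = den a b i c x"
  define x' where "x' = e_coord (S1 n k) a b i c x"
  \<comment> \<open>For \<open>l \<le> b\<close> this is the value with
    \<open>x(l, i) + \<tau> l * x(l, i + 1) = x'(l, i)\<close>. Beyond row \<open>b\<close> column
    \<open>i\<close> has no variable, and the parameter stays at its initial value.\<close>
  define \<tau> where "\<tau> l = (if b < l then (c - 1) / d b else (c - 1) * x (l, i) / (D l * d l * x (l, i + 1)))" for l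
  have ab: "a \<le> b" "1 \<le> a" "b \<le> k" using a1_b1[OF i] by (simp_all add: a_def b_def)
  have S: "(l, i) \<in> S1 n k \<longleftrightarrow> a \<le> l \<and> l \<le> b" for l unfolding a_def b_def by (rule mem_S1_iff[OF i])
  have x0: "x s \<noteq> 0" for s by (rule torusD(1)[OF x])
  have D0: "D l \<noteq> 0" for l unfolding D_def by (rule D_coord_nonzero[OF x0])
  have d0: "d l \<noteq> 0" if "a - 1 \<le> l" "l \<le> b" for l using nz[of l] that by (simp add: d_def a_def b_def)
  have dstep: "d (l - 1) = d l + (c - 1) / D l" if "a \<le> l" "l \<le> b" for l
    unfolding d_def D_def by (rule den_step[OF that])
  have x'_eq: "x' (l, i) = x (l, i) * (d (l - 1) / d l)" if "a \<le> l" "l \<le> b" for l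
    unfolding x'_def d_def by (rule e_coord_eq) (use that S in auto)
  have x'_other: "x' (l, m) = x (l, m)" if "m \<noteq> i \<or> \<not> (a \<le> l \<and> l \<le> b)" for l m
    unfolding x'_def by (rule e_coord_other) (use that S in auto)
  have x'_torus: "x' \<in> torus (S1 n k)"
    unfolding x'_def a_def b_def by (rule e_coord_torus[OF x i nz])
  have main: "Xpair i (i + 1) (\<tau> l) (level n k x l) = level n k x' l" if "a - 1 + 1 \<le> l" "l \<le> k" for l
  proof -
    have base: "Xpair i (i + 1) t (level n k x (a - 1)) = level n k x' (a - 1)" for t
    proof -
      have "Xpair i (i + 1) t (level n k x (a - 1)) = level n k x (a - 1)"
        by (rule Xpair_level_low) (use i ab in \<open>auto simp: a_def a1_def\<close>)
      also have "\<dots> = level n k x' (a - 1)"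
        by (rule level_cong) (use ab x'_other in auto)
      finally show ?thesis .
    qed
    have "a - 1 \<le> l" using that by simp
    \<comment> \<open>At \<open>l = a - 1\<close> nothing is claimed about the parameter, because
      \<open>base\<close> holds for every value of it.\<close>
    then have "(l = a - 1 \<or> Xpair i (i + 1) (\<tau> l) (level n k x l) = level n k x' l)"
      using that(2)
    proof (induction l rule: int_upto_induct)
      case (step l)
      have l: "1 \<le> l" "l \<le> k" using step ab by auto
      let ?\<alpha> = "if (l, i) \<in> S1 n k
         then \<tau> l * x (l, i + 1) * x (l, i - 1) / (x (l, i) * (x (l, i) + \<tau> l * x (l, i + 1)))
         else \<tau> l * x (l, i + 1) * x (l, i - 1)"
      have new: "x (l, i) + \<tau> l * x (l, i + 1) = x' (l, i)" if "l \<le> b"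
      proof -
        have "x (l, i) + \<tau> l * x (l, i + 1) = x (l, i) * ((d l + (c - 1) / D l) / d l)"
          using that x0 D0 d0[of l] step.hyps by (simp add: \<tau>_def field_simps)
        also have "\<dots> = x' (l, i)" using x'_eq[of l] dstep[of l] that step.hyps by simp
        finally show ?thesis .
      qed
      have "Xpair i (i + 1) (\<tau> l) (level n k x l) =
        chain (\<lambda>m. if m = i then x (l, i) + \<tau> l * x (l, i + 1) else x (l, m)) (k - l + 1) (n + 1 - l)
          (Xpair i (i + 1) ?\<alpha> (level n k x (l - 1)))"
        by (rule Xpair_level_step[OF x l]) (use new S torusD(1)[OF x'_torus] in auto)
      also have "\<dots> = chain (\<lambda>m. x' (l, m)) (k - l + 1) (n + 1 - l) (Xpair i (i + 1) ?\<alpha> (level n k x (l - 1)))"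
      proof (rule chain_cong)
        fix m assume m: "k - l + 1 \<le> m" "m \<le> n + 1 - l"
        show "(if m = i then x (l, i) + \<tau> l * x (l, i + 1) else x (l, m)) = x' (l, m)"
        proof (cases "m = i")
          case True
          then have "(l, i) \<in> S1 n k" using m l by (auto simp: S1_def)
          then show ?thesis using True new S by auto
        qed (use x'_other in auto)
      qed
      also have "Xpair i (i + 1) ?\<alpha> (level n k x (l - 1)) = level n k x' (l - 1)"
      proof (cases "l = a")
        case True
        then show ?thesis using base by simp
      next
        case False
        then have la: "a < l" using step.hyps by simp
        have "?\<alpha> = \<tau> (l - 1)"
        proof (cases "l \<le> b")
          case True
          have xl: "x' (l, i) = x (l, i) * (d (l - 1) / d l)" using x'_eq True la by simp
          have Dl: "D (l - 1) * x (l, i - 1) * x (l - 1, i + 1) = x (l - 1, i) * x (l, i) * D l"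
            unfolding D_def by (rule D_coord_step[OF True x0])
          have dn: "d l \<noteq> 0" "d (l - 1) \<noteq> 0" using d0 True la by auto
          have "?\<alpha> = \<tau> l * x (l, i + 1) * x (l, i - 1) / (x (l, i) * x' (l, i))"
            using True la S new by simp
          also have "\<dots> = (c - 1) * x (l, i - 1) / (D l * x (l, i) * d (l - 1))"
            using True x0 D0 dn by (simp add: \<tau>_def xl field_simps)
          also have "\<dots> = (c - 1) * x (l - 1, i) / (D (l - 1) * d (l - 1) * x (l - 1, i + 1))"
          proof -
            have "(c - 1) * x (l, i - 1) * (D (l - 1) * d (l - 1) * x (l - 1, i + 1)) =
              (c - 1) * d (l - 1) * (D (l - 1) * x (l, i - 1) * x (l - 1, i + 1))" by (simp add: algebra_simps)
            also have "\<dots> = (c - 1) * x (l - 1, i) * (D l * x (l, i) * d (l - 1))"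
              unfolding Dl by (simp add: algebra_simps)
            finally show ?thesis using x0 D0 dn by (simp add: frac_eq_eq)
          qed
          also have "\<dots> = \<tau> (l - 1)" using True la by (simp add: \<tau>_def)
          finally show ?thesis .
        next
          case lb: False
          then have "b < k" using l by simp
          then have b: "b = n + 1 - i" using ab by (auto simp: b_def b1_def)
          have "(l, i + 1) \<notin> S1 n k" using lb b by (auto simp: S1_def)
          then have xp: "x (l, i + 1) = 1" by (rule torusD(2)[OF x])
          have \<alpha>: "?\<alpha> = (c - 1) / d b * x (l, i - 1)" using lb S xp by (simp add: \<tau>_def)
          show ?thesis
          proof (cases "l = b + 1")
            case True
            \<comment> \<open>Row \<open>b + 1\<close> no longer has a variable in column
              \<open>i\<close> but still has one in column \<open>i - 1\<close>; that variable
              rescales the parameter here and occurs in \<open>D b\<close>.\<close>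
            have Db: "D b = x (b, i) / (x (b + 1, i - 1) * x (b, i + 1))" by (simp add: D_def D_coord_def)
            have "\<tau> b = (c - 1) / d b * x (b + 1, i - 1)" using x0 by (simp add: \<tau>_def Db)
            then show ?thesis unfolding \<alpha> using True by simp
          next
            case False
            then have "(l, i - 1) \<notin> S1 n k" using lb b by (auto simp: S1_def)
            then have "x (l, i - 1) = 1" by (rule torusD(2)[OF x])
            then show ?thesis unfolding \<alpha> using False lb by (simp add: \<tau>_def)
          qed
        qed
        then show ?thesis using step.IH la l by simp
      qed
      also have "chain (\<lambda>m. x' (l, m)) (k - l + 1) (n + 1 - l) (level n k x' (l - 1)) = level n k x' l"
        by (simp add: level_step[OF l(1)])
      finally show ?case ..
    qed simp
    then show ?thesis using that by auto
  qed
  have "\<tau> k = (c - 1) / d b"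
  proof (cases "b < k")
    case False
    then have b: "b = k" using ab by simp
    have "(k + 1, i - 1) \<notin> S1 n k" by (auto simp: S1_def)
    then have "x (k + 1, i - 1) = 1" by (rule torusD(2)[OF x])
    then have Dk: "D k = x (k, i) / x (k, i + 1)" by (simp add: D_def D_coord_def b)
    then show ?thesis using b x0 by (simp add: \<tau>_def Dk)
  qed (simp add: \<tau>_def)
  moreover have "d b = eps_coord a b i x" unfolding d_def by (rule den_last) simp
  ultimately show ?thesis
    using main[of k] ab v1_level[OF x] v1_level[OF x'_torus] by (simp add: x'_def a_def b_def)
qed

text \<open>The quotient multiplied to \<open>D_coord\<close> in the definition supplies exactly the
  end factors missing from the three column products.\<close>

lemma Qprod_gamma:
  assumes x: "x \<in> torus (S1 n k)" and i: "1 \<le> i" "i \<le> n"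
  shows "gamma_coord (a1 k i) (b1 n k i) i x = (Qprod i x)\<^sup>2 / (Qprod (i - 1) x * Qprod (i + 1) x)"
proof -
  define a b where "a = a1 k i" and "b = b1 n k i"
  have ab: "a \<le> b" "1 \<le> a" "b \<le> k" using a1_b1[OF i] by (simp_all add: a_def b_def)
  have "(\<Prod>p=a..b. x (p, i)) = Qprod i x"
    by (rule Qprod_eq[OF x]) (auto simp: a_def b_def a1_def b1_def)
  then have 1: "Qprod i x = x (a, i) * (\<Prod>p=a+1..b. x (p, i))" using prod_first_int[OF ab(1), of "\<lambda>p. x (p, i)"] by simp
  have "(\<Prod>p=a..b+1. x (p, i - 1)) = Qprod (i - 1) x"
    by (rule Qprod_eq[OF x]) (auto simp: a_def b_def a1_def b1_def)
  then have 2: "Qprod (i - 1) x = x (a, i - 1) * (\<Prod>p=a+1..b+1. x (p, i - 1))"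
    using prod_first_int[of a "b + 1" "\<lambda>p. x (p, i - 1)"] ab(1) by simp
  have "(\<Prod>p=a-1..b. x (p, i + 1)) = Qprod (i + 1) x"
    by (rule Qprod_eq[OF x]) (auto simp: a_def b_def a1_def b1_def)
  then have 3: "Qprod (i + 1) x = x (a - 1, i + 1) * (\<Prod>p=a..b. x (p, i + 1))"
    using prod_first_int[of "a - 1" b "\<lambda>p. x (p, i + 1)"] ab(1) by simp
  show ?thesis
    unfolding gamma_coord_def D_coord_def a_def[symmetric] b_def[symmetric] 1 2 3
    by (simp add: prod_power_distrib power2_eq_square algebra_simps prod.distrib)
qed

text \<open>The row factors telescope to \<open>den (a - 1) / den b\<close>, and these two ends are
  \<open>c * eps\<close> and \<open>eps\<close>.\<close>

lemma Qprod_e_coord: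
  assumes x: "x \<in> torus (S1 n k)" and i: "1 \<le> i" "i \<le> n"
    and nz: "\<And>l. a1 k i - 1 \<le> l \<Longrightarrow> l \<le> b1 n k i \<Longrightarrow> den (a1 k i) (b1 n k i) i c x l \<noteq> 0"
  shows "Qprod i (e_coord (S1 n k) (a1 k i) (b1 n k i) i c x) = c * Qprod i x"
proof -
  define a b where "a = a1 k i" and "b = b1 n k i"
  define d where "d = den a b i c x"
  define x' where "x' = e_coord (S1 n k) a b i c x"
  have ab: "a \<le> b" "1 \<le> a" "b \<le> k" using a1_b1[OF i] by (simp_all add: a_def b_def)
  have S: "(l, i) \<in> S1 n k \<longleftrightarrow> a \<le> l \<and> l \<le> b" for l unfolding a_def b_def by (rule mem_S1_iff[OF i])
  have d0: "d l \<noteq> 0" if "a - 1 \<le> l" "l \<le> b" for l using nz[of l] that by (simp add: d_def a_def b_def)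
  have tele: "(\<Prod>p=a..l. d (p - 1) / d p) = d (a - 1) / d l" if "a - 1 \<le> l" "l \<le> b" for l
    using that
  proof (induction l rule: int_upto_induct)
    case base
    then show ?case using d0[of "a - 1"] ab by simp
  next
    case (step l)
    then show ?case using d0[of "l - 1"] by (simp add: prod_last_int)
  qed
  have "Qprod i x' = (\<Prod>p=a..b. x' (p, i))"
    by (rule Qprod_eq[symmetric]) (use e_coord_torus[OF x i nz] in \<open>auto simp: x'_def a_def b_def a1_def b1_def\<close>)
  also have "\<dots> = (\<Prod>p=a..b. x (p, i) * (d (p - 1) / d p))"
    unfolding x'_def d_def by (intro prod.cong refl e_coord_eq) (use S in auto)
  also have "\<dots> = (\<Prod>p=a..b. x (p, i)) * (d (a - 1) / d b)" using tele[of b] ab by (subst prod.distrib) simp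
  also have "(\<Prod>p=a..b. x (p, i)) = Qprod i x"
    by (rule Qprod_eq[OF x]) (auto simp: a_def b_def a1_def b1_def)
  also have "d (a - 1) / d b = c"
  proof -
    have "d b \<noteq> 0" using d0 ab by simp
    then show ?thesis using den_first[of "a - 1" a b i c x] den_last[of b b a i c x] by (simp add: d_def)
  qed
  finally show ?thesis by (simp add: x'_def a_def b_def)
qed

end

text \<open>
  A geometric lift of the relation \<open>c \<cdot> s\<^sub>b \<cdots> s\<^sub>a\<^sub>+\<^sub>1 = s\<^sub>b\<^sub>-\<^sub>1 \<cdots> s\<^sub>a \<cdot> c\<close> for the Coxeter element
  \<open>c = s\<^sub>b \<cdots> s\<^sub>a\<close>, obtained by one braid move for each index.
\<close>

lemma chain_exchange:
  assumes "a \<le> b"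
    and z: "\<And>m. a \<le> m \<Longrightarrow> m \<le> b \<Longrightarrow> z m \<noteq> 0" and X: "\<And>m. a < m \<Longrightarrow> m \<le> b \<Longrightarrow> X m \<noteq> 0"
    and Z: "\<And>m. a \<le> m \<Longrightarrow> m \<le> b \<Longrightarrow> Z m \<noteq> 0"
    and rec: "\<And>m. a < m \<Longrightarrow> m \<le> b \<Longrightarrow> Z (m - 1) = z (m - 1) / z m * Z m + X m"
    and y: "\<And>m. a < m \<Longrightarrow> m \<le> b \<Longrightarrow> y m = z m * X m / Z m"
  shows "Ypair b (b + 1) (z b / Z b) (chain z a (b - 1) (chain X (a + 1) b v)) =
         chain Z a (b - 1) (chain y (a + 1) b (Ypair a (a + 1) (z a / Z a) v))"
  using assms
proof (induction b rule: int_ge_induct)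
  case base
  then show ?case by simp
next
  case (step b)
  let ?Y = "\<lambda>m. Ypair m (m + 1)"
  have nz: "z (b + 1) \<noteq> 0" "z b \<noteq> 0" "X (b + 1) \<noteq> 0" "Z (b + 1) \<noteq> 0" "Z b \<noteq> 0"
    using step by auto
  have Zb: "Z b = z b / z (b + 1) * Z (b + 1) + X (b + 1)" using step.prems(4)[of "b + 1"] step.hyps by simp
  have sum: "z b + z (b + 1) / Z (b + 1) * X (b + 1) = z (b + 1) / Z (b + 1) * Z b"
    unfolding Zb using nz by (simp add: field_simps)
  have yb: "y (b + 1) = z (b + 1) / Z (b + 1) * X (b + 1)" using step.prems(5)[of "b + 1"] step.hyps by simp
  have "?Y (b + 1) (z (b + 1) / Z (b + 1)) (chain z a b (chain X (a + 1) (b + 1) v)) =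
    ?Y (b + 1) (z (b + 1) / Z (b + 1)) (?Y b (z b) (chain z a (b - 1)
      (?Y (b + 1) (X (b + 1)) (chain X (a + 1) b v))))"
    using step.hyps by (simp add: chain_last)
  also have "chain z a (b - 1) (?Y (b + 1) (X (b + 1)) (chain X (a + 1) b v)) =
     ?Y (b + 1) (X (b + 1)) (chain z a (b - 1) (chain X (a + 1) b v))"
    by (rule Ypair_chain_commute[symmetric]) auto
  also have "?Y (b + 1) (z (b + 1) / Z (b + 1)) (?Y b (z b) (?Y (b + 1) (X (b + 1))
        (chain z a (b - 1) (chain X (a + 1) b v)))) =
     ?Y b (Z b) (?Y (b + 1) (y (b + 1)) (?Y b (z b / Z b) (chain z a (b - 1) (chain X (a + 1) b v))))"
  proof -
    \<comment> \<open>The recursion for \<open>Z\<close> at \<open>b + 1\<close> identifies the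
      three parameters that the braid move produces.\<close>
    have "z b / (z (b + 1) / Z (b + 1)) + X (b + 1) = Z b" unfolding Zb using nz by (simp add: field_simps)
    moreover have "z (b + 1) / Z (b + 1) * z b / (z b + z (b + 1) / Z (b + 1) * X (b + 1)) = z b / Z b"
      unfolding sum using nz by (simp add: field_simps)
    moreover have "z b + z (b + 1) / Z (b + 1) * X (b + 1) \<noteq> 0" unfolding sum using nz by simp
    ultimately show ?thesis
      using Ypair_braid[of b "b + 1" "b + 1 + 1" "z (b + 1) / Z (b + 1)" "z b" "X (b + 1)"] nz
      by (simp only: yb) simp
  qed
  also have "?Y b (z b / Z b) (chain z a (b - 1) (chain X (a + 1) b v)) =
     chain Z a (b - 1) (chain y (a + 1) b (Ypair a (a + 1) (z a / Z a) v))"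
    by (rule step.IH) (use step.prems in auto)
  also have "?Y (b + 1) (y (b + 1)) (chain Z a (b - 1) (chain y (a + 1) b (Ypair a (a + 1) (z a / Z a) v))) =
     chain Z a (b - 1) (?Y (b + 1) (y (b + 1)) (chain y (a + 1) b (Ypair a (a + 1) (z a / Z a) v)))"
    by (rule Ypair_chain_commute) auto
  finally show ?case using step.hyps by (simp add: chain_last)
qed

lemma Ypair_add: "Ypair s t c (\<lambda>J. f J + g J) = (\<lambda>J. Ypair s t c f J + Ypair s t c g J)"
  by (auto simp: Ypair_def fun_eq_iff algebra_simps add_divide_distrib)

lemma Ypair_sum: "finite A \<Longrightarrow> Ypair s t c (\<lambda>J. \<Sum>m\<in>A. f m J) = (\<lambda>J. \<Sum>m\<in>A. Ypair s t c (f m) J)"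
  by (induction A rule: finite_induct) (simp_all add: Ypair_add, simp add: Ypair_def fun_eq_iff)

lemma Ypair_basis_vec_out: "s \<notin> K \<Longrightarrow> t \<notin> K \<Longrightarrow> Ypair s t c (basis_vec K) = basis_vec K"
  by (auto simp: Ypair_def basis_vec_def fun_eq_iff)

lemma Ypair_basis_vec:
  assumes "s \<notin> R" "t \<notin> R" "s \<noteq> t"
  shows "Ypair s t c (basis_vec (insert s R)) = (\<lambda>J. c * basis_vec (insert s R) J + basis_vec (insert t R) J)"
proof
  fix J
  have 1: "insert s (J - {t}) = insert s R \<longleftrightarrow> J = insert t R" if "t \<in> J" "s \<notin> J"
  proof -
    have "insert s (J - {t}) = insert s R \<longleftrightarrow> J - {t} = R" by (rule insert_ident) (use that assms in auto)
    also have "\<dots> \<longleftrightarrow> J = insert t R" using that(1) assms(2) by blast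
    finally show ?thesis .
  qed
  consider "s \<in> J" "t \<notin> J" | "t \<in> J" "s \<notin> J" | "s \<in> J \<longleftrightarrow> t \<in> J" by blast
  then show "Ypair s t c (basis_vec (insert s R)) J = c * basis_vec (insert s R) J + basis_vec (insert t R) J"
  proof cases
    case 1
    then have "J \<noteq> insert t R" by blast
    with 1 show ?thesis by (simp add: Ypair_def basis_vec_def)
  next
    case 2
    then have "J \<noteq> insert s R" by blast
    with 2 \<open>t \<in> J \<Longrightarrow> s \<notin> J \<Longrightarrow> _\<close> show ?thesis by (simp add: Ypair_def basis_vec_def)
  next
    case 3
    then have "J \<noteq> insert s R" "J \<noteq> insert t R" using assms by blast+
    with 3 show ?thesis by (simp add: Ypair_def basis_vec_def)
  qed
qed

text \<open>Each factor leaves the torus weight at its position and passes the entry on with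
  coefficient 1. The entry \<open>e\<close> is outside the range of the chain, so its term stays as
  it is.\<close>

lemma chain_basis_vec:
  assumes "a - 1 \<le> b" "\<And>m. a \<le> m \<Longrightarrow> m \<le> b + 1 \<Longrightarrow> m \<notin> R" "\<And>m. a \<le> m \<Longrightarrow> m \<le> b + 1 \<Longrightarrow> m \<noteq> e"
  shows "chain z a b (\<lambda>J. \<alpha> * basis_vec (insert e R) J + \<beta> * basis_vec (insert a R) J) =
    (\<lambda>J. \<alpha> * basis_vec (insert e R) J + \<beta> * ((\<Sum>m=a..b. z m * basis_vec (insert m R) J) + basis_vec (insert (b + 1) R) J))"
  using assms
proof (induction b rule: int_upto_induct)
  case (step b)
  have R: "b \<notin> R" "b + 1 \<notin> R" "b \<noteq> e" "b + 1 \<noteq> e" using step by auto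
  have m: "Ypair b (b + 1) (z b) (basis_vec (insert m R)) = basis_vec (insert m R)" if "a \<le> m" "m \<le> b - 1" for m
    by (rule Ypair_basis_vec_out) (use that R in auto)
  have s: "Ypair b (b + 1) (z b) (\<lambda>J. \<Sum>m=a..b-1. z m * basis_vec (insert m R) J) =
     (\<lambda>J. \<Sum>m=a..b-1. z m * basis_vec (insert m R) J)"
    by (subst Ypair_sum) (auto simp: Ypair_scale m intro!: sum.cong)
  have e: "Ypair b (b + 1) (z b) (basis_vec (insert e R)) = basis_vec (insert e R)"
    by (rule Ypair_basis_vec_out) (use R in auto)
  have IH: "chain z a (b - 1) (\<lambda>J. \<alpha> * basis_vec (insert e R) J + \<beta> * basis_vec (insert a R) J) =
    (\<lambda>J. \<alpha> * basis_vec (insert e R) J + \<beta> * ((\<Sum>m=a..b-1. z m * basis_vec (insert m R) J) + basis_vec (insert (b - 1 + 1) R) J))"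
    by (rule step.IH) (use step.prems in auto)
  show ?case
    using step.hyps R
    by (simp add: chain_last IH Ypair_add Ypair_scale s e Ypair_basis_vec sum_last_int[of a b])
       (simp add: algebra_simps)
qed simp

section \<open>Path sums\<close>

lemma path_weight_Cons: "path_weight x (s # t # ps) = step_weight x s t * path_weight x (t # ps)"
  by (simp add: path_weight_def)

lemma path_weight_single: "path_weight x [s] = 1"
  by (simp add: path_weight_def)

context grassmann
begin

lemma paths_last: "paths n k (1, n) = {[(1, n)]}"
proof (rule set_eqI)
  fix ps
  have "(1, n) \<in> S1 n k" using k1 kn by (simp add: S1_def)
  moreover have False if "ps = (1, n) # t # qs" "set ps \<subseteq> S1 n k" "successively path_step ps" for t qs
    using that by (auto simp: path_step_def S1_def)
  ultimately show "ps \<in> paths n k (1, n) \<longleftrightarrow> ps \<in> {[(1, n)]}"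
    by (cases ps; cases "tl ps") (auto simp: paths_def)
qed

lemma paths_rec:
  assumes "s \<in> S1 n k" "s \<noteq> (1, n)"
  shows "paths n k s = Cons s ` (\<Union>t\<in>{(fst s, snd s + 1), (fst s - 1, snd s + 1)} \<inter> S1 n k. paths n k t)"
proof (rule set_eqI)
  fix ps
  show "ps \<in> paths n k s \<longleftrightarrow> ps \<in> Cons s ` (\<Union>t\<in>{(fst s, snd s + 1), (fst s - 1, snd s + 1)} \<inter> S1 n k. paths n k t)"
    (is "_ \<longleftrightarrow> _ \<in> Cons s ` ?U")
  proof
    assume ps: "ps \<in> paths n k s"
    then obtain qs where q: "ps = s # qs" by (cases ps) (auto simp: paths_def)
    with ps assms(2) obtain t rs where r: "qs = t # rs" by (cases qs) (auto simp: paths_def)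
    from ps have "path_step s t" "t \<in> S1 n k" "t # rs \<in> paths n k t" unfolding q r by (auto simp: paths_def)
    then have "qs \<in> ?U" unfolding r by (auto simp: path_step_def)
    then show "ps \<in> Cons s ` ?U" using q by blast
  next
    assume "ps \<in> Cons s ` ?U"
    then obtain t qs where "ps = s # qs" "path_step s t" "t \<in> S1 n k" "qs \<in> paths n k t"
      by (auto simp: path_step_def)
    moreover from this obtain rs where "qs = t # rs" by (cases qs) (auto simp: paths_def)
    ultimately show "ps \<in> paths n k s" using assms(1) by (auto simp: paths_def)
  qed
qed

text \<open>Every path step raises the second coordinate, so \<open>n - m\<close> decreases along a
  path.\<close>

lemma S1_induct [consumes 1, case_names last step]:
  assumes "(l, m) \<in> S1 n k" and "P 1 n"
    and "\<And>l m. (l, m) \<in> S1 n k \<Longrightarrow> (l, m) \<noteq> (1, n) \<Longrightarrow>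
      ((l, m + 1) \<in> S1 n k \<Longrightarrow> P l (m + 1)) \<Longrightarrow> ((l - 1, m + 1) \<in> S1 n k \<Longrightarrow> P (l - 1) (m + 1)) \<Longrightarrow> P l m"
  shows "P l m"
  using assms(1)
proof (induction "nat (n - m)" arbitrary: l m rule: less_induct)
  case less
  show ?case
  proof (cases "(l, m) = (1, n)")
    case True
    then show ?thesis using assms(2) by simp
  next
    case False
    have "m < n" using less.prems False by (auto simp: S1_def)
    then have "nat (n - (m + 1)) < nat (n - m)" by simp
    then show ?thesis using assms(3)[OF less.prems False] less.hyps by blast
  qed
qed

lemma finite_paths: "(l, m) \<in> S1 n k \<Longrightarrow> finite (paths n k (l, m))"
proof (induction rule: S1_induct)
  case (step l m)
  then show ?case by (subst paths_rec) auto
qed (simp add: paths_last)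

lemma Xfun_last: "Xfun n k x 1 n = 1"
  using k1 kn by (simp add: Xfun_def paths_last path_weight_single)

lemma Xfun_sum: "(l, m) \<in> S1 n k \<Longrightarrow> Xfun n k x l m = (\<Sum>ps\<in>paths n k (l, m). path_weight x ps)"
  by (auto simp: Xfun_def S1_def)

lemma Xfun_rec:
  assumes s: "(l, m) \<in> S1 n k" "(l, m) \<noteq> (1, n)"
  shows "Xfun n k x l m = (if (l, m + 1) \<in> S1 n k then x (l, m) / x (l, m + 1) * Xfun n k x l (m + 1) else 0)
      + (if (l - 1, m + 1) \<in> S1 n k then Xfun n k x (l - 1) (m + 1) else 0)"
proof -
  let ?T = "{(l, m + 1), (l - 1, m + 1)} \<inter> S1 n k"
  have hd: "hd ps = t \<and> ps \<noteq> []" if "ps \<in> paths n k t" for ps t using that by (auto simp: paths_def)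
  have "Xfun n k x l m = (\<Sum>ps\<in>(\<Union>t\<in>?T. paths n k t). path_weight x ((l, m) # ps))"
    using paths_rec[OF s] by (simp add: Xfun_sum[OF s(1)] sum.reindex)
  also have "\<dots> = (\<Sum>t\<in>?T. \<Sum>ps\<in>paths n k t. path_weight x ((l, m) # ps))"
  proof (rule sum.UNION_disjoint)
    show "\<forall>t\<in>?T. finite (paths n k t)" using finite_paths by auto
    show "\<forall>t\<in>?T. \<forall>u\<in>?T. t \<noteq> u \<longrightarrow> paths n k t \<inter> paths n k u = {}"
    proof (intro ballI impI, rule ccontr)
      fix t u assume "t \<noteq> u" "paths n k t \<inter> paths n k u \<noteq> {}"
      then obtain ps where "ps \<in> paths n k t" "ps \<in> paths n k u" by blast
      then have "hd ps = t" "hd ps = u" using hd[of ps t] hd[of ps u] by blast+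
      with \<open>t \<noteq> u\<close> show False by simp
    qed
  qed simp
  also have "\<dots> = (\<Sum>t\<in>?T. step_weight x (l, m) t * Xfun n k x (fst t) (snd t))"
  proof (rule sum.cong[OF refl])
    fix t assume t: "t \<in> ?T"
    have "(\<Sum>ps\<in>paths n k t. path_weight x ((l, m) # ps)) =
        (\<Sum>ps\<in>paths n k t. step_weight x (l, m) t * path_weight x ps)"
    proof (rule sum.cong[OF refl])
      fix ps assume "ps \<in> paths n k t"
      with hd[OF this] obtain qs where "ps = t # qs" by (cases ps) auto
      then show "path_weight x ((l, m) # ps) = step_weight x (l, m) t * path_weight x ps"
        by (simp add: path_weight_Cons)
    qed
    then show "(\<Sum>ps\<in>paths n k t. path_weight x ((l, m) # ps)) = step_weight x (l, m) t * Xfun n k x (fst t) (snd t)"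
      using t by (cases t) (auto simp: Xfun_sum sum_distrib_left)
  qed
  also have "\<dots> = (if (l, m + 1) \<in> S1 n k then x (l, m) / x (l, m + 1) * Xfun n k x l (m + 1) else 0)
      + (if (l - 1, m + 1) \<in> S1 n k then Xfun n k x (l - 1) (m + 1) else 0)"
    by (simp add: step_weight_def)
  finally show ?thesis .
qed

text \<open>On the diagonal \<open>l + m = n + 1\<close> a horizontal step leaves \<open>S1\<close>,
  so the only path consists of vertical steps of weight 1.\<close>

lemma Xfun_diag: "1 \<le> l \<Longrightarrow> l \<le> k \<Longrightarrow> Xfun n k x l (n + 1 - l) = 1"
proof (induction l rule: int_ge_induct)
  case base
  then show ?case by (simp add: Xfun_last)
next
  case (step l)
  have "(l + 1, n + 1 - (l + 1)) \<in> S1 n k" "(l + 1, n + 1 - (l + 1) + 1) \<notin> S1 n k"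
    "(l + 1 - 1, n + 1 - (l + 1) + 1) \<in> S1 n k" using step kn by (auto simp: S1_def)
  then have "Xfun n k x (l + 1) (n + 1 - (l + 1)) = Xfun n k x (l + 1 - 1) (n + 1 - (l + 1) + 1)"
    using step.hyps by (subst Xfun_rec) auto
  also have "n + 1 - (l + 1) + 1 = n + 1 - l" by simp
  finally show ?case using step by simp
qed

lemma Xfun_pos:
  assumes x: "x \<in> tpos (S1 n k)" and "(l, m) \<in> S1 n k"
  shows "Xfun n k x l m \<in> cpos"
  using assms(2)
proof (induction rule: S1_induct)
  case (step l m)
  note p = tpos_cpos[OF x]
  show ?case
  proof (cases "(l, m + 1) \<in> S1 n k")
    case True
    then show ?thesis using step p
      by (subst Xfun_rec) (auto intro!: cpos_add cpos_mult cpos_divide)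
  next
    case False
    then have "(l - 1, m + 1) \<in> S1 n k" using step.hyps by (auto simp: S1_def)
    then show ?thesis using step False by (subst Xfun_rec) auto
  qed
qed (simp add: Xfun_last)

text \<open>In row 1 only horizontal steps are possible, and their weights telescope.\<close>

lemma Xfun_row:
  assumes x: "x \<in> torus (S1 n k)" and "(1, m) \<in> S1 n k"
  shows "Xfun n k x 1 m = x (1, m) / x (1, n)"
proof -
  have "l = 1 \<longrightarrow> Xfun n k x l m = x (1, m) / x (1, n)" if "(l, m) \<in> S1 n k" for l m
    using that
  proof (induction rule: S1_induct)
    case last
    then show ?case using torusD(1)[OF x] by (simp add: Xfun_last)
  next
    case (step l m)
    show ?case
    proof
      assume l: "l = 1"
      then have "(l, m + 1) \<in> S1 n k" "(l - 1, m + 1) \<notin> S1 n k" using step.hyps by (auto simp: S1_def)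
      then show "Xfun n k x l m = x (1, m) / x (1, n)"
        using step l torusD(1)[OF x] by (subst Xfun_rec) auto
    qed
  qed
  then show ?thesis using assms(2) by blast
qed

section \<open>The second chart\<close>

text \<open>This form is meant for \<open>j \<le> k - 1\<close>, where all indices are positive. The
  factor \<open>l = k\<close> starts with index 0, which is the pair \<open>(n + 1, 1)\<close>, and
  is treated in \<open>v2_level2\<close>.\<close>

definition level2 :: "(int \<times> int \<Rightarrow> complex) \<Rightarrow> int \<Rightarrow> (int set \<Rightarrow> complex)" where
  "level2 y j = fold (\<lambda>l. chain (\<lambda>m. y (l, m)) (k - l) (n - l)) [1..j] (basis_vec (insert (n + 1) {1..k - 1}))"

lemma level2_zero [simp]: "j \<le> 0 \<Longrightarrow> level2 y j = basis_vec (insert (n + 1) {1..k - 1})"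
  by (simp add: level2_def)

lemma level2_step: "1 \<le> j \<Longrightarrow> level2 y j = chain (\<lambda>m. y (j, m)) (k - j) (n - j) (level2 y (j - 1))"
  by (simp add: level2_def upto_rec2)

lemma in_module_level2: "j \<le> k - 1 \<Longrightarrow> in_module n k (level2 y j)"
proof (cases "1 - 1 \<le> j")
  case True
  assume "j \<le> k - 1"
  with True show ?thesis
  proof (induction j rule: int_upto_induct)
    case base
    have "card (insert (n + 1) {1..k - 1}) = nat k" using k1 kn by (simp add: nat_diff_distrib)
    then show ?case using k1 kn by (auto simp: in_module_def basis_vec_def basisW_def)
  qed (auto simp: level2_step intro!: in_module_chain)
next
  case False
  have "card (insert (n + 1) {1..k - 1}) = nat k" using k1 kn by (simp add: nat_diff_distrib)
  then show ?thesis using False k1 kn by (auto simp: in_module_def basis_vec_def basisW_def)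
qed

lemma level2_support: "0 \<le> j \<Longrightarrow> j \<le> k - 1 \<Longrightarrow> \<not> {1..k - j - 1} \<subseteq> J \<Longrightarrow> level2 y j J = 0"
proof -
  assume *: "0 \<le> j" "j \<le> k - 1" "\<not> {1..k - j - 1} \<subseteq> J"
  then have "1 - 1 \<le> j" by simp
  then show ?thesis using *(2,3)
  proof (induction j arbitrary: J rule: int_upto_induct)
    case base
    then show ?case by (auto simp: basis_vec_def)
  next
    case (step j)
    show ?case unfolding level2_step[OF step.hyps]
    proof (rule chain_support[of "{1..k - j - 1}"])
      show "level2 y (j - 1) J = 0" if "\<not> {1..k - j - 1} \<subseteq> J" for J
        by (rule step.IH) (use that step.prems in force)+
    qed (use step.prems in auto)
  qed
qed

lemma torus2D:
  assumes "y \<in> torus (S2 n k)"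
  shows "y s \<noteq> 0" "s \<notin> S2 n k \<Longrightarrow> y s = 1"
proof -
  have y: "\<forall>s\<in>S2 n k. y s \<noteq> 0" "\<forall>s. s \<notin> S2 n k \<longrightarrow> y s = 1"
    using assms by (simp_all add: torus_def)
  show "y s = 1" if "s \<notin> S2 n k" for s using y(2) that by blast
  then show "y s \<noteq> 0" using y(1) by (metis zero_neq_one)
qed

lemma v2_level2:
  assumes y: "y \<in> torus (S2 n k)"
  shows "v2 n k y = chain (\<lambda>m. y (k, m)) 1 (n - k) (Ypair (n + 1) 1 (y (k, 0)) (level2 y (k - 1)))"
proof -
  have "fold (\<lambda>l. fold (\<lambda>m. Y_op n k m (y (l, m))) [k - l..n - l]) [1..j] (basis_vec (insert (n + 1) {1..k - 1}))
      = level2 y j" if "1 - 1 \<le> j" "j \<le> k - 1" for j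
    using that
  proof (induction j rule: int_upto_induct)
    case (step j)
    then show ?case
      by (simp add: upto_rec2 level2_step)
         (rule fold_Y_op[OF in_module_level2]; use n2 k1 torus2D[OF y] in simp)
  qed simp
  from this[of "k - 1"] have "v2 n k y = fold (\<lambda>m. Y_op n k m (y (k, m))) [0..n - k] (level2 y (k - 1))"
    using k1 by (simp add: v2_def upto_rec2[of 1 k])
  also have "\<dots> = fold (\<lambda>m. Y_op n k m (y (k, m))) [1..n - k] (Y_op n k 0 (y (k, 0)) (level2 y (k - 1)))"
    using kn by (simp add: upto_rec1[of 0 "n - k"])
  also have "Y_op n k 0 (y (k, 0)) (level2 y (k - 1)) = Ypair (n + 1) 1 (y (k, 0)) (level2 y (k - 1))"
    using Y_op_eq[OF in_module_level2[of "k - 1" y], of 0 "y (k, 0)"] n2 torus2D(1)[OF y] by (simp add: src_def)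
  also have "fold (\<lambda>m. Y_op n k m (y (k, m))) [1..n - k] (Ypair (n + 1) 1 (y (k, 0)) (level2 y (k - 1))) =
      chain (\<lambda>m. y (k, m)) 1 (n - k) (Ypair (n + 1) 1 (y (k, 0)) (level2 y (k - 1)))"
    by (rule fold_Y_op) (use n2 k1 torus2D[OF y] in \<open>auto intro!: in_module_Ypair in_module_level2\<close>)
  finally show ?thesis .
qed

lemma Sigma_map_eq:
  "(l, m) \<in> S2 n k \<Longrightarrow> Sigma_map n k x (l, m) = x (l + 1, m) * Xfun n k x l m / Xfun n k x (l + 1) m"
  by (simp add: Sigma_map_def)

lemma Xfun_boundary: "l + m = k \<Longrightarrow> l \<le> k \<Longrightarrow> Xfun n k x l m = 1 / x (1, n)"
  by (simp add: Xfun_def)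

lemma Xfun_top: "Xfun n k x (k + 1) m = 1"
  by (simp add: Xfun_def)

lemma Xfun_pos2:
  assumes x: "x \<in> tpos (S1 n k)" and "1 \<le> l" "l \<le> k + 1" "k \<le> l + m" "l + m \<le> n + 1"
  shows "Xfun n k x l m \<in> cpos"
proof -
  consider "l = k + 1" | "l \<le> k" "l + m = k" | "(l, m) \<in> S1 n k" using assms by (force simp: S1_def)
  then show ?thesis
  proof cases
    case 2
    then show ?thesis using tpos_cpos[OF x] by (simp add: Xfun_boundary cpos_divide)
  qed (use Xfun_pos[OF x] in \<open>auto simp: Xfun_top\<close>)
qed

lemma Sigma_map_tpos:
  assumes x: "x \<in> tpos (S1 n k)"
  shows "Sigma_map n k x \<in> tpos (S2 n k)"
proof (rule tposI)
  fix s assume "s \<in> S2 n k"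
  then show "Sigma_map n k x s \<in> cpos"
    using tpos_cpos[OF x] Xfun_pos2[OF x]
    by (cases s) (auto simp: Sigma_map_eq S2_def intro!: cpos_mult cpos_divide)
qed (auto simp: Sigma_map_def)

text \<open>Induction on \<open>l\<close> with the invariant
  \<open>P_l ... P_1 u_1 = x(1, n) N_l Q_(l-1) ... Q_1 u_2\<close>. Passing \<open>P_(l+1)\<close>
  through \<open>N_l\<close> gives \<open>N_(l+1) Q_l\<close>, and the path recursion of
  \<open>X\<close> is exactly what makes the braid moves fit.\<close>

theorem v1_Sigma:
  assumes x: "x \<in> tpos (S1 n k)"
  shows "v1 n k x = (\<lambda>J. x (1, n) * v2 n k (Sigma_map n k x) J)"
proof -
  define y where "y = Sigma_map n k x"
  define c where "c = 1 / x (1, n)"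
  have xt: "x \<in> torus (S1 n k)" by (rule tpos_torus[OF x])
  have x0: "x s \<noteq> 0" for s by (rule torusD(1)[OF xt])
  have c0: "c \<noteq> 0" using x0 by (simp add: c_def)
  have yt: "y \<in> torus (S2 n k)" unfolding y_def by (rule tpos_torus[OF Sigma_map_tpos[OF x]])
  have X0: "Xfun n k x l m \<noteq> 0" if "1 \<le> l" "l \<le> k + 1" "k \<le> l + m" "l + m \<le> n + 1" for l m
    using Xfun_pos2[OF x that] cpos_nonzero by blast
  \<comment> \<open>The transition operator: a chain with the path sums of row \<open>l\<close> as
    parameters, preceded by one factor that moves \<open>n + 1\<close> to the lowest entry of that
    chain.\<close>
  define NN where "NN l v = chain (Xfun n k x l) (k - l + 1) (n - l) (Ypair (n + 1) (k - l + 1) c v)" for l v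
  have "level n k x l = (\<lambda>J. x (1, n) * NN l (level2 y (l - 1)) J)" if "1 \<le> l" "l \<le> k" for l
    using that
  proof (induction l rule: int_ge_induct)
    case base
    let ?R = "{1..k - 1}"
    have k: "{1..k} = insert k ?R" using k1 by auto
    have L: "level n k x 1 = (\<lambda>J. (\<Sum>m=k..n. x (1, m) * basis_vec (insert m ?R) J) + basis_vec (insert (n + 1) ?R) J)"
    proof -
      have "level n k x 1 = chain (\<lambda>m. x (1, m)) k n (\<lambda>J. 0 * basis_vec (insert 0 ?R) J + 1 * basis_vec (insert k ?R) J)"
        using k by (simp add: level_step)
      also have "\<dots> = (\<lambda>J. 0 * basis_vec (insert 0 ?R) J
           + 1 * ((\<Sum>m=k..n. x (1, m) * basis_vec (insert m ?R) J) + basis_vec (insert (n + 1) ?R) J))"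
        by (rule chain_basis_vec) (use k1 kn in auto)
      finally show ?thesis by simp
    qed
    have "NN 1 (level2 y 0) = chain (Xfun n k x 1) k (n - 1)
        (\<lambda>J. c * basis_vec (insert (n + 1) ?R) J + 1 * basis_vec (insert k ?R) J)"
      using kn by (simp add: NN_def Ypair_basis_vec)
    also have "\<dots> = (\<lambda>J. c * basis_vec (insert (n + 1) ?R) J
         + 1 * ((\<Sum>m=k..n-1. Xfun n k x 1 m * basis_vec (insert m ?R) J) + basis_vec (insert (n - 1 + 1) ?R) J))"
      by (rule chain_basis_vec) (use k1 kn in auto)
    also have "\<dots> = (\<lambda>J. c * basis_vec (insert (n + 1) ?R) J
         + ((\<Sum>m=k..n-1. c * (x (1, m) * basis_vec (insert m ?R) J)) + basis_vec (insert n ?R) J))"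
    proof -
      have "Xfun n k x 1 m = c * x (1, m)" if "m \<in> {k..n - 1}" for m
        using Xfun_row[OF xt, of m] that k1 by (simp add: c_def S1_def)
      then show ?thesis by (simp add: mult.assoc)
    qed
    finally have "NN 1 (level2 y (1 - 1)) = \<dots>" by simp
    then show ?case
      unfolding L using kn x0
      by (auto simp: fun_eq_iff c_def sum_last_int[of k n] distrib_left sum_distrib_left)
  next
    case (step l)
    define a b where "a = k - l" and "b = n - l"
    have ab: "1 \<le> a" "a \<le> b" "b < n" "b + 1 < n + 1" using step kn by (auto simp: a_def b_def)
    let ?z = "\<lambda>m. x (l + 1, m)" and ?X = "Xfun n k x l" and ?Z = "Xfun n k x (l + 1)" and ?y = "\<lambda>m. y (l, m)"
    let ?L = "level2 y (l - 1)"
    \<comment> \<open>The exchange expects the parameter \<open>z b / Z b\<close> in its leftmost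
      factor; on the diagonal the path sum is 1, so the given parameter \<open>z b\<close> has this
      form.\<close>
    have Zb: "?Z b = 1" using Xfun_diag[of "l + 1" x] step by (simp add: b_def)
    have z0: "?z m \<noteq> 0" for m by (rule x0)
    have nzX: "?X m \<noteq> 0" "?Z m \<noteq> 0" if "a \<le> m" "m \<le> b" for m
      using X0[of l m] X0[of "l + 1" m] that step by (auto simp: a_def b_def)
    have rec: "?Z (m - 1) = ?z (m - 1) / ?z m * ?Z m + ?X m" if "a < m" "m \<le> b" for m
    proof -
      have "(l + 1, m - 1) \<in> S1 n k" "(l + 1, m - 1) \<noteq> (1, n)" "(l + 1, m - 1 + 1) \<in> S1 n k" "(l, m) \<in> S1 n k"
        using that step by (auto simp: S1_def a_def b_def)
      then show ?thesis using Xfun_rec[of "l + 1" "m - 1" x] by simp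
    qed
    have ym: "?y m = ?z m * ?X m / ?Z m" if "a \<le> m" "m \<le> b" for m
      unfolding y_def by (rule Sigma_map_eq) (use that step in \<open>auto simp: S2_def a_def b_def\<close>)
    have "level n k x (l + 1) = chain ?z a b (\<lambda>J. x (1, n) * NN l ?L J)"
      using step by (simp add: level_step a_def b_def)
    also have "\<dots> = (\<lambda>J. x (1, n) * chain ?z a b (NN l ?L) J)" by (rule chain_scale)
    also have "chain ?z a b (NN l ?L) = Ypair b (b + 1) (?z b / ?Z b)
        (chain ?z a (b - 1) (chain ?X (a + 1) b (Ypair (n + 1) (a + 1) c ?L)))"
      using ab(2) Zb by (simp add: chain_last NN_def a_def b_def)
    also have "\<dots> = chain ?Z a (b - 1) (chain ?y (a + 1) b (Ypair a (a + 1) (?z a / ?Z a) (Ypair (n + 1) (a + 1) c ?L)))"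
      by (rule chain_exchange[OF ab(2)]) (use z0 nzX rec ym in auto)
    \<comment> \<open>The target of the entry \<open>n + 1\<close> drops from \<open>a + 1\<close>
      to \<open>a\<close>. The earlier factors of the second chart have not moved the entry
      \<open>a\<close>, which gives the support condition.\<close>
    also have "Ypair a (a + 1) (?z a / ?Z a) (Ypair (n + 1) (a + 1) c ?L) =
        Ypair (n + 1) a c (Ypair a (a + 1) (?z a / ?Z a * c) ?L)"
    proof (rule Ypair_boundary)
      fix J assume "a \<notin> J"
      then have "\<not> {1..k - (l - 1) - 1} \<subseteq> J" using ab by (auto simp: a_def subset_iff)
      then show "level2 y (l - 1) J = 0" by (intro level2_support) (use step in auto)
    qed (use ab z0 nzX c0 in auto)
    also have "?z a / ?Z a * c = ?y a"
      using ym[of a] ab Xfun_boundary[of l a x] step by (simp add: a_def c_def)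
    also have "chain ?y (a + 1) b (Ypair (n + 1) a c (Ypair a (a + 1) (?y a) ?L)) =
       Ypair (n + 1) a c (chain ?y (a + 1) b (Ypair a (a + 1) (?y a) ?L))"
      by (rule Ypair_chain_commute[symmetric]) (use ab in auto)
    also have "chain ?y (a + 1) b (Ypair a (a + 1) (?y a) ?L) = level2 y l"
      using step ab by (simp add: level2_step chain_first a_def b_def)
    also have "chain ?Z a (b - 1) (Ypair (n + 1) a c (level2 y l)) = NN (l + 1) (level2 y (l + 1 - 1))"
      by (simp add: NN_def a_def b_def algebra_simps)
    finally show ?case .
  qed
  from this[of k] have "v1 n k x = (\<lambda>J. x (1, n) * NN k (level2 y (k - 1)) J)"
    using k1 v1_level[OF xt] by simp
  \<comment> \<open>For \<open>l = k\<close> the extra pair is \<open>(n + 1, 1)\<close>, that is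
    index 0, and row \<open>k\<close> of \<open>Sigma\<close> consists of the path sums themselves,
    as both values in row \<open>k + 1\<close> are 1.\<close>
  moreover have "NN k (level2 y (k - 1)) = v2 n k y"
  proof -
    have "y (k, m) = Xfun n k x k m" if "0 \<le> m" "m \<le> n - k" for m
    proof -
      have "x (k + 1, m) = 1" by (rule torusD(2)[OF xt]) (simp add: S1_def)
      then show ?thesis
        unfolding y_def using that k1 by (subst Sigma_map_eq) (auto simp: S2_def Xfun_top)
    qed
    moreover from this[of 0] have "y (k, 0) = c" using kn by (simp add: Xfun_boundary c_def)
    ultimately have "chain (\<lambda>m. y (k, m)) 1 (n - k) v = chain (Xfun n k x k) 1 (n - k) v" for v
      by (intro chain_cong) simp
    with \<open>y (k, 0) = c\<close> show ?thesis by (simp add: v2_level2[OF yt] NN_def)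
  qed
  ultimately show ?thesis by (simp add: y_def)
qed

end

text \<open>The \<open>f\<close>'s and \<open>g\<close>'s are the raising parameters on the two
  sides of the Verma relation, numbered from the left. With \<open>P = qi * V\<close> and
  \<open>S = qj * T\<close>, the relation \<open>P + S = ri * rj\<close> turns every shifted
  denominator into simple factors times \<open>d * P + S\<close>, \<open>P + c * S\<close> or a
  quotient of these. The conclusions are the hypotheses of \<open>Xpair_braid\<close>.\<close>

lemma verma_scalars:
  fixes c d :: complex
  assumes nz: "ri \<noteq> 0" "rj \<noteq> 0" and rel: "qi * V + qj * T = ri * rj"
    and f3: "f3 = (d - 1) * qi / ri" and f2: "f2 = (c * d - 1) * qj / (rj + f3 * V)"
    and f1: "f1 = (c - 1) * (d * qi) / (ri + f2 * T)"
    and g3: "g3 = (c - 1) * qj / rj" and g2: "g2 = (c * d - 1) * qi / (ri + g3 * T)"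
    and g1: "g1 = (d - 1) * (c * qj) / (rj + g2 * V)"
    and nz': "rj + f3 * V \<noteq> 0" "ri + f2 * T \<noteq> 0" "ri + g3 * T \<noteq> 0" "rj + g2 * V \<noteq> 0"
    and cd: "c \<noteq> 0" "d \<noteq> 0"
  shows "f1 + f3 = g2" "g1 + g3 = f2" "f1 * f2 = g2 * g3"
proof -
  define P S where "P = qi * V" and "S = qj * T"
  have PS: "P + S = ri * rj" using rel by (simp add: P_def S_def)
  have A: "rj + f3 * V = (d * P + S) / ri"
  proof -
    have "(rj + f3 * V) * ri = ri * rj + (d - 1) * P" using nz by (simp add: f3 P_def field_simps)
    also have "\<dots> = d * P + S" by (simp add: PS[symmetric] algebra_simps)
    finally show ?thesis using nz by (simp add: field_simps)
  qed
  have A0: "d * P + S \<noteq> 0" using nz'(1) unfolding A by auto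
  have f2': "f2 = (c * d - 1) * qj * ri / (d * P + S)" unfolding f2 A by simp
  have B: "ri + f2 * T = ri * (d * (P + c * S)) / (d * P + S)"
  proof -
    have "(ri + f2 * T) * (d * P + S) = ri * (d * P + S) + (c * d - 1) * ri * S"
      using A0 by (simp add: f2' S_def field_simps)
    also have "\<dots> = ri * (d * (P + c * S))" by (simp add: algebra_simps)
    finally show ?thesis using A0 by (simp add: field_simps)
  qed
  have B0: "P + c * S \<noteq> 0" using nz'(2) unfolding B by auto
  have f1': "f1 = (c - 1) * qi * (d * P + S) / (ri * (P + c * S))"
  proof -
    have "(c - 1) * (d * qi) / (ri * (d * W) / U) = (c - 1) * qi * U / (ri * W)" if "U \<noteq> 0" "W \<noteq> 0" for U W
      using nz cd that by (simp add: field_simps)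
    then show ?thesis unfolding f1 B using A0 B0 by blast
  qed
  have C: "ri + g3 * T = (P + c * S) / rj"
  proof -
    have "(ri + g3 * T) * rj = ri * rj + (c - 1) * S" using nz by (simp add: g3 S_def field_simps)
    also have "\<dots> = P + c * S" by (simp add: PS[symmetric] algebra_simps)
    finally show ?thesis using nz by (simp add: field_simps)
  qed
  have g2': "g2 = (c * d - 1) * qi * rj / (P + c * S)" unfolding g2 C by simp
  have D: "rj + g2 * V = rj * (c * (d * P + S)) / (P + c * S)"
  proof -
    have "(rj + g2 * V) * (P + c * S) = rj * (P + c * S) + (c * d - 1) * rj * P"
      using B0 by (simp add: g2' P_def field_simps)
    also have "\<dots> = rj * (c * (d * P + S))" by (simp add: algebra_simps)
    finally show ?thesis using B0 by (simp add: field_simps)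
  qed
  have g1': "g1 = (d - 1) * qj * (P + c * S) / (rj * (d * P + S))"
  proof -
    have "(d - 1) * (c * qj) / (rj * (c * U) / W) = (d - 1) * qj * W / (rj * U)" if "U \<noteq> 0" "W \<noteq> 0" for U W
      using nz cd that by (simp add: field_simps)
    then show ?thesis unfolding g1 D using A0 B0 by blast
  qed
  have "(f1 + f3) * (ri * (P + c * S)) = qi * ((c - 1) * (d * P + S) + (d - 1) * (P + c * S))"
  proof -
    have "((c - 1) * qi * U / (ri * W) + (d - 1) * qi / ri) * (ri * W) = qi * ((c - 1) * U + (d - 1) * W)"
      if "W \<noteq> 0" for U W
      using nz that by (simp add: field_simps)
    then show ?thesis unfolding f1' f3 using B0 by blast
  qed
  also have "(c - 1) * (d * P + S) + (d - 1) * (P + c * S) = (c * d - 1) * (P + S)"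
    by (simp add: algebra_simps)
  also have "qi * ((c * d - 1) * (P + S)) = g2 * (ri * (P + c * S))"
    unfolding PS g2' using B0 by simp
  finally show "f1 + f3 = g2" using nz B0 by simp
  have "(g1 + g3) * (rj * (d * P + S)) = qj * ((d - 1) * (P + c * S) + (c - 1) * (d * P + S))"
  proof -
    have "((d - 1) * qj * W / (rj * U) + (c - 1) * qj / rj) * (rj * U) = qj * ((d - 1) * W + (c - 1) * U)"
      if "U \<noteq> 0" for U W
      using nz that by (simp add: field_simps)
    then show ?thesis unfolding g1' g3 using A0 by blast
  qed
  also have "(d - 1) * (P + c * S) + (c - 1) * (d * P + S) = (c * d - 1) * (P + S)"
    by (simp add: algebra_simps)
  also have "qj * ((c * d - 1) * (P + S)) = f2 * (rj * (d * P + S))"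
    unfolding PS f2' using A0 by simp
  finally show "g1 + g3 = f2" using nz A0 by simp
  show "f1 * f2 = g2 * g3"
  proof -
    have "(c - 1) * qi * U / (ri * W) * ((c * d - 1) * qj * ri / U) = (c * d - 1) * qi * rj / W * ((c - 1) * qj / rj)"
      if "U \<noteq> 0" "W \<noteq> 0" for U W
      using nz that by (simp add: field_simps)
    then show ?thesis unfolding f1' f2' g2' g3 using A0 B0 by blast
  qed
qed

context grassmann
begin

section \<open>The cyclic symmetry\<close>

text \<open>The identity outside \<open>1, ..., n + 1\<close>, so that \<open>rho\<close> is
  injective on all integers and acts on all sets.\<close>

definition rho :: "int \<Rightarrow> int" where
  "rho j = (if j = n + 1 then 1 else if 1 \<le> j \<and> j \<le> n then j + 1 else j)"

text \<open>The representative of a residue class in \<open>1, ..., n + 1\<close>.\<close>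

definition ps :: "int \<Rightarrow> int" where
  "ps i = (i - 1) mod (n + 1) + 1"

lemma ps_range: "1 \<le> ps i" "ps i \<le> n + 1"
  using n2 pos_mod_bound[of "n + 1" "i - 1"] by (simp_all add: ps_def)

lemma ps_id: "1 \<le> i \<Longrightarrow> i \<le> n + 1 \<Longrightarrow> ps i = i"
  by (simp add: ps_def)

lemma ps_mod: "(i - ps j) mod (n + 1) = (i - j) mod (n + 1)"
proof -
  have "i - ps j = (i - 1) - (j - 1) mod (n + 1)" by (simp add: ps_def)
  also have "\<dots> mod (n + 1) = ((i - 1) - (j - 1)) mod (n + 1)" by (rule mod_diff_right_eq)
  finally show ?thesis by simp
qed

lemma ps_cong: "(i - j) mod (n + 1) = 0 \<Longrightarrow> ps i = ps j"
  by (simp add: ps_def mod_eq_0_iff_dvd mod_eq_dvd_iff)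

lemma ps_eq_iff: "ps i = ps j \<longleftrightarrow> (i - j) mod (n + 1) = 0"
  by (simp add: ps_def mod_eq_0_iff_dvd mod_eq_dvd_iff)

lemma rho_inj: "inj rho"
  by (rule injI) (use n2 in \<open>auto simp: rho_def split: if_splits\<close>)

lemma rho_ps: "rho (ps i) = ps (i + 1)"
proof -
  have "(i - 1 + 1) mod (n + 1) = ((i - 1) mod (n + 1) + 1) mod (n + 1)" by (simp add: mod_simps)
  then have *: "i mod (n + 1) = ps i mod (n + 1)" by (simp add: ps_def)
  show ?thesis
  proof (cases "ps i = n + 1")
    case True
    then show ?thesis using * by (simp add: rho_def ps_def)
  next
    case False
    then have "1 \<le> ps i" "ps i \<le> n" using ps_range[of i] by auto
    then show ?thesis using * by (simp add: rho_def) (simp add: ps_def)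
  qed
qed

definition rot :: "(int set \<Rightarrow> complex) \<Rightarrow> (int set \<Rightarrow> complex)" where
  "rot p = (\<lambda>J. p (rho ` J))"

lemma rho_power: "(rho ^^ m) (ps i) = ps (i + int m)"
  by (induction m) (simp_all add: rho_ps algebra_simps)

lemma rho_power_id: "(rho ^^ nat (n + 1)) j = j"
proof (cases "1 \<le> j \<and> j \<le> n + 1")
  case True
  have "(rho ^^ nat (n + 1)) (ps j) = ps (j + (n + 1))" using rho_power[of "nat (n + 1)" j] n2 by simp
  also have "\<dots> = ps j" by (rule ps_cong) simp
  finally show ?thesis using True by (simp add: ps_id)
next
  case False
  have "(rho ^^ m) j = j" for m by (induction m) (use False n2 in \<open>auto simp: rho_def\<close>)
  then show ?thesis .
qed

lemma rot_power: "(rot ^^ m) p = (\<lambda>J. p ((rho ^^ m) ` J))"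
proof (induction m arbitrary: p)
  case (Suc m)
  have "(rot ^^ Suc m) p = rot ((rot ^^ m) p)" by simp
  also have "\<dots> = (\<lambda>J. p ((rho ^^ m) ` rho ` J))" unfolding Suc rot_def ..
  also have "\<dots> = (\<lambda>J. p ((rho ^^ Suc m) ` J))" by (simp add: image_comp funpow_Suc_right del: funpow.simps)
  finally show ?case .
qed simp

lemma rot_power_id: "(rot ^^ nat (n + 1)) p = p"
  by (simp add: rot_power rho_power_id)

definition shift :: "(int \<times> int \<Rightarrow> complex) \<Rightarrow> (int \<times> int \<Rightarrow> complex)" where
  "shift y = (\<lambda>(l, m). y (l, m - 1))"

lemma S1_shift: "(l, m) \<in> S1 n k \<longleftrightarrow> (l, m - 1) \<in> S2 n k"
  by (auto simp: S1_def S2_def)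

lemma shift_torus: "y \<in> torus (S2 n k) \<Longrightarrow> shift y \<in> torus (S1 n k)"
  by (auto simp: torus_def shift_def S1_shift)

lemma shift_tpos: "y \<in> tpos (S2 n k) \<Longrightarrow> shift y \<in> tpos (S1 n k)"
  by (auto simp: tpos_def shift_torus) (simp add: shift_def)

lemma chain_rot:
  assumes "1 \<le> a" "b \<le> n - 1"
  shows "chain z a b (rot p) = rot (chain (\<lambda>m. z (m - 1)) (a + 1) (b + 1) p)"
proof (cases "a - 1 \<le> b")
  case True
  then show ?thesis using assms(2)
  proof (induction b rule: int_upto_induct)
    case (step b)
    have b: "rho b = b + 1" "rho (b + 1) = b + 1 + 1" using step assms(1) by (auto simp: rho_def)
    have "chain z a b (rot p) = Ypair b (b + 1) (z b) (rot (chain (\<lambda>m. z (m - 1)) (a + 1) (b - 1 + 1) p))"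
      using step by (simp add: chain_last)
    also have "\<dots> = rot (Ypair (b + 1) (b + 1 + 1) (z b) (chain (\<lambda>m. z (m - 1)) (a + 1) b p))"
      unfolding rot_def by (simp add: Ypair_rotate[OF rho_inj] b)
    also have "\<dots> = rot (chain (\<lambda>m. z (m - 1)) (a + 1) (b + 1) p)"
      using step.hyps chain_last[of "a + 1" "b + 1" "\<lambda>m. z (m - 1)" p] by simp
    finally show ?case .
  qed simp
qed simp

lemma basis_rot: "basis_vec (insert (n + 1) {1..k - 1}) = rot (basis_vec {1..k})"
proof -
  have "rho ` insert (n + 1) {1..k - 1} = {1..k}"
  proof -
    have "rho ` {1..k - 1} = (\<lambda>j. j + 1) ` {1..k - 1}"
      by (rule image_cong) (use kn in \<open>auto simp: rho_def\<close>)
    then have "rho ` {1..k - 1} = {2..k}" by simp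
    then show ?thesis using k1 by (auto simp: rho_def)
  qed
  then have "rho ` J = {1..k} \<longleftrightarrow> J = insert (n + 1) {1..k - 1}" for J
    using inj_image_eq_iff[OF rho_inj] by metis
  then show ?thesis by (simp add: basis_vec_def rot_def fun_eq_iff)
qed

lemma v2_rot:
  assumes y: "y \<in> torus (S2 n k)"
  shows "v2 n k y = rot (v1 n k (shift y))"
proof -
  have "level2 y j = rot (level n k (shift y) j)" if "1 - 1 \<le> j" "j \<le> k - 1" for j
    using that
  proof (induction j rule: int_upto_induct)
    case base
    then show ?case by (simp add: basis_rot)
  next
    case (step j)
    have "level2 y j = chain (\<lambda>m. y (j, m)) (k - j) (n - j) (rot (level n k (shift y) (j - 1)))"
      using step by (simp add: level2_step)
    also have "\<dots> = rot (chain (\<lambda>m. y (j, m - 1)) (k - j + 1) (n - j + 1) (level n k (shift y) (j - 1)))"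
      by (rule chain_rot) (use step in auto)
    also have "\<dots> = rot (level n k (shift y) j)"
      using step.hyps by (simp add: level_step shift_def algebra_simps)
    finally show ?case .
  qed
  from this[of "k - 1"] have L: "level2 y (k - 1) = rot (level n k (shift y) (k - 1))" using k1 by simp
  \<comment> \<open>Index 0 becomes the pair \<open>(1, 2)\<close>, which is the first link of the
    last chain in the first chart.\<close>
  have r: "rho (n + 1) = 1" "rho 1 = 2" using n2 by (auto simp: rho_def)
  have "v2 n k y = chain (\<lambda>m. y (k, m)) 1 (n - k) (rot (Ypair 1 2 (y (k, 0)) (level n k (shift y) (k - 1))))"
    unfolding v2_level2[OF y] L rot_def by (simp add: Ypair_rotate[OF rho_inj] r)
  also have "\<dots> = rot (chain (\<lambda>m. y (k, m - 1)) (1 + 1) (n - k + 1) (Ypair 1 2 (y (k, 0)) (level n k (shift y) (k - 1))))"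
    by (rule chain_rot) (use k1 in auto)
  also have "\<dots> = rot (chain (\<lambda>m. y (k, m - 1)) 1 (n - k + 1) (level n k (shift y) (k - 1)))"
    using kn by (simp add: chain_first[of 1])
  also have "\<dots> = rot (level n k (shift y) k)"
    using k1 by (simp add: level_step[of k] shift_def algebra_simps)
  finally show ?thesis by (simp add: v1_level[OF shift_torus[OF y]])
qed

section \<open>The positive cone\<close>

text \<open>Multiples are included because the two charts are related only up to the scalar
  \<open>x(1, n)\<close>.\<close>

definition cone :: "(int set \<Rightarrow> complex) set" where
  "cone = {(\<lambda>J. c * v1 n k x J) | c x. c \<in> cpos \<and> x \<in> tpos (S1 n k)}"

lemma coneI: "c \<in> cpos \<Longrightarrow> x \<in> tpos (S1 n k) \<Longrightarrow> (\<lambda>J. c * v1 n k x J) \<in> cone"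
  unfolding cone_def by blast

lemma coneE:
  assumes "p \<in> cone" obtains c x where "c \<in> cpos" "x \<in> tpos (S1 n k)" "p = (\<lambda>J. c * v1 n k x J)"
  using assms unfolding cone_def by blast

lemma v1_cone: "x \<in> tpos (S1 n k) \<Longrightarrow> v1 n k x \<in> cone"
  using coneI[of 1 x] by simp

text \<open>Combine \<open>v1_Sigma\<close> with \<open>v2_rot\<close>: a point of the first chart
  is a multiple of a point of the second, and the latter is a rotated point of the first.\<close>

lemma cone_unrot:
  assumes "p \<in> cone" obtains p' where "p' \<in> cone" "p = rot p'"
proof -
  obtain d x where d: "d \<in> cpos" "x \<in> tpos (S1 n k)" "p = (\<lambda>J. d * v1 n k x J)" by (rule coneE[OF assms(1)])
  let ?y = "shift (Sigma_map n k x)"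
  have y: "Sigma_map n k x \<in> tpos (S2 n k)" by (rule Sigma_map_tpos[OF d(2)])
  have "p = rot (\<lambda>J. d * x (1, n) * v1 n k ?y J)"
    unfolding d(3) v1_Sigma[OF d(2)] v2_rot[OF tpos_torus[OF y]] by (simp add: rot_def mult.assoc)
  moreover have "(\<lambda>J. d * x (1, n) * v1 n k ?y J) \<in> cone"
    using d tpos_cpos[OF d(2)] by (intro coneI cpos_mult shift_tpos[OF y])
  ultimately show ?thesis using that by blast
qed

text \<open>The rotation has finite order, so the cone is also closed under its inverse.\<close>

lemma cone_rot:
  assumes "p \<in> cone" shows "rot p \<in> cone"
proof -
  have "\<exists>p'\<in>cone. p = (rot ^^ m) p'" for m
  proof (induction m)
    case (Suc m)
    then obtain p' where p': "p' \<in> cone" "p = (rot ^^ m) p'" by blast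
    obtain r where "r \<in> cone" "p' = rot r" by (rule cone_unrot[OF p'(1)])
    then show ?case using p'(2) by (intro bexI[of _ r]) (simp_all add: funpow_Suc_right del: funpow.simps)
  qed (use assms in auto)
  then obtain p' where p': "p' \<in> cone" "p = (rot ^^ nat n) p'" by blast
  have "nat (n + 1) = Suc (nat n)" using n2 by simp
  then have "rot p = (rot ^^ nat (n + 1)) p'" using p'(2) by simp
  then show ?thesis using p'(1) by (simp add: rot_power_id)
qed

definition Bset :: "int \<Rightarrow> int set" where
  "Bset i = insert (ps (i + 1)) (Aset i - {ps i})"

definition XX :: "int \<Rightarrow> complex \<Rightarrow> (int set \<Rightarrow> complex) \<Rightarrow> (int set \<Rightarrow> complex)" where
  "XX i = Xpair (ps i) (ps (i + 1))"

definition Eop :: "int \<Rightarrow> (int set \<Rightarrow> complex) \<Rightarrow> (int set \<Rightarrow> complex)" where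
  "Eop i p = (\<lambda>J. if ps i \<in> J \<and> ps (i + 1) \<notin> J then p (insert (ps (i + 1)) (J - {ps i})) else 0)"

text \<open>The raising step whose parameter makes the coefficient at \<open>Aset i\<close> exactly
  \<open>c\<close> times as large, since \<open>Eop i p (Aset i) = p (Bset i)\<close>.\<close>

definition ec :: "int \<Rightarrow> complex \<Rightarrow> (int set \<Rightarrow> complex) \<Rightarrow> (int set \<Rightarrow> complex)" where
  "ec i c p = XX i ((c - 1) * p (Aset i) / p (Bset i)) p"

lemma XX_Eop: "XX i a p J = p J + a * Eop i p J"
  by (simp add: XX_def Eop_def Xpair_def)

lemma ps_mem_Aset: "ps j \<in> Aset i \<longleftrightarrow> (i - j) mod (n + 1) < k"
  using ps_range[of j] by (simp add: Aset_def ps_mod)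

lemma mod_pred: "(i - (j + 1)) mod (n + 1) = (if (i - j) mod (n + 1) = 0 then n else (i - j) mod (n + 1) - 1)"
proof -
  let ?d = "(i - j) mod (n + 1)"
  have d: "0 \<le> ?d" "?d < n + 1"
    using n2 pos_mod_sign[of "n + 1" "i - j"] pos_mod_bound[of "n + 1" "i - j"] by linarith+
  have "(i - (j + 1)) mod (n + 1) = (?d - 1) mod (n + 1)" by (simp add: mod_simps algebra_simps)
  also have "\<dots> = (if ?d = 0 then n else ?d - 1)"
  proof (cases "?d = 0")
    case True
    then show ?thesis using zmod_minus1[of "n + 1"] n2 by simp
  next
    case False
    then show ?thesis using d by (simp add: mod_pos_pos_trivial)
  qed
  finally show ?thesis .
qed

lemma ps_mem_Bset: "ps j \<in> Bset i \<longleftrightarrow> (let d = (i - j) mod (n + 1) in (1 \<le> d \<and> d < k) \<or> d = n)"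
proof -
  define d where "d = (i - j) mod (n + 1)"
  have d_bounds: "0 \<le> d" "d < n + 1"
    using n2 pos_mod_sign[of "n + 1" "i - j"] pos_mod_bound[of "n + 1" "i - j"] unfolding d_def by linarith+
  have "ps j = ps i \<longleftrightarrow> d = 0" using ps_eq_iff[of i j] by (auto simp: d_def)
  moreover have "ps j = ps (i + 1) \<longleftrightarrow> d = n"
  proof -
    have "ps j = ps (i + 1) \<longleftrightarrow> (i + 1 - j) mod (n + 1) = 0" using ps_eq_iff[of "i + 1" j] by auto
    also have "\<dots> \<longleftrightarrow> d = n"
      using mod_pred[of "i + 1" j] d_bounds n2 pos_mod_bound[of "n + 1" "i + 1 - j"] pos_mod_sign[of "n + 1" "i + 1 - j"]
      by (auto simp: d_def[symmetric] split: if_splits)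
    finally show ?thesis .
  qed
  ultimately show ?thesis
    using d_bounds k1 kn n2 unfolding Bset_def Let_def by (auto simp: ps_mem_Aset d_def[symmetric])
qed

lemma ps_next_ne: "ps i \<noteq> ps (i + 1)" "ps i \<noteq> ps (i + 1 + 1)"
  using n2 zmod_minus1[of "n + 1"] by (auto simp: ps_eq_iff mod_eq_0_iff_dvd dest: zdvd_imp_le)

lemma rho_Aset: "rho ` Aset i = Aset (i + 1)"
proof (rule set_eqI)
  fix x
  have r: "j = ps j" if "1 \<le> j" "j \<le> n + 1" for j using ps_id[OF that] by simp
  show "x \<in> rho ` Aset i \<longleftrightarrow> x \<in> Aset (i + 1)"
  proof
    assume "x \<in> rho ` Aset i"
    then obtain j where j: "j \<in> Aset i" "x = rho j" by blast
    then have "j = ps j" using r by (simp add: Aset_def)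
    then have "x = ps (j + 1)" using j rho_ps[of j] by simp
    moreover have "(i - j) mod (n + 1) < k" using j(1) by (simp add: Aset_def)
    ultimately show "x \<in> Aset (i + 1)" by (simp add: ps_mem_Aset)
  next
    assume x: "x \<in> Aset (i + 1)"
    then have "x = ps x" using r by (simp add: Aset_def)
    then have "x = rho (ps (x - 1))" using rho_ps[of "x - 1"] by simp
    moreover have "ps (x - 1) \<in> Aset i" using x by (simp add: ps_mem_Aset) (simp add: Aset_def algebra_simps)
    ultimately show "x \<in> rho ` Aset i" by blast
  qed
qed

lemma rho_Bset: "rho ` Bset i = Bset (i + 1)"
  unfolding Bset_def by (simp add: image_set_diff[OF rho_inj] rho_Aset rho_ps)

lemma Aset_period: "Aset (i + (n + 1)) = Aset i"
proof -
  have "(i + (n + 1) - j) mod (n + 1) = (i - j) mod (n + 1)" for j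
    using mod_add_self2[of "i - j" "n + 1"] by (simp add: algebra_simps)
  then show ?thesis by (simp add: Aset_def)
qed

lemma ps_period: "ps (i + (n + 1)) = ps i"
  by (rule ps_cong) simp

lemma ps_period_Suc: "ps (i + (n + 1) + 1) = ps (i + 1)"
proof -
  have "i + (n + 1) + 1 = i + 1 + (n + 1)" by simp
  then show ?thesis by (simp only: ps_period)
qed

lemma Bset_period: "Bset (i + (n + 1)) = Bset i"
  unfolding Bset_def Aset_period ps_period_Suc ps_period ..

lemma XX_period: "XX (i + (n + 1)) = XX i"
  unfolding XX_def ps_period_Suc ps_period ..

lemma Eop_period: "Eop (i + (n + 1)) = Eop i"
  unfolding Eop_def ps_period_Suc ps_period ..

lemma rot_Aset: "rot p (Aset i) = p (Aset (i + 1))"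
  by (simp add: rot_def rho_Aset)

lemma rot_Bset: "rot p (Bset i) = p (Bset (i + 1))"
  by (simp add: rot_def rho_Bset)

lemma XX_rot: "XX i a (rot p) = rot (XX (i + 1) a p)"
  unfolding XX_def rot_def by (simp add: Xpair_rotate[OF rho_inj] rho_ps)

lemma ec_rot: "ec i c (rot p) = rot (ec (i + 1) c p)"
  by (simp add: ec_def XX_rot rot_Aset rot_Bset)

lemma Eop_rot: "Eop i (rot p) = rot (Eop (i + 1) p)"
proof
  fix J
  have "XX i 1 (rot p) J = rot (XX (i + 1) 1 p) J" by (simp add: XX_rot)
  then show "Eop i (rot p) J = rot (Eop (i + 1) p) J" by (simp add: XX_Eop rot_def)
qed

lemma ec_scale: "c' \<noteq> 0 \<Longrightarrow> ec i c (\<lambda>J. c' * p J) = (\<lambda>J. c' * ec i c p J)"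
  by (simp add: ec_def XX_def Xpair_scale mult.left_commute)

lemma Eop_scale: "Eop i (\<lambda>J. c * p J) = (\<lambda>J. c * Eop i p J)"
  by (auto simp: Eop_def)

text \<open>An entry lies in a cyclic interval while its successor does not only at the upper end of
  the interval.\<close>

lemma Eop_Aset: "Eop i p (Aset m) = (if (m - i) mod (n + 1) = 0 then p (Bset i) else 0)"
proof (cases "(m - i) mod (n + 1) = 0")
  case True
  then have "Aset m = Aset i"
  proof -
    have "(m - j) mod (n + 1) = (i - j) mod (n + 1)" for j
      using True by (simp add: mod_eq_0_iff_dvd mod_eq_dvd_iff)
    then show ?thesis by (simp add: Aset_def)
  qed
  moreover have "ps i \<in> Aset i" "ps (i + 1) \<notin> Aset i"
    using k1 kn mod_pred[of i i] by (simp_all add: ps_mem_Aset)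
  ultimately show ?thesis using True by (simp add: Eop_def Bset_def)
next
  case False
  have "0 \<le> (m - i) mod (n + 1)" using n2 by simp
  then show ?thesis using False mod_pred[of m i] by (auto simp: Eop_def ps_mem_Aset)
qed

text \<open>\<open>Bset m\<close> is a cyclic interval whose last entry was moved from
  \<open>m\<close> to \<open>m + 1\<close>. Going upwards, membership can stop only after
  \<open>m - 1\<close> and after \<open>m + 1\<close>.\<close>

lemma Eop_Bset_zero:
  assumes "(m - i) mod (n + 1) \<noteq> 1" "(m - i) mod (n + 1) \<noteq> n"
  shows "Eop i p (Bset m) = 0"
  using assms mod_pred[of m i] n2 by (auto simp: Eop_def ps_mem_Bset Let_def)

text \<open>At these two sets the second-order terms vanish, so a raising step with one index does
  not change the derivative in the direction of the neighbouring index.\<close>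

lemma Eop_Eop_Bset:
  "Eop (i + 1) (Eop i p) (Bset i) = 0" "Eop i (Eop (i + 1) p) (Bset (i + 1)) = 0"
proof -
  have i: "ps i \<notin> Bset i" using n2 by (simp add: ps_mem_Bset)
  have "ps i \<notin> insert (ps (i + 1 + 1)) (Bset i - {ps (i + 1)})" using i ps_next_ne by auto
  then have "Eop i p (insert (ps (i + 1 + 1)) (Bset i - {ps (i + 1)})) = 0"
    by (simp only: Eop_def simp_thms if_False)
  then show "Eop (i + 1) (Eop i p) (Bset i) = 0" by (simp only: Eop_def[of "i + 1" "Eop i p"] if_cancel)
  have "ps (i + 1 + 1) \<in> Bset (i + 1)" by (simp add: Bset_def)
  then have "ps (i + 1 + 1) \<in> insert (ps (i + 1)) (Bset (i + 1) - {ps i})" using ps_next_ne[of i] by auto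
  then have "Eop (i + 1) p (insert (ps (i + 1)) (Bset (i + 1) - {ps i})) = 0"
    by (simp only: Eop_def simp_thms if_False)
  then show "Eop i (Eop (i + 1) p) (Bset (i + 1)) = 0" by (simp only: Eop_def[of i "Eop (i + 1) p"] if_cancel)
qed

lemma Eop_XX: "Eop j (XX i a p) J = Eop j p J + a * Eop j (Eop i p) J"
  by (simp add: Eop_def XX_Eop)

end

section \<open>The crystal functions on the cone and the three-term relation\<close>

lemma D_coord_cpos: "(\<And>s. x s \<in> cpos) \<Longrightarrow> D_coord b l i x \<in> cpos"
  unfolding D_coord_def by (intro cpos_divide cpos_mult cpos_prod cpos_power)

lemma den_cpos:
  assumes "\<And>s. x s \<in> cpos" "c \<in> cpos" "a \<le> b"
  shows "den a b i c x l \<in> cpos"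
  unfolding den_def using assms by (intro cpos_sum cpos_divide D_coord_cpos) auto

lemma eps_cpos: "(\<And>s. x s \<in> cpos) \<Longrightarrow> a \<le> b \<Longrightarrow> eps_coord a b i x \<in> cpos"
  unfolding eps_coord_def by (intro cpos_sum cpos_divide D_coord_cpos) auto

lemma e_coord_tpos:
  assumes x: "x \<in> tpos S" and c: "c \<in> cpos" and ab: "a \<le> b" and S: "\<And>l. (l, i) \<in> S \<Longrightarrow> a \<le> l \<and> l \<le> b"
  shows "e_coord S a b i c x \<in> tpos S"
proof (rule tposI)
  fix s assume s: "s \<in> S"
  obtain l m where lm: "s = (l, m)" by (cases s)
  note xp = tpos_cpos[OF x]
  show "e_coord S a b i c x s \<in> cpos"
  proof (cases "m = i")
    case True
    then have "e_coord S a b i c x s = x (l, i) * (den a b i c x (l - 1) / den a b i c x l)"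
      using e_coord_eq[of a l b i S c x] S s lm by auto
    then show ?thesis using xp c ab by (auto intro!: cpos_mult cpos_divide den_cpos)
  next
    case False
    then show ?thesis unfolding lm using xp by (simp add: e_coord_other)
  qed
next
  fix s assume "s \<notin> S"
  then show "e_coord S a b i c x s = 1"
    using e_coord_other[of "snd s" i "fst s" S] tpos_torus[OF x] by (cases s) (auto simp: torus_def)
qed

context grassmann
begin

lemma e_coord1_tpos:
  assumes "x \<in> tpos (S1 n k)" "c \<in> cpos" "1 \<le> i" "i \<le> n"
  shows "e_coord (S1 n k) (a1 k i) (b1 n k i) i c x \<in> tpos (S1 n k)"
  using assms a1_b1[OF assms(3,4)] mem_S1_iff[OF assms(3,4)] by (intro e_coord_tpos) auto

lemma Qprod_cpos: "x \<in> tpos (S1 n k) \<Longrightarrow> Qprod i x \<in> cpos"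
  unfolding Qprod_def by (intro cpos_prod tpos_cpos)

lemma v1_e_coord_pos:
  assumes x: "x \<in> tpos (S1 n k)" and c: "c \<in> cpos" and i: "1 \<le> i" "i \<le> n"
  shows "XX i ((c - 1) / eps_coord (a1 k i) (b1 n k i) i x) (v1 n k x) =
    v1 n k (e_coord (S1 n k) (a1 k i) (b1 n k i) i c x)"
proof -
  have "ps i = i" "ps (i + 1) = i + 1" using i by (simp_all add: ps_id)
  moreover have "den (a1 k i) (b1 n k i) i c x l \<noteq> 0" for l
    by (rule cpos_nonzero, rule den_cpos) (use tpos_cpos[OF x] c a1_b1[OF i] in auto)
  ultimately show ?thesis
    unfolding XX_def using v1_e_coord[OF tpos_torus[OF x] i] by simp
qed

text \<open>Compare the coefficients at \<open>Aset i\<close> for \<open>c = 2\<close>: raising adds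
  the coefficient at \<open>Bset i\<close> divided by \<open>eps\<close>, while the new coordinates
  double \<open>Qprod i\<close>.\<close>

lemma v1_Bset:
  assumes x: "x \<in> tpos (S1 n k)" and i: "1 \<le> i" "i \<le> n"
  shows "v1 n k x (Bset i) = eps_coord (a1 k i) (b1 n k i) i x * Qprod i x"
proof -
  let ?e = "eps_coord (a1 k i) (b1 n k i) i x" and ?x = "e_coord (S1 n k) (a1 k i) (b1 n k i) i 2 x"
  have two: "(2::complex) \<in> cpos" using cpos_add[OF cpos_one cpos_one] by simp
  have e0: "?e \<noteq> 0" by (rule cpos_nonzero, rule eps_cpos) (use tpos_cpos[OF x] a1_b1[OF i] in auto)
  have x': "?x \<in> tpos (S1 n k)" by (rule e_coord1_tpos[OF x two i])
  have d0: "den (a1 k i) (b1 n k i) i 2 x l \<noteq> 0" for l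
    by (rule cpos_nonzero, rule den_cpos) (use tpos_cpos[OF x] two a1_b1[OF i] in auto)
  have "v1 n k ?x (Aset i) = v1 n k x (Aset i) + (2 - 1) / ?e * v1 n k x (Bset i)"
    using v1_e_coord_pos[OF x two i] by (simp add: XX_Eop Eop_Aset flip: v1_e_coord_pos[OF x two i])
  moreover have "v1 n k ?x (Aset i) = 2 * Qprod i x"
    using Qprod_e_coord[OF tpos_torus[OF x] i d0] v1_Aset[OF tpos_torus[OF x'], of i] i by simp
  ultimately show ?thesis
    using v1_Aset[OF tpos_torus[OF x], of i] i e0 by (simp add: field_simps)
qed

lemma ec_v1:
  assumes x: "x \<in> tpos (S1 n k)" and c: "c \<in> cpos" and i: "1 \<le> i" "i \<le> n"
  shows "ec i c (v1 n k x) = v1 n k (e_coord (S1 n k) (a1 k i) (b1 n k i) i c x)"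
proof -
  have "v1 n k x (Aset i) / v1 n k x (Bset i) = 1 / eps_coord (a1 k i) (b1 n k i) i x"
    using v1_Bset[OF x i] v1_Aset[OF tpos_torus[OF x], of i] i cpos_nonzero[OF Qprod_cpos[OF x]] by simp
  then have "(c - 1) * v1 n k x (Aset i) / v1 n k x (Bset i) = (c - 1) / eps_coord (a1 k i) (b1 n k i) i x"
    by (metis mult.right_neutral times_divide_eq_right)
  then show ?thesis unfolding ec_def using v1_e_coord_pos[OF x c i] by simp
qed

definition good :: "int \<Rightarrow> bool" where
  "good i \<longleftrightarrow> (\<forall>p\<in>cone. p (Aset i) \<in> cpos \<and> p (Bset i) \<in> cpos \<and> (\<forall>c\<in>cpos. ec i c p \<in> cone))"

definition three_term :: "int \<Rightarrow> bool" where
  "three_term i \<longleftrightarrow> (\<forall>p\<in>cone. p (Aset i) * Eop i p (Bset (i + 1)) + p (Aset (i + 1)) * Eop (i + 1) p (Bset i)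
     = p (Bset i) * p (Bset (i + 1)))"

lemma good_range:
  assumes i: "1 \<le> i" "i \<le> n" shows "good i"
  unfolding good_def
proof (intro ballI conjI)
  fix p assume "p \<in> cone"
  then obtain d x where d: "d \<in> cpos" "x \<in> tpos (S1 n k)" "p = (\<lambda>J. d * v1 n k x J)" by (rule coneE)
  show "p (Aset i) \<in> cpos"
    using d i Qprod_cpos by (simp add: v1_Aset[OF tpos_torus[OF d(2)]] cpos_mult)
  show "p (Bset i) \<in> cpos"
    using d i Qprod_cpos tpos_cpos[OF d(2)] a1_b1[OF i] by (simp add: v1_Bset cpos_mult eps_cpos)
  show "ec i c p \<in> cone" if "c \<in> cpos" for c
    unfolding d(3) ec_scale[OF cpos_nonzero[OF d(1)]] ec_v1[OF d(2) that i]
    by (intro coneI d(1) e_coord1_tpos d(2) that i)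
qed

text \<open>Writing a point of the cone as a rotated point of the cone raises all indices by one, so
  the property for \<open>i\<close> applies.\<close>

lemma good_pred: "good i \<Longrightarrow> good (i - 1)"
  unfolding good_def
proof (intro ballI conjI)
  fix p assume g: "\<forall>p\<in>cone. p (Aset i) \<in> cpos \<and> p (Bset i) \<in> cpos \<and> (\<forall>c\<in>cpos. ec i c p \<in> cone)"
  assume "p \<in> cone"
  then obtain p' where p': "p' \<in> cone" "p = rot p'" by (rule cone_unrot)
  show "p (Aset (i - 1)) \<in> cpos" "p (Bset (i - 1)) \<in> cpos"
    using g p' by (simp_all add: rot_Aset rot_Bset)
  show "ec (i - 1) c p \<in> cone" if "c \<in> cpos" for c
    using g p' that by (simp add: ec_rot cone_rot)
qed

lemma three_term_pred: "three_term i \<Longrightarrow> three_term (i - 1)"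
  unfolding three_term_def
proof (intro ballI)
  fix p assume g: "\<forall>p\<in>cone. p (Aset i) * Eop i p (Bset (i + 1)) + p (Aset (i + 1)) * Eop (i + 1) p (Bset i)
     = p (Bset i) * p (Bset (i + 1))"
  assume "p \<in> cone"
  then obtain p' where p': "p' \<in> cone" "p = rot p'" by (rule cone_unrot)
  then show "p (Aset (i - 1)) * Eop (i - 1) p (Bset (i - 1 + 1)) + p (Aset (i - 1 + 1)) * Eop (i - 1 + 1) p (Bset (i - 1))
     = p (Bset (i - 1)) * p (Bset (i - 1 + 1))"
    using g by (simp add: rot_Aset rot_Bset Eop_rot)
qed

text \<open>Rotation only lets a property descend; subtracting a large multiple of the period brings
  every index below 1.\<close>

lemma cyclic_descent:
  assumes "P 1" "\<And>i. P i \<Longrightarrow> P (i - 1)" "\<And>i. P (i + (n + 1)) \<longleftrightarrow> P i"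
  shows "P (i :: int)"
proof -
  have low: "P i" if "i \<le> 1" for i
    using that by (induction i rule: int_le_induct) (use assms in auto)
  have per: "P (i + (n + 1) * int m) \<longleftrightarrow> P i" for i m
  proof (induction m)
    case (Suc m)
    have eq: "i + (n + 1) * int (Suc m) = i + (n + 1) * int m + (n + 1)" by (simp add: algebra_simps)
    show ?case unfolding eq assms(3) by (rule Suc)
  qed simp
  let ?m = "nat (max 0 i)"
  have "(n + 1) * int ?m \<ge> i" using n2 mult_right_mono[of 1 "n + 1" "max 0 i"] by simp
  then have "P (i - (n + 1) * int ?m)" by (intro low) simp
  then show ?thesis using per[of "i - (n + 1) * int ?m" ?m] by simp
qed

lemma good: "good i"
proof (rule cyclic_descent[of good])
  have "good (i + (n + 1)) \<longleftrightarrow> good i" for i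
    unfolding good_def ec_def Aset_period Bset_period XX_period ..
  then show "\<And>i. good (i + (n + 1)) \<longleftrightarrow> good i" .
qed (use good_range[of 1] n2 good_pred in auto)

text \<open>The comparison of \<open>v1_Bset\<close>, now at \<open>Bset i\<close> for the action
  with index \<open>j\<close>: it adds \<open>Eop j p (Bset i) / eps_j\<close> and leaves column
  \<open>i\<close>, hence \<open>Qprod i\<close>, unchanged.\<close>

lemma eps_step:
  assumes x: "x \<in> tpos (S1 n k)" and i: "1 \<le> i" "i \<le> n" and j: "1 \<le> j" "j \<le> n" and "i \<noteq> j"
  shows "Eop j (v1 n k x) (Bset i) = Qprod i x * eps_coord (a1 k j) (b1 n k j) j x *
     (eps_coord (a1 k i) (b1 n k i) i (e_coord (S1 n k) (a1 k j) (b1 n k j) j 2 x) - eps_coord (a1 k i) (b1 n k i) i x)"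
proof -
  let ?e = "eps_coord (a1 k j) (b1 n k j) j x" and ?x = "e_coord (S1 n k) (a1 k j) (b1 n k j) j 2 x"
  have two: "(2::complex) \<in> cpos" using cpos_add[OF cpos_one cpos_one] by simp
  have e0: "?e \<noteq> 0" by (rule cpos_nonzero, rule eps_cpos) (use tpos_cpos[OF x] a1_b1[OF j] in auto)
  have x': "?x \<in> tpos (S1 n k)" by (rule e_coord1_tpos[OF x two j])
  have "Qprod i ?x = Qprod i x"
    unfolding Qprod_def by (intro prod.cong refl e_coord_other) (use assms(6) in auto)
  then have "v1 n k ?x (Bset i) = Qprod i x * eps_coord (a1 k i) (b1 n k i) i ?x"
    using v1_Bset[OF x' i] by simp
  moreover have "v1 n k ?x (Bset i) = v1 n k x (Bset i) + (2 - 1) / ?e * Eop j (v1 n k x) (Bset i)"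
    by (simp add: XX_Eop flip: v1_e_coord_pos[OF x two j])
  ultimately show ?thesis using v1_Bset[OF x i] e0 by (simp add: field_simps)
qed

text \<open>The three-term relation for index 1 after inserting \<open>eps_step\<close>: taking
  \<open>2\<close> off the factor \<open>3\<close> leaves the product of the two epsilons. It can be
  checked by hand because column 1 has a single variable and column 2 at most two.\<close>

lemma eps_ratio:
  assumes x: "x \<in> tpos (S1 n k)"
  defines "x' \<equiv> e_coord (S1 n k) (a1 k 2) (b1 n k 2) 2 2 x"
    and "x'' \<equiv> e_coord (S1 n k) (a1 k 1) (b1 n k 1) 1 2 x"
  shows "eps_coord (a1 k 2) (b1 n k 2) 2 x'' * eps_coord (a1 k 1) (b1 n k 1) 1 x
     + eps_coord (a1 k 1) (b1 n k 1) 1 x' * eps_coord (a1 k 2) (b1 n k 2) 2 x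
     = 3 * (eps_coord (a1 k 1) (b1 n k 1) 1 x * eps_coord (a1 k 2) (b1 n k 2) 2 x)"
proof -
  have xt: "x \<in> torus (S1 n k)" by (rule tpos_torus[OF x])
  have x0: "x s \<noteq> 0" for s by (rule torusD(1)[OF xt])
  have ab1: "a1 k 1 = k" "b1 n k 1 = k" using k1 kn by (auto simp: a1_def b1_def)
  have out: "x (l, m) = 1" if "(l, m) \<notin> S1 n k" for l m by (rule torusD(2)[OF xt that])
  have o1: "x (k + 1, m) = 1" for m by (rule out) (simp add: S1_def)
  have o0: "x (l, 0) = 1" for l by (rule out) (auto simp: S1_def)
  have same': "x' (l, m) = x (l, m)" if "m \<noteq> 2" for l m unfolding x'_def by (rule e_coord_other) (use that in simp)
  have same'': "x'' (l, m) = x (l, m)" if "m \<noteq> 1 \<or> (l, m) \<notin> S1 n k" for l m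
    unfolding x''_def by (rule e_coord_other) (use that in simp)
  have E1: "eps_coord k k 1 z = z (k, 2) / z (k, 1) * z (k + 1, 0)" for z
    by (simp add: eps_coord_def D_coord_def)
  have x''k: "x'' (k, 1) = 2 * x (k, 1)"
  proof -
    have "(k, 1) \<in> S1 n k" using k1 kn by (simp add: S1_def)
    then have "x'' (k, 1) = x (k, 1) * (den k k 1 2 x (k - 1) / den k k 1 2 x k)"
      unfolding x''_def ab1 by (intro e_coord_eq) auto
    moreover have "den k k 1 2 x k \<noteq> 0"
      using x0 D_coord_nonzero[OF x0] by (simp add: den_def)
    ultimately show ?thesis using den_first[of "k - 1" k k 1 2 x] den_last[of k k k 1 2 x] by simp
  qed
  \<comment> \<open>Column 2 consists of row \<open>k\<close> only, of row \<open>k - 1\<close>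
    only, or of both.\<close>
  consider "k = 1" | "k = n" "k \<noteq> 1" | "2 \<le> k" "k < n" using k1 kn by linarith
  then show ?thesis
  proof cases
    case 1
    then have ab2: "a1 k 2 = 1" "b1 n k 2 = 1" using n2 by (auto simp: a1_def b1_def)
    have E2: "eps_coord 1 1 2 z = z (1, 3) / z (1, 2) * z (2, 1)" for z
      by (simp add: eps_coord_def D_coord_def)
    have "(1, 2) \<in> S1 n k" using 1 n2 by (simp add: S1_def)
    then have "x' (1, 2) = x (1, 2) * (den 1 1 2 2 x (1 - 1) / den 1 1 2 2 x 1)"
      unfolding x'_def ab2 by (intro e_coord_eq) auto
    moreover have "den 1 1 2 2 x 1 \<noteq> 0" using D_coord_nonzero[OF x0] by (simp add: den_def)
    ultimately have x'k: "x' (1, 2) = 2 * x (1, 2)"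
      using den_first[of 0 1 1 2 2 x] den_last[of 1 1 1 2 2 x] by simp
    have "x'' (2, 1) = x (2, 1)" by (rule same'') (use 1 in \<open>auto simp: S1_def\<close>)
    then show ?thesis
      unfolding ab1 ab2 E2 unfolding 1 E1[unfolded 1] using x'k same' same'' x0 by (simp add: field_simps)
  next
    case 2
    then have ab2: "a1 k 2 = k - 1" "b1 n k 2 = k - 1" using n2 by (auto simp: a1_def b1_def)
    have E2: "eps_coord (k - 1) (k - 1) 2 z = z (k - 1, 3) * z (k, 1) / z (k - 1, 2)" for z
      by (simp add: eps_coord_def D_coord_def)
    have "(k, 2) \<notin> S1 n k" using 2 by (simp add: S1_def)
    then have "x' (k, 2) = x (k, 2)" unfolding x'_def by (intro e_coord_other) simp
    then show ?thesis
      unfolding ab1 ab2 E1 E2 using same' same'' x''k x0 by (simp add: field_simps)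
  next
    case 3
    then have ab2: "a1 k 2 = k - 1" "b1 n k 2 = k" by (auto simp: a1_def b1_def)
    have kk: "{k - 1..k} = {k - 1, k}" "{k..k + 1} = {k, k + 1}" by auto
    have x''k1: "x'' (k + 1, 1) = 1" using same''[of 1 "k + 1"] o1 by (simp add: S1_def)
    \<comment> \<open>The two summands of \<open>eps\<close> for index 2. The action with index 1
      doubles \<open>u\<close>; the action with index 2 multiplies \<open>x(k, 2)\<close>, and with
      it \<open>eps\<close> for index 1, by \<open>(u + 2 w) / (u + w)\<close>.\<close>
    define u w where "u = 1 / D_coord k (k - 1) 2 x" and "w = 1 / D_coord k k 2 x"
    have "D_coord k (k - 1) 2 x'' = D_coord k (k - 1) 2 x / 2"
      using same'' x''k o1 x''k1 by (simp add: D_coord_def kk S1_def)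
    moreover have "D_coord k k 2 x'' = D_coord k k 2 x"
      using same'' o1 x''k1 by (simp add: D_coord_def S1_def)
    ultimately have "1 / D_coord k (k - 1) 2 x'' = 2 * u" "1 / D_coord k k 2 x'' = w"
      by (simp_all only: u_def w_def) simp
    then have e2'': "eps_coord (k - 1) k 2 x'' = 2 * u + w" by (simp add: eps_coord_def kk)
    have e2: "eps_coord (k - 1) k 2 x = u + w" by (simp add: eps_coord_def kk u_def w_def)
    have dk: "den (k - 1) k 2 2 x k = u + w" "den (k - 1) k 2 2 x (k - 1) = u + 2 * w"
      by (simp_all add: den_def kk u_def w_def)
    have nz: "u + w \<noteq> 0"
      using cpos_nonzero[OF eps_cpos[of x "k - 1" k 2]] tpos_cpos[OF x] e2 by simp
    have "(k, 2) \<in> S1 n k" using 3 by (simp add: S1_def)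
    then have "x' (k, 2) = x (k, 2) * (den (k - 1) k 2 2 x (k - 1) / den (k - 1) k 2 2 x k)"
      unfolding x'_def ab2 by (intro e_coord_eq) auto
    then have x'k: "x' (k, 2) * (u + w) = x (k, 2) * (u + 2 * w)" using nz by (simp add: dk)
    have "eps_coord k k 1 x' * (u + w) = x (k, 2) * (u + 2 * w) / x (k, 1) * x (k + 1, 0)"
      unfolding E1 using x'k same' by simp
    then show ?thesis
      unfolding ab1 ab2 e2 e2'' unfolding E1[of x] using x0 by (simp add: field_simps)
  qed
qed

lemma three_term_one: "three_term 1"
  unfolding three_term_def
proof
  fix p assume "p \<in> cone"
  then obtain d x where d: "d \<in> cpos" "x \<in> tpos (S1 n k)" "p = (\<lambda>J. d * v1 n k x J)" by (rule coneE)
  have i: "(1::int) \<le> 1" "1 \<le> n" "(1::int) \<le> 2" "2 \<le> n" using n2 by auto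
  define Q1 Q2 E1 E2 where "Q1 = Qprod 1 x" and "Q2 = Qprod 2 x"
    and "E1 = eps_coord (a1 k 1) (b1 n k 1) 1 x" and "E2 = eps_coord (a1 k 2) (b1 n k 2) 2 x"
  define F1 F2 where "F1 = eps_coord (a1 k 1) (b1 n k 1) 1 (e_coord (S1 n k) (a1 k 2) (b1 n k 2) 2 2 x)"
    and "F2 = eps_coord (a1 k 2) (b1 n k 2) 2 (e_coord (S1 n k) (a1 k 1) (b1 n k 1) 1 2 x)"
  have F: "F2 * E1 + F1 * E2 = 3 * (E1 * E2)"
    unfolding E1_def E2_def F1_def F2_def by (rule eps_ratio[OF d(2)])
  have A: "v1 n k x (Aset 1) = Q1" "v1 n k x (Aset 2) = Q2"
    unfolding Q1_def Q2_def by (rule v1_Aset[OF tpos_torus[OF d(2)]]; use n2 in simp)+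
  have B: "v1 n k x (Bset 1) = E1 * Q1" "v1 n k x (Bset 2) = E2 * Q2"
    unfolding Q1_def Q2_def E1_def E2_def by (rule v1_Bset[OF d(2)]; use n2 in simp)+
  have T: "Eop 2 (v1 n k x) (Bset 1) = Q1 * E2 * (F1 - E1)" "Eop 1 (v1 n k x) (Bset 2) = Q2 * E1 * (F2 - E2)"
    unfolding Q1_def Q2_def E1_def E2_def F1_def F2_def by (rule eps_step[OF d(2)]; use n2 in simp)+
  let ?L = "Q1 * (Q2 * E1 * (F2 - E2)) + Q2 * (Q1 * E2 * (F1 - E1))"
  have "?L = Q1 * Q2 * ((F2 * E1 + F1 * E2) - 2 * (E1 * E2))"
    by (simp add: algebra_simps)
  also have "\<dots> = E1 * Q1 * (E2 * Q2)" unfolding F by (simp add: algebra_simps)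
  finally have key: "?L = E1 * Q1 * (E2 * Q2)" .
  have "p (Aset 1) * Eop 1 p (Bset 2) + p (Aset 2) * Eop 2 p (Bset 1) = d * d * ?L"
    unfolding d(3) Eop_scale A T by (simp add: algebra_simps)
  also have "\<dots> = p (Bset 1) * p (Bset 2)" unfolding key d(3) B by simp
  finally show "p (Aset 1) * Eop 1 p (Bset (1 + 1)) + p (Aset (1 + 1)) * Eop (1 + 1) p (Bset 1) = p (Bset 1) * p (Bset (1 + 1))"
    by simp
qed

lemma three_term: "three_term i"
proof (rule cyclic_descent[of three_term])
  have "three_term (i + (n + 1)) \<longleftrightarrow> three_term i" for i
  proof -
    have "i + (n + 1) + 1 = i + 1 + (n + 1)" by simp
    then show ?thesis
      unfolding three_term_def by (simp only: Aset_period Bset_period Eop_period)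
  qed
  then show "\<And>i. three_term (i + (n + 1)) \<longleftrightarrow> three_term i" .
qed (use three_term_one three_term_pred in auto)

lemma goodD:
  assumes "p \<in> cone"
  shows "p (Aset i) \<in> cpos" "p (Bset i) \<in> cpos" "c \<in> cpos \<Longrightarrow> ec i c p \<in> cone"
  using good[of i] assms by (auto simp: good_def)

section \<open>Relations on the cone\<close>

lemma ec_one: "ec i 1 p = p"
  by (simp add: ec_def XX_def Xpair_def fun_eq_iff)

lemma XX_add: "XX i a (XX i b p) = XX i (a + b) p"
  unfolding XX_def by (rule Xpair_add[OF ps_next_ne(1)])

lemma ec_Aset:
  assumes "p (Bset i) \<noteq> 0"
  shows "ec i c p (Aset m) = (if (m - i) mod (n + 1) = 0 then c * p (Aset m) else p (Aset m))"
proof (cases "(m - i) mod (n + 1) = 0")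
  case True
  then have "Aset m = Aset i"
  proof -
    have "(m - j) mod (n + 1) = (i - j) mod (n + 1)" for j
      using True by (simp add: mod_eq_0_iff_dvd mod_eq_dvd_iff)
    then show ?thesis by (simp add: Aset_def)
  qed
  then show ?thesis using True assms by (simp add: ec_def XX_Eop Eop_Aset) (simp add: field_simps)
qed (simp add: ec_def XX_Eop Eop_Aset)

lemma ec_Bset:
  assumes "(m - i) mod (n + 1) \<noteq> 1" "(m - i) mod (n + 1) \<noteq> n"
  shows "ec i c p (Bset m) = p (Bset m)"
  by (simp add: ec_def XX_Eop Eop_Bset_zero[OF assms])

lemma ec_Bset_self: "ec i c p (Bset i) = p (Bset i)"
  by (rule ec_Bset) (use n2 in auto)

lemma ec_mult:
  assumes p: "p \<in> cone"
  shows "ec i c (ec i d p) = ec i (c * d) p"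
proof -
  have B: "p (Bset i) \<noteq> 0" using goodD(2)[OF p] cpos_nonzero by blast
  have "ec i c (ec i d p) = XX i ((c - 1) * (d * p (Aset i)) / p (Bset i) + (d - 1) * p (Aset i) / p (Bset i)) p"
    unfolding ec_def[of i c] ec_Bset_self ec_Aset[of p i, OF B] by (simp add: ec_def XX_add)
  also have "(c - 1) * (d * p (Aset i)) / p (Bset i) + (d - 1) * p (Aset i) / p (Bset i)
      = (c * d - 1) * p (Aset i) / p (Bset i)"
    using B by (simp add: field_simps)
  finally show ?thesis by (simp add: ec_def)
qed

lemma ec_commute:
  assumes p: "p \<in> cone" and ij: "(i - j) mod (n + 1) \<noteq> 0" "(i - j) mod (n + 1) \<noteq> 1" "(i - j) mod (n + 1) \<noteq> n"
  shows "ec i c (ec j d p) = ec j d (ec i c p)"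
proof -
  have neg: "(j - i) mod (n + 1) = n + 1 - (i - j) mod (n + 1)"
    using zmod_zminus1_eq_if[of "i - j" "n + 1"] ij(1) by simp
  have ji: "(j - i) mod (n + 1) \<noteq> 0" "(j - i) mod (n + 1) \<noteq> 1" "(j - i) mod (n + 1) \<noteq> n"
    using neg ij pos_mod_bound[of "n + 1" "i - j"] n2 by auto
  have B: "p (Bset i) \<noteq> 0" "p (Bset j) \<noteq> 0" using goodD(2)[OF p] cpos_nonzero by blast+
  have ne: "ps i \<noteq> ps j" "ps i \<noteq> ps (j + 1)" "ps (i + 1) \<noteq> ps j" "ps (i + 1) \<noteq> ps (j + 1)"
  proof -
    have z: "(n::int) \<noteq> 0" using n2 by simp
    show "ps i \<noteq> ps j" "ps i \<noteq> ps (j + 1)"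
      using ij mod_pred[of i j] unfolding ps_eq_iff by (simp_all split: if_splits)
    show "ps (i + 1) \<noteq> ps j"
      using ji mod_pred[of j i] unfolding ps_eq_iff[of j "i + 1"] eq_commute[of "ps (i + 1)"] by (simp split: if_splits)
    show "ps (i + 1) \<noteq> ps (j + 1)" using ij unfolding ps_eq_iff by simp
  qed
  have "XX i a (XX j b p) = XX j b (XX i a p)" for a b
    unfolding XX_def by (rule Xpair_disjoint) (use ne ps_next_ne in auto)
  moreover have "ec j d p (Aset i) = p (Aset i)" "ec i c p (Aset j) = p (Aset j)"
    using ij ji by (simp_all add: ec_Aset B)
  moreover have "ec j d p (Bset i) = p (Bset i)" "ec i c p (Bset j) = p (Bset j)"
    using ij ji by (simp_all add: ec_Bset)
  ultimately show ?thesis by (simp add: ec_def)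
qed

text \<open>Both sides are three successive raising steps. Their parameters are found by following
  the coefficients at \<open>Aset\<close>, which are multiplied by known factors, and at
  \<open>Bset\<close>, which change by first-order terms with constant derivatives \<open>V\<close>
  and \<open>T\<close>. Then \<open>three_term\<close> and \<open>verma_scalars\<close> provide the
  scalars for \<open>Xpair_braid\<close>.\<close>

lemma ec_braid:
  assumes p: "p \<in> cone" and c: "c \<in> cpos" and d: "d \<in> cpos"
  shows "ec i c (ec (i + 1) (c * d) (ec i d p)) = ec (i + 1) d (ec i (c * d) (ec (i + 1) c p))"
proof -
  let ?j = "i + 1"
  define qi qj ri rj V T where "qi = p (Aset i)" and "qj = p (Aset ?j)" and "ri = p (Bset i)" and "rj = p (Bset ?j)"
    and "V = Eop i p (Bset ?j)" and "T = Eop ?j p (Bset i)"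
  have cd: "c * d \<in> cpos" by (rule cpos_mult[OF c d])
  have m: "(i - ?j) mod (n + 1) \<noteq> 0" "(?j - i) mod (n + 1) \<noteq> 0"
    using n2 zmod_minus1[of "n + 1"] by simp_all
  note Bnz = cpos_nonzero[OF goodD(2)]
  define f3 where "f3 = (d - 1) * qi / ri"
  define p1 where "p1 = XX i f3 p"
  have p1: "ec i d p = p1" by (simp add: ec_def p1_def f3_def qi_def ri_def)
  have p1c: "p1 \<in> cone" using goodD(3)[OF p d, of i] by (simp add: p1)
  have A1: "p1 (Aset i) = d * qi" "p1 (Aset ?j) = qj"
    unfolding p1[symmetric] using ec_Aset[of p i d, OF Bnz[OF p]] m by (simp_all add: qi_def qj_def)
  have B1: "p1 (Bset i) = ri" "p1 (Bset ?j) = rj + f3 * V"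
    unfolding p1[symmetric] by (simp_all add: ec_Bset_self ri_def) (simp add: p1 p1_def XX_Eop rj_def V_def)
  have T1: "Eop ?j p1 (Bset i) = T" unfolding p1_def Eop_XX by (simp add: Eop_Eop_Bset T_def)
  define f2 where "f2 = (c * d - 1) * qj / (rj + f3 * V)"
  define p2 where "p2 = XX ?j f2 p1"
  have p2: "ec ?j (c * d) p1 = p2" by (simp add: ec_def p2_def f2_def A1 B1)
  have p2c: "p2 \<in> cone" using goodD(3)[OF p1c cd, of ?j] by (simp add: p2)
  have A2: "p2 (Aset i) = d * qi"
    unfolding p2[symmetric] using ec_Aset[of p1 ?j "c * d", OF Bnz[OF p1c]] m by (simp add: A1)
  have B2: "p2 (Bset i) = ri + f2 * T" by (simp add: p2_def XX_Eop B1 T1)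
  define f1 where "f1 = (c - 1) * (d * qi) / (ri + f2 * T)"
  have L: "ec i c p2 = XX i f1 p2" by (simp add: ec_def f1_def A2 B2)
  define g3 where "g3 = (c - 1) * qj / rj"
  define r1 where "r1 = XX ?j g3 p"
  have r1: "ec ?j c p = r1" by (simp add: ec_def r1_def g3_def qj_def rj_def)
  have r1c: "r1 \<in> cone" using goodD(3)[OF p c, of ?j] by (simp add: r1)
  have A3: "r1 (Aset i) = qi" "r1 (Aset ?j) = c * qj"
    unfolding r1[symmetric] using ec_Aset[of p ?j c, OF Bnz[OF p]] m by (simp_all add: qi_def qj_def)
  have B3: "r1 (Bset ?j) = rj" "r1 (Bset i) = ri + g3 * T"
    unfolding r1[symmetric] by (simp_all add: ec_Bset_self rj_def) (simp add: r1 r1_def XX_Eop ri_def T_def)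
  have V3: "Eop i r1 (Bset ?j) = V" unfolding r1_def Eop_XX by (simp add: Eop_Eop_Bset V_def)
  define g2 where "g2 = (c * d - 1) * qi / (ri + g3 * T)"
  define r2 where "r2 = XX i g2 r1"
  have r2: "ec i (c * d) r1 = r2" by (simp add: ec_def r2_def g2_def A3 B3)
  have r2c: "r2 \<in> cone" using goodD(3)[OF r1c cd, of i] by (simp add: r2)
  have A4: "r2 (Aset ?j) = c * qj"
    unfolding r2[symmetric] using ec_Aset[of r1 i "c * d", OF Bnz[OF r1c]] m by (simp add: A3)
  have B4: "r2 (Bset ?j) = rj + g2 * V" by (simp add: r2_def XX_Eop B3 V3)
  define g1 where "g1 = (d - 1) * (c * qj) / (rj + g2 * V)"
  have R: "ec ?j d r2 = XX ?j g1 r2" by (simp add: ec_def g1_def A4 B4)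
  have rel: "qi * V + qj * T = ri * rj"
    using three_term[of i] p unfolding three_term_def qi_def qj_def ri_def rj_def V_def T_def by blast
  have nz: "ri \<noteq> 0" "rj \<noteq> 0" "rj + f3 * V \<noteq> 0" "ri + f2 * T \<noteq> 0" "ri + g3 * T \<noteq> 0" "rj + g2 * V \<noteq> 0"
    using Bnz[OF p] Bnz[OF p1c, of ?j] Bnz[OF p2c, of i] Bnz[OF r1c, of i] Bnz[OF r2c, of ?j]
    by (simp_all add: ri_def rj_def B1 B2 B3 B4)
  note sc = verma_scalars[OF nz(1,2) rel f3_def f2_def f1_def g3_def g2_def g1_def nz(3-6)
      cpos_nonzero[OF c] cpos_nonzero[OF d]]
  have "XX i f1 (XX ?j f2 (XX i f3 p)) = XX ?j g1 (XX i g2 (XX ?j g3 p))"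
    unfolding XX_def by (rule Xpair_braid[OF ps_next_ne(1) ps_next_ne(1) ps_next_ne(2) sc])
  then show ?thesis
    unfolding p1 p2 L r1 r2 R unfolding p2_def p1_def r2_def r1_def .
qed

end

lemma reg_cong:
  assumes "reg X D f" "\<And>p. p \<in> X \<Longrightarrow> f p = g p"
  shows "reg X D g"
proof -
  obtain N M where NM: "N \<in> poly_fun" "M \<in> poly_fun" "frac_on (X \<inter> nz D) N M f" by (rule regE[OF assms(1)])
  show ?thesis
  proof (rule regI[OF NM(1,2)])
    fix p assume p: "p \<in> X" "p \<in> nz D"
    show "M p \<noteq> 0 \<and> g p = N p / M p" using frac_onD[OF NM(3) p] assms(2)[OF p(1)] by simp
  qed
qed

lemma mor_cong:
  assumes X: "pos_dense X P" and \<phi>: "mor X P Y Q \<phi>" and eq: "\<And>p. p \<in> X \<Longrightarrow> \<phi> p = \<psi> p"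
  shows "mor X P Y Q \<psi>"
proof -
  obtain D where D: "D \<in> poly_fun" "P \<subseteq> nz D" "\<phi> ` (X \<inter> nz D) \<subseteq> Y" "reg_map X D \<phi>" "\<phi> ` P \<subseteq> Q"
    by (rule morE[OF \<phi>])
  show ?thesis
  proof (rule morI[OF D(1,2)])
    show "\<psi> ` (X \<inter> nz D) \<subseteq> Y" using D(3) eq by fastforce
    show "reg_map X D \<psi>"
      by (rule reg_mapI, rule reg_cong[OF reg_mapD[OF D(4)]]) (simp add: eq)
    show "\<psi> ` P \<subseteq> Q" using D(5) eq pos_dense_subset[OF X] by fastforce
  qed
qed

text \<open>A polynomial composed with the map is a fraction whose denominator vanishes nowhere on
  \<open>X\<close>, so its nonvanishing set is cut out by the numerator.\<close>

lemma pos_dense_image: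
  assumes X: "pos_dense X P" and \<phi>: "reg_map X (\<lambda>_. 1) \<phi>"
  shows "pos_dense (\<phi> ` X) (\<phi> ` P)"
proof -
  have pull: "\<exists>g\<in>poly_fun. X \<inter> nz g = X \<inter> {p. \<phi> p \<in> nz f}" if f: "f \<in> poly_fun" for f
  proof -
    obtain N M where NM: "N \<in> poly_fun" "M \<in> poly_fun" "frac_on (X \<inter> nz (\<lambda>_. 1)) N M (\<lambda>p. f (\<phi> p))"
      using reg_poly_comp[OF f \<phi>] by (rule regE)
    have "p \<in> nz N \<longleftrightarrow> \<phi> p \<in> nz f" if "p \<in> X" for p
      using frac_onD[OF NM(3) that] by (simp add: nz_iff)
    then show ?thesis using NM(1) by (intro bexI[of _ N]) auto
  qed
  show ?thesis
    unfolding pos_dense_def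
  proof (intro conjI ballI impI)
    show "\<phi> ` P \<subseteq> \<phi> ` X" "\<phi> ` P \<noteq> {}" using pos_dense_subset[OF X] pos_dense_nonempty[OF X] by auto
  next
    fix f :: "('b \<Rightarrow> complex) \<Rightarrow> complex" assume f: "f \<in> poly_fun" "\<phi> ` P \<inter> nz f = {}"
    obtain g where g: "g \<in> poly_fun" "X \<inter> nz g = X \<inter> {p. \<phi> p \<in> nz f}" using pull[OF f(1)] by (rule bexE)
    have "P \<inter> nz g = {}" using f(2) g(2) pos_dense_subset[OF X] by blast
    then have "X \<inter> nz g = {}" by (rule pos_dense_vanish[OF X g(1)])
    then show "\<phi> ` X \<inter> nz f = {}" using g(2) by blast
  next
    fix f h :: "('b \<Rightarrow> complex) \<Rightarrow> complex"
    assume f: "f \<in> poly_fun" "h \<in> poly_fun" "\<phi> ` X \<inter> nz f \<noteq> {}" "\<phi> ` X \<inter> nz h \<noteq> {}"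
    obtain g where g: "g \<in> poly_fun" "X \<inter> nz g = X \<inter> {p. \<phi> p \<in> nz f}" using pull[OF f(1)] by (rule bexE)
    obtain g' where g': "g' \<in> poly_fun" "X \<inter> nz g' = X \<inter> {p. \<phi> p \<in> nz h}" using pull[OF f(2)] by (rule bexE)
    have "X \<inter> nz g \<noteq> {}" "X \<inter> nz g' \<noteq> {}" using f(3,4) g(2) g'(2) by blast+
    then have "X \<inter> nz g \<inter> nz g' \<noteq> {}" by (rule pos_dense_inter[OF X g(1) g'(1)])
    then show "\<phi> ` X \<inter> nz f \<inter> nz h \<noteq> {}" using g(2) g'(2) by blast
  qed
qed

section \<open>Functions and maps that are both regular near the positive points and
  subtraction-free\<close>

definition posfun :: "'s set \<Rightarrow> (('s \<Rightarrow> complex) \<Rightarrow> complex) \<Rightarrow> bool" where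
  "posfun S f \<longleftrightarrow> finite S \<and> scal (torus S) (tpos S) f \<and> subtraction_free S f"

lemma posfunI: "finite S \<Longrightarrow> scal (torus S) (tpos S) f \<Longrightarrow> subtraction_free S f \<Longrightarrow> posfun S f"
  by (simp add: posfun_def)

lemma posfunD:
  assumes "posfun S f"
  shows posfun_finite: "finite S" and posfun_scal: "scal (torus S) (tpos S) f" and posfun_sf: "subtraction_free S f"
  using assms by (simp_all add: posfun_def)

lemma posfun_cpos: "posfun S f \<Longrightarrow> x \<in> tpos S \<Longrightarrow> f x \<in> cpos"
  by (rule subtraction_free_cpos[OF posfun_sf])

lemma posfun_one: "finite S \<Longrightarrow> posfun S (\<lambda>_. 1)"
  by (intro posfunI scal_const sf_one)

lemma posfun_coord: "finite S \<Longrightarrow> posfun S (\<lambda>x. x s)"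
  by (intro posfunI scal_coord sf_coord)

lemma posfun_mult: "posfun S f \<Longrightarrow> posfun S g \<Longrightarrow> posfun S (\<lambda>x. f x * g x)"
  unfolding posfun_def by (intro conjI scal_mult sf_mult) simp_all

lemma posfun_divide:
  assumes "posfun S f" "posfun S g" shows "posfun S (\<lambda>x. f x / g x)"
proof (rule posfunI)
  show "finite S" by (rule posfun_finite[OF assms(1)])
  show "scal (torus S) (tpos S) (\<lambda>x. f x / g x)"
    by (rule scal_divide[OF pos_dense_torus[OF posfun_finite[OF assms(1)]] posfun_scal[OF assms(1)] posfun_scal[OF assms(2)]])
      (rule cpos_nonzero, rule posfun_cpos[OF assms(2)])
  show "subtraction_free S (\<lambda>x. f x / g x)" by (rule sf_divide[OF posfun_sf[OF assms(1)] posfun_sf[OF assms(2)]])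
qed

lemma posfun_prod: "finite S \<Longrightarrow> (\<And>i. i \<in> A \<Longrightarrow> posfun S (f i)) \<Longrightarrow> posfun S (\<lambda>x. \<Prod>i\<in>A. f i x)"
  unfolding posfun_def by (intro conjI scal_prod sf_prod) simp_all

lemma posfun_sum:
  assumes "finite A" "A \<noteq> {}" "\<And>i. i \<in> A \<Longrightarrow> posfun S (f i)"
  shows "posfun S (\<lambda>x. \<Sum>i\<in>A. f i x)"
proof (rule posfunI)
  obtain i where "i \<in> A" using assms(2) by blast
  then show "finite S" by (rule posfun_finite[OF assms(3)])
qed (intro scal_sum sf_sum assms posfun_scal posfun_sf; assumption)+

lemma posfun_power: "posfun S f \<Longrightarrow> posfun S (\<lambda>x. f x ^ m)"
  unfolding posfun_def by (intro conjI scal_power sf_power) simp_all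

definition posmap :: "'s set \<Rightarrow> 't set \<Rightarrow> (('s \<Rightarrow> complex) \<Rightarrow> ('t \<Rightarrow> complex)) \<Rightarrow> bool" where
  "posmap S S' \<phi> \<longleftrightarrow> finite S \<and> finite S' \<and> (\<forall>s\<in>S'. posfun S (\<lambda>x. \<phi> x s)) \<and> (\<forall>s. \<forall>x\<in>torus S. s \<notin> S' \<longrightarrow> \<phi> x s = 1)"

lemma posmapI:
  "finite S \<Longrightarrow> finite S' \<Longrightarrow> (\<And>s. s \<in> S' \<Longrightarrow> posfun S (\<lambda>x. \<phi> x s)) \<Longrightarrow>
    (\<And>s x. x \<in> torus S \<Longrightarrow> s \<notin> S' \<Longrightarrow> \<phi> x s = 1) \<Longrightarrow> posmap S S' \<phi>"
  by (simp add: posmap_def)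

lemma posmapD:
  assumes "posmap S S' \<phi>"
  shows "finite S" "finite S'" "s \<in> S' \<Longrightarrow> posfun S (\<lambda>x. \<phi> x s)" "x \<in> torus S \<Longrightarrow> s \<notin> S' \<Longrightarrow> \<phi> x s = 1"
  using assms by (auto simp: posmap_def)

lemma posmap_mor:
  assumes "posmap S S' \<phi>" shows "mor (torus S) (tpos S) (torus S') (tpos S') \<phi>"
  by (rule mor_torusI[OF pos_dense_torus[OF posmapD(1)[OF assms]] posmapD(2)[OF assms]])
    (use posmapD(4)[OF assms] posmapD(3)[OF assms, THEN posfun_scal] posmapD(3)[OF assms, THEN posfun_cpos] in auto)

lemma posmap_tpos: "posmap S S' \<phi> \<Longrightarrow> x \<in> tpos S \<Longrightarrow> \<phi> x \<in> tpos S'"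
  by (rule mor_pos[OF posmap_mor])

lemma posfun_comp:
  assumes f: "posfun S' f" and \<phi>: "posmap S S' \<phi>"
  shows "posfun S (\<lambda>x. f (\<phi> x))"
proof (rule posfunI)
  show fin: "finite S" by (rule posmapD(1)[OF \<phi>])
  show "scal (torus S) (tpos S) (\<lambda>x. f (\<phi> x))"
    by (rule scal_comp[OF pos_dense_torus[OF fin] posmap_mor[OF \<phi>] posfun_scal[OF f]])
  show "subtraction_free S (\<lambda>x. f (\<phi> x))"
    by (rule sf_comp[OF posfun_sf[OF f]]) (use posmapD(3)[OF \<phi>, THEN posfun_sf] posmap_tpos[OF \<phi>] in auto)
qed

lemma posmap_Some: "finite S \<Longrightarrow> posmap (insert None (Some ` S)) S (\<lambda>z. z \<circ> Some)"
  by (intro posmapI) (auto intro!: posfun_coord[of "insert None (Some ` S)"] simp: torus_def)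

lemma posfun_D_coord: "finite S \<Longrightarrow> posfun S (D_coord b l i)"
  unfolding D_coord_def by (intro posfun_divide posfun_mult posfun_prod posfun_power posfun_coord)

lemma posfun_eps_coord: "finite S \<Longrightarrow> a \<le> b \<Longrightarrow> posfun S (eps_coord a b i)"
  unfolding eps_coord_def by (intro posfun_sum posfun_divide posfun_D_coord posfun_one) auto

lemma posfun_gamma_coord: "finite S \<Longrightarrow> posfun S (gamma_coord a b i)"
  unfolding gamma_coord_def by (intro posfun_mult posfun_divide posfun_D_coord posfun_coord)

lemma posfun_den:
  assumes "finite S" "a \<le> b"
  shows "posfun (insert None (Some ` S)) (\<lambda>z. den a b i (z None) (z \<circ> Some) l)"
  unfolding den_def
proof (intro posfun_sum posfun_divide)
  fix p
  show "posfun (insert None (Some ` S)) (\<lambda>z. if p \<le> l then 1 else z None)"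
    using assms by (cases "p \<le> l") (simp_all add: posfun_one posfun_coord)
  show "posfun (insert None (Some ` S)) (\<lambda>z. D_coord b p i (z \<circ> Some))"
    by (rule posfun_comp[OF posfun_D_coord posmap_Some]) (use assms in auto)
qed (use assms in auto)

lemma posmap_e_coord:
  assumes "finite S" "a \<le> b" and S: "\<And>l. (l, i) \<in> S \<Longrightarrow> a \<le> l \<and> l \<le> b"
  shows "posmap (insert None (Some ` S)) S (\<lambda>z. e_coord S a b i (z None) (z \<circ> Some))"
proof (rule posmapI)
  fix s assume s: "s \<in> S"
  obtain l m where lm: "s = (l, m)" by (cases s)
  show "posfun (insert None (Some ` S)) (\<lambda>z. e_coord S a b i (z None) (z \<circ> Some) s)"
  proof (cases "m = i")
    case True
    have "e_coord S a b i c x s = x (l, i) * (den a b i c x (l - 1) / den a b i c x l)" for c x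
      using e_coord_eq[of a l b i S c x] S s lm True by auto
    then show ?thesis
      using assms by (simp only: o_def) (intro posfun_mult posfun_divide posfun_coord posfun_den[unfolded o_def]; simp)
  next
    case False
    then show ?thesis unfolding lm using assms by (simp add: e_coord_other posfun_coord)
  qed
next
  fix s :: "int \<times> int" and z :: "(int \<times> int) option \<Rightarrow> complex"
  assume z: "z \<in> torus (insert None (Some ` S))" "s \<notin> S"
  then have "e_coord S a b i (z None) (z \<circ> Some) s = z (Some s)"
    using e_coord_other[of "snd s" i "fst s" S] by (cases s) simp
  also have "\<dots> = 1" using z unfolding torus_def by blast
  finally show "e_coord S a b i (z None) (z \<circ> Some) s = 1" .
qed (use assms in auto)

text \<open>Coefficients of a product of \<open>Y\<close>'s may vanish identically, which a
  subtraction-free function cannot; hence the alternative. The polynomial \<open>1\<close> expresses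
  regularity on the whole torus.\<close>

definition reg_pos :: "'s set \<Rightarrow> (('s \<Rightarrow> complex) \<Rightarrow> complex) \<Rightarrow> bool" where
  "reg_pos S f \<longleftrightarrow> reg (torus S) (\<lambda>_. 1) f \<and> (subtraction_free S f \<or> (\<forall>x\<in>tpos S. f x = 0))"

lemma reg_pos_zero: "reg_pos S (\<lambda>_. 0)"
  by (simp add: reg_pos_def reg_const)

lemma reg_pos_one: "reg_pos S (\<lambda>_. 1)"
  by (simp add: reg_pos_def reg_const sf_one)

lemma reg_pos_coord: "finite S \<Longrightarrow> reg_pos S (\<lambda>x. x s)"
  by (simp add: reg_pos_def reg_poly poly_fun.coord sf_coord)

lemma torus_nonzero: "x \<in> torus S \<Longrightarrow> x s \<noteq> 0"
  by (cases "s \<in> S") (auto simp: torus_def)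

lemma reg_pos_inverse_coord: "finite S \<Longrightarrow> reg_pos S (\<lambda>x. inverse (x s))"
  unfolding reg_pos_def
  by (intro conjI disjI1 sf_inverse sf_coord reg_inverse reg_poly poly_fun.coord torus_nonzero)

lemma reg_pos_mult: "reg_pos S f \<Longrightarrow> reg_pos S g \<Longrightarrow> reg_pos S (\<lambda>x. f x * g x)"
  unfolding reg_pos_def by (elim conjE disjE; simp add: reg_mult sf_mult)

lemma reg_pos_add:
  assumes "reg_pos S f" "reg_pos S g" shows "reg_pos S (\<lambda>x. f x + g x)"
proof -
  have "subtraction_free S (\<lambda>x. f x + g x) \<or> (\<forall>x\<in>tpos S. f x + g x = 0)"
  proof -
    consider "subtraction_free S f" "subtraction_free S g" | "subtraction_free S f" "\<forall>x\<in>tpos S. g x = 0"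
      | "\<forall>x\<in>tpos S. f x = 0" "subtraction_free S g" | "\<forall>x\<in>tpos S. f x = 0" "\<forall>x\<in>tpos S. g x = 0"
      using assms unfolding reg_pos_def by argo
    then show ?thesis
    proof cases
      case 1
      then show ?thesis by (intro disjI1 sf_add)
    next
      case 2
      then show ?thesis by (intro disjI1 subtraction_free_cong[OF 2(1)]) simp
    next
      case 3
      then show ?thesis by (intro disjI1 subtraction_free_cong[OF 3(2)]) simp
    qed simp
  qed
  then show ?thesis using assms by (simp add: reg_pos_def reg_add)
qed

lemma reg_pos_Ypair:
  assumes "finite S" "\<And>J. reg_pos S (\<lambda>x. v x J)"
  shows "reg_pos S (\<lambda>x. Ypair i j (x s) (v x) J)"
proof -
  have "reg_pos S (\<lambda>x. inverse (x s) * v x J + v x (insert i (J - {j})))" "reg_pos S (\<lambda>x. x s * v x J)"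
    by (intro reg_pos_add reg_pos_mult reg_pos_coord reg_pos_inverse_coord assms)+
  then show ?thesis using assms(2)
    by (cases "i \<in> J"; cases "j \<in> J") (simp_all add: Ypair_def divide_inverse mult.commute)
qed

lemma reg_pos_chain:
  assumes "finite S" "\<And>J. reg_pos S (\<lambda>x. v x J)"
  shows "reg_pos S (\<lambda>x. chain (\<lambda>m. x (l, m)) a b (v x) J)"
proof (cases "a - 1 \<le> b")
  case True
  then show ?thesis
  proof (induction b arbitrary: J rule: int_upto_induct)
    case base
    then show ?case using assms(2) by simp
  next
    case (step b)
    have "reg_pos S (\<lambda>x. Ypair b (b + 1) (x (l, b)) (chain (\<lambda>m. x (l, m)) a (b - 1) (v x)) J)"
      by (rule reg_pos_Ypair[OF assms(1)]) (rule step.IH)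
    then show ?case using step.hyps by (simp add: chain_last)
  qed
qed (use assms(2) in simp)

lemma finite_S1: "finite (S1 n k)"
  by (rule finite_subset[of _ "{1..k} \<times> {k - k..n + 1}"]) (auto simp: S1_def)

lemma finite_S2: "finite (S2 n k)"
  by (rule finite_subset[of _ "{1..k} \<times> {k - k..n}"]) (auto simp: S2_def)

lemma reg_pos_level: "0 \<le> j \<Longrightarrow> reg_pos (S1 n k) (\<lambda>x. level n k x j J)"
proof (induction j arbitrary: J rule: int_ge_induct)
  case base
  show ?case by (cases "J = {1..k}") (simp_all add: basis_vec_def reg_pos_zero reg_pos_one)
next
  case (step j)
  have "reg_pos (S1 n k) (\<lambda>x. chain (\<lambda>m. x (j + 1, m)) (k - (j + 1) + 1) (n + 1 - (j + 1)) (level n k x j) J)"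
    by (rule reg_pos_chain[OF finite_S1]) (rule step.IH)
  then show ?case using step.hyps by (simp add: level_step)
qed

context grassmann
begin

lemma reg_pos_v1: "reg_pos (S1 n k) (\<lambda>x. v1 n k x J)"
proof -
  have L: "reg_pos (S1 n k) (\<lambda>x. level n k x k J)" using k1 by (intro reg_pos_level) simp
  have eq: "level n k x k J = v1 n k x J" if "x \<in> torus (S1 n k)" for x using v1_level[OF that] by simp
  have "reg (torus (S1 n k)) (\<lambda>_. 1) (\<lambda>x. v1 n k x J)"
    using L unfolding reg_pos_def by (elim conjE, intro reg_cong[OF _ eq])
  moreover have "subtraction_free (S1 n k) (\<lambda>x. v1 n k x J) \<or> (\<forall>x\<in>tpos (S1 n k). v1 n k x J = 0)"
    using L[unfolded reg_pos_def, THEN conjunct2]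
  proof
    assume "subtraction_free (S1 n k) (\<lambda>x. level n k x k J)"
    then have "subtraction_free (S1 n k) (\<lambda>x. v1 n k x J)"
      by (rule subtraction_free_cong) (rule eq[OF tpos_torus])
    then show ?thesis ..
  next
    assume "\<forall>x\<in>tpos (S1 n k). level n k x k J = 0"
    then show ?thesis by (intro disjI2) (simp add: eq tpos_torus)
  qed
  ultimately show ?thesis unfolding reg_pos_def by (rule conjI)
qed

definition V1pos :: "(int set \<Rightarrow> complex) set" where
  "V1pos = v1 n k ` tpos (S1 n k)"

definition V2pos :: "(int set \<Rightarrow> complex) set" where
  "V2pos = v2 n k ` tpos (S2 n k)"

lemma V1posE: assumes "p \<in> V1pos" obtains x where "x \<in> tpos (S1 n k)" "p = v1 n k x"
  using assms unfolding V1pos_def by blast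

lemma V2posE: assumes "p \<in> V2pos" obtains y where "y \<in> tpos (S2 n k)" "p = v2 n k y"
  using assms unfolding V2pos_def by blast

lemma v2_cone: "y \<in> tpos (S2 n k) \<Longrightarrow> v2 n k y \<in> cone"
  unfolding v2_rot[OF tpos_torus] by (intro cone_rot v1_cone shift_tpos)

lemma V1pos_cone: "V1pos \<subseteq> cone" and V2pos_cone: "V2pos \<subseteq> cone"
  using v1_cone v2_cone by (auto simp: V1pos_def V2pos_def)

lemma V1E: assumes "p \<in> V1 n k" obtains x where "x \<in> torus (S1 n k)" "p = v1 n k x"
  using assms unfolding V1_def by blast

lemma reg_v1: "reg_map (torus (S1 n k)) (\<lambda>_. 1) (v1 n k)"
  by (rule reg_mapI) (use reg_pos_v1 in \<open>simp add: reg_pos_def\<close>)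

lemma posmap_shift: "posmap (S2 n k) (S1 n k) shift"
  by (intro posmapI finite_S1 finite_S2)
    (auto simp: shift_def posfun_coord finite_S2 S1_shift torus_def)

lemma reg_v2: "reg_map (torus (S2 n k)) (\<lambda>_. 1) (v2 n k)"
proof (rule reg_mapI)
  fix J
  have sh: "reg_map (torus (S2 n k)) (\<lambda>_. 1) shift"
    by (rule reg_mapI) (auto simp: shift_def split: prod.split intro: reg_poly poly_fun.coord)
  have "shift ` (torus (S2 n k) \<inter> nz (\<lambda>_. 1)) \<subseteq> torus (S1 n k) \<inter> nz (\<lambda>_. 1)"
    using shift_torus by auto
  then have "reg (torus (S2 n k)) (\<lambda>_. 1) (\<lambda>y. v1 n k (shift y) (rho ` J))"
    by (rule reg_comp[OF reg_mapD[OF reg_v1] _ sh])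
  then show "reg (torus (S2 n k)) (\<lambda>_. 1) (\<lambda>y. v2 n k y J)"
    by (rule reg_cong) (simp add: v2_rot rot_def)
qed

lemma pos_dense_V1: "pos_dense (V1 n k) V1pos"
  unfolding V1_def V1pos_def by (rule pos_dense_image[OF pos_dense_torus[OF finite_S1] reg_v1])

lemma pos_dense_V2: "pos_dense (V2 n k) V2pos"
  unfolding V2_def V2pos_def by (rule pos_dense_image[OF pos_dense_torus[OF finite_S2] reg_v2])

lemma mor_v1: "mor (torus (S1 n k)) (tpos (S1 n k)) (V1 n k) V1pos (v1 n k)"
  by (rule morI[OF poly_fun.const[of 1] _ _ reg_v1]) (auto simp: V1_def V1pos_def)

lemma mor_v2: "mor (torus (S2 n k)) (tpos (S2 n k)) (V2 n k) V2pos (v2 n k)"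
  by (rule morI[OF poly_fun.const[of 1] _ _ reg_v2]) (auto simp: V2_def V2pos_def)

section \<open>Coordinates\<close>

text \<open>By \<open>v1_T\<close> the two coefficients are products over column \<open>m\<close>
  that differ by the factor \<open>x(l, m)\<close>. The quotient has degree 0, so it is also
  meaningful on multiples, in particular on positive points of the second chart; this gives the
  inverse of \<open>sigma\<close>.\<close>

definition kappa :: "(int set \<Rightarrow> complex) \<Rightarrow> (int \<times> int \<Rightarrow> complex)" where
  "kappa p = (\<lambda>(l, m). if (l, m) \<in> S1 n k then p (Tset (l - 1) m) / p (Tset l m) else 1)"

lemma kappa_v1:
  assumes x: "x \<in> torus (S1 n k)" and d: "d \<noteq> 0"
  shows "kappa (\<lambda>J. d * v1 n k x J) = x"
proof
  fix s :: "int \<times> int" obtain l m where s: "s = (l, m)" by (cases s)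
  show "kappa (\<lambda>J. d * v1 n k x J) s = x s"
  proof (cases "s \<in> S1 n k")
    case True
    then have lm: "1 \<le> l" "l \<le> k" "k < l + m" "l + m \<le> n + 1" by (auto simp: s S1_def)
    have "v1 n k x (Tset (l - 1) m) = (\<Prod>p=l..k. x (p, m))" "v1 n k x (Tset l m) = (\<Prod>p=l+1..k. x (p, m))"
      using lm v1_T[OF x, of "l - 1" m] v1_T[OF x, of l m] by simp_all
    moreover have "(\<Prod>p=l+1..k. x (p, m)) \<noteq> 0" using torusD(1)[OF x] by simp
    ultimately show ?thesis using True lm d by (simp add: s kappa_def prod_first_int)
  next
    case False
    then show ?thesis using torusD(2)[OF x] by (simp add: s kappa_def)
  qed
qed

lemma kappa_v1_1: "x \<in> torus (S1 n k) \<Longrightarrow> kappa (v1 n k x) = x"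
  using kappa_v1[of x 1] by simp

lemma cone_Tset:
  assumes "p \<in> cone" "(l, m) \<in> S1 n k"
  shows "p (Tset (l - 1) m) \<in> cpos" "p (Tset l m) \<in> cpos"
proof -
  obtain d x where d: "d \<in> cpos" "x \<in> tpos (S1 n k)" "p = (\<lambda>J. d * v1 n k x J)" by (rule coneE[OF assms(1)])
  have lm: "1 \<le> l" "l \<le> k" "k < l + m" "l + m \<le> n + 1" using assms(2) by (auto simp: S1_def)
  show "p (Tset (l - 1) m) \<in> cpos" "p (Tset l m) \<in> cpos"
    using lm d tpos_cpos[OF d(2)] v1_T[OF tpos_torus[OF d(2)], of "l - 1" m] v1_T[OF tpos_torus[OF d(2)], of l m]
    by (simp_all add: cpos_mult cpos_prod)
qed

lemma kappa_tpos: "p \<in> cone \<Longrightarrow> kappa p \<in> tpos (S1 n k)"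
  by (rule tposI) (auto simp: kappa_def cpos_divide cone_Tset)

lemma mor_kappa:
  assumes X: "pos_dense X P" and P: "P \<subseteq> cone"
  shows "mor X P (torus (S1 n k)) (tpos (S1 n k)) kappa"
proof (rule mor_torusI[OF X finite_S1])
  fix s assume s: "s \<in> S1 n k"
  obtain l m where lm: "s = (l, m)" by (cases s)
  have "scal X P (\<lambda>p. p (Tset (l - 1) m) / p (Tset l m))"
    by (rule scal_divide[OF X scal_coord scal_coord], rule cpos_nonzero, rule cone_Tset)
      (use P s lm in auto)
  then show "scal X P (\<lambda>p. kappa p s)" using s by (simp add: lm kappa_def)
  show "kappa p s \<in> cpos" if "p \<in> P" for p using tpos_cpos[OF kappa_tpos] P that by blast
qed (auto simp: kappa_def)

lemma coords1_v1: "x \<in> torus (S1 n k) \<Longrightarrow> coords1 n k (v1 n k x) = x"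
  unfolding coords1_def by (rule inv_into_f_f) (auto intro: inj_on_inverseI[of _ kappa] simp: kappa_v1_1)

lemma coords1_kappa: "p \<in> V1 n k \<Longrightarrow> coords1 n k p = kappa p"
  by (auto simp: V1_def coords1_v1 kappa_v1_1)

text \<open>The power \<open>rot ^^ nat n\<close> is the inverse of \<open>rot\<close>; it undoes
  the rotation in \<open>v2_rot\<close>, and the shift of \<open>m\<close> undoes
  \<open>shift\<close>.\<close>

definition kappa2 :: "(int set \<Rightarrow> complex) \<Rightarrow> (int \<times> int \<Rightarrow> complex)" where
  "kappa2 p = (\<lambda>(l, m). kappa ((rot ^^ nat n) p) (l, m + 1))"

lemma unrot_rot: "(rot ^^ nat n) (rot p) = p"
proof -
  have "nat (n + 1) = Suc (nat n)" using n2 by simp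
  then show ?thesis using rot_power_id[of p] by (simp add: funpow_Suc_right del: funpow.simps)
qed

lemma kappa2_v2: "y \<in> torus (S2 n k) \<Longrightarrow> kappa2 (v2 n k y) = y"
  by (simp add: kappa2_def v2_rot unrot_rot kappa_v1_1 shift_torus) (simp add: shift_def)

lemma coords2_v2: "y \<in> torus (S2 n k) \<Longrightarrow> coords2 n k (v2 n k y) = y"
  unfolding coords2_def by (rule inv_into_f_f) (auto intro: inj_on_inverseI[of _ kappa2] simp: kappa2_v2)

lemma mor_coords2: "mor (V2 n k) V2pos (torus (S2 n k)) (tpos (S2 n k)) (coords2 n k)"
proof (rule mor_cong[OF pos_dense_V2])
  show "kappa2 p = coords2 n k p" if "p \<in> V2 n k" for p
    using that by (auto simp: V2_def coords2_v2 kappa2_v2)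
  show "mor (V2 n k) V2pos (torus (S2 n k)) (tpos (S2 n k)) kappa2"
  proof (rule mor_torusI[OF pos_dense_V2 finite_S2])
    fix s assume s: "s \<in> S2 n k"
    obtain l m where lm: "s = (l, m)" by (cases s)
    have s1: "(l, m + 1) \<in> S1 n k" using s by (simp add: lm S1_shift)
    have cone: "(rot ^^ nat n) p \<in> cone" if "p \<in> V2pos" for p
    proof -
      obtain y where y: "y \<in> tpos (S2 n k)" "p = v2 n k y" by (rule V2posE[OF \<open>p \<in> V2pos\<close>])
      show ?thesis unfolding y(2) v2_rot[OF tpos_torus[OF y(1)]] unrot_rot by (intro v1_cone shift_tpos y(1))
    qed
    have eq: "kappa2 p s = (rot ^^ nat n) p (Tset (l - 1) (m + 1)) / (rot ^^ nat n) p (Tset l (m + 1))" for p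
      using s1 by (simp add: lm kappa2_def kappa_def)
    have "(rot ^^ nat n) p (Tset l (m + 1)) \<noteq> 0" if "p \<in> V2pos" for p
      by (rule cpos_nonzero, rule cone_Tset(2)[OF cone[OF that] s1])
    then show "scal (V2 n k) V2pos (\<lambda>p. kappa2 p s)"
      unfolding eq rot_power by (intro scal_divide[OF pos_dense_V2] scal_coord)
    show "kappa2 p s \<in> cpos" if "p \<in> V2pos" for p
      unfolding eq by (intro cpos_divide cone_Tset[OF cone[OF that] s1])
  next
    fix s p assume "s \<notin> S2 n k"
    then show "kappa2 p s = 1" by (cases s) (simp add: kappa2_def kappa_def S1_shift)
  qed
qed

section \<open>The variety\<close>

lemma topspace_zariski: "topspace zariski = (UNIV :: ('b \<Rightarrow> complex) set)"
proof -
  have "openin zariski (UNIV \<inter> nz (\<lambda>_. 1) :: ('b \<Rightarrow> complex) set)"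
    using openin_principal[OF poly_fun.const[of 1], of "UNIV"] by (simp add: subtopology_UNIV)
  then show ?thesis by (auto simp: topspace_def)
qed

lemma reg_kappa: "reg_map UNIV (\<lambda>p. \<Prod>(l, m)\<in>S1 n k. p (Tset (l - 1) m) * p (Tset l m)) kappa"
    (is "reg_map UNIV ?D kappa")
proof (rule reg_mapI)
  fix s :: "int \<times> int" obtain l m where s: "s = (l, m)" by (cases s)
  show "reg UNIV ?D (\<lambda>p. kappa p s)"
  proof (cases "s \<in> S1 n k")
    case True
    have "p (Tset l m) \<noteq> 0" if "p \<in> nz ?D" for p
      using that True finite_S1 by (auto simp: nz_iff s)
    then have "reg UNIV ?D (\<lambda>p. p (Tset (l - 1) m) * inverse (p (Tset l m)))"
      by (intro reg_mult reg_inverse reg_poly poly_fun.coord)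
    then show ?thesis using True by (simp add: s kappa_def divide_inverse)
  qed (simp add: s kappa_def reg_const)
qed

text \<open>On the principal open set of \<open>?D\<close> the map \<open>kappa\<close> is regular,
  and there \<open>p = v1 n k (kappa p)\<close> characterizes \<open>V1\<close>. Cleared of
  denominators, these equations hold on \<open>V1\<close>, hence on its Zariski closure
  \<open>C\<close>.\<close>

lemma V1_locally_closed: "\<exists>U C. openin zariski U \<and> closedin zariski C \<and> V1 n k = U \<inter> C"
proof -
  let ?D = "\<lambda>p :: int set \<Rightarrow> complex. \<Prod>(l, m)\<in>S1 n k. p (Tset (l - 1) m) * p (Tset l m)"
  define F where "F = {f \<in> poly_fun. V1 n k \<inter> nz f = {}}"
  define C where "C = {p. \<forall>f\<in>F. f p = 0}"
  have D: "?D \<in> poly_fun"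
    by (rule poly_fun_prod) (auto intro!: poly_fun_intros)
  have open_D: "openin zariski (nz ?D)"
    using openin_principal[OF D, of UNIV] by (simp add: subtopology_UNIV)
  have "openin zariski {p. \<exists>f\<in>F. f p \<noteq> 0}"
    unfolding openin_zariski by (rule exI[of _ F]) (auto simp: F_def)
  moreover have "- C = {p. \<exists>f\<in>F. f p \<noteq> 0}" by (auto simp: C_def)
  ultimately have closed: "closedin zariski C"
    by (simp add: closedin_def topspace_zariski Compl_eq_Diff_UNIV)
  have nzD: "p \<in> nz ?D" if "p \<in> V1 n k" for p
  proof -
    obtain x where x: "x \<in> torus (S1 n k)" "p = v1 n k x" by (rule V1E[OF \<open>p \<in> V1 n k\<close>])
    have "v1 n k x (Tset (l - 1) m) \<noteq> 0" "v1 n k x (Tset l m) \<noteq> 0" if "(l, m) \<in> S1 n k" for l m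
    proof -
      have lm: "1 \<le> l" "l \<le> k" "k < l + m" "l + m \<le> n + 1" using that by (auto simp: S1_def)
      show "v1 n k x (Tset (l - 1) m) \<noteq> 0" "v1 n k x (Tset l m) \<noteq> 0"
        using lm torusD(1)[OF x(1)] v1_T[OF x(1), of "l - 1" m] v1_T[OF x(1), of l m] by simp_all
    qed
    then show ?thesis using finite_S1 by (auto simp: nz_iff x(2))
  qed
  have kt: "kappa p \<in> torus (S1 n k)" if "p \<in> nz ?D" for p
    using that finite_S1 by (auto simp: nz_iff torus_def kappa_def)
  have "p \<in> V1 n k" if p: "p \<in> nz ?D" "p \<in> C" for p
  proof -
    have "p J = v1 n k (kappa p) J" for J
    proof -
      have "kappa ` (UNIV \<inter> nz ?D) \<subseteq> torus (S1 n k) \<inter> nz (\<lambda>_. 1)" using kt by auto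
      then have "reg UNIV ?D (\<lambda>p. v1 n k (kappa p) J)"
        by (rule reg_comp[OF reg_mapD[OF reg_v1] _ reg_kappa])
      then obtain N M where NM: "N \<in> poly_fun" "M \<in> poly_fun" "frac_on (UNIV \<inter> nz ?D) N M (\<lambda>p. v1 n k (kappa p) J)"
        by (rule regE)
      have fr: "M q \<noteq> 0" "v1 n k (kappa q) J = N q / M q" if "q \<in> nz ?D" for q
        using frac_onD[OF NM(3) UNIV_I that] by auto
      \<comment> \<open>The equation for the coefficient at \<open>J\<close>, multiplied by its
        denominator.\<close>
      define g where "g = (\<lambda>q. q J * M q - N q)"
      have "g \<in> poly_fun" unfolding g_def by (intro poly_fun_minus poly_fun_intros NM)
      moreover have "g q = 0" if q: "q \<in> V1 n k" for q
      proof -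
        have "q J = v1 n k (kappa q) J" using q by (auto simp: V1_def kappa_v1_1)
        then show ?thesis using fr[OF nzD[OF q]] by (simp add: g_def)
      qed
      ultimately have "g \<in> F" by (auto simp: F_def nz_iff)
      then have "g p = 0" using p(2) by (simp add: C_def)
      then have "p J = N p / M p" using fr(1)[OF p(1)] by (simp add: g_def eq_divide_eq)
      then show ?thesis using fr(2)[OF p(1)] by simp
    qed
    then have "p = v1 n k (kappa p)" by (rule ext)
    then show ?thesis using kt[OF p(1)] by (metis V1_def imageI)
  qed
  moreover have "V1 n k \<subseteq> C" by (auto simp: C_def F_def nz_iff)
  ultimately have "V1 n k = nz ?D \<inter> C" using nzD by blast
  then show ?thesis using open_D closed by blast
qed

lemma variety_V1: "variety (V1 n k)"
  unfolding variety_def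
proof (intro conjI allI impI)
  show "V1 n k \<noteq> {}" using pos_dense_subset[OF pos_dense_V1] pos_dense_nonempty[OF pos_dense_V1] by blast
  show "\<exists>B. finite B \<and> (\<forall>p\<in>V1 n k. \<forall>q\<in>V1 n k. \<forall>i. i \<notin> B \<longrightarrow> p i = q i)"
  proof (intro exI conjI ballI allI impI)
    show "finite (basisW n k)" by (rule finite_subset[of _ "Pow {1..n + 1}"]) (auto simp: basisW_def)
    fix p q J assume pq: "p \<in> V1 n k" "q \<in> V1 n k" "J \<notin> basisW n k"
    have "r J = 0" if "r \<in> V1 n k" for r
    proof -
      obtain x where x: "x \<in> torus (S1 n k)" "r = v1 n k x" by (rule V1E[OF \<open>r \<in> V1 n k\<close>])
      show ?thesis using in_module_level[of k x] pq(3) by (simp add: x(2) v1_level[OF x(1)] in_module_def)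
    qed
    from this[OF pq(1)] this[OF pq(2)] show "p J = q J" by simp
  qed
  show "\<exists>U C. openin zariski U \<and> closedin zariski C \<and> V1 n k = U \<inter> C" by (rule V1_locally_closed)
  fix U V assume UV: "openin (subtopology zariski (V1 n k)) U \<and> openin (subtopology zariski (V1 n k)) V \<and> U \<noteq> {} \<and> V \<noteq> {}"
  have principal: "\<exists>f\<in>poly_fun. V1 n k \<inter> nz f \<noteq> {} \<and> V1 n k \<inter> nz f \<subseteq> W"
    if W: "openin (subtopology zariski (V1 n k)) W" "W \<noteq> {}" for W
  proof -
    obtain p where p: "p \<in> W" using W(2) by blast
    obtain f where f: "f \<in> poly_fun" "p \<in> nz f \<and> V1 n k \<inter> nz f \<subseteq> W \<and> p \<in> V1 n k"
      using openin_contains_principal[OF W(1) p] by (rule bexE)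
    then show ?thesis by (intro bexI[of _ f]) auto
  qed
  have U: "\<exists>f\<in>poly_fun. V1 n k \<inter> nz f \<noteq> {} \<and> V1 n k \<inter> nz f \<subseteq> U" by (rule principal) (use UV in auto)
  have V: "\<exists>f\<in>poly_fun. V1 n k \<inter> nz f \<noteq> {} \<and> V1 n k \<inter> nz f \<subseteq> V" by (rule principal) (use UV in auto)
  obtain f where f: "f \<in> poly_fun" "V1 n k \<inter> nz f \<noteq> {} \<and> V1 n k \<inter> nz f \<subseteq> U" using U by (rule bexE)
  obtain g where g: "g \<in> poly_fun" "V1 n k \<inter> nz g \<noteq> {} \<and> V1 n k \<inter> nz g \<subseteq> V" using V by (rule bexE)
  have "V1 n k \<inter> nz f \<inter> nz g \<noteq> {}" by (rule pos_dense_inter[OF pos_dense_V1 f(1) g(1)]) (use f(2) g(2) in auto)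
  then show "U \<inter> V \<noteq> {}" using f(2) g(2) by auto
qed

section \<open>The map \<sigma> and the index 0\<close>

lemma posfun_path_weight: "posfun (S1 n k) (\<lambda>x. path_weight x qs)"
proof (induction qs rule: induct_list012)
  case 1
  show ?case by (simp add: path_weight_def posfun_one finite_S1)
next
  case (2 s)
  show ?case by (simp add: path_weight_single posfun_one finite_S1)
next
  case (3 s t qs)
  have "posfun (S1 n k) (\<lambda>x. step_weight x s t)"
    unfolding step_weight_def
    by (cases "fst t = fst s") (simp_all add: posfun_one posfun_divide posfun_coord finite_S1)
  then show ?case unfolding path_weight_Cons using 3(2) by (rule posfun_mult)
qed

lemma posfun_Xfun:
  assumes "(l, m) \<in> S1 n k" shows "posfun (S1 n k) (\<lambda>x. Xfun n k x l m)"
proof -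
  \<comment> \<open>Evaluation at the all-ones point shows that a path exists, since an empty sum
    would not be positive.\<close>
  have "(\<lambda>_. 1) \<in> tpos (S1 n k)" by (intro tposI) auto
  then have "Xfun n k (\<lambda>_. 1) l m \<noteq> 0" using Xfun_pos[OF _ assms] cpos_nonzero by blast
  then have "paths n k (l, m) \<noteq> {}" unfolding Xfun_sum[OF assms] by auto
  then show ?thesis
    unfolding Xfun_sum[OF assms] by (intro posfun_sum finite_paths[OF assms] posfun_path_weight)
qed

lemma posmap_Sigma: "posmap (S1 n k) (S2 n k) (Sigma_map n k)"
proof (intro posmapI finite_S1 finite_S2)
  fix s assume s: "s \<in> S2 n k"
  obtain l m where lm: "s = (l, m)" by (cases s)
  have b: "1 \<le> l" "l \<le> k" "k \<le> l + m" "l + m \<le> n" using s by (auto simp: lm S2_def)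
  have "posfun (S1 n k) (\<lambda>x. Xfun n k x l m)"
  proof (cases "l + m = k")
    case True
    then show ?thesis using b
      by (simp add: Xfun_boundary posfun_divide posfun_one posfun_coord finite_S1)
  qed (use b in \<open>intro posfun_Xfun, simp add: S1_def\<close>)
  moreover have "posfun (S1 n k) (\<lambda>x. Xfun n k x (l + 1) m)"
  proof (cases "l = k")
    case True
    then show ?thesis by (simp add: Xfun_top posfun_one finite_S1)
  qed (use b in \<open>intro posfun_Xfun, simp add: S1_def\<close>)
  ultimately have "posfun (S1 n k) (\<lambda>x. x (l + 1, m) * Xfun n k x l m / Xfun n k x (l + 1) m)"
    by (intro posfun_divide posfun_mult posfun_coord finite_S1)
  then show "posfun (S1 n k) (\<lambda>x. Sigma_map n k x s)" using s by (simp add: lm Sigma_map_eq)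
qed (auto simp: Sigma_map_def)

text \<open>The coefficient of v1 at \<open>Aset 0\<close> is 1, so this selects the point of
  \<open>V1\<close> on the ray of a point of the cone.\<close>

definition nrm :: "(int set \<Rightarrow> complex) \<Rightarrow> (int set \<Rightarrow> complex)" where
  "nrm p = (\<lambda>J. p J / p (Aset 0))"

lemma nrm_scale: "d \<noteq> 0 \<Longrightarrow> nrm (\<lambda>J. d * p J) = nrm p"
  by (simp add: nrm_def)

lemma nrm_v1: "x \<in> torus (S1 n k) \<Longrightarrow> nrm (v1 n k x) = v1 n k x"
  using n2 by (simp add: nrm_def v1_Aset Qprod_zero)

lemma v1_kappa:
  assumes "p \<in> cone" shows "v1 n k (kappa p) = nrm p"
proof -
  obtain d x where d: "d \<in> cpos" "x \<in> tpos (S1 n k)" "p = (\<lambda>J. d * v1 n k x J)" by (rule coneE[OF assms])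
  have "d \<noteq> 0" by (rule cpos_nonzero[OF d(1)])
  then show ?thesis
    unfolding d(3) using kappa_v1[OF tpos_torus[OF d(2)]] nrm_scale[of d "v1 n k x"] nrm_v1[OF tpos_torus[OF d(2)]] by simp
qed

lemma nrm_V1pos: "p \<in> V1pos \<Longrightarrow> nrm p = p"
  by (erule V1posE) (simp add: nrm_v1 tpos_torus)

lemma nrm_in_V1pos: "p \<in> cone \<Longrightarrow> nrm p \<in> V1pos"
  using kappa_tpos v1_kappa[of p] by (auto simp: V1pos_def intro!: image_eqI[of _ _ "kappa p"])

lemma nrm_ec_nrm:
  assumes "p \<in> cone" shows "nrm (ec i c (nrm p)) = nrm (ec i c p)"
proof -
  have "p (Aset 0) \<noteq> 0" by (rule cpos_nonzero[OF goodD(1)[OF assms]])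
  then have d: "inverse (p (Aset 0)) \<noteq> 0" by simp
  have "nrm p = (\<lambda>J. inverse (p (Aset 0)) * p J)" by (simp add: nrm_def divide_inverse mult.commute)
  then show ?thesis by (simp only: ec_scale[OF d] nrm_scale[OF d])
qed

lemma sigma_v1:
  assumes x: "x \<in> tpos (S1 n k)"
  shows "sigma n k (v1 n k x) = v2 n k (Sigma_map n k x)"
    and "sigma n k (v1 n k x) = (\<lambda>J. inverse (x (1, n)) * v1 n k x J)"
proof -
  show 1: "sigma n k (v1 n k x) = v2 n k (Sigma_map n k x)"
    by (simp add: sigma_def coords1_v1 tpos_torus x)
  have "x (1, n) \<noteq> 0" by (rule cpos_nonzero[OF tpos_cpos[OF x]])
  then show "sigma n k (v1 n k x) = (\<lambda>J. inverse (x (1, n)) * v1 n k x J)"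
    unfolding 1 using v1_Sigma[OF x] by (metis (no_types, lifting) ext mult.assoc left_inverse mult_1_left)
qed

lemma mor_sigma: "mor (V1 n k) V1pos (V2 n k) V2pos (sigma n k)"
proof (rule mor_cong[OF pos_dense_V1])
  show "mor (V1 n k) V1pos (V2 n k) V2pos (\<lambda>p. v2 n k (Sigma_map n k (kappa p)))"
    by (intro mor_comp[OF pos_dense_V1 _ mor_v2] mor_comp[OF pos_dense_V1 _ posmap_mor[OF posmap_Sigma]]
        mor_kappa pos_dense_V1 V1pos_cone)
qed (simp add: sigma_def coords1_kappa)

lemma mor_psi: "mor (V2 n k) V2pos (V1 n k) V1pos (\<lambda>q. v1 n k (kappa q))"
  by (intro mor_comp[OF pos_dense_V2 _ mor_v1] mor_kappa pos_dense_V2 V2pos_cone)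

lemma psi_sigma:
  assumes "p \<in> V1pos" shows "v1 n k (kappa (sigma n k p)) = p"
proof -
  obtain x where x: "x \<in> tpos (S1 n k)" "p = v1 n k x" by (rule V1posE[OF assms])
  have "inverse (x (1, n)) \<noteq> 0" using cpos_nonzero[OF tpos_cpos[OF x(1)]] by simp
  then show ?thesis
    unfolding x(2) sigma_v1(2)[OF x(1)] by (simp add: kappa_v1 tpos_torus x)
qed

lemma v2_Aset_n: "y \<in> torus (S2 n k) \<Longrightarrow> v2 n k y (Aset n) = 1"
  using n2 by (simp add: v2_rot rot_Aset v1_Aset shift_torus Qprod_last)

text \<open>Both maps are rescalings, so the result is a multiple of \<open>q\<close>; the multiple
  is 1 because every point of the second chart has coefficient 1 at \<open>Aset n\<close>.\<close>

lemma sigma_psi: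
  assumes "q \<in> V2pos" shows "sigma n k (v1 n k (kappa q)) = q"
proof -
  obtain y where y: "y \<in> tpos (S2 n k)" "q = v2 n k y" by (rule V2posE[OF assms])
  have q: "q \<in> cone" using assms V2pos_cone by blast
  let ?x = "kappa q"
  have x: "?x \<in> tpos (S1 n k)" by (rule kappa_tpos[OF q])
  define a where "a = inverse (?x (1, n)) * inverse (q (Aset 0))"
  have s: "sigma n k (v1 n k ?x) = (\<lambda>J. a * q J)"
    unfolding sigma_v1(2)[OF x] unfolding v1_kappa[OF q] nrm_def by (simp add: a_def divide_inverse ac_simps)
  have "sigma n k (v1 n k ?x) (Aset n) = 1"
    unfolding sigma_v1(1)[OF x] by (rule v2_Aset_n[OF tpos_torus[OF Sigma_map_tpos[OF x]]])
  moreover have "q (Aset n) = 1" unfolding y(2) by (rule v2_Aset_n[OF tpos_torus[OF y(1)]])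
  ultimately have "a = 1" unfolding s by simp
  then show ?thesis unfolding s by simp
qed

lemma bounds_shift: "a2 k i = a1 k (i + 1)" "b2 n k i = b1 n k (i + 1)"
  by (simp_all add: a1_def a2_def b1_def b2_def)

lemma D_coord_shift: "D_coord b l i y = D_coord b l (i + 1) (shift y)"
  unfolding D_coord_def shift_def prod.case by (simp only: add_diff_cancel_right')

lemma eps_coord_shift: "eps_coord a b i y = eps_coord a b (i + 1) (shift y)"
  unfolding eps_coord_def D_coord_shift[of _ _ i] ..

lemma gamma_coord_shift: "gamma_coord a b i y = gamma_coord a b (i + 1) (shift y)"
  unfolding gamma_coord_def D_coord_shift[of _ _ i] by (simp only: shift_def prod.case add_diff_cancel_right')

lemma e_coord_shift: "shift (e_coord (S2 n k) a b i c y) = e_coord (S1 n k) a b (i + 1) c (shift y)"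
proof
  fix s :: "int \<times> int" obtain l m where s: "s = (l, m)" by (cases s)
  show "shift (e_coord (S2 n k) a b i c y) s = e_coord (S1 n k) a b (i + 1) c (shift y) s"
    unfolding s e_coord_def prod.case D_coord_shift[of _ _ i, symmetric] S1_shift
    by (auto simp: shift_def e_coord_def)
qed

lemma S2_zero: "(l, 0) \<in> S2 n k \<Longrightarrow> a2 k 0 \<le> l \<and> l \<le> b2 n k 0" and ab2: "a2 k 0 \<le> b2 n k 0"
  using k1 kn by (auto simp: S2_def a2_def b2_def)

lemma mor_e2: "mor (ctimes (V2 n k)) (ctimes_pos V2pos) (V2 n k) V2pos (\<lambda>z. e2 n k 0 (z None) (z \<circ> Some))"
proof -
  note C = pos_dense_ctimes[OF pos_dense_V2]
  have "mor (ctimes (V2 n k)) (ctimes_pos V2pos) (torus (insert None (Some ` S2 n k))) (tpos (insert None (Some ` S2 n k)))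
      (\<lambda>z. case_option (z None) (coords2 n k (z \<circ> Some)))"
    unfolding ctimes_torus[symmetric] ctimes_tpos[symmetric]
    by (rule mor_pair[OF C scal_coord _ mor_comp[OF C mor_Some mor_coords2]]) (simp add: mem_ctimes_pos)
  from mor_comp[OF C mor_comp[OF C this posmap_mor[OF posmap_e_coord[OF finite_S2 ab2 S2_zero]]] mor_v2]
  show ?thesis by (simp add: e2_def)
qed

lemma mor_e1:
  assumes i: "1 \<le> i" "i \<le> n"
  shows "mor (ctimes (V1 n k)) (ctimes_pos V1pos) (V1 n k) V1pos (\<lambda>z. e1 n k i (z None) (z \<circ> Some))"
proof -
  note C = pos_dense_ctimes[OF pos_dense_V1]
  have kap: "mor (V1 n k) V1pos (torus (S1 n k)) (tpos (S1 n k)) (coords1 n k)"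
    by (rule mor_cong[OF pos_dense_V1 mor_kappa[OF pos_dense_V1 V1pos_cone]]) (simp add: coords1_kappa)
  have "mor (ctimes (V1 n k)) (ctimes_pos V1pos) (torus (insert None (Some ` S1 n k))) (tpos (insert None (Some ` S1 n k)))
      (\<lambda>z. case_option (z None) (coords1 n k (z \<circ> Some)))"
    unfolding ctimes_torus[symmetric] ctimes_tpos[symmetric]
    by (rule mor_pair[OF C scal_coord _ mor_comp[OF C mor_Some kap]]) (simp add: mem_ctimes_pos)
  from mor_comp[OF C mor_comp[OF C this posmap_mor[OF posmap_e_coord[OF finite_S1, of "a1 k i" "b1 n k i" i]]] mor_v1]
  show ?thesis using a1_b1[OF i] mem_S1_iff[OF i] by (simp add: e1_def)
qed

text \<open>Through \<open>rot\<close> and \<open>shift\<close>, index 0 of the second chart becomes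
  index 1 of the first, where the formulas on the cone are known.\<close>

lemma crystal_v2:
  assumes y: "y \<in> tpos (S2 n k)"
  shows "gamma2 n k 0 (v2 n k y) = (v2 n k y (Aset 0))\<^sup>2 / (v2 n k y (Aset (0 - 1)) * v2 n k y (Aset (0 + 1)))"
    and "eps2 n k 0 (v2 n k y) = v2 n k y (Bset 0) / v2 n k y (Aset 0)"
    and "c \<in> cpos \<Longrightarrow> e2 n k 0 c (v2 n k y) = ec 0 c (v2 n k y)"
proof -
  let ?x = "shift y"
  have yt: "y \<in> torus (S2 n k)" by (rule tpos_torus[OF y])
  have x: "?x \<in> tpos (S1 n k)" by (rule shift_tpos[OF y])
  have xt: "?x \<in> torus (S1 n k)" by (rule tpos_torus[OF x])
  have one: "1 \<le> (1::int)" "1 \<le> n" using n2 by auto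
  have A: "v1 n k ?x (Aset j) = Qprod j ?x" if "0 \<le> j" "j \<le> n + 1" for j by (rule v1_Aset[OF xt that])
  show "gamma2 n k 0 (v2 n k y) = (v2 n k y (Aset 0))\<^sup>2 / (v2 n k y (Aset (0 - 1)) * v2 n k y (Aset (0 + 1)))"
    unfolding gamma2_def coords2_v2[OF yt] bounds_shift gamma_coord_shift[of _ _ 0]
    using Qprod_gamma[OF xt one] n2 by (simp add: v2_rot[OF yt] rot_Aset A)
  show "eps2 n k 0 (v2 n k y) = v2 n k y (Bset 0) / v2 n k y (Aset 0)"
    unfolding eps2_def coords2_v2[OF yt] bounds_shift eps_coord_shift[of _ _ 0]
    using v1_Bset[OF x one] cpos_nonzero[OF Qprod_cpos[OF x]] n2 by (simp add: v2_rot[OF yt] rot_Bset rot_Aset A)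
  assume c: "c \<in> cpos"
  let ?y = "e_coord (S2 n k) (a2 k 0) (b2 n k 0) 0 c y"
  have y': "?y \<in> tpos (S2 n k)" by (rule e_coord_tpos[OF y c ab2 S2_zero])
  have "e2 n k 0 c (v2 n k y) = rot (v1 n k (shift ?y))"
    unfolding e2_def coords2_v2[OF yt] by (rule v2_rot[OF tpos_torus[OF y']])
  also have "\<dots> = rot (ec 1 c (v1 n k ?x))"
    unfolding e_coord_shift bounds_shift using ec_v1[OF x c one] by simp
  also have "\<dots> = ec 0 c (v2 n k y)" unfolding v2_rot[OF yt] ec_rot by simp
  finally show "e2 n k 0 c (v2 n k y) = ec 0 c (v2 n k y)" .
qed

text \<open>For \<open>j = 0\<close> the map \<open>sigma\<close> only rescales the point, and the
  right side has degree 0, so the scalar cancels.\<close>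

lemma gammaV_pos:
  assumes "p \<in> V1pos" "0 \<le> j" "j \<le> n"
  shows "gammaV n k j p = (p (Aset j))\<^sup>2 / (p (Aset (j - 1)) * p (Aset (j + 1)))"
proof -
  obtain x where x: "x \<in> tpos (S1 n k)" "p = v1 n k x" by (rule V1posE[OF assms(1)])
  have xt: "x \<in> torus (S1 n k)" by (rule tpos_torus[OF x(1)])
  show ?thesis
  proof (cases "j = 0")
    case True
    define d where "d = inverse (x (1, n))"
    have d: "d \<noteq> 0" unfolding d_def using cpos_nonzero[OF tpos_cpos[OF x(1)]] by simp
    have s: "v2 n k (Sigma_map n k x) = (\<lambda>J. d * p J)"
      using sigma_v1[OF x(1)] by (simp add: x(2) d_def)
    have "gammaV n k j p = gamma2 n k 0 (\<lambda>J. d * p J)"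
      using True sigma_v1(2)[OF x(1)] by (simp add: gammaV_def x(2) d_def)
    also have "\<dots> = (d * p (Aset 0))\<^sup>2 / (d * p (Aset (0 - 1)) * (d * p (Aset (0 + 1))))"
      by (rule crystal_v2(1)[OF Sigma_map_tpos[OF x(1)], unfolded s])
    finally show ?thesis using d True by (simp add: power2_eq_square)
  next
    case False
    then have j: "1 \<le> j" "j \<le> n" using assms by auto
    then show ?thesis
      using Qprod_gamma[OF xt j] by (simp add: gammaV_def gamma1_def x(2) coords1_v1[OF xt] v1_Aset[OF xt])
  qed
qed

lemma epsV_pos:
  assumes "p \<in> V1pos" "0 \<le> j" "j \<le> n"
  shows "epsV n k j p = p (Bset j) / p (Aset j)"
proof -
  obtain x where x: "x \<in> tpos (S1 n k)" "p = v1 n k x" by (rule V1posE[OF assms(1)])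
  have xt: "x \<in> torus (S1 n k)" by (rule tpos_torus[OF x(1)])
  show ?thesis
  proof (cases "j = 0")
    case True
    define d where "d = inverse (x (1, n))"
    have d: "d \<noteq> 0" unfolding d_def using cpos_nonzero[OF tpos_cpos[OF x(1)]] by simp
    have s: "v2 n k (Sigma_map n k x) = (\<lambda>J. d * p J)"
      using sigma_v1[OF x(1)] by (simp add: x(2) d_def)
    have "epsV n k j p = eps2 n k 0 (\<lambda>J. d * p J)"
      using True sigma_v1(2)[OF x(1)] by (simp add: epsV_def x(2) d_def)
    also have "\<dots> = d * p (Bset 0) / (d * p (Aset 0))"
      by (rule crystal_v2(2)[OF Sigma_map_tpos[OF x(1)], unfolded s])
    finally show ?thesis using d True by simp
  next
    case False
    then have j: "1 \<le> j" "j \<le> n" using assms by auto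
    then show ?thesis
      using v1_Bset[OF x(1) j] cpos_nonzero[OF Qprod_cpos[OF x(1)]]
      by (simp add: epsV_def eps1_def x(2) coords1_v1[OF xt] v1_Aset[OF xt])
  qed
qed

text \<open>
  A representative of \<open>eV n k i\<close> in which the inverse of \<open>\<sigma>\<close>, an arbitrary choice in \<open>rat_inv\<close>, is
  replaced by the explicit map \<open>v1 n k \<circ> kappa\<close>.
\<close>

definition eW :: "int \<Rightarrow> complex \<Rightarrow> (int set \<Rightarrow> complex) \<Rightarrow> (int set \<Rightarrow> complex)" where
  "eW i c p = (if i = 0 then v1 n k (kappa (e2 n k 0 c (sigma n k p))) else e1 n k i c p)"

lemma eW_pos:
  assumes p: "p \<in> V1pos" and c: "c \<in> cpos" and i: "0 \<le> i" "i \<le> n"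
  shows "eW i c p = nrm (ec i c p)"
proof -
  obtain x where x: "x \<in> tpos (S1 n k)" "p = v1 n k x" by (rule V1posE[OF p])
  have xt: "x \<in> torus (S1 n k)" by (rule tpos_torus[OF x(1)])
  show ?thesis
  proof (cases "i = 0")
    case True
    define d where "d = inverse (x (1, n))"
    have d: "d \<noteq> 0" unfolding d_def using cpos_nonzero[OF tpos_cpos[OF x(1)]] by simp
    have y: "Sigma_map n k x \<in> tpos (S2 n k)" by (rule Sigma_map_tpos[OF x(1)])
    have s: "v2 n k (Sigma_map n k x) = (\<lambda>J. d * p J)"
      using sigma_v1[OF x(1)] by (simp add: x(2) d_def)
    have "eW i c p = v1 n k (kappa (ec 0 c (v2 n k (Sigma_map n k x))))"
      using True sigma_v1(1)[OF x(1)] crystal_v2(3)[OF y c] by (simp add: eW_def x(2))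
    also have "\<dots> = nrm (ec 0 c (v2 n k (Sigma_map n k x)))"
      by (rule v1_kappa[OF goodD(3)[OF v2_cone[OF y] c]])
    also have "\<dots> = nrm (ec 0 c p)" unfolding s ec_scale[OF d] nrm_scale[OF d] ..
    finally show ?thesis using True by simp
  next
    case False
    then have j: "1 \<le> i" "i \<le> n" using i by auto
    have "eW i c p = ec i c p"
      using False ec_v1[OF x(1) c j] by (simp add: eW_def e1_def x(2) coords1_v1[OF xt])
    moreover have "ec i c p = v1 n k (e_coord (S1 n k) (a1 k i) (b1 n k i) i c x)"
      using ec_v1[OF x(1) c j] by (simp add: x(2))
    ultimately show ?thesis
      using nrm_v1[OF tpos_torus[OF e_coord1_tpos[OF x(1) c j]]] by simp
  qed
qed

lemma eW_V1pos:
  assumes "p \<in> V1pos" "c \<in> cpos" "0 \<le> i" "i \<le> n"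
  shows "eW i c p \<in> V1pos"
  unfolding eW_pos[OF assms] by (intro nrm_in_V1pos goodD(3) assms subsetD[OF V1pos_cone])

lemma mor_eW:
  assumes i: "0 \<le> i" "i \<le> n"
  shows "mor (ctimes (V1 n k)) (ctimes_pos V1pos) (V1 n k) V1pos (uncurry1 (eW i))"
proof (cases "i = 0")
  case True
  note C = pos_dense_ctimes[OF pos_dense_V1]
  have "mor (ctimes (V1 n k)) (ctimes_pos V1pos) (ctimes (V2 n k)) (ctimes_pos V2pos)
      (\<lambda>z. case_option (z None) (sigma n k (z \<circ> Some)))"
    by (rule mor_pair[OF C scal_coord _ mor_comp[OF C mor_Some mor_sigma]]) (simp add: mem_ctimes_pos)
  from mor_comp[OF C mor_comp[OF C this mor_e2] mor_psi]
  show ?thesis using True by (simp add: eW_def uncurry1_def[abs_def])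
next
  case False
  then show ?thesis using mor_e1[of i] i by (simp add: eW_def uncurry1_def[abs_def])
qed

lemma eV_generic:
  assumes i: "0 \<le> i" "i \<le> n"
  shows "generically (ctimes (V1 n k)) (\<lambda>z. uncurry1 (eV n k i) z = uncurry1 (eW i) z)"
proof (cases "i = 0")
  case True
  note C = pos_dense_ctimes[OF pos_dense_V1]
  let ?f = "\<lambda>z. e2 n k 0 (z None) (sigma n k (z \<circ> Some))"
  have "mor (ctimes (V1 n k)) (ctimes_pos V1pos) (ctimes (V2 n k)) (ctimes_pos V2pos)
      (\<lambda>z. case_option (z None) (sigma n k (z \<circ> Some)))"
    by (rule mor_pair[OF C scal_coord _ mor_comp[OF C mor_Some mor_sigma]]) (simp add: mem_ctimes_pos)
  from mor_comp[OF C this mor_e2]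
  have f: "mor (ctimes (V1 n k)) (ctimes_pos V1pos) (V2 n k) V2pos ?f" by simp
  \<comment> \<open>Needed to pull back the generic description of \<open>rat_inv\<close>; the
    parameter \<open>1\<close> and the explicit inverse of \<open>sigma\<close> give a
    preimage.\<close>
  have "V2pos \<subseteq> ?f ` ctimes_pos V1pos"
  proof
    fix q assume q: "q \<in> V2pos"
    obtain y where y: "y \<in> tpos (S2 n k)" "q = v2 n k y" by (rule V2posE[OF q])
    let ?z = "case_option 1 (v1 n k (kappa q))"
    have "?f ?z = e2 n k 0 1 q" by (simp add: sigma_psi[OF q])
    also have "\<dots> = q" unfolding y(2) crystal_v2(3)[OF y(1) cpos_one] ec_one ..
    finally have "q = ?f ?z" ..
    moreover have "?z \<in> ctimes_pos V1pos"
      using kappa_tpos[of q] q V2pos_cone by (auto simp: mem_ctimes_pos V1pos_def)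
    ultimately show "q \<in> ?f ` ctimes_pos V1pos" by (rule image_eqI)
  qed
  moreover have "generically (V2 n k) (\<lambda>q. rat_inv (V1 n k) (V2 n k) (sigma n k) q = v1 n k (kappa q))"
    by (rule rat_inv_generic(2)[OF pos_dense_V1 pos_dense_V2 mor_sigma mor_psi psi_sigma sigma_psi])
  ultimately have "generically (ctimes (V1 n k)) (\<lambda>z. ?f z \<in> V2 n k \<and> rat_inv (V1 n k) (V2 n k) (sigma n k) (?f z) = v1 n k (kappa (?f z)))"
    by (rule generically_comp[OF C pos_dense_V2 f])
  then show ?thesis
    by (rule generically_mono) (simp add: True eV_def eW_def uncurry1_def)
next
  case False
  then show ?thesis
    by (intro generically_refl[OF pos_dense_ctimes[OF pos_dense_V1]]) (simp add: eV_def eW_def uncurry1_def)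
qed

text \<open>The coefficients at the sets \<open>Tset\<close> are positive on the cone, which rules
  out the vanishing alternative in \<open>reg_pos\<close>.\<close>

lemma posfun_kappa_v2:
  assumes "(l, m) \<in> S1 n k"
  shows "posfun (S2 n k) (\<lambda>y. kappa (v2 n k y) (l, m))"
proof -
  have pf: "posfun (S2 n k) (\<lambda>y. v2 n k y J)" if nz: "\<And>y. y \<in> tpos (S2 n k) \<Longrightarrow> v2 n k y J \<noteq> 0" for J
  proof (rule posfunI[OF finite_S2])
    show "scal (torus (S2 n k)) (tpos (S2 n k)) (\<lambda>y. v2 n k y J)" by (rule mor_scal[OF mor_v2])
    have eq: "v1 n k (shift y) (rho ` J) = v2 n k y J" if "y \<in> tpos (S2 n k)" for y
      by (simp add: v2_rot[OF tpos_torus[OF that]] rot_def)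
    have one: "(\<lambda>_. 1) \<in> tpos (S2 n k)" by (intro tposI) auto
    have "v1 n k (shift (\<lambda>_. 1)) (rho ` J) \<noteq> 0" unfolding eq[OF one] by (rule nz[OF one])
    then have "subtraction_free (S1 n k) (\<lambda>x. v1 n k x (rho ` J))"
      using reg_pos_v1[of "rho ` J"] shift_tpos[OF one] unfolding reg_pos_def by blast
    then have "subtraction_free (S2 n k) (\<lambda>y. v1 n k (shift y) (rho ` J))"
      by (rule sf_comp) (use posmapD(3)[OF posmap_shift, THEN posfun_sf] shift_tpos in auto)
    then show "subtraction_free (S2 n k) (\<lambda>y. v2 n k y J)" by (rule subtraction_free_cong) (rule eq)
  qed
  have "posfun (S2 n k) (\<lambda>y. v2 n k y (Tset (l - 1) m) / v2 n k y (Tset l m))"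
    by (intro posfun_divide pf cpos_nonzero cone_Tset[OF v2_cone assms])
  then show ?thesis using assms by (simp add: kappa_def)
qed

text \<open>For index 0 the map is factored in coordinates as \<open>Sigma_map\<close>, the action
  in the second chart, and \<open>kappa\<close> after \<open>v2\<close>; each of the three is
  subtraction-free.\<close>

lemma sf_kappa_eW:
  assumes i: "0 \<le> i" "i \<le> n" and s: "s \<in> S1 n k"
  shows "subtraction_free (insert None (Some ` S1 n k)) (\<lambda>z. kappa (eW i (z None) (v1 n k (z \<circ> Some))) s)"
proof (cases "i = 0")
  case True
  let ?S = "insert None (Some ` S1 n k)"
  let ?p = "\<lambda>z. case_option (z None) (Sigma_map n k (z \<circ> Some))"
  let ?e = "\<lambda>z. e_coord (S2 n k) (a2 k 0) (b2 n k 0) 0 (z None) (z \<circ> Some)"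
  have "posmap ?S (insert None (Some ` S2 n k)) ?p"
  proof (rule posmapI)
    fix t assume "t \<in> insert None (Some ` S2 n k)"
    then show "posfun ?S (\<lambda>z. ?p z t)"
      using posfun_comp[OF posmapD(3)[OF posmap_Sigma] posmap_Some[OF finite_S1]]
      by (auto simp: posfun_coord finite_S1)
  next
    fix t z assume "t \<notin> insert None (Some ` S2 n k)"
    then show "?p z t = 1" by (cases t) (auto simp: Sigma_map_def)
  qed (simp_all add: finite_S1 finite_S2)
  from posfun_comp[OF posfun_comp[OF posfun_kappa_v2 posmap_e_coord[OF finite_S2 ab2 S2_zero]] this]
  have "posfun ?S (\<lambda>z. kappa (v2 n k (?e (?p z))) s)" using s by (cases s) simp
  then have "subtraction_free ?S (\<lambda>z. kappa (v2 n k (?e (?p z))) s)" by (rule posfun_sf)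
  then show ?thesis
  proof (rule subtraction_free_cong)
    fix z assume z: "z \<in> tpos ?S"
    then have c: "z None \<in> cpos" and x: "z \<circ> Some \<in> tpos (S1 n k)"
      unfolding ctimes_tpos[symmetric] mem_ctimes_pos by auto
    let ?y = "Sigma_map n k (z \<circ> Some)"
    have y: "?y \<in> tpos (S2 n k)" by (rule Sigma_map_tpos[OF x])
    have "e2 n k 0 (z None) (v2 n k ?y) = v2 n k (?e (?p z))"
      by (simp add: e2_def coords2_v2[OF tpos_torus[OF y]])
    moreover have "e2 n k 0 (z None) (v2 n k ?y) \<in> cone"
      unfolding crystal_v2(3)[OF y c] by (intro goodD(3) v2_cone y c)
    ultimately show "kappa (v2 n k (?e (?p z))) s = kappa (eW i (z None) (v1 n k (z \<circ> Some))) s"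
      using True kappa_v1_1[OF tpos_torus[OF kappa_tpos]] by (simp add: eW_def sigma_v1(1)[OF x])
  qed
next
  case False
  then have j: "1 \<le> i" "i \<le> n" using i by auto
  have "posmap (insert None (Some ` S1 n k)) (S1 n k) (\<lambda>z. e_coord (S1 n k) (a1 k i) (b1 n k i) i (z None) (z \<circ> Some))"
    by (rule posmap_e_coord[OF finite_S1]) (use a1_b1[OF j] mem_S1_iff[OF j] in auto)
  from posfun_sf[OF posmapD(3)[OF this s]] show ?thesis
  proof (rule subtraction_free_cong)
    fix z assume z: "z \<in> tpos (insert None (Some ` S1 n k))"
    then have c: "z None \<in> cpos" and x: "z \<circ> Some \<in> tpos (S1 n k)"
      unfolding ctimes_tpos[symmetric] mem_ctimes_pos by auto
    show "e_coord (S1 n k) (a1 k i) (b1 n k i) i (z None) (z \<circ> Some) s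
        = kappa (eW i (z None) (v1 n k (z \<circ> Some))) s"
      using False kappa_v1_1[OF tpos_torus[OF e_coord1_tpos[OF x c j]]]
      by (simp add: eW_def e1_def coords1_v1[OF tpos_torus[OF x]])
  qed
qed

lemma scal_V1:
  assumes "posfun (S1 n k) f" "\<And>p. p \<in> V1 n k \<Longrightarrow> f (coords1 n k p) = g p"
  shows "scal (V1 n k) V1pos g"
proof (rule scal_cong)
  show "scal (V1 n k) V1pos (\<lambda>p. f (kappa p))"
    by (rule scal_comp[OF pos_dense_V1 mor_kappa[OF pos_dense_V1 V1pos_cone] posfun_scal[OF assms(1)]])
qed (use assms(2) coords1_kappa in auto)

lemma gammaV_epsV_regular_positive:
  assumes i: "0 \<le> i" "i \<le> n"
  shows "scal (V1 n k) V1pos (gammaV n k i)" "scal (V1 n k) V1pos (epsV n k i)"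
    "subtraction_free (S1 n k) (gammaV n k i \<circ> v1 n k)" "subtraction_free (S1 n k) (epsV n k i \<circ> v1 n k)"
proof -
  have "scal (V1 n k) V1pos (gammaV n k i) \<and> scal (V1 n k) V1pos (epsV n k i) \<and>
    subtraction_free (S1 n k) (gammaV n k i \<circ> v1 n k) \<and> subtraction_free (S1 n k) (epsV n k i \<circ> v1 n k)"
  proof (cases "i = 0")
    case True
    have g: "posfun (S2 n k) (gamma_coord (a2 k 0) (b2 n k 0) 0)" and e: "posfun (S2 n k) (eps_coord (a2 k 0) (b2 n k 0) 0)"
      by (intro posfun_gamma_coord posfun_eps_coord finite_S2 ab2)+
    have "scal (V2 n k) V2pos (gamma2 n k 0)" "scal (V2 n k) V2pos (eps2 n k 0)"
      unfolding gamma2_def[abs_def] eps2_def[abs_def]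
      by (rule scal_comp[OF pos_dense_V2 mor_coords2 posfun_scal], rule g e)+
    from this[THEN scal_comp[OF pos_dense_V1 mor_sigma]]
    have "scal (V1 n k) V1pos (\<lambda>p. gamma2 n k 0 (sigma n k p))" "scal (V1 n k) V1pos (\<lambda>p. eps2 n k 0 (sigma n k p))" .
    moreover have c2: "coords2 n k (sigma n k (v1 n k x)) = Sigma_map n k x" if "x \<in> tpos (S1 n k)" for x
      unfolding sigma_v1(1)[OF that] by (rule coords2_v2[OF tpos_torus[OF Sigma_map_tpos[OF that]]])
    have "subtraction_free (S1 n k) (\<lambda>x. gamma2 n k 0 (sigma n k (v1 n k x)))"
      "subtraction_free (S1 n k) (\<lambda>x. eps2 n k 0 (sigma n k (v1 n k x)))"
      unfolding gamma2_def eps2_def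
      by (rule subtraction_free_cong[OF posfun_sf[OF posfun_comp[OF g posmap_Sigma]]], simp add: c2,
          rule subtraction_free_cong[OF posfun_sf[OF posfun_comp[OF e posmap_Sigma]]], simp add: c2)
    ultimately show ?thesis using True by (simp add: gammaV_def epsV_def o_def)
  next
    case False
    then have j: "1 \<le> i" "i \<le> n" using i by auto
    have g: "posfun (S1 n k) (gamma_coord (a1 k i) (b1 n k i) i)" and e: "posfun (S1 n k) (eps_coord (a1 k i) (b1 n k i) i)"
      using a1_b1[OF j] by (simp_all add: posfun_gamma_coord posfun_eps_coord finite_S1)
    have V: "gammaV n k i = gamma1 n k i" "epsV n k i = eps1 n k i" using False by (simp_all add: gammaV_def epsV_def)
    have "scal (V1 n k) V1pos (gammaV n k i)" "scal (V1 n k) V1pos (epsV n k i)"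
      unfolding V by (rule scal_V1[OF g], simp add: gamma1_def, rule scal_V1[OF e], simp add: eps1_def)
    moreover have "subtraction_free (S1 n k) (gammaV n k i \<circ> v1 n k)" "subtraction_free (S1 n k) (epsV n k i \<circ> v1 n k)"
      unfolding V
      by (rule subtraction_free_cong[OF posfun_sf[OF g]], simp add: gamma1_def coords1_v1 tpos_torus,
          rule subtraction_free_cong[OF posfun_sf[OF e]], simp add: eps1_def coords1_v1 tpos_torus)
    ultimately show ?thesis by blast
  qed
  then show "scal (V1 n k) V1pos (gammaV n k i)" "scal (V1 n k) V1pos (epsV n k i)"
    "subtraction_free (S1 n k) (gammaV n k i \<circ> v1 n k)" "subtraction_free (S1 n k) (epsV n k i \<circ> v1 n k)" by auto
qed

section \<open>The crystal relations\<close>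

lemma residue_cases:
  assumes i: "0 \<le> i" "i \<le> n" and j: "0 \<le> j" "j \<le> n"
  shows "(i - j) mod (n + 1) = (if j \<le> i then i - j else i - j + (n + 1))"
proof (cases "j \<le> i")
  case False
  have "(i - j) mod (n + 1) = (i - j + (n + 1)) mod (n + 1)" by simp
  also have "\<dots> = i - j + (n + 1)" using False i j by (intro mod_pos_pos_trivial) auto
  finally show ?thesis using False by simp
qed (use i j in \<open>simp add: mod_pos_pos_trivial\<close>)

lemma residue_pm:
  "(i - (j + 1)) mod (n + 1) = 0 \<longleftrightarrow> (i - j) mod (n + 1) = 1"
  "(i - (j - 1)) mod (n + 1) = 0 \<longleftrightarrow> (i - j) mod (n + 1) = n"
proof -
  show "(i - (j + 1)) mod (n + 1) = 0 \<longleftrightarrow> (i - j) mod (n + 1) = 1"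
    unfolding mod_pred using n2 by (auto split: if_splits)
  have "(i - (j - 1 + 1)) mod (n + 1) = n \<longleftrightarrow> (i - (j - 1)) mod (n + 1) = 0"
    unfolding mod_pred using pos_mod_bound[of "n + 1" "i - (j - 1)"] n2 by (auto split: if_splits)
  then show "(i - (j - 1)) mod (n + 1) = 0 \<longleftrightarrow> (i - j) mod (n + 1) = n" by simp
qed

lemma cartan_residue:
  assumes "0 \<le> i" "i \<le> n" "0 \<le> j" "j \<le> n"
  shows "cartan n i j = (if (i - j) mod (n + 1) = 0 then 2
     else if (i - j) mod (n + 1) = 1 \<or> (i - j) mod (n + 1) = n then -1 else 0)"
proof -
  have e: "[i = j'] (mod (n + 1)) \<longleftrightarrow> (i - j') mod (n + 1) = 0" for j'
    by (simp add: cong_iff_dvd_diff mod_eq_0_iff_dvd)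
  have "i = j \<longleftrightarrow> (i - j) mod (n + 1) = 0" using residue_cases[OF assms] assms by auto
  then show ?thesis unfolding cartan_def e residue_pm by simp
qed

text \<open>The action multiplies only the coefficient at \<open>Aset i\<close>, so the exponent is
  read off from which of \<open>j - 1\<close>, \<open>j\<close>, \<open>j + 1\<close> is congruent
  to \<open>i\<close>.\<close>

lemma gammaV_eW:
  assumes i: "0 \<le> i" "i \<le> n" and j: "0 \<le> j" "j \<le> n" and c: "c \<in> cpos" and p: "p \<in> V1pos"
  shows "gammaV n k j (eW i c p) = c powi cartan n i j * gammaV n k j p"
proof -
  have pc: "p \<in> cone" using p V1pos_cone by blast
  have c0: "c \<noteq> 0" by (rule cpos_nonzero[OF c])
  define q where "q = ec i c p"
  have q0: "q (Aset 0) \<noteq> 0" unfolding q_def by (rule cpos_nonzero[OF goodD(1)[OF goodD(3)[OF pc c]]])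
  have B: "p (Bset i) \<noteq> 0" by (rule cpos_nonzero[OF goodD(2)[OF pc]])
  have A: "p (Aset m) \<noteq> 0" for m by (rule cpos_nonzero[OF goodD(1)[OF pc]])
  have q: "q (Aset m) = (if (m - i) mod (n + 1) = 0 then c * p (Aset m) else p (Aset m))" for m
    unfolding q_def by (rule ec_Aset[of p i, OF B])
  have "gammaV n k j (eW i c p) = (q (Aset j))\<^sup>2 / (q (Aset (j - 1)) * q (Aset (j + 1)))"
    unfolding gammaV_pos[OF eW_V1pos[OF p c i] j] unfolding eW_pos[OF p c i] q_def[symmetric]
    using q0 by (simp add: nrm_def power2_eq_square)
  moreover have "(j - i) mod (n + 1) = 0 \<longleftrightarrow> (i - j) mod (n + 1) = 0"
    by (simp add: mod_eq_0_iff_dvd dvd_diff_commute)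
  moreover have "(j - 1 - i) mod (n + 1) = 0 \<longleftrightarrow> (i - j) mod (n + 1) = n"
    using residue_pm(2)[of i j] dvd_diff_commute[of "n + 1" "j - 1" i] by (simp add: mod_eq_0_iff_dvd)
  moreover have "(j + 1 - i) mod (n + 1) = 0 \<longleftrightarrow> (i - j) mod (n + 1) = 1"
    using residue_pm(1)[of i j] dvd_diff_commute[of "n + 1" "j + 1" i] by (simp add: mod_eq_0_iff_dvd)
  ultimately show ?thesis
    unfolding gammaV_pos[OF p j] cartan_residue[OF i j] q using n2 c0 A
    by (auto simp: power2_eq_square field_simps power_int_minus)
qed

lemma ec_period: "ec (i + (n + 1)) = ec i"
  by (intro ext) (simp only: ec_def Aset_period Bset_period XX_period)

text \<open>Actions commute with scalars, so it is enough to normalise once, after the last of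
  them.\<close>

lemma eW_eW:
  assumes p: "p \<in> V1pos" and c: "c \<in> cpos" "d \<in> cpos" and i: "0 \<le> i" "i \<le> n" "0 \<le> j" "j \<le> n"
  shows "eW i c (eW j d p) = nrm (ec i c (ec j d p))"
proof -
  have pc: "p \<in> cone" using p V1pos_cone by blast
  show ?thesis
    unfolding eW_pos[OF eW_V1pos[OF p c(2) i(3,4)] c(1) i(1,2)] unfolding eW_pos[OF p c(2) i(3,4)]
    by (rule nrm_ec_nrm[OF goodD(3)[OF pc c(2)]])
qed

lemma eW_eW_eW:
  assumes p: "p \<in> V1pos" and c: "c \<in> cpos" "d \<in> cpos" "e \<in> cpos" and i: "0 \<le> i" "i \<le> n" "0 \<le> j" "j \<le> n"
  shows "eW i c (eW j d (eW i e p)) = nrm (ec i c (ec j d (ec i e p)))"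
proof -
  have pc: "p \<in> cone" using p V1pos_cone by blast
  show ?thesis
    unfolding eW_pos[OF eW_V1pos[OF eW_V1pos[OF p c(3) i(1,2)] c(2) i(3,4)] c(1) i(1,2)]
    unfolding eW_eW[OF p c(2,3) i(3,4,1,2)]
    by (rule nrm_ec_nrm[OF goodD(3)[OF goodD(3)[OF pc c(3)] c(2)]])
qed

lemma eW_braid:
  assumes p: "p \<in> V1pos" and c: "c \<in> cpos" and d: "d \<in> cpos"
    and i: "0 \<le> i" "i \<le> n" and j: "0 \<le> j" "j \<le> n" and "cartan n i j = -1"
  shows "eW i c (eW j (c * d) (eW i d p)) = eW j d (eW i (c * d) (eW j c p))"
proof -
  have pc: "p \<in> cone" using p V1pos_cone by blast
  have "(i - j) mod (n + 1) = 1 \<or> (i - j) mod (n + 1) = n"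
    using assms(8) unfolding cartan_residue[OF i j] by (auto split: if_splits)
  \<comment> \<open>Since \<open>ec\<close> depends only on the index modulo \<open>n + 1\<close>,
    the neighbours \<open>n\<close> and \<open>0\<close> are covered as well.\<close>
  then have "ec j = ec (i + 1) \<or> ec i = ec (j + 1)"
    unfolding residue_cases[OF i j]
  proof
    assume "(if j \<le> i then i - j else i - j + (n + 1)) = 1"
    then have "i = j + 1 \<or> j + 1 = i + (n + 1)" by (auto split: if_splits)
    then have "ec i = ec (j + 1)" by (elim disjE) (simp_all only: ec_period)
    then show ?thesis ..
  next
    assume "(if j \<le> i then i - j else i - j + (n + 1)) = n"
    then have "j = i + 1 \<or> i + 1 = j + (n + 1)" by (auto split: if_splits)
    then have "ec j = ec (i + 1)" by (elim disjE) (simp_all only: ec_period)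
    then show ?thesis ..
  qed
  then have "ec i c (ec j (c * d) (ec i d p)) = ec j d (ec i (c * d) (ec j c p))"
  proof
    assume "ec j = ec (i + 1)"
    then show ?thesis using ec_braid[OF pc c d, of i] by simp
  next
    assume "ec i = ec (j + 1)"
    then show ?thesis using ec_braid[OF pc d c, of j] by (simp add: mult.commute)
  qed
  then show ?thesis
    using eW_eW_eW[OF p c cpos_mult[OF c d] d i j] eW_eW_eW[OF p d cpos_mult[OF c d] c j i] by simp
qed

lemma geometric_crystal_V1:
  "geometric_crystal {0..n} (cartan n) (V1 n k) (eV n k) (gammaV n k) (epsV n k)"
proof (rule geometric_crystalI[OF pos_dense_V1 variety_V1, where e = eW])
  fix i assume "i \<in> {0..n}"
  then have i: "0 \<le> i" "i \<le> n" by auto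
  show "mor (ctimes (V1 n k)) (ctimes_pos V1pos) (V1 n k) V1pos (uncurry1 (eW i))" by (rule mor_eW[OF i])
  show "generically (ctimes (V1 n k)) (\<lambda>z. uncurry1 (eV n k i) z = uncurry1 (eW i) z)" by (rule eV_generic[OF i])
  show "scal (V1 n k) V1pos (gammaV n k i)" "scal (V1 n k) V1pos (epsV n k i)" by (rule gammaV_epsV_regular_positive[OF i])+
  fix p assume p: "p \<in> V1pos"
  then have pc: "p \<in> cone" using V1pos_cone by blast
  show "eW i 1 p = p" by (simp add: eW_pos[OF p cpos_one i] ec_one nrm_V1pos[OF p])
  fix c assume c: "c \<in> cpos"
  show "epsV n k i (eW i c p) = inverse c * epsV n k i p"
  proof -
    have B: "p (Bset i) \<noteq> 0" by (rule cpos_nonzero[OF goodD(2)[OF pc]])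
    have "ec i c p (Aset 0) \<noteq> 0" by (rule cpos_nonzero[OF goodD(1)[OF goodD(3)[OF pc c]]])
    then have "epsV n k i (eW i c p) = ec i c p (Bset i) / ec i c p (Aset i)"
      unfolding epsV_pos[OF eW_V1pos[OF p c i] i] unfolding eW_pos[OF p c i] by (simp add: nrm_def)
    then show ?thesis
      unfolding epsV_pos[OF p i] ec_Bset_self ec_Aset[of p i, OF B] by (simp add: field_simps)
  qed
  show "eW i c (eW i d p) = eW i (c * d) p" if d: "d \<in> cpos" for d
    unfolding eW_eW[OF p c d i i] eW_pos[OF p cpos_mult[OF c d] i] ec_mult[OF pc] ..
next
  fix i j c p assume "i \<in> {0..n}" "j \<in> {0..n}" and c: "c \<in> cpos" and p: "p \<in> V1pos"
  then have i: "0 \<le> i" "i \<le> n" and j: "0 \<le> j" "j \<le> n" by auto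
  have pc: "p \<in> cone" using p V1pos_cone by blast
  show "gammaV n k j (eW i c p) = c powi cartan n i j * gammaV n k j p" by (rule gammaV_eW[OF i j c p])
  show "eW i c (eW j d p) = eW j d (eW i c p)" if d: "d \<in> cpos" and "cartan n i j = 0" for d
  proof -
    have "(i - j) mod (n + 1) \<noteq> 0" "(i - j) mod (n + 1) \<noteq> 1" "(i - j) mod (n + 1) \<noteq> n"
      using that(2) unfolding cartan_residue[OF i j] by (auto split: if_splits)
    then have "ec i c (ec j d p) = ec j d (ec i c p)" by (rule ec_commute[OF pc])
    then show ?thesis using eW_eW[OF p c d i j] eW_eW[OF p d c j i] by simp
  qed
  show "eW i c (eW j (c * d) (eW i d p)) = eW j d (eW i (c * d) (eW j c p))"
    if d: "d \<in> cpos" and "cartan n i j = -1" for d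
    by (rule eW_braid[OF p c d i j that(2)])
  show "epsV n k i (eW j c p) = epsV n k i p" if "cartan n i j = 0"
  proof -
    have ij: "(i - j) mod (n + 1) \<noteq> 0" "(i - j) mod (n + 1) \<noteq> 1" "(i - j) mod (n + 1) \<noteq> n"
      using that unfolding cartan_residue[OF i j] by (auto split: if_splits)
    have B: "p (Bset j) \<noteq> 0" by (rule cpos_nonzero[OF goodD(2)[OF pc]])
    have "ec j c p (Aset 0) \<noteq> 0" by (rule cpos_nonzero[OF goodD(1)[OF goodD(3)[OF pc c]]])
    then have "epsV n k i (eW j c p) = ec j c p (Bset i) / ec j c p (Aset i)"
      unfolding epsV_pos[OF eW_V1pos[OF p c j] i] unfolding eW_pos[OF p c j] by (simp add: nrm_def)
    then show ?thesis
      unfolding epsV_pos[OF p i] ec_Bset[OF ij(2,3)] ec_Aset[of p j, OF B] using ij(1) by simp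
  qed
qed

lemma positive_structure_V1:
  "positive_structure {0..n} (V1 n k) (eV n k) (gammaV n k) (epsV n k) (S1 n k) (v1 n k)"
proof (rule positive_structureI[OF pos_dense_V1 finite_S1 mor_v1 mor_kappa[OF pos_dense_V1 V1pos_cone], where e = eW])
  fix i assume "i \<in> {0..n}"
  then have i: "0 \<le> i" "i \<le> n" by auto
  show "mor (ctimes (V1 n k)) (ctimes_pos V1pos) (V1 n k) V1pos (uncurry1 (eW i))" by (rule mor_eW[OF i])
  show "generically (ctimes (V1 n k)) (\<lambda>z. uncurry1 (eV n k i) z = uncurry1 (eW i) z)" by (rule eV_generic[OF i])
  show "scal (V1 n k) V1pos (gammaV n k i)" "scal (V1 n k) V1pos (epsV n k i)"
    "subtraction_free (S1 n k) (gammaV n k i \<circ> v1 n k)" "subtraction_free (S1 n k) (epsV n k i \<circ> v1 n k)"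
    by (rule gammaV_epsV_regular_positive[OF i])+
  show "eW i 1 p = p" if "p \<in> V1pos" for p by (simp add: eW_pos[OF that cpos_one i] ec_one nrm_V1pos[OF that])
  show "subtraction_free (insert None (Some ` S1 n k)) (\<lambda>z. kappa (eW i (z None) (v1 n k (z \<circ> Some))) s)"
    if "s \<in> S1 n k" for s by (rule sf_kappa_eW[OF i that])
next
  show "kappa (v1 n k t) = t" if "t \<in> tpos (S1 n k)" for t by (rule kappa_v1_1[OF tpos_torus[OF that]])
  show "v1 n k (kappa p) = p" if "p \<in> V1pos" for p
    using v1_kappa[of p] nrm_V1pos[OF that] that V1pos_cone by auto
qed

end

theorem theorem6p1:
  fixes n k :: int
  assumes "2 \<le> n" and "1 \<le> k" and "k \<le> n"
  shows "geometric_crystal {0..n} (cartan n) (V1 n k) (eV n k) (gammaV n k) (epsV n k) \<and>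
         positive_structure {0..n} (V1 n k) (eV n k) (gammaV n k) (epsV n k) (S1 n k) (v1 n k)"
proof -
  interpret grassmann n k by unfold_locales (use assms in auto)
  show ?thesis using geometric_crystal_V1 positive_structure_V1 by (rule conjI)
qed

end
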